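(* Let $a<b$, $\alpha\in(0,1)$, $\beta>0$, $y_1^a,y_2^a,y_1^b,y_2^b\in\mathbb{R}$, and let $L:(x,y_1,y_2,v_1,v_2,w_1,w_2,z)\mapsto L$, $l:(x,y_1,y_2,v_1,v_2,w_1,w_2)\mapsto l$ and $g:(x,y_1,y_2)\mapsto g(x,y_1,y_2)$ be smooth real-valued functions. For $y_1,y_2\in\mathcal{F}([a,b];\mathbb{R})$ put $$\{y_1,y_2\}(x)=\bigl(x,y_1(x),y_2(x),{^C_aD_x^\alpha}y_1(x),{^C_aD_x^\alpha}y_2(x),{_aI_x^\beta}y_1(x),{_aI_x^\beta}y_2(x)\bigr),$$ $z(x)=\int_a^x l\{y_1,y_2\}(t)\,dt$, let $[y_1,y_2](x)$ be the tuple $\{y_1,y_2\}(x)$ followed by $z(x)$, and let $$J(y_1,y_2)=\int_a^b L[y_1,y_2](x)\,dx.$$ Let the pair $(y_1,y_2)$ be a minimizer of $J$ subject to the boundary conditions $(y_1(a),y_2(a))=(y_1^a,y_2^a)$, $(y_1(b),y_2(b))=(y_1^b,y_2^b)$ and the holonomic constraint $g(x,y_1(x),y_2(x))=0$. If $\frac{\partial g}{\partial y_2}\neq0$ everywhere, then there exists a continuous function $\lambda:[a,b]\to\mathbb{R}$ such that $(y_1,y_2)$ satisfies, for all $x\in[a,b]$ and $i=1,2$, $$\frac{\partial F}{\partial y_i}[y_1,y_2](x)+{_xD^\alpha_b}\left(\frac{\partial F}{\partial v_i}[y_1,y_2](x)\right)+{_xI_b^\beta}\left(\frac{\partial F}{\partial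 w_i}[y_1,y_2](x)\right)+\int_x^b\frac{\partial F}{\partial z}[y_1,y_2](t)\,dt\cdot\frac{\partial l}{\partial y_i}\{y_1,y_2\}(x)$$ $$+{_xD^\alpha_b}\left(\int_x^b\frac{\partial F}{\partial z}[y_1,y_2](t)\,dt\cdot\frac{\partial l}{\partial v_i}\{y_1,y_2\}(x)\right)+{_xI^\beta_b}\left(\int_x^b\frac{\partial F}{\partial z}[y_1,y_2](t)\,dt\cdot\frac{\partial l}{\partial w_i}\{y_1,y_2\}(x)\right)=0,$$ where $F[y_1,y_2](x)=L[y_1,y_2](x)-\lambda(x)\,g(x,y_1(x),y_2(x))$.
   Context: For $\gamma>0$, the left and right Riemann--Liouville fractional integrals are ${_aI_x^\gamma}f(x)=\frac{1}{\Gamma(\gamma)}\int_a^x(x-t)^{\gamma-1}f(t)\,dt$ and ${_xI_b^\gamma}f(x)=\frac{1}{\Gamma(\gamma)}\int_x^b(t-x)^{\gamma-1}f(t)\,dt$. For $\alpha\in(0,1)$, the right Riemann--Liouville fractional derivative is ${_xD_b^\alpha}f(x)=\frac{-1}{\Gamma(1-\alpha)}\frac{d}{dx}\int_x^b(t-x)^{-\alpha}f(t)\,dt$, and the left Caputo fractional derivative of an absolutely continuous $f$ is ${^C_aD_x^\alpha}f(x)=\frac{1}{\Gamma(1-\alpha)}\int_a^x(x-t)^{-\alpha}f'(t)\,dt$. $\mathcal{F}([a,b];\mathbb{R})$ denotes the class of absolutely continuous functions $y:[a,b]\to\mathbb{R}$ such that ${^C_aD_x^\alpha}y(x)$ and ${_aI_x^\beta}y(x)$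 exist and are continuous on $[a,b]$. $F$ is regarded as the function $F(x,y_1,y_2,v_1,v_2,w_1,w_2,z)=L(x,y_1,y_2,v_1,v_2,w_1,w_2,z)-\lambda(x)g(x,y_1,y_2)$. Partial derivatives of $L,F$ are with respect to their named variables and are evaluated at $[y_1,y_2](\cdot)$; those of $l$ are evaluated at $\{y_1,y_2\}(\cdot)$. An expression such as ${_xD_b^\alpha}(\phi(x))$ means the operator applied to the function $\phi$, evaluated at $x$.
   Formalization: Added hypotheses: for i=1,2 both right Riemann–Liouville derivatives in the equations exist at every x in [a,b], and for i=2 their sum is continuous on [a,b]. Without them the claim fails, e.g. g=y2−y1, l=0, L=v1(v1−v2), where λ can be unbounded near b. *)

theory Defs
  imports "HOL-Analysis.Analysis"
begin

section \<open>Fractional operators\<close>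

text \<open>All integrals are Lebesgue integrals. The singular kernel has the value 0 at the
  endpoint \<open>t = x\<close> (because \<open>0 powr c = 0\<close>), which is a null set.\<close>

definition rl_int_left :: "real \<Rightarrow> real \<Rightarrow> (real \<Rightarrow> real) \<Rightarrow> real \<Rightarrow> real" where
  "rl_int_left \<gamma> a f x =
     (LINT t:{a..x}|lebesgue. (x - t) powr (\<gamma> - 1) * f t) / Gamma \<gamma>"

definition rl_int_right :: "real \<Rightarrow> real \<Rightarrow> (real \<Rightarrow> real) \<Rightarrow> real \<Rightarrow> real" where
  "rl_int_right \<gamma> b f x =
     (LINT t:{x..b}|lebesgue. (t - x) powr (\<gamma> - 1) * f t) / Gamma \<gamma>"

text \<open>The functions live on \<open>[a,b]\<close> only, so the outer derivative is taken within
  \<open>[a,b]\<close>; it is one-sided at the two endpoints.\<close>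

definition rl_deriv_right :: "real \<Rightarrow> real \<Rightarrow> real \<Rightarrow> (real \<Rightarrow> real) \<Rightarrow> real \<Rightarrow> real" where
  "rl_deriv_right \<alpha> a b f x =
     - 1 / Gamma (1 - \<alpha>) *
     vector_derivative (\<lambda>u. LINT t:{u..b}|lebesgue. (t - u) powr (- \<alpha>) * f t)
       (at x within {a..b})"

definition rl_deriv_right_exists :: "real \<Rightarrow> real \<Rightarrow> real \<Rightarrow> (real \<Rightarrow> real) \<Rightarrow> bool" where
  "rl_deriv_right_exists \<alpha> a b f \<longleftrightarrow>
     (\<forall>x\<in>{a..b}.
        set_integrable lebesgue {x..b} (\<lambda>t. (t - x) powr (- \<alpha>) * f t) \<and>
        (\<lambda>u. LINT t:{u..b}|lebesgue. (t - u) powr (- \<alpha>) * f t)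
          differentiable (at x within {a..b}))"

text \<open>The derivative of an absolutely continuous function exists almost everywhere, and the
  value of \<^const>\<open>deriv\<close> on the exceptional null set does not matter.\<close>

definition caputo_left :: "real \<Rightarrow> real \<Rightarrow> (real \<Rightarrow> real) \<Rightarrow> real \<Rightarrow> real" where
  "caputo_left \<alpha> a f x =
     (LINT t:{a..x}|lebesgue. (x - t) powr (- \<alpha>) * deriv f t) / Gamma (1 - \<alpha>)"


section \<open>The class of trajectories\<close>

text \<open>Absolute continuity on \<open>[a,b]\<close>: \<open>d\<close> ranges over the finite families of
  non-overlapping compact intervals \<open>[Inf k, Sup k]\<close> contained in \<open>[a,b]\<close>.\<close>

definition abs_continuous_on :: "real \<Rightarrow> real \<Rightarrow> (real \<Rightarrow> real) \<Rightarrow> bool" where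
  "abs_continuous_on a b f \<longleftrightarrow>
     (\<forall>\<epsilon>>0. \<exists>\<delta>>0. \<forall>d S. d division_of S \<and> S \<subseteq> {a..b} \<and>
        (\<Sum>k\<in>d. Sup k - Inf k) < \<delta> \<longrightarrow> (\<Sum>k\<in>d. \<bar>f (Sup k) - f (Inf k)\<bar>) < \<epsilon>)"

definition traj_class :: "real \<Rightarrow> real \<Rightarrow> real \<Rightarrow> real \<Rightarrow> (real \<Rightarrow> real) set" where
  "traj_class \<alpha> \<beta> a b = {f. abs_continuous_on a b f \<and>
     (\<forall>x\<in>{a..b}. set_integrable lebesgue {a..x} (\<lambda>t. (x - t) powr (- \<alpha>) * deriv f t)) \<and>
     continuous_on {a..b} (caputo_left \<alpha> a f) \<and>
     (\<forall>x\<in>{a..b}. set_integrable lebesgue {a..x} (\<lambda>t. (x - t) powr (\<beta> - 1) * f t)) \<and>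
     continuous_on {a..b} (rl_int_left \<beta> a f)}"


section \<open>Smooth functions and partial derivatives\<close>

text \<open>For \<open>e\<close> in \<^const>\<open>Basis\<close> this is the usual partial derivative of \<open>f\<close> at \<open>p\<close>
  with respect to the coordinate belonging to \<open>e\<close>.\<close>

definition partial_deriv ::
  "'a::real_normed_vector \<Rightarrow> ('a \<Rightarrow> real) \<Rightarrow> 'a \<Rightarrow> real" where
  "partial_deriv e f p = deriv (\<lambda>s. f (p + s *\<^sub>R e)) 0"

primrec Ck_on :: "nat \<Rightarrow> ('a::euclidean_space \<Rightarrow> real) \<Rightarrow> 'a set \<Rightarrow> bool" where
  "Ck_on 0 f U \<longleftrightarrow> continuous_on U f"
| "Ck_on (Suc k) f U \<longleftrightarrow>
     f differentiable_on U \<and> (\<forall>e\<in>Basis. Ck_on k (partial_deriv e f) U)"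

text \<open>Smoothness on an arbitrary, not necessarily open, set: the function is the restriction
  of a \<open>C\<^sup>\<infinity>\<close> function on an open neighbourhood.\<close>

definition smooth_on :: "'a::euclidean_space set \<Rightarrow> ('a \<Rightarrow> real) \<Rightarrow> bool" where
  "smooth_on S f \<longleftrightarrow>
     (\<exists>U h. open U \<and> S \<subseteq> U \<and> (\<forall>k. Ck_on k h U) \<and> (\<forall>p\<in>S. h p = f p))"


section \<open>The variational problem\<close>

text \<open>The seven-tuple \<open>(x, y1, y2, v1, v2, w1, w2)\<close> is grouped as \<open>(x, y, v, w)\<close> with
  \<open>y\<close>, \<open>v\<close>, \<open>w\<close> in \<open>\<real>\<^sup>2\<close>; the eight-tuple is a pair of such a tuple and \<open>z\<close>. In the
  index type \<open>2\<close> the elements are \<open>1\<close> and \<open>2\<close> (the latter coincides with \<open>0\<close>).\<close>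

type_synonym state = "real \<times> (real^2) \<times> (real^2) \<times> (real^2)"

abbreviation dir_y :: "2 \<Rightarrow> state" where "dir_y i \<equiv> (0, axis i 1, 0, 0)"
abbreviation dir_v :: "2 \<Rightarrow> state" where "dir_v i \<equiv> (0, 0, axis i 1, 0)"
abbreviation dir_w :: "2 \<Rightarrow> state" where "dir_w i \<equiv> (0, 0, 0, axis i 1)"

text \<open>\<open>{y1, y2}(x)\<close>\<close>

definition jet :: "real \<Rightarrow> real \<Rightarrow> real \<Rightarrow> (real \<Rightarrow> real^2) \<Rightarrow> real \<Rightarrow> state" where
  "jet \<alpha> \<beta> a y x =
     (x, y x, (\<chi> i. caputo_left \<alpha> a (\<lambda>t. y t $ i) x), (\<chi> i. rl_int_left \<beta> a (\<lambda>t. y t $ i) x))"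

text \<open>\<open>[y1, y2](x)\<close>\<close>

definition ext_jet ::
  "real \<Rightarrow> real \<Rightarrow> real \<Rightarrow> (state \<Rightarrow> real) \<Rightarrow> (real \<Rightarrow> real^2) \<Rightarrow> real \<Rightarrow> state \<times> real" where
  "ext_jet \<alpha> \<beta> a l y x =
     (jet \<alpha> \<beta> a y x, LINT t:{a..x}|lebesgue. l (jet \<alpha> \<beta> a y t))"

definition functional ::
  "real \<Rightarrow> real \<Rightarrow> real \<Rightarrow> real \<Rightarrow> (state \<times> real \<Rightarrow> real) \<Rightarrow> (state \<Rightarrow> real) \<Rightarrow>
     (real \<Rightarrow> real^2) \<Rightarrow> real" where
  "functional \<alpha> \<beta> a b L l y = (LINT x:{a..b}|lebesgue. L (ext_jet \<alpha> \<beta> a l y x))"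

definition admissible ::
  "real \<Rightarrow> real \<Rightarrow> real \<Rightarrow> real \<Rightarrow> real^2 \<Rightarrow> real^2 \<Rightarrow> (real \<times> (real^2) \<Rightarrow> real) \<Rightarrow>
     (real \<Rightarrow> real^2) set" where
  "admissible \<alpha> \<beta> a b ya yb g =
     {y. (\<forall>i. (\<lambda>x. y x $ i) \<in> traj_class \<alpha> \<beta> a b) \<and> y a = ya \<and> y b = yb \<and>
         (\<forall>x\<in>{a..b}. g (x, y x) = 0)}"

definition augmented ::
  "(state \<times> real \<Rightarrow> real) \<Rightarrow> (real \<Rightarrow> real) \<Rightarrow> (real \<times> (real^2) \<Rightarrow> real) \<Rightarrow>
     state \<times> real \<Rightarrow> real" where
  "augmented L lam g = (\<lambda>((x, y, v, w), z). L ((x, y, v, w), z) - lam x * g (x, y))"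

end

(*
  Let y be the minimizer and u^e the family of curves with first component y_1 + e eta, eta(a) = eta(b) = 0,
  eta' = kappa continuous, whose second component solves g(x, u^e(x)) = 0.  The delicate point is that u^e_2
  again has a continuous Caputo derivative, although y_1' is only integrable.  A continuous Caputo derivative
  makes a function alpha-Hoelder, and the increments of u_2 and of u_1 along the constraint satisfy
  u_2(x) - u_2(t) = m(x) (u_1(x) - u_1(t)) + O(|x - t|^min(2 alpha, 1)) with m = - g_1 / g_2; integrating by
  parts, D^alpha u_2 - m D^alpha u_1 becomes an absolutely convergent integral of this remainder.
  Absolutely continuous functions are differentiable almost everywhere (by Vitali's covering theorem), so the
  operators can be expressed through integrable densities, and dominated convergence gives
  d/de J(u^e) = 0 at e = 0.  By Fubini this reads: integral of kappa F = 0 for every kappa with mean 0, where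
  F = int_x^b A_1 + P_1 + int_x^b m (A_2 + D_2), P_i is the right fractional integral in the equations, D_i the
  derivative -P_i' and A_i collects the remaining terms.  Hence F is constant (du Bois-Reymond), and differentiating
  gives A_1 + D_1 = (g_1 / g_2) (A_2 + D_2).  Both equations then hold with lambda = (A_2 + D_2) / g_2.
*)
theory Submission
  imports Defs
begin

section \<open>Absolutely continuous functions\<close>

text \<open>Two asymmetries shape the argument. \<open>D 1\<close> is only known to exist, whereas
  \<open>D 2\<close> is continuous. So \<open>P 1\<close> is never integrated by parts: it stays
  inside the function tested against \<kappa> and is differentiated only after that function is
  known to be constant. \<open>P 2\<close>, on the other hand, is a constant plus the integral of
  \<open>D 2\<close>. This matters because the test density of the second component contains the
  merely integrable y_1', and it can be traded for the density of the first component only after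
  passing to the variations themselves, which are proportional with factor m. The coefficient m is
  frozen at x, the point where the fractional derivative is evaluated, because it then commutes with
  the integral in t. The remainder order min(2 \<alpha>, 1) exceeds \<alpha> since 0 < \<alpha> < 1,
  which is what beats the kernel (x - t)^(-\<alpha> - 1). All bounds must be common to the whole
  family of curves, hence estimates in a fixed compact convex box rather than a local implicit
  function.\<close>

abbreviation increment :: "(real \<Rightarrow> real) \<Rightarrow> real set \<Rightarrow> real" where
  "increment f k \<equiv> f (Sup k) - f (Inf k)"

lemma sum_increment_division:
  fixes f :: "real \<Rightarrow> real"
  assumes "d division_of {u..v}" "u \<le> v"
  shows "(\<Sum>k\<in>d. increment f k) = f v - f u"
proof -
  \<comment> \<open>Additive interval functions must have the value 0 on the empty interval, where
    \<open>Sup\<close> and \<open>Inf\<close> carry no information.\<close>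
  let ?g = "\<lambda>k. if k = {} then 0 else increment f k"
  interpret operative_real plus 0 ?g
    rewrites "comm_monoid_set.F plus 0 = (sum :: _ \<Rightarrow> real set set \<Rightarrow> real)"
  proof -
    show "operative_real (+) 0 ?g"
      by unfold_locales auto
  qed (simp add: sum_def)
  have "(\<Sum>k\<in>d. increment f k) = sum ?g d"
    using assms by (intro sum.cong) auto
  also have "\<dots> = ?g {u..v}"
    using division[of d u v] assms by simp
  finally show ?thesis using assms by simp
qed

lemma division_member_real:
  fixes d :: "real set set"
  assumes "d division_of S" "k \<in> d"
  obtains u v where "u \<le> v" "k = {u..v}" "{u..v} \<subseteq> S"
  using division_ofD(2,3,4)[OF assms] by (metis atLeastatMost_empty_iff2 box_real(2) not_le)

lemma measure_division_real:
  fixes d :: "real set set"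
  assumes "d division_of S"
  shows "measure lebesgue S = (\<Sum>k\<in>d. Sup k - Inf k)"
proof -
  have "measure lebesgue S = sum (measure lebesgue) d"
    using content_division[OF assms] by simp
  also have "\<dots> = (\<Sum>k\<in>d. Sup k - Inf k)"
    by (intro sum.cong refl) (auto elim!: division_member_real[OF assms])
  finally show ?thesis .
qed

text \<open>The covering theorem leaves a null set uncovered by countably many disjoint balls;
  continuity of the measure from above, available because \<open>E\<close> has finite measure, cuts
  them down to finitely many at the cost of \<open>e\<close>. A point lies strictly inside its
  interval but need not be the centre, so the intervals are indexed by midpoint and radius.\<close>

lemma Vitali_intervals:
  fixes E W :: "real set" and P :: "real \<Rightarrow> real \<Rightarrow> bool"
  assumes E: "E \<in> lmeasurable" "open W" "E \<subseteq> W"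
    and cov: "\<And>x r. x \<in> E \<Longrightarrow> 0 < r \<Longrightarrow> \<exists>u v. u < x \<and> x < v \<and> v - u < r \<and> P u v"
    and e: "0 < e"
  obtains d S where "d division_of S" "S \<subseteq> W"
    "\<And>k. k \<in> d \<Longrightarrow> \<exists>u v. k = {u..v} \<and> u < v \<and> P u v"
    "measure lebesgue (E - (\<Union>k\<in>d. interior k)) < e"
proof -
  define K where "K = {i. 0 < snd i \<and> cball (fst i) (snd i) \<subseteq> W \<and> P (fst i - snd i) (fst i + snd i)}"
  have "\<exists>i. i \<in> K \<and> x \<in> ball (fst i) (snd i) \<and> snd i < r" if xr: "x \<in> E" "0 < r" for x r
  proof -
    obtain s where s: "0 < s" "ball x s \<subseteq> W" using openE[OF E(2) subsetD[OF E(3) xr(1)]] by blast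
    obtain u v where uv: "u < x" "x < v" "v - u < min r s" "P u v"
      using cov[of x "min r s"] xr s by auto
    have c: "cball ((u+v)/2) ((v-u)/2) = {u..v}" "ball ((u+v)/2) ((v-u)/2) = {u<..<v}"
      by (simp_all add: cball_eq_atLeastAtMost ball_eq_greaterThanLessThan field_simps)
    have "{u..v} \<subseteq> ball x s" using uv by (auto simp: dist_real_def)
    then have "((u+v)/2, (v-u)/2) \<in> K"
      unfolding K_def using c s uv by (auto simp: field_simps)
    then show ?thesis using c uv by (intro exI[of _ "((u+v)/2, (v-u)/2)"]) auto
  qed
  then obtain C where C: "countable C" "C \<subseteq> K"
      "pairwise (\<lambda>i j. disjnt (ball (fst i) (snd i)) (ball (fst j) (snd j))) C"
      "negligible (E - (\<Union>i\<in>C. ball (fst i) (snd i)))"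
    using Vitali_covering_theorem_balls[of E K fst snd] by blast
  define B where "B i = ball (fst i) (snd i)" for i :: "real \<times> real"
  have "\<exists>F. finite F \<and> F \<subseteq> C \<and> measure lebesgue (E - (\<Union>i\<in>F. B i)) < e"
  proof (cases "finite C")
    case True
    then show ?thesis using C(4) e unfolding B_def
      by (intro exI[of _ C]) (auto simp: negligible_imp_measure0)
  next
    case False
    define h where "h = from_nat_into C"
    have rg: "range h = C" unfolding h_def using False C(1)
      by (simp add: range_from_nat_into infinite_imp_nonempty)
    define A where "A n = E - (\<Union>i\<in>h ` {..n}. B i)" for n
    have Am: "A n \<in> lmeasurable" for n
      unfolding A_def B_def using E(1)
      by (intro fmeasurable_Diff) (auto intro!: sets.finite_UN)
    have "(\<lambda>n. measure lebesgue (A n)) \<longlonglongrightarrow> measure lebesgue (\<Inter>n. A n)"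
    proof (rule Lim_measure_decseq)
      show "range A \<subseteq> sets lebesgue" using Am by (auto simp: fmeasurableD)
      show "decseq A" by (force simp: A_def decseq_def)
      show "emeasure lebesgue (A n) \<noteq> \<infinity>" for n using fmeasurableD2[OF Am] by simp
    qed
    moreover have "(\<Inter>n. A n) = E - (\<Union>i\<in>C. B i)"
      unfolding A_def rg[symmetric] by auto
    ultimately have "(\<lambda>n. measure lebesgue (A n)) \<longlonglongrightarrow> 0"
      using C(4) unfolding B_def by (simp add: negligible_imp_measure0)
    from order_tendstoD(2)[OF this e] obtain n where "measure lebesgue (A n) < e"
      unfolding eventually_sequentially by blast
    then show ?thesis using rg unfolding A_def by (intro exI[of _ "h ` {..n}"]) auto
  qed
  then obtain F where F: "finite F" "F \<subseteq> C" "measure lebesgue (E - (\<Union>i\<in>F. B i)) < e" by blast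
  define d where "d = (\<lambda>i. cball (fst i) (snd i)) ` F"
  have FK: "0 < snd i" "cball (fst i) (snd i) \<subseteq> W" "P (fst i - snd i) (fst i + snd i)"
    if "i \<in> F" for i
  proof -
    have "i \<in> K" using F(2) C(2) that by blast
    then show "0 < snd i" "cball (fst i) (snd i) \<subseteq> W" "P (fst i - snd i) (fst i + snd i)"
      unfolding K_def by blast+
  qed
  show thesis
  proof (rule that[of d "\<Union>d"])
    show "d division_of \<Union>d"
    proof (rule division_ofI)
      fix k l assume "k \<in> d" "l \<in> d" "k \<noteq> l"
      then obtain i j where ij: "i \<in> F" "j \<in> F" "i \<noteq> j" "k = cball (fst i) (snd i)"
        "l = cball (fst j) (snd j)" unfolding d_def by auto
      then have "disjnt (ball (fst i) (snd i)) (ball (fst j) (snd j))"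
        using C(3) F(2) by (auto simp: pairwise_def)
      then show "interior k \<inter> interior l = {}" using ij by (simp add: disjnt_def interior_cball)
    next
      fix k assume "k \<in> d"
      then obtain i where i: "i \<in> F" "k = cball (fst i) (snd i)" unfolding d_def by auto
      then have "0 < snd i" using FK by blast
      then show "k \<noteq> {}" "\<exists>a b. k = cbox a b" "k \<subseteq> \<Union>d"
        using i \<open>k \<in> d\<close> by (auto simp: cball_eq_atLeastAtMost intro!: exI)
    qed (use F in \<open>auto simp: d_def\<close>)
    show "\<Union>d \<subseteq> W" using FK unfolding d_def by blast
    show "\<exists>u v. k = {u..v} \<and> u < v \<and> P u v" if k: "k \<in> d" for k
    proof -
      obtain i where i: "i \<in> F" "k = cball (fst i) (snd i)" using k unfolding d_def by auto
      then have "0 < snd i" "P (fst i - snd i) (fst i + snd i)" using FK by blast+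
      then show ?thesis using i by (auto simp: cball_eq_atLeastAtMost intro!: exI)
    qed
    have "(\<Union>k\<in>d. interior k) = (\<Union>i\<in>F. B i)" unfolding d_def B_def by (simp add: interior_cball)
    then show "measure lebesgue (E - (\<Union>k\<in>d. interior k)) < e" using F by simp
  qed
qed

lemma abs_continuous_onE:
  assumes "abs_continuous_on a b f" "0 < e"
  obtains \<delta> where "0 < \<delta>" "\<And>d S. d division_of S \<Longrightarrow> S \<subseteq> {a..b} \<Longrightarrow> measure lebesgue S < \<delta> \<Longrightarrow>
     (\<Sum>k\<in>d. \<bar>increment f k\<bar>) < e"
  using assms unfolding abs_continuous_on_def by (metis measure_division_real)

lemma abs_continuous_on_imp_continuous:
  assumes "abs_continuous_on a b f"
  shows "continuous_on {a..b} f"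
  unfolding continuous_on_iff
proof (intro ballI allI impI)
  fix x e :: real assume x: "x \<in> {a..b}" "0 < e"
  obtain \<delta> where \<delta>: "0 < \<delta>" "\<And>d S. d division_of S \<Longrightarrow> S \<subseteq> {a..b} \<Longrightarrow> measure lebesgue S < \<delta> \<Longrightarrow>
     (\<Sum>k\<in>d. \<bar>increment f k\<bar>) < e" using abs_continuous_onE[OF assms x(2)] by blast
  have "\<bar>f v - f u\<bar> < e" if "u \<in> {a..b}" "v \<in> {a..b}" "u \<le> v" "v - u < \<delta>" for u v
    using \<delta>(2)[of "{{u..v}}" "{u..v}"] that division_of_self[of u v] by auto
  then have "dist x' x < \<delta> \<Longrightarrow> dist (f x') (f x) < e" if "x' \<in> {a..b}" for x'
    using that x by (cases "x \<le> x'") (fastforce simp: dist_real_def abs_minus_commute)+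
  then show "\<exists>d>0. \<forall>x'\<in>{a..b}. dist x' x < d \<longrightarrow> dist (f x') (f x) < e"
    using \<delta>(1) by blast
qed

section \<open>Differentiability almost everywhere of absolutely continuous functions\<close>

definition slope :: "(real \<Rightarrow> real) \<Rightarrow> real \<Rightarrow> real \<Rightarrow> real" where
  "slope f u v = (f v - f u) / (v - u)"

text \<open>The upper derivate is taken over intervals straddling \<open>x\<close>, so that the relevant intervals form a
  Vitali cover of the set by sets with \<open>x\<close> in the interior.\<close>

definition steep :: "(real \<Rightarrow> real) \<Rightarrow> real \<Rightarrow> real \<Rightarrow> real \<Rightarrow> real set" where
  "steep f a b q = {x\<in>{a<..<b}. \<forall>r>0. \<exists>u v. u < x \<and> x < v \<and> v - u < r \<and>
      u \<in> {a<..<b} \<and> v \<in> {a<..<b} \<and> q < slope f u v}"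

text \<open>For each bound \<open>1 / real (Suc n)\<close> on the length, the points lying strictly
  inside a short interval of slope above \<open>q\<close> form a union of open intervals. So the set
  is a countable intersection of open sets.\<close>

lemma steep_measurable: "steep f a b q \<in> sets borel"
proof -
  define U where "U n = (\<Union>(u,v)\<in>{(u,v). v - u < 1 / real (Suc n) \<and> u \<in> {a<..<b} \<and> v \<in> {a<..<b} \<and>
      q < slope f u v}. {u<..<v})" for n
  have eq: "steep f a b q = (\<Inter>n. {a<..<b} \<inter> U n)"
  proof (intro equalityI subsetI)
    fix x assume "x \<in> steep f a b q"
    then have x: "x \<in> {a<..<b}" and P: "\<And>r. r > 0 \<Longrightarrow> \<exists>u v. u < x \<and> x < v \<and> v - u < r \<and>
      u \<in> {a<..<b} \<and> v \<in> {a<..<b} \<and> q < slope f u v" unfolding steep_def by blast+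
    have "x \<in> U n" for n using P[of "1 / real (Suc n)"] unfolding U_def by auto
    then show "x \<in> (\<Inter>n. {a<..<b} \<inter> U n)" using x by blast
  next
    fix x assume x: "x \<in> (\<Inter>n. {a<..<b} \<inter> U n)"
    show "x \<in> steep f a b q"
      unfolding steep_def
    proof (intro CollectI conjI allI impI)
      show "x \<in> {a<..<b}" using x by auto
      fix r :: real assume "0 < r"
      then obtain n where n: "1 / real (Suc n) < r" using nat_approx_posE by blast
      have "x \<in> U n" using x by auto
      then show "\<exists>u v. u < x \<and> x < v \<and> v - u < r \<and> u \<in> {a<..<b} \<and> v \<in> {a<..<b} \<and> q < slope f u v"
        using n unfolding U_def by fastforce
    qed
  qed
  have "open (U n)" for n unfolding U_def by auto
  then show ?thesis unfolding eq by auto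
qed

lemma steep_lmeasurable: "steep f a b q \<in> lmeasurable"
proof -
  have "steep f a b q \<in> sets lebesgue" using steep_measurable by auto
  moreover have "bounded (steep f a b q)"
    by (rule bounded_subset[of "{a<..<b}"]) (auto simp: steep_def)
  ultimately show ?thesis by (simp add: bounded_set_imp_lmeasurable)
qed

text \<open>These are the points with infinite upper derivate. If they had positive measure near
  \<open>x\<close>, disjoint intervals of slope above a large \<open>N\<close> would fill half of
  that measure inside a window of length below \<delta>, and their increments would add up to more
  than 1, which absolute continuity forbids.\<close>

lemma steep_infinite_negligible:
  assumes ac: "abs_continuous_on a b f"
  shows "negligible (\<Inter>N::nat. steep f a b (real N))" (is "negligible ?E")
proof (subst locally_negligible_alt, intro ballI)
  fix x assume x: "x \<in> ?E"
  obtain \<delta> where \<delta>: "0 < \<delta>" "\<And>d S. d division_of S \<Longrightarrow> S \<subseteq> {a..b} \<Longrightarrow> measure lebesgue S < \<delta> \<Longrightarrow>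
     (\<Sum>k\<in>d. \<bar>increment f k\<bar>) < 1" using abs_continuous_onE[OF ac zero_less_one] by blast
  define W where "W = {x - \<delta>/3 <..< x + \<delta>/3} \<inter> {a<..<b}"
  define A where "A = ?E \<inter> W"
  have Esub: "?E \<subseteq> {a<..<b}" by (auto simp: steep_def)
  have Am: "A \<in> lmeasurable"
  proof -
    have "?E \<in> sets lebesgue" using steep_measurable[of f a b]
      by (intro sets.countable_INT) auto
    then show ?thesis unfolding A_def W_def
      by (intro bounded_set_imp_lmeasurable) (auto intro: bounded_subset[of "{a<..<b}"])
  qed
  have "measure lebesgue A = 0"
  proof (rule ccontr)
    assume "measure lebesgue A \<noteq> 0"
    then have s: "0 < measure lebesgue A" by (simp add: zero_less_measure_iff)
    obtain N :: nat where N: "1 < real N * (measure lebesgue A / 2)"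
      using s reals_Archimedean3[of "measure lebesgue A / 2"] by (metis half_gt_zero)
    obtain d S where d: "d division_of S" "S \<subseteq> W"
        "\<And>k. k \<in> d \<Longrightarrow> \<exists>u v. k = {u..v} \<and> u < v \<and> real N < slope f u v"
        "measure lebesgue (A - (\<Union>k\<in>d. interior k)) < measure lebesgue A / 2"
    proof (rule Vitali_intervals[of A W "\<lambda>u v. real N < slope f u v" "measure lebesgue A / 2"])
      show "\<exists>u v. u < z \<and> z < v \<and> v - u < r \<and> real N < slope f u v" if "z \<in> A" "0 < r" for z r
        using that unfolding A_def steep_def by blast
    qed (use Am s in \<open>auto simp: A_def W_def\<close>)
    have Sm: "S \<in> lmeasurable" using d(1) by (metis lmeasurable_division)
    have "(\<Union>k\<in>d. interior k) \<in> sets lebesgue" by (intro sets_completionI_sets) (simp add: borel_open open_UN)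
    then have Dm: "A - (\<Union>k\<in>d. interior k) \<in> lmeasurable" using Am by (rule fmeasurable_Diff[rotated])
    have "measure lebesgue A \<le> measure lebesgue (S \<union> (A - (\<Union>k\<in>d. interior k)))"
    proof (rule measure_mono_fmeasurable)
      have "(\<Union>k\<in>d. interior k) \<subseteq> S" using division_ofD(2)[OF d(1)] interior_subset by blast
      then show "A \<subseteq> S \<union> (A - (\<Union>k\<in>d. interior k))" by blast
      show "S \<union> (A - (\<Union>k\<in>d. interior k)) \<in> lmeasurable"
        using Sm Dm by (rule fmeasurable.Un)
    qed (use Am in auto)
    also have "\<dots> \<le> measure lebesgue S + measure lebesgue (A - (\<Union>k\<in>d. interior k))"
      using Sm Dm by (intro measure_Un_le) auto
    finally have S1: "measure lebesgue A / 2 < measure lebesgue S" using d(4) by simp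
    have "measure lebesgue S \<le> measure lebesgue {x - \<delta>/3 .. x + \<delta>/3}"
      using d(2) Sm unfolding W_def by (intro measure_mono_fmeasurable) auto
    also have "\<dots> < \<delta>" using \<delta>(1) by simp
    finally have "(\<Sum>k\<in>d. \<bar>increment f k\<bar>) < 1"
      using \<delta>(2)[OF d(1)] d(2) unfolding W_def by force
    moreover have "real N * measure lebesgue S \<le> (\<Sum>k\<in>d. \<bar>increment f k\<bar>)"
      unfolding measure_division_real[OF d(1)] sum_distrib_left
    proof (rule sum_mono)
      fix k assume "k \<in> d"
      then obtain u v where "k = {u..v}" "u < v" "real N < slope f u v" using d(3) by blast
      then show "real N * (Sup k - Inf k) \<le> \<bar>increment f k\<bar>"
        unfolding slope_def by (simp add: field_simps)
    qed
    moreover have "real N * (measure lebesgue A / 2) \<le> real N * measure lebesgue S"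
      using S1 by (intro mult_left_mono) auto
    ultimately show False using N by linarith
  qed
  then have "negligible A" using Am negligible_iff_measure by blast
  moreover have "openin (top_of_set ?E) A"
    unfolding A_def W_def by (intro openin_open_Int open_Int) auto
  moreover have "x \<in> A" unfolding A_def W_def using x subsetD[OF Esub x] \<delta>(1) by simp
  ultimately show "\<exists>U. openin (top_of_set ?E) U \<and> x \<in> U \<and> negligible U" by blast
qed

lemma slope_uminus: "slope (\<lambda>x. - f x) u v = - slope f u v"
  unfolding slope_def by (simp add: minus_divide_left)

lemma abs_continuous_on_uminus: "abs_continuous_on a b f \<Longrightarrow> abs_continuous_on a b (\<lambda>x. - f x)"
  unfolding abs_continuous_on_def by (simp add: abs_minus_commute)

text \<open>If the set \<open>?E\<close> had measure \<open>s > 0\<close>, intervals \<open>D1\<close> with slopes below \<open>p\<close> would fill almost all of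
  it, and so would intervals \<open>D2\<close> with slopes above \<open>q\<close> chosen inside those of \<open>D1\<close>. The remainder \<open>R\<close> of
  \<open>D1\<close> is small, hence so is the increment of \<open>f\<close> over it, and \<open>q s \<le> p s\<close> up to a small error.\<close>

lemma steep_pair_negligible:
  assumes ac: "abs_continuous_on a b f" and "p < q" and "a < b"
  shows "negligible (steep f a b q \<inter> steep (\<lambda>x. - f x) a b (- p))" (is "negligible ?E")
proof (rule ccontr)
  assume nn: "\<not> negligible ?E"
  define s where "s = measure lebesgue ?E"
  have Em: "?E \<in> lmeasurable" using steep_lmeasurable by blast
  have s: "0 < s" using nn Em unfolding s_def
    by (simp add: negligible_iff_measure zero_less_measure_iff)
  have Esub: "?E \<subseteq> {a<..<b}" by (auto simp: steep_def)
  \<comment> \<open>The final comparison sets \<open>(q - p) * m2 < 2 * e'\<close> against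
    \<open>(q - p) * m2 \<ge> (q - p) * (s / 2)\<close>, which is \<open>4 * e'\<close> by this
    choice.\<close>
  define e' where "e' = (q - p) * s / 8"
  have e': "0 < e'" unfolding e'_def using s \<open>p < q\<close> by simp
  obtain \<delta> where \<delta>: "0 < \<delta>" "\<And>d S. d division_of S \<Longrightarrow> S \<subseteq> {a..b} \<Longrightarrow> measure lebesgue S < \<delta> \<Longrightarrow>
     (\<Sum>k\<in>d. \<bar>increment f k\<bar>) < e'" using abs_continuous_onE[OF ac e'] by blast
  \<comment> \<open>The first bound gives \<open>m2 > s / 2\<close>; the second makes the remainder
    \<open>R\<close>, of measure below \<open>3 * e\<close>, short enough for absolute continuity;
    the third keeps \<open>\<bar>p\<bar>\<close> times that measure at most
    \<open>e'\<close>.\<close>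
  define e where "e = min (s / 4) (min (\<delta> / 3) (e' / (3 * (\<bar>p\<bar> + 1))))"
  have e: "0 < e" "e \<le> s / 4" "3 * e \<le> \<delta>" "\<bar>p\<bar> * (3 * e) \<le> e'"
  proof -
    show "0 < e" unfolding e_def using s \<delta> e' by auto
    show "e \<le> s / 4" "3 * e \<le> \<delta>" unfolding e_def by linarith+
    have "e * (3 * (\<bar>p\<bar> + 1)) \<le> e'" unfolding e_def
      by (subst pos_le_divide_eq[symmetric]) auto
    then show "\<bar>p\<bar> * (3 * e) \<le> e'" using \<open>0 < e\<close> by (simp add: algebra_simps)
  qed
  obtain T where T: "open T" "?E \<subseteq> T" "T - ?E \<in> lmeasurable" "emeasure lebesgue (T - ?E) < ennreal e"
    using sets_lebesgue_outer_open[OF fmeasurableD[OF Em] e(1)] by blast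
  define W where "W = T \<inter> {a<..<b}"
  have W: "open W" "?E \<subseteq> W" "W \<subseteq> {a<..<b}" using T Esub unfolding W_def by auto
  have Wm: "W \<in> lmeasurable" using W
    by (intro bounded_set_imp_lmeasurable) (auto intro: bounded_subset[of "{a<..<b}"])
  have WE: "measure lebesgue (W - ?E) < e"
  proof -
    have "measure lebesgue (W - ?E) \<le> measure lebesgue (T - ?E)"
      using T(3) Wm Em unfolding W_def by (intro measure_mono_fmeasurable) auto
    also have "\<dots> < e" using T(3,4) e(1) by (simp add: emeasure_eq_measure2 ennreal_less_iff)
    finally show ?thesis .
  qed
  have mW: "measure lebesgue W < s + e"
    using measurable_measure_Diff[OF Wm, of ?E] Em W WE unfolding s_def by simp
  obtain D1 S1 where D1: "D1 division_of S1" "S1 \<subseteq> W"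
      "\<And>k. k \<in> D1 \<Longrightarrow> \<exists>u v. k = {u..v} \<and> u < v \<and> - p < slope (\<lambda>x. - f x) u v"
      "measure lebesgue (?E - (\<Union>k\<in>D1. interior k)) < e"
  proof (rule Vitali_intervals[OF Em W(1,2) _ e(1), of "\<lambda>u v. - p < slope (\<lambda>x. - f x) u v"])
    show "\<exists>u v. u < z \<and> z < v \<and> v - u < r \<and> - p < slope (\<lambda>x. - f x) u v" if "z \<in> ?E" "0 < r" for z r
      using that unfolding steep_def by blast
  qed blast
  define T1 where "T1 = (\<Union>k\<in>D1. interior k)"
  have T1: "open T1" "T1 \<subseteq> S1" "T1 \<in> lmeasurable"
  proof -
    show "open T1" unfolding T1_def by auto
    show "T1 \<subseteq> S1" using division_ofD(2)[OF D1(1)] interior_subset unfolding T1_def by blast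
    then have "T1 \<subseteq> {a<..<b}" using D1(2) W by blast
    then show "T1 \<in> lmeasurable" using \<open>open T1\<close>
      by (intro bounded_set_imp_lmeasurable) (auto intro: bounded_subset[of "{a<..<b}"])
  qed
  have E1m: "?E \<inter> T1 \<in> lmeasurable" using Em T1 by blast
  obtain D2 S2 where D2: "D2 division_of S2" "S2 \<subseteq> T1"
      "\<And>k. k \<in> D2 \<Longrightarrow> \<exists>u v. k = {u..v} \<and> u < v \<and> q < slope f u v"
      "measure lebesgue (?E \<inter> T1 - (\<Union>k\<in>D2. interior k)) < e"
  proof (rule Vitali_intervals[OF E1m T1(1) _ _ e(1), of "\<lambda>u v. q < slope f u v"])
    show "\<exists>u v. u < z \<and> z < v \<and> v - u < r \<and> q < slope f u v" if "z \<in> ?E \<inter> T1" "0 < r" for z r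
      using that unfolding steep_def by blast
  qed blast+
  have S1m: "S1 \<in> lmeasurable" and S2m: "S2 \<in> lmeasurable"
    using D1(1) D2(1) by (metis lmeasurable_division)+
  define T2 where "T2 = (\<Union>k\<in>D2. interior k)"
  have T2: "open T2" "T2 \<subseteq> S2" unfolding T2_def
    using division_ofD(2)[OF D2(1)] interior_subset by blast+
  have d1: "measure lebesgue S1 < s + e"
    using measure_mono_fmeasurable[OF D1(2) fmeasurableD[OF S1m] Wm] mW by simp
  have d2: "s - 2 * e < measure lebesgue S2"
  proof -
    have m: "?E - T1 \<in> lmeasurable" "?E \<inter> T1 - T2 \<in> lmeasurable"
      using Em E1m T1(1) T2(1) by (auto intro!: fmeasurable_Diff sets_completionI_sets)
    have "s \<le> measure lebesgue (S2 \<union> ((?E - T1) \<union> (?E \<inter> T1 - T2)))"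
      unfolding s_def using S2m m T2(2) Em
      by (intro measure_mono_fmeasurable fmeasurable.Un fmeasurableD[OF Em]) auto
    also have "\<dots> \<le> measure lebesgue S2 + (measure lebesgue (?E - T1) + measure lebesgue (?E \<inter> T1 - T2))"
      using S2m m by (intro order_trans[OF measure_Un_le] add_mono measure_Un_le) auto
    finally show ?thesis using D1(4) D2(4) unfolding T1_def T2_def by simp
  qed
  have S1ab: "S1 \<subseteq> {a..b}" using D1(2) W by force
  \<comment> \<open>Both families are completed to divisions of \<open>[a,b]\<close> sharing
    \<open>q1 - D1\<close>. The increments of either division telescope to the same value, and this
    yields \<open>split\<close>.\<close>
  obtain q1 where q1: "D1 \<subseteq> q1" "q1 division_of {a..b}"
    using partial_division_extend[OF D1(1) division_of_self[of a b] ] S1ab \<open>a < b\<close> by auto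
  have q1': "q1 - D1 division_of \<Union>(q1 - D1)"
    using division_of_subset[of q1] q1(2) by blast
  have dj: "T1 \<inter> interior (\<Union>(q1 - D1)) = {}"
  proof -
    have "interior k \<inter> interior (\<Union>(q1 - D1)) = {}" if "k \<in> D1" for k
    proof (rule Int_interior_Union_intervals)
      show "\<And>T. T \<in> q1 - D1 \<Longrightarrow> interior k \<inter> interior T = {}"
        using division_ofD(5)[OF q1(2)] that q1(1) by blast
    qed (use division_ofD(1,4)[OF q1'] in auto)
    then show ?thesis unfolding T1_def by blast
  qed
  have p2: "D2 \<union> (q1 - D1) division_of S2 \<union> \<Union>(q1 - D1)"
    using dj D2(2) interior_subset[of S2] by (intro division_disjoint_union D2(1) q1') blast
  have p2ab: "S2 \<union> \<Union>(q1 - D1) \<subseteq> {a..b}"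
    using D2(2) T1(2) S1ab division_ofD(6)[OF q1(2)] by blast
  obtain q2 where q2: "D2 \<union> (q1 - D1) \<subseteq> q2" "q2 division_of {a..b}"
    using partial_division_extend[OF p2 division_of_self[of a b]] p2ab \<open>a < b\<close> by auto
  define R where "R = q2 - (D2 \<union> (q1 - D1))"
  have R: "R division_of \<Union>R" unfolding R_def
    using division_of_subset[of q2] q2(2) by blast
  have Rab: "\<Union>R \<subseteq> {a..b}" using division_ofD(6)[OF q2(2)] unfolding R_def by blast
  \<comment> \<open>A common member would have empty interior, since \<open>T1\<close> does not meet
    the interior of the rest, whereas members of \<open>D2\<close> are nondegenerate.\<close>
  have D2dj: "D2 \<inter> (q1 - D1) = {}"
  proof -
    { fix k assume k: "k \<in> D2" "k \<in> q1 - D1"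
      then obtain u v where uv: "k = {u..v}" "u < v" using D2(3) by blast
      have "interior k \<subseteq> T1"
        using k(1) D2(2) division_ofD(2)[OF D2(1)] interior_subset by blast
      moreover have "interior k \<subseteq> interior (\<Union>(q1 - D1))" using k by (intro interior_mono) auto
      ultimately have "interior k = {}" using dj by blast
      then have False using uv by simp }
    then show ?thesis by blast
  qed
  have split: "(\<Sum>k\<in>D1. increment h k) = (\<Sum>k\<in>D2. increment h k) + (\<Sum>k\<in>R. increment h k)"
    for h :: "real \<Rightarrow> real"
  proof -
    have fin: "finite q1" "finite q2" using q1 q2 by auto
    have "(\<Sum>k\<in>q1. increment h k) = (\<Sum>k\<in>q2. increment h k)"
      using sum_increment_division[OF q1(2), of h] sum_increment_division[OF q2(2), of h] \<open>a < b\<close> by simp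
    moreover have "(\<Sum>k\<in>q1. increment h k) = (\<Sum>k\<in>D1. increment h k) + (\<Sum>k\<in>q1 - D1. increment h k)"
      using sum.subset_diff[OF q1(1) fin(1)] by (simp add: add.commute)
    moreover have "(\<Sum>k\<in>q2. increment h k) = (\<Sum>k\<in>D2 \<union> (q1 - D1). increment h k) + (\<Sum>k\<in>R. increment h k)"
      using sum.subset_diff[OF q2(1) fin(2)] unfolding R_def by (simp add: add.commute)
    moreover have "(\<Sum>k\<in>D2 \<union> (q1 - D1). increment h k)
        = (\<Sum>k\<in>D2. increment h k) + (\<Sum>k\<in>q1 - D1. increment h k)"
      using D2(1) fin D2dj by (intro sum.union_disjoint) auto
    ultimately show ?thesis by simp
  qed
  \<comment> \<open>For the identity function the increments are the lengths.\<close>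
  have mR: "measure lebesgue (\<Union>R) = measure lebesgue S1 - measure lebesgue S2"
    using split[of "\<lambda>x. x"] measure_division_real[OF D1(1)] measure_division_real[OF D2(1)]
      measure_division_real[OF R] by simp
  then have "(\<Sum>k\<in>R. \<bar>increment f k\<bar>) < e'"
    using \<delta>(2)[OF R Rab] d1 d2 e(3) by simp
  then have rest: "- e' < (\<Sum>k\<in>R. increment f k)"
    using sum_abs[of "increment f" R] by linarith
  have up: "(\<Sum>k\<in>D1. increment f k) \<le> p * measure lebesgue S1"
    unfolding measure_division_real[OF D1(1)] sum_distrib_left
  proof (rule sum_mono)
    fix k assume "k \<in> D1"
    then obtain u v where "k = {u..v}" "u < v" "slope f u v < p" using D1(3) slope_uminus[of f] by force
    then show "increment f k \<le> p * (Sup k - Inf k)"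
      unfolding slope_def by (simp add: field_simps)
  qed
  have lo: "q * measure lebesgue S2 \<le> (\<Sum>k\<in>D2. increment f k)"
    unfolding measure_division_real[OF D2(1)] sum_distrib_left
  proof (rule sum_mono)
    fix k assume "k \<in> D2"
    then obtain u v where "k = {u..v}" "u < v" "q < slope f u v" using D2(3) by blast
    then show "q * (Sup k - Inf k) \<le> increment f k"
      unfolding slope_def by (simp add: field_simps)
  qed
  define m1 m2 where "m1 = measure lebesgue S1" and "m2 = measure lebesgue S2"
  have "q * m2 < p * m1 + e'" using up lo rest split[of f] unfolding m1_def m2_def by linarith
  moreover have "p * (m1 - m2) \<le> \<bar>p\<bar> * (3 * e)"
  proof -
    have "p * (m1 - m2) \<le> \<bar>p\<bar> * (m1 - m2)"
      using mR measure_nonneg[of lebesgue "\<Union>R"] unfolding m1_def m2_def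
      by (intro mult_right_mono) auto
    also have "\<dots> \<le> \<bar>p\<bar> * (3 * e)" using d1 d2 unfolding m1_def m2_def by (intro mult_left_mono) auto
    finally show ?thesis .
  qed
  ultimately have "(q - p) * m2 < 2 * e'" using e(4) by (simp add: algebra_simps)
  moreover have "(q - p) * (s / 2) \<le> (q - p) * m2"
    using d2 e(2) \<open>p < q\<close> unfolding m2_def by (intro mult_left_mono) auto
  moreover have "(q - p) * (s / 2) = 4 * e'" unfolding e'_def by simp
  ultimately show False using e' by linarith
qed

lemma not_steepD:
  assumes "x \<notin> steep f a b q" "x \<in> {a<..<b}"
  obtains r where "0 < r" "\<And>u v. u < x \<Longrightarrow> x < v \<Longrightarrow> v - u < r \<Longrightarrow> u \<in> {a<..<b} \<Longrightarrow> v \<in> {a<..<b} \<Longrightarrow>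
     slope f u v \<le> q"
proof -
  have "\<not> (\<forall>r>0. \<exists>u v. u < x \<and> x < v \<and> v - u < r \<and> u \<in> {a<..<b} \<and> v \<in> {a<..<b} \<and> q < slope f u v)"
    using assms unfolding steep_def by blast
  then show thesis using that by (meson not_le)
qed

text \<open>The supremum \<open>l\<close> of the levels at which \<open>x\<close> is steep is the
  upper derivate; \<open>M\<close> and \<open>N\<close> make it finite, and \<open>pq\<close> forces
  the lower derivate up to it, so slopes over shrinking intervals around \<open>x\<close> tend to
  \<open>l\<close>. Continuity then moves one endpoint of such an interval to \<open>x\<close>,
  which turns the slopes into difference quotients.\<close>

lemma not_steep_imp_differentiable:
  assumes x: "x \<in> {a<..<b}" and cont: "continuous_on {a..b} f"
    and inf: "x \<notin> steep f a b M" "x \<notin> steep (\<lambda>x. - f x) a b N"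
    and pq: "\<And>p q. p \<in> \<rat> \<Longrightarrow> q \<in> \<rat> \<Longrightarrow> p < q \<Longrightarrow> x \<notin> steep f a b q \<or> x \<notin> steep (\<lambda>x. - f x) a b (- p)"
  shows "f differentiable at x"
proof -
  define A where "A = {q. x \<in> steep f a b q}"
  have mono: "q \<in> A" if "q' \<in> A" "q \<le> q'" for q q'
    using that unfolding A_def steep_def by (simp, meson le_less_trans)
  have bdd: "bdd_above A"
    using mono[of _ M] inf(1) unfolding bdd_above_def A_def by (metis linear mem_Collect_eq)
  obtain r0 where r0: "0 < r0" "\<And>u v. u < x \<Longrightarrow> x < v \<Longrightarrow> v - u < r0 \<Longrightarrow> u \<in> {a<..<b} \<Longrightarrow> v \<in> {a<..<b} \<Longrightarrow>
     slope (\<lambda>x. - f x) u v \<le> N" using not_steepD[OF inf(2) x] by blast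
  have "- N - 1 \<in> A"
  proof -
    have "\<exists>u v. u < x \<and> x < v \<and> v - u < r \<and> u \<in> {a<..<b} \<and> v \<in> {a<..<b} \<and> - N - 1 < slope f u v"
      if r: "0 < r" for r
    proof -
      define h where "h = min (min r r0) (min (x - a) (b - x)) / 3"
      have h: "0 < h" "2 * h < r" "2 * h < r0" "h < x - a" "h < b - x"
        unfolding h_def using r r0 x by (auto simp: min_def)
      then have "slope (\<lambda>x. - f x) (x - h) (x + h) \<le> N" using x by (intro r0(2)) auto
      then show ?thesis using h x unfolding slope_uminus
        by (intro exI[of _ "x - h"] exI[of _ "x + h"]) auto
    qed
    then show ?thesis unfolding A_def steep_def using x by blast
  qed
  then have ne: "A \<noteq> {}" by blast
  define l where "l = Sup A"
  have close: "\<exists>r>0. \<forall>u v. u < x \<and> x < v \<and> v - u < r \<and> u \<in> {a<..<b} \<and> v \<in> {a<..<b} \<longrightarrow>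
      \<bar>slope f u v - l\<bar> \<le> e" if e: "0 < e" for e
  proof -
    have "l + e \<notin> A" using cSup_upper[OF _ bdd, of "l + e"] e unfolding l_def by force
    then obtain r1 where r1: "0 < r1" "\<And>u v. u < x \<Longrightarrow> x < v \<Longrightarrow> v - u < r1 \<Longrightarrow> u \<in> {a<..<b} \<Longrightarrow>
        v \<in> {a<..<b} \<Longrightarrow> slope f u v \<le> l + e" using not_steepD[OF _ x] unfolding A_def by blast
    obtain q' where q': "q' \<in> A" "l - e < q'"
      using less_cSup_iff[OF ne bdd, of "l - e"] e unfolding l_def by auto
    \<comment> \<open>\<open>pq\<close> speaks of rational levels only, so two of them are inserted
      between \<open>l - e\<close> and a level at which \<open>x\<close> is steep.\<close>
    obtain q where q: "q \<in> \<rat>" "l - e < q" "q < q'" using Rats_dense_in_real[OF q'(2)] by blast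
    obtain p where p: "p \<in> \<rat>" "l - e < p" "p < q" using Rats_dense_in_real[OF q(2)] by blast
    have "x \<in> steep f a b q" using mono[OF q'(1), of q] q unfolding A_def by auto
    then have "x \<notin> steep (\<lambda>x. - f x) a b (- p)" using pq[OF p(1) q(1) p(3)] by blast
    then obtain r2 where r2: "0 < r2" "\<And>u v. u < x \<Longrightarrow> x < v \<Longrightarrow> v - u < r2 \<Longrightarrow> u \<in> {a<..<b} \<Longrightarrow>
        v \<in> {a<..<b} \<Longrightarrow> - slope f u v \<le> - p" using not_steepD[OF _ x] slope_uminus by metis
    have "\<bar>slope f u v - l\<bar> \<le> e"
      if "u < x" "x < v" "v - u < min r1 r2" "u \<in> {a<..<b}" "v \<in> {a<..<b}" for u v
      using r1(2)[of u v] r2(2)[of u v] that p(2) by (auto simp: abs_le_iff)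
    then show ?thesis using r1(1) r2(1) by (intro exI[of _ "min r1 r2"]) auto
  qed
  have cx: "isCont f x" using cont x by (simp add: continuous_on_interior)
  have "((\<lambda>z. (f z - f x) / (z - x)) \<longlongrightarrow> l) (at x)"
    unfolding tendsto_iff
  proof (intro allI impI)
    fix e :: real assume e: "0 < e"
    obtain r where r: "0 < r" "\<And>u v. u < x \<Longrightarrow> x < v \<Longrightarrow> v - u < r \<Longrightarrow> u \<in> {a<..<b} \<Longrightarrow> v \<in> {a<..<b} \<Longrightarrow>
      \<bar>slope f u v - l\<bar> \<le> e / 2" using close[of "e / 2"] e by auto
    \<comment> \<open>With both endpoints within \<open>r/2\<close> of \<open>x\<close> the
      straddling interval is shorter than \<open>r\<close>.\<close>
    have "eventually (\<lambda>z. z \<in> {a<..<b} \<inter> ball x (r/2)) (at x)"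
      using x r by (intro eventually_at_in_open') auto
    then show "eventually (\<lambda>z. dist ((f z - f x) / (z - x)) l < e) (at x)"
      using eventually_neq_at_within[of x x UNIV]
    proof eventually_elim
      case (elim z)
      have ev: "eventually (\<lambda>w. w \<in> {a<..<b} \<inter> ball x (r/2)) (at x)"
        using x r by (intro eventually_at_in_open') auto
      have evl: "eventually (\<lambda>w. w \<in> {a<..<b} \<inter> ball x (r/2)) (at_left x)"
        and evr: "eventually (\<lambda>w. w \<in> {a<..<b} \<inter> ball x (r/2)) (at_right x)"
        using ev unfolding eventually_at_split by blast+
      have evlt: "eventually (\<lambda>u. u < x) (at_left x)" by (simp add: eventually_at_filter)
      have "\<bar>(f z - f x) / (z - x) - l\<bar> \<le> e / 2"
      proof (cases "x < z")
        case True
        have "((\<lambda>u. \<bar>slope f u z - l\<bar>) \<longlongrightarrow> \<bar>slope f x z - l\<bar>) (at_left x)"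
          unfolding slope_def using True isCont_def cx
          by (intro tendsto_intros) (auto intro: filterlim_mono[OF _ order_refl at_le])
        moreover have "eventually (\<lambda>u. \<bar>slope f u z - l\<bar> \<le> e / 2) (at_left x)"
          using evl evlt
        proof eventually_elim
          case (elim u)
          then show ?case using \<open>z \<in> _\<close> True by (intro r(2)) (auto simp: dist_real_def)
        qed
        ultimately show ?thesis
          using tendsto_upperbound[OF _ _ trivial_limit_at_left_real] unfolding slope_def by blast
      next
        case False
        then have z: "z < x" using elim by auto
        have "((\<lambda>u. \<bar>slope f z u - l\<bar>) \<longlongrightarrow> \<bar>slope f z x - l\<bar>) (at_right x)"
          unfolding slope_def using z isCont_def cx
          by (intro tendsto_intros) (auto intro: filterlim_mono[OF _ order_refl at_le])
        moreover have "eventually (\<lambda>u. \<bar>slope f z u - l\<bar> \<le> e / 2) (at_right x)"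
          using evr eventually_at_right_less[of x]
        proof eventually_elim
          case (elim u)
          then show ?case using \<open>z \<in> _\<close> z by (intro r(2)) (auto simp: dist_real_def)
        qed
        ultimately have "\<bar>slope f z x - l\<bar> \<le> e / 2"
          using tendsto_upperbound[OF _ _ trivial_limit_at_right_real] by blast
        moreover have "slope f z x = (f z - f x) / (z - x)"
          unfolding slope_def by (metis minus_diff_eq minus_divide_divide)
        ultimately show ?thesis by simp
      qed
      then show ?case using e by (simp add: dist_real_def)
    qed
  qed
  then have "(f has_real_derivative l) (at x)" by (simp add: has_field_derivative_iff)
  then show ?thesis using real_differentiable_def by blast
qed

text \<open>A point outside the endpoints, the two sets of infinite derivates and the sets of
  \<open>steep_pair_negligible\<close> for rational \<open>p < q\<close> meets the criterion just
  proved, and these are countably many null sets.\<close>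

theorem abs_continuous_on_differentiable_ae:
  assumes ac: "abs_continuous_on a b f" and "a < b"
  shows "negligible {x\<in>{a..b}. \<not> f differentiable at x}"
proof -
  let ?E = "\<lambda>(p,q). if p < q then steep f a b q \<inter> steep (\<lambda>x. - f x) a b (- p) else {}"
  let ?I = "\<lambda>h. (\<Inter>N::nat. steep h a b (real N))"
  let ?U = "({a, b} \<union> ?I f \<union> ?I (\<lambda>x. - f x)) \<union> (\<Union>pq\<in>\<rat> \<times> \<rat>. ?E pq)"
  have "negligible (\<Union>pq\<in>\<rat> \<times> \<rat>. ?E pq)"
    using steep_pair_negligible[OF ac _ \<open>a < b\<close>]
    by (intro negligible_countable_Union) (auto intro!: countable_rat)
  then have "negligible ?U"
    using steep_infinite_negligible[OF ac] steep_infinite_negligible[OF abs_continuous_on_uminus[OF ac]]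
    by (intro negligible_Un) auto
  moreover have "{x\<in>{a..b}. \<not> f differentiable at x} \<subseteq> ?U"
  proof (rule subsetI, rule ccontr)
    fix x assume x: "x \<in> {x\<in>{a..b}. \<not> f differentiable at x}" and nU: "x \<notin> ?U"
    obtain M N :: nat where "x \<notin> steep f a b (real M)" "x \<notin> steep (\<lambda>x. - f x) a b (real N)"
      using nU by auto
    moreover have "x \<notin> steep f a b q \<or> x \<notin> steep (\<lambda>x. - f x) a b (- p)"
      if "p \<in> \<rat>" "q \<in> \<rat>" "p < q" for p q
    proof -
      have "x \<notin> ?E (p, q)" using nU that by blast
      then show ?thesis using that by simp
    qed
    moreover have "x \<in> {a<..<b}" using x nU by auto
    ultimately have "f differentiable at x"
      using abs_continuous_on_imp_continuous[OF ac] by (intro not_steep_imp_differentiable) auto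
    then show False using x by simp
  qed
  ultimately show ?thesis using negligible_subset by blast
qed

text \<open>The gauge separates the tags. Outside \<open>N\<close> it comes from differentiability,
  and the error is at most \<open>e/2\<close> times the length. At tags in \<open>N\<close> it is an
  open set of measure below \<delta>, where absolute continuity keeps the total increment of
  \<open>f\<close> below \<open>e * (b - a) / 2\<close>.\<close>

lemma has_integral_abs_continuous:
  assumes ac: "abs_continuous_on a b f" and "a \<le> b" and N: "negligible N"
    and der: "\<And>x. x \<in> {a..b} - N \<Longrightarrow> (f has_real_derivative g x) (at x)"
  shows "(g has_integral f b - f a) {a..b}"
proof (cases "a = b")
  case True
  then show ?thesis using has_integral_refl(2)[of g b] by simp
next
  case False
  then have ab: "a < b" using \<open>a \<le> b\<close> by simp
  \<comment> \<open>With the value 0 on \<open>N\<close>, a tag there contributes nothing but the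
    increment of \<open>f\<close>.\<close>
  define h where "h x = (if x \<in> N then 0 else g x)" for x
  have "(h has_integral f b - f a) {a..b}"
    unfolding has_integral_factor_content_real
  proof (intro allI impI)
    fix e :: real assume e: "0 < e"
    define e' where "e' = e * (b - a) / 2"
    have e': "0 < e'" using e ab unfolding e'_def by simp
    obtain \<delta> where \<delta>: "0 < \<delta>" "\<And>d S. d division_of S \<Longrightarrow> S \<subseteq> {a..b} \<Longrightarrow> measure lebesgue S < \<delta> \<Longrightarrow>
       (\<Sum>k\<in>d. \<bar>increment f k\<bar>) < e'" using abs_continuous_onE[OF ac e'] by blast
    obtain U where U: "open U" "N \<subseteq> U" "U - N \<in> lmeasurable" "emeasure lebesgue (U - N) < ennreal \<delta>"
      using sets_lebesgue_outer_open[OF negligible_imp_sets[OF N] \<delta>(1)] by blast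
    have "(U - N) \<union> N \<in> lmeasurable"
      using U(3) negligible_imp_measurable[OF N] by (rule fmeasurable.Un)
    moreover have "(U - N) \<union> N = U" using U(2) by blast
    ultimately have Um: "U \<in> lmeasurable" by simp
    have mU: "measure lebesgue U < \<delta>"
    proof -
      have "measure lebesgue U = measure lebesgue (U - N)"
        by (rule measure_negligible_symdiff[OF U(3)])
          (use negligible_subset[OF N] in \<open>auto intro: negligible_subset[OF N]\<close>)
      then show ?thesis using U(3,4) \<delta>(1) by (simp add: emeasure_eq_measure2 ennreal_less_iff)
    qed
    have "\<exists>r>0. \<forall>y. \<bar>y - x\<bar> < r \<longrightarrow> \<bar>f y - f x - g x * (y - x)\<bar> \<le> e/2 * \<bar>y - x\<bar>"
      if "x \<in> {a..b} - N" for x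
    proof -
      have "(f has_derivative (*) (g x)) (at x)"
        using der[OF that] by (simp add: has_field_derivative_def)
      then have "\<forall>\<epsilon>>0. \<exists>d>0. \<forall>y. norm (y - x) < d \<longrightarrow> norm (f y - f x - g x * (y - x)) \<le> \<epsilon> * norm (y - x)"
        unfolding has_derivative_within_alt by blast
      then show ?thesis using e by (metis half_gt_zero real_norm_def)
    qed
    then obtain r where r: "\<And>x. x \<in> {a..b} - N \<Longrightarrow> 0 < r x"
      "\<And>x y. x \<in> {a..b} - N \<Longrightarrow> \<bar>y - x\<bar> < r x \<Longrightarrow> \<bar>f y - f x - g x * (y - x)\<bar> \<le> e/2 * \<bar>y - x\<bar>"
      by metis
    define \<gamma> where "\<gamma> x = (if x \<in> N then U else if x \<in> {a..b} then ball x (r x) else UNIV)" for x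
    have g1: "gauge \<gamma>" unfolding gauge_def \<gamma>_def using U r(1) by auto
    have g2: "norm ((\<Sum>(x,k)\<in>p. measure lborel k *\<^sub>R h x) - (f b - f a)) \<le> e * measure lborel {a..b}"
      if p: "p tagged_division_of {a..b}" "\<gamma> fine p" for p
    proof -
      have fin: "finite p" using p by auto
      define pN where "pN = {(x,k)\<in>p. x \<in> N}"
      have pNsub: "pN \<subseteq> p" unfolding pN_def by auto
      have pt: "pN tagged_partial_division_of {a..b}"
        using p(1) pNsub tagged_partial_division_subset unfolding tagged_division_of_def by blast
      have mem: "\<exists>u v. k = {u..v} \<and> u \<le> v \<and> x \<in> {u..v} \<and> {u..v} \<subseteq> {a..b}" if "(x,k) \<in> p" for x k
        using tagged_division_ofD(2,3,4)[OF p(1) that] by (metis atLeastAtMost_iff box_real(2) order_trans)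
      have "f b - f a = (\<Sum>(x,k)\<in>p. increment f k)"
        using additive_tagged_division_1[OF \<open>a \<le> b\<close> p(1), of f] by simp
      then have "norm ((\<Sum>(x,k)\<in>p. measure lborel k *\<^sub>R h x) - (f b - f a))
          = \<bar>\<Sum>(x,k)\<in>p. measure lborel k * h x - increment f k\<bar>"
        by (simp add: sum_subtractf case_prod_unfold)
      also have "\<dots> \<le> (\<Sum>(x,k)\<in>p. \<bar>measure lborel k * h x - increment f k\<bar>)"
        by (rule order_trans[OF sum_abs]) (simp add: case_prod_unfold)
      also have "\<dots> \<le> (\<Sum>(x,k)\<in>p. e/2 * measure lborel k + (if x \<in> N then \<bar>increment f k\<bar> else 0))"
      proof (intro sum_mono, clarify)
        fix x k assume xk: "(x, k) \<in> p"
        obtain u v where uv: "k = {u..v}" "u \<le> v" "x \<in> {u..v}" "{u..v} \<subseteq> {a..b}"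
          using mem[OF xk] by blast
        show "\<bar>measure lborel k * h x - increment f k\<bar> \<le> e/2 * measure lborel k + (if x \<in> N then \<bar>increment f k\<bar> else 0)"
        proof (cases "x \<in> N")
          case True
          moreover have "0 \<le> e/2 * measure lborel k" using e by simp
          ultimately show ?thesis unfolding h_def by (simp add: abs_minus_commute)
        next
          case False
          then have x: "x \<in> {a..b} - N" using uv by auto
          have "{u..v} \<subseteq> ball x (r x)"
            using fineD[OF p(2) xk] x uv(1) unfolding \<gamma>_def by simp
          then have "\<bar>u - x\<bar> < r x" "\<bar>v - x\<bar> < r x" using uv(2) by (auto simp: subset_iff dist_real_def abs_minus_commute)
          then have "\<bar>f u - f x - g x * (u - x)\<bar> \<le> e/2 * \<bar>u - x\<bar>" "\<bar>f v - f x - g x * (v - x)\<bar> \<le> e/2 * \<bar>v - x\<bar>"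
            using r(2)[OF x] by blast+
          \<comment> \<open>The error over \<open>{u..v}\<close> is the difference of the
            linearisation errors from the tag to the two endpoints.\<close>
          moreover have "measure lborel k * h x - increment f k
              = (f u - f x - g x * (u - x)) - (f v - f x - g x * (v - x))"
            using uv False unfolding h_def by (simp add: algebra_simps)
          moreover have "e/2 * \<bar>u - x\<bar> + e/2 * \<bar>v - x\<bar> = e/2 * measure lborel k"
            using uv by (simp add: field_simps)
          ultimately have "\<bar>measure lborel k * h x - increment f k\<bar> \<le> e/2 * measure lborel k" by linarith
          then show ?thesis using False by simp
        qed
      qed
      also have "\<dots> = e/2 * (\<Sum>(x,k)\<in>p. measure lborel k) + (\<Sum>(x,k)\<in>p. if x \<in> N then \<bar>increment f k\<bar> else 0)"
        by (simp add: sum.distrib sum_distrib_left case_prod_unfold)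
      also have "(\<Sum>(x,k)\<in>p. measure lborel k) = b - a"
        using additive_content_tagged_division[of p a b] p(1) \<open>a \<le> b\<close> by simp
      also have "(\<Sum>(x,k)\<in>p. if x \<in> N then \<bar>increment f k\<bar> else 0) = (\<Sum>(x,k)\<in>pN. \<bar>increment f k\<bar>)"
        unfolding pN_def using fin
        by (intro sum.mono_neutral_cong_right) (auto split: if_splits)
      \<comment> \<open>Dropping the tags in the next step requires a function that is 0 on every
        interval without interior, the empty one included.\<close>
      also have "\<dots> = (\<Sum>(x,k)\<in>pN. if k = {} then 0 else \<bar>increment f k\<bar>)"
        using mem pNsub by (intro sum.cong) fastforce+
      also have "\<dots> = (\<Sum>k\<in>snd ` pN. if k = {} then 0 else \<bar>increment f k\<bar>)"
      proof (rule sum.over_tagged_division_lemma)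
        show "pN tagged_division_of \<Union>(snd ` pN)"
          using tagged_partial_division_of_Union_self[OF pt] .
      qed (auto simp: le_less)
      also have "\<dots> = (\<Sum>k\<in>snd ` pN. \<bar>increment f k\<bar>)"
        using mem pNsub by (intro sum.cong) fastforce+
      also have "\<dots> < e'"
      proof (rule \<delta>(2))
        show d: "snd ` pN division_of \<Union>(snd ` pN)" using partial_division_of_tagged_division[OF pt] .
        show "\<Union>(snd ` pN) \<subseteq> {a..b}" using tagged_partial_division_ofD(3)[OF pt] by fastforce
        have 1: "\<Union>(snd ` pN) \<subseteq> U"
          using fineD[OF p(2)] pNsub unfolding \<gamma>_def pN_def by fastforce
        have 2: "\<Union>(snd ` pN) \<in> sets lebesgue" using d by (metis lmeasurable_division fmeasurableD)
        show "measure lebesgue (\<Union>(snd ` pN)) < \<delta>"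
          using measure_mono_fmeasurable[OF 1 2 Um] mU by linarith
      qed
      finally show ?thesis using \<open>a \<le> b\<close> unfolding e'_def by (simp add: field_simps)
    qed
    show "\<exists>d. gauge d \<and> (\<forall>p. p tagged_division_of {a..b} \<and> d fine p \<longrightarrow>
        norm ((\<Sum>(x,k)\<in>p. measure lborel k *\<^sub>R h x) - (f b - f a)) \<le> e * measure lborel {a..b})"
      using g1 g2 by (intro exI[of _ \<gamma>] conjI allI impI) simp_all
  qed
  then show ?thesis
    by (rule has_integral_spike[OF N, rotated]) (simp add: h_def)
qed

section \<open>Borel densities and the passage from \<open>lebesgue\<close> to
  \<open>lborel\<close>\<close>

lemma abs_continuous_on_subset:
  "abs_continuous_on a b f \<Longrightarrow> {c..d} \<subseteq> {a..b} \<Longrightarrow> abs_continuous_on c d f"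
  unfolding abs_continuous_on_def by (meson order_trans)

text \<open>For a nonnegative integrand, gauge integrability already gives absolute integrability.
  This imports the integrals of singular powers; Borel measurability carries them over to
  \<open>lborel\<close>.\<close>

lemma integrable_lborel_nonneg:
  fixes f :: "real \<Rightarrow> real"
  assumes "f \<in> borel_measurable borel" "S \<in> sets borel" "(f has_integral I) S" "\<And>x. x \<in> S \<Longrightarrow> 0 \<le> f x"
  shows "set_integrable lborel S f" "(LINT x:S|lborel. f x) = I"
proof -
  have L: "set_integrable lebesgue S f"
    using nonnegative_absolutely_integrable_1 assms by blast
  have m: "(\<lambda>x. indicator S x *\<^sub>R f x) \<in> borel_measurable lborel" using assms by simp
  show "set_integrable lborel S f"
    using L unfolding set_integrable_def by (simp only: integrable_completion[OF m])
  have "(LINT x:S|lebesgue. f x) = integral S f"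
    using L by (rule set_lebesgue_integral_eq_integral)
  then show "(LINT x:S|lborel. f x) = I"
    using integral_unique[OF assms(3)] unfolding set_lebesgue_integral_def integral_completion[OF m] by simp
qed

text \<open>\<open>q\<close> is a Borel representative, supported in \<open>[a,b]\<close>, of the derivative of \<open>f\<close>.\<close>

definition has_density :: "real \<Rightarrow> real \<Rightarrow> (real \<Rightarrow> real) \<Rightarrow> (real \<Rightarrow> real) \<Rightarrow> bool" where
  "has_density a b f q \<longleftrightarrow> q \<in> borel_measurable borel \<and> integrable lborel q \<and> (\<forall>x. x \<notin> {a..b} \<longrightarrow> q x = 0) \<and>
     negligible {x\<in>{a..b}. \<not> (f has_real_derivative q x) (at x)}"

text \<open>\<open>deriv f\<close> is only known to be Lebesgue measurable, while Fubini's theorem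
  is applied to Borel functions on a product. Hence a Borel function equal to it almost everywhere
  is taken and cut off outside \<open>[a,b]\<close>.\<close>

lemma abs_continuous_has_density:
  assumes ac: "abs_continuous_on a b f" and "a < b" and int: "set_integrable lebesgue {a..b} (deriv f)"
  obtains q where "has_density a b f q"
proof -
  let ?g = "\<lambda>x. indicator {a..b} x * deriv f x"
  have gi: "integrable lebesgue ?g" using int unfolding set_integrable_def by simp
  then have gm: "?g \<in> borel_measurable (completion lborel)" by auto
  obtain g' where g': "g' \<in> borel_measurable lborel" "AE x in lborel. ?g x = g' x"
    using completion_ex_borel_measurable_real[OF gm] by blast
  define q where "q x = indicator {a..b} x * g' x" for x
  have qm: "q \<in> borel_measurable borel" unfolding q_def using g'(1) by simp
  have ae: "AE x in lborel. ?g x = q x"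
    using g'(2)
  proof eventually_elim
    case (elim x)
    then show ?case by (cases "x \<in> {a..b}") (simp_all add: q_def)
  qed
  have aeL: "AE x in lebesgue. ?g x = q x" using AE_completion[OF ae] .
  have "integrable lebesgue q"
    using qm by (intro integrable_cong_AE_imp[OF gi _ aeL] measurable_completion) simp
  then have qi: "integrable lborel q" using qm by (simp add: integrable_completion)
  have "{x\<in>{a..b}. \<not> (f has_real_derivative q x) (at x)}
      \<subseteq> {x\<in>{a..b}. \<not> f differentiable at x} \<union> {x. ?g x \<noteq> q x}"
  proof -
    have "(f has_real_derivative deriv f x) (at x)" if "f differentiable at x" for x
      using that by (metis DERIV_imp_deriv real_differentiable_def)
    then show ?thesis by (auto simp: indicator_def) metis
  qed
  moreover have neg: "negligible {x. ?g x \<noteq> q x}"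
  proof -
    obtain N where N: "N \<in> null_sets lborel" "{x\<in>space lborel. \<not> ?g x = q x} \<subseteq> N"
      using ae by (auto elim: AE_E simp: null_sets_def)
    have "negligible N" unfolding negligible_iff_null_sets using N(1) by (rule null_sets_completionI)
    then show ?thesis by (rule negligible_subset) (use N(2) in auto)
  qed
  ultimately have "negligible {x\<in>{a..b}. \<not> (f has_real_derivative q x) (at x)}"
    using negligible_subset[OF negligible_Un[OF abs_continuous_on_differentiable_ae[OF ac \<open>a < b\<close>] neg]] by blast
  moreover have "\<forall>x. x \<notin> {a..b} \<longrightarrow> q x = 0" by (simp add: q_def)
  ultimately show thesis using that[of q] qm qi unfolding has_density_def by blast
qed

text \<open>The bridge between the definitions, which integrate over \<open>lebesgue\<close> and do
  not see null sets, and the calculations with Borel integrands over \<open>lborel\<close>, where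
  affine substitution and Fubini are applied.\<close>

lemma integral_spike_lborel:
  fixes f q :: "real \<Rightarrow> real"
  assumes N: "negligible N" and eq: "\<And>x. x \<in> S - N \<Longrightarrow> f x = q x"
    and q: "q \<in> borel_measurable borel" and S: "S \<in> sets borel"
  shows "set_integrable lebesgue S f \<longleftrightarrow> set_integrable lborel S q"
    and "(LINT x:S|lebesgue. f x) = (LINT x:S|lborel. q x)"
proof -
  have qm: "(\<lambda>x. indicator S x *\<^sub>R q x) \<in> borel_measurable lborel" using q S by simp
  have eqL: "set_integrable lebesgue S q \<longleftrightarrow> set_integrable lborel S q"
    unfolding set_integrable_def by (rule integrable_completion[OF qm])
  have iff: "set_integrable lebesgue S f \<longleftrightarrow> set_integrable lebesgue S q"
    using absolutely_integrable_spike_eq[OF N, of S f q] eq by auto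
  show 1: "set_integrable lebesgue S f \<longleftrightarrow> set_integrable lborel S q"
    using iff eqL by blast
  show "(LINT x:S|lebesgue. f x) = (LINT x:S|lborel. q x)"
  proof (cases "set_integrable lborel S q")
    case True
    then have "(LINT x:S|lebesgue. f x) = integral S f" "(LINT x:S|lebesgue. q x) = integral S q"
      using 1 eqL by (auto intro: set_lebesgue_integral_eq_integral)
    moreover have "integral S f = integral S q" using eq by (intro integral_spike[OF N]) auto
    moreover have "(LINT x:S|lebesgue. q x) = (LINT x:S|lborel. q x)"
      unfolding set_lebesgue_integral_def by (rule integral_completion[OF qm])
    ultimately show ?thesis by simp
  next
    \<comment> \<open>Both integrals then have the default value 0.\<close>
    case False
    then show ?thesis using 1 unfolding set_lebesgue_integral_def set_integrable_def
      by (simp add: not_integrable_integral_eq)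
  qed
qed

lemma has_density_integral:
  assumes d: "has_density a b f q" and ac: "abs_continuous_on a b f"
    and cd: "a \<le> c" "c \<le> d" "d \<le> b"
  shows "f d - f c = (LINT t:{c..d}|lborel. q t)"
proof -
  define N where "N = {x\<in>{a..b}. \<not> (f has_real_derivative q x) (at x)}"
  have N: "negligible N" using d unfolding has_density_def N_def by blast
  have "(q has_integral f d - f c) {c..d}"
    using cd by (intro has_integral_abs_continuous[OF abs_continuous_on_subset[OF ac] _ N]) (auto simp: N_def)
  moreover have "set_integrable lborel {c..d} q"
    using d integrable_mult_indicator[of "{c..d}" lborel q] unfolding has_density_def set_integrable_def by simp
  ultimately show ?thesis
    using has_integral_set_lebesgue set_borel_integral_eq_integral(2) integral_unique by metis
qed

section \<open>Fractional integrals as convolutions\<close>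

text \<open>Vanishing for \<open>r \<le> 0\<close> builds the condition \<open>t < x\<close> into
  \<open>frac_kernel \<gamma> (x - t)\<close>, so fractional integrals become integrals over the
  whole line.\<close>

definition frac_kernel :: "real \<Rightarrow> real \<Rightarrow> real" where
  "frac_kernel \<gamma> r = (if 0 < r then r powr (\<gamma> - 1) else 0)"

lemma frac_kernel_nonneg [simp]: "0 \<le> frac_kernel \<gamma> r"
  unfolding frac_kernel_def by simp

lemma frac_kernel_measurable [measurable]: "frac_kernel \<gamma> \<in> borel_measurable borel"
  unfolding frac_kernel_def by measurable

lemma frac_kernel_integral:
  assumes "0 < \<gamma>" "0 \<le> c"
  shows "integrable lborel (\<lambda>s. indicator {0..c} s * frac_kernel \<gamma> s)"
    and "(LINT s|lborel. indicator {0..c} s * frac_kernel \<gamma> s) = c powr \<gamma> / \<gamma>"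
proof -
  have "((\<lambda>s. s powr (\<gamma> - 1)) has_integral (c powr \<gamma> / \<gamma>)) {0..c}"
    using has_integral_powr_from_0[of "\<gamma> - 1" c] assms by simp
  then have h: "(frac_kernel \<gamma> has_integral (c powr \<gamma> / \<gamma>)) {0..c}"
    by (rule has_integral_spike[of "{0}", rotated 2]) (auto simp: frac_kernel_def)
  show "integrable lborel (\<lambda>s. indicator {0..c} s * frac_kernel \<gamma> s)"
    "(LINT s|lborel. indicator {0..c} s * frac_kernel \<gamma> s) = c powr \<gamma> / \<gamma>"
    using integrable_lborel_nonneg[OF _ _ h] unfolding set_integrable_def set_lebesgue_integral_def by auto
qed

lemma frac_kernel_integral_left:
  assumes "0 < \<gamma>" "c \<le> x"
  shows "integrable lborel (\<lambda>t. indicator {c..} t * frac_kernel \<gamma> (x - t))"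
    and "(LINT t|lborel. indicator {c..} t * frac_kernel \<gamma> (x - t)) = (x - c) powr \<gamma> / \<gamma>"
proof -
  have e: "indicator {0..x - c} (x + - 1 * t) * frac_kernel \<gamma> (x + - 1 * t)
      = indicator {c..} t * frac_kernel \<gamma> (x - t)" for t
    by (auto simp: frac_kernel_def indicator_def)
  show "integrable lborel (\<lambda>t. indicator {c..} t * frac_kernel \<gamma> (x - t))"
    using lborel_integrable_real_affine[OF frac_kernel_integral(1), of \<gamma> "x - c" "-1" x] assms
    unfolding e by simp
  show "(LINT t|lborel. indicator {c..} t * frac_kernel \<gamma> (x - t)) = (x - c) powr \<gamma> / \<gamma>"
    using lborel_integral_real_affine[of "-1" "\<lambda>s. indicator {0..x - c} s * frac_kernel \<gamma> s" x]
      frac_kernel_integral(2)[of \<gamma> "x - c"] assms unfolding e by simp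
qed

lemma frac_kernel_integral_right:
  assumes "0 < \<gamma>" "t \<le> c"
  shows "integrable lborel (\<lambda>x. indicator {..c} x * frac_kernel \<gamma> (x - t))"
    and "(LINT x|lborel. indicator {..c} x * frac_kernel \<gamma> (x - t)) = (c - t) powr \<gamma> / \<gamma>"
proof -
  have e: "indicator {0..c - t} (- t + 1 * x) * frac_kernel \<gamma> (- t + 1 * x)
      = indicator {..c} x * frac_kernel \<gamma> (x - t)" for x
    by (auto simp: frac_kernel_def indicator_def)
  show "integrable lborel (\<lambda>x. indicator {..c} x * frac_kernel \<gamma> (x - t))"
    using lborel_integrable_real_affine[OF frac_kernel_integral(1), of \<gamma> "c - t" 1 "- t"] assms
    unfolding e by simp
  show "(LINT x|lborel. indicator {..c} x * frac_kernel \<gamma> (x - t)) = (c - t) powr \<gamma> / \<gamma>"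
    using lborel_integral_real_affine[of 1 "\<lambda>s. indicator {0..c - t} s * frac_kernel \<gamma> s" "- t"]
      frac_kernel_integral(2)[of \<gamma> "c - t"] assms unfolding e by simp
qed

text \<open>The substitution \<open>t = x - s\<close> moves the singularity to the fixed point
  \<open>s = 0\<close>, and one integrable kernel on \<open>[0, b - a]\<close> then dominates the
  integrands for all \<open>x\<close> at once. This is why continuity is asked of
  \<open>\<lambda>x. K x (x - s)\<close> for each fixed \<open>s\<close>.\<close>

lemma continuous_on_kernel_integral:
  fixes K :: "real \<Rightarrow> real \<Rightarrow> real"
  assumes "0 < \<gamma>"
    and meas: "\<And>x. x \<in> {a..b} \<Longrightarrow> (\<lambda>t. indicator {a..<x} t * K x t) \<in> borel_measurable borel"
    and bound: "\<And>x t. x \<in> {a..b} \<Longrightarrow> a \<le> t \<Longrightarrow> t < x \<Longrightarrow> \<bar>K x t\<bar> \<le> C * frac_kernel \<gamma> (x - t)"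
    and cont: "\<And>s. 0 < s \<Longrightarrow> continuous_on {a+s..b} (\<lambda>x. K x (x - s))"
  shows "continuous_on {a..b} (\<lambda>x. LINT t|lborel. indicator {a..<x} t * K x t)"
    and "\<And>x. x \<in> {a..b} \<Longrightarrow> integrable lborel (\<lambda>t. indicator {a..<x} t * K x t)"
    and "\<And>x. x \<in> {a..b} \<Longrightarrow> \<bar>LINT t|lborel. indicator {a..<x} t * K x t\<bar> \<le> C * ((x - a) powr \<gamma> / \<gamma>)"
proof -
  have bnd: "norm (indicator {a..<x} t * K x t) \<le> C * (indicator {a..} t * frac_kernel \<gamma> (x - t))"
    if "x \<in> {a..b}" for x t
    using bound[OF that, of t] by (auto simp: indicator_def frac_kernel_def)
  show int: "integrable lborel (\<lambda>t. indicator {a..<x} t * K x t)" if x: "x \<in> {a..b}" for x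
    by (rule Bochner_Integration.integrable_bound[where f = "\<lambda>t. C * (indicator {a..} t * frac_kernel \<gamma> (x - t))"])
      (use frac_kernel_integral_left(1)[OF \<open>0 < \<gamma>\<close>, of a x] meas[OF x] bnd[OF x] x in
        \<open>auto intro!: AE_I2 order_trans[OF bnd[OF x, unfolded real_norm_def] abs_ge_self]\<close>)
  show "\<bar>LINT t|lborel. indicator {a..<x} t * K x t\<bar> \<le> C * ((x - a) powr \<gamma> / \<gamma>)" if x: "x \<in> {a..b}" for x
  proof -
    have "\<bar>LINT t|lborel. indicator {a..<x} t * K x t\<bar> \<le> (LINT t|lborel. norm (indicator {a..<x} t * K x t))"
      using integral_norm_bound[of lborel "\<lambda>t. indicator {a..<x} t * K x t"] by simp
    also have "\<dots> \<le> (LINT t|lborel. C * (indicator {a..} t * frac_kernel \<gamma> (x - t)))"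
      using frac_kernel_integral_left(1)[OF \<open>0 < \<gamma>\<close>, of a x] x
      by (intro integral_mono integrable_norm int[OF x] bnd[OF x] integrable_mult_right) auto
    also have "\<dots> = C * ((x - a) powr \<gamma> / \<gamma>)"
      using frac_kernel_integral_left(2)[OF \<open>0 < \<gamma>\<close>, of a x] x by simp
    finally show ?thesis .
  qed
  define F where "F x s = indicator {0<..x - a} s * K x (x - s)" for x s
  have eq: "(LINT t|lborel. indicator {a..<x} t * K x t) = (LINT s|lborel. F x s)" for x
  proof -
    have "indicator {a..<x} (x + - 1 * s) * K x (x + - 1 * s) = F x s" for s
      unfolding F_def by (auto simp: indicator_def)
    then show ?thesis
      using lborel_integral_real_affine[of "-1" "\<lambda>t. indicator {a..<x} t * K x t" x] by simp
  qed
  show "continuous_on {a..b} (\<lambda>x. LINT t|lborel. indicator {a..<x} t * K x t)"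
    unfolding eq continuous_on_sequentially comp_def
  proof (intro allI ballI impI)
    fix X x assume x: "x \<in> {a..b}" and X: "(\<forall>n. X n \<in> {a..b}) \<and> X \<longlonglongrightarrow> x"
    have Fm: "F z \<in> borel_measurable borel" if "z \<in> {a..b}" for z
    proof -
      have "(\<lambda>s. indicator {a..<z} (z - s) * K z (z - s)) \<in> borel_measurable borel"
        using measurable_compose[OF _ meas[OF that], of "\<lambda>s. z - s" borel] by simp
      also have "(\<lambda>s. indicator {a..<z} (z - s) * K z (z - s)) = F z"
        unfolding F_def fun_eq_iff by (auto simp: indicator_def)
      finally show ?thesis .
    qed
    show "(\<lambda>n. LINT s|lborel. F (X n) s) \<longlonglongrightarrow> (LINT s|lborel. F x s)"
    proof (rule integral_dominated_convergence[where w = "\<lambda>s. \<bar>C\<bar> * (indicator {0..b - a} s * frac_kernel \<gamma> s)"])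
      show "integrable lborel (\<lambda>s. \<bar>C\<bar> * (indicator {0..b - a} s * frac_kernel \<gamma> s))"
        using frac_kernel_integral(1)[OF \<open>0 < \<gamma>\<close>, of "b - a"] x by (intro integrable_mult_right) auto
      show "AE s in lborel. norm (F (X n) s) \<le> \<bar>C\<bar> * (indicator {0..b - a} s * frac_kernel \<gamma> s)" for n
      proof (rule AE_I2)
        fix s
        show "norm (F (X n) s) \<le> \<bar>C\<bar> * (indicator {0..b - a} s * frac_kernel \<gamma> s)"
        proof (cases "s \<in> {0<..X n - a}")
          case True
          then have "\<bar>K (X n) (X n - s)\<bar> \<le> C * frac_kernel \<gamma> s"
            using bound[of "X n" "X n - s"] X by auto
          moreover have "C * frac_kernel \<gamma> s \<le> \<bar>C\<bar> * frac_kernel \<gamma> s" by (intro mult_right_mono) auto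
          moreover have "X n \<in> {a..b}" using X by blast
          ultimately show ?thesis using True unfolding F_def by simp
        qed (simp add: F_def)
      qed
      \<comment> \<open>At \<open>s = x - a\<close> the cut-off may oscillate along the sequence, so
        this single point is left out.\<close>
      show "AE s in lborel. (\<lambda>n. F (X n) s) \<longlonglongrightarrow> F x s"
        using AE_lborel_singleton[of "x - a"]
      proof eventually_elim
        case (elim s)
        have Xa: "(\<lambda>n. X n - a) \<longlonglongrightarrow> x - a" using X by (intro tendsto_intros) auto
        consider "s \<le> 0" | "0 < s" "x - a < s" | "0 < s" "s < x - a" using elim by linarith
        then show ?case
        proof cases
          case 1
          then show ?thesis by (simp add: F_def)
        next
          case 2
          have "eventually (\<lambda>n. X n - a < s) sequentially" using order_tendstoD(2)[OF Xa 2(2)] .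
          then have "eventually (\<lambda>n. F x s = F (X n) s) sequentially"
            by eventually_elim (use 2 in \<open>simp add: F_def\<close>)
          then show ?thesis by (rule Lim_transform_eventually[OF tendsto_const])
        next
          case 3
          have ev: "eventually (\<lambda>n. s < X n - a) sequentially" using order_tendstoD(1)[OF Xa 3(2)] .
          have "(\<lambda>n. K (X n) (X n - s)) \<longlonglongrightarrow> K x (x - s)"
          proof (rule continuous_on_tendsto_compose[OF cont[OF 3(1)], of X])
            show "eventually (\<lambda>n. X n \<in> {a + s..b}) sequentially"
              using ev by eventually_elim (use X in \<open>auto simp: algebra_simps intro: less_imp_le\<close>)
          qed (use X x 3 in auto)
          moreover have "eventually (\<lambda>n. K (X n) (X n - s) = F (X n) s) sequentially"
            using ev by eventually_elim (use 3 in \<open>simp add: F_def\<close>)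
          moreover have "K x (x - s) = F x s" using 3 by (simp add: F_def)
          ultimately show ?thesis using Lim_transform_eventually by fastforce
        qed
      qed
    qed (use Fm X x in auto)
  qed
qed

text \<open>For \<open>q\<close> supported in \<open>[a,\<infinity>)\<close> and \<open>M\<close> supported in \<open>(-\<infinity>,b]\<close>, these are the left and right
  Riemann--Liouville integrals without the factor \<open>1 / Gamma \<gamma>\<close>.\<close>

definition conv_left :: "real \<Rightarrow> (real \<Rightarrow> real) \<Rightarrow> real \<Rightarrow> real" where
  "conv_left \<gamma> q x = (LINT t|lborel. frac_kernel \<gamma> (x - t) * q t)"

definition conv_right :: "real \<Rightarrow> (real \<Rightarrow> real) \<Rightarrow> real \<Rightarrow> real" where
  "conv_right \<gamma> M t = (LINT x|lborel. frac_kernel \<gamma> (x - t) * M x)"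

text \<open>Absolute integrability in one order of integration yields joint integrability, and with
  it both iterated integrals. Integrability of \<open>k\<close> in \<open>s\<close> is asked only
  where \<open>q t \<noteq> 0\<close>, since elsewhere the product is 0.\<close>

lemma Fubini_kernel:
  fixes k :: "real \<Rightarrow> real \<Rightarrow> real"
  assumes k: "(\<lambda>(s,t). k s t) \<in> borel_measurable (borel \<Otimes>\<^sub>M borel)" and q: "q \<in> borel_measurable borel"
    and ks: "\<And>t. q t \<noteq> 0 \<Longrightarrow> integrable lborel (\<lambda>s. k s t)"
    and int: "integrable lborel (\<lambda>t. \<bar>q t\<bar> * (LINT s|lborel. \<bar>k s t\<bar>))"
  shows "integrable lborel (\<lambda>s. LINT t|lborel. k s t * q t)"
    and "integrable lborel (\<lambda>t. q t * (LINT s|lborel. k s t))"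
    and "(LINT s|lborel. LINT t|lborel. k s t * q t) = (LINT t|lborel. q t * (LINT s|lborel. k s t))"
proof -
  note k[measurable] q[measurable]
  let ?f = "\<lambda>(t,s). k s t * q t"
  have m: "?f \<in> borel_measurable (lborel \<Otimes>\<^sub>M lborel)" by measurable
  have f: "integrable (lborel \<Otimes>\<^sub>M lborel) ?f"
  proof (rule lborel_pair.Fubini_integrable[OF m])
    show "integrable lborel (\<lambda>t. LINT s|lborel. norm (?f (t, s)))"
      using int by (simp add: abs_mult mult.commute)
    show "AE t in lborel. integrable lborel (\<lambda>s. ?f (t, s))"
    proof (rule AE_I2)
      fix t
      show "integrable lborel (\<lambda>s. ?f (t, s))" using ks[of t] by (cases "q t = 0") auto
    qed
  qed
  show "integrable lborel (\<lambda>t. q t * (LINT s|lborel. k s t))"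
    using lborel_pair.integrable_fst'[OF f] by (simp add: mult.commute)
  have f': "integrable (lborel \<Otimes>\<^sub>M lborel) (\<lambda>(s,t). k s t * q t)"
    using lborel_pair.integrable_product_swap[OF f] by simp
  show "integrable lborel (\<lambda>s. LINT t|lborel. k s t * q t)"
    using lborel_pair.integrable_fst'[OF f'] by simp
  show "(LINT s|lborel. LINT t|lborel. k s t * q t) = (LINT t|lborel. q t * (LINT s|lborel. k s t))"
    using lborel_pair.Fubini_integral[of "\<lambda>t s. k s t * q t"] f by (simp add: mult.commute)
qed

text \<open>Fractional integration by parts: both sides are iterated integrals of
  \<open>M x * frac_kernel \<gamma> (x - t) * q t\<close>. The bound on \<open>M\<close> and its
  support keep the inner integral below \<open>C * ((b - a) powr \<gamma> / \<gamma>)\<close>, so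
  Fubini applies to any integrable \<open>q\<close>.\<close>

lemma conv_duality:
  assumes "0 < \<gamma>" and q: "integrable lborel q" "\<And>t. t \<notin> {a..b} \<Longrightarrow> q t = 0"
    and M: "M \<in> borel_measurable borel" "\<And>x. x \<notin> {a..b} \<Longrightarrow> M x = 0" "\<And>x. \<bar>M x\<bar> \<le> C"
  shows "integrable lborel (\<lambda>x. M x * conv_left \<gamma> q x)"
    and "integrable lborel (\<lambda>t. q t * conv_right \<gamma> M t)"
    and "(LINT x|lborel. M x * conv_left \<gamma> q x) = (LINT t|lborel. q t * conv_right \<gamma> M t)"
proof -
  note M(1)[measurable]
  have qm[measurable]: "q \<in> borel_measurable borel" using q(1) by auto
  define k where "k x t = M x * frac_kernel \<gamma> (x - t)" for x t
  have km: "(\<lambda>(x,t). k x t) \<in> borel_measurable (borel \<Otimes>\<^sub>M borel)" unfolding k_def by measurable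
  have C: "0 \<le> C" using M(3)[of 0] by linarith
  have bnd: "norm (k x t) \<le> C * (indicator {..b} x * frac_kernel \<gamma> (x - t))" for x t
    unfolding k_def using M(2)[of x] M(3)[of x]
    by (cases "x \<in> {a..b}") (auto simp: abs_mult intro!: mult_right_mono mult_nonneg_nonneg C)
  have ki: "integrable lborel (\<lambda>x. k x t)" if "q t \<noteq> 0" for t
  proof (rule Bochner_Integration.integrable_bound[where f = "\<lambda>x. C * (indicator {..b} x * frac_kernel \<gamma> (x - t))"])
    have "t \<le> b" using that q(2)[of t] by fastforce
    then show "integrable lborel (\<lambda>x. C * (indicator {..b} x * frac_kernel \<gamma> (x - t)))"
      using frac_kernel_integral_right(1)[OF \<open>0 < \<gamma>\<close>] by simp
    show "(\<lambda>x. k x t) \<in> borel_measurable lborel" unfolding k_def by measurable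
    show "AE x in lborel. norm (k x t) \<le> norm (C * (indicator {..b} x * frac_kernel \<gamma> (x - t)))"
      using bnd[of _ t] C by (intro AE_I2) (auto intro: order_trans)
  qed
  have kb: "\<bar>q t\<bar> * (LINT x|lborel. \<bar>k x t\<bar>) \<le> (C * ((b - a) powr \<gamma> / \<gamma>)) * \<bar>q t\<bar>" for t
  proof (cases "q t = 0")
    case False
    then have t: "t \<in> {a..b}" using q(2)[of t] by fastforce
    have "(LINT x|lborel. \<bar>k x t\<bar>) \<le> (LINT x|lborel. C * (indicator {..b} x * frac_kernel \<gamma> (x - t)))"
      using frac_kernel_integral_right(1)[OF \<open>0 < \<gamma>\<close>, of t b] ki[OF False] bnd[of _ t] t
      by (intro integral_mono integrable_mult_right integrable_abs) auto
    also have "\<dots> = C * ((b - t) powr \<gamma> / \<gamma>)"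
      using frac_kernel_integral_right(2)[OF \<open>0 < \<gamma>\<close>, of t b] t by simp
    also have "\<dots> \<le> C * ((b - a) powr \<gamma> / \<gamma>)"
      using t C \<open>0 < \<gamma>\<close> by (intro mult_left_mono divide_right_mono powr_mono2) auto
    finally have "\<bar>q t\<bar> * (LINT x|lborel. \<bar>k x t\<bar>) \<le> \<bar>q t\<bar> * (C * ((b - a) powr \<gamma> / \<gamma>))"
      by (rule mult_left_mono) simp
    then show ?thesis by (simp only: mult.commute)
  qed simp
  have int: "integrable lborel (\<lambda>t. \<bar>q t\<bar> * (LINT x|lborel. \<bar>k x t\<bar>))"
  proof (rule Bochner_Integration.integrable_bound[where f = "\<lambda>t. (C * ((b - a) powr \<gamma> / \<gamma>)) * \<bar>q t\<bar>"])
    show "integrable lborel (\<lambda>t. (C * ((b - a) powr \<gamma> / \<gamma>)) * \<bar>q t\<bar>)" using q(1) by simp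
    show "(\<lambda>t. \<bar>q t\<bar> * (LINT x|lborel. \<bar>k x t\<bar>)) \<in> borel_measurable lborel"
      unfolding k_def by measurable
    show "AE t in lborel. norm (\<bar>q t\<bar> * (LINT x|lborel. \<bar>k x t\<bar>)) \<le> norm ((C * ((b - a) powr \<gamma> / \<gamma>)) * \<bar>q t\<bar>)"
    proof (rule AE_I2)
      fix t
      have "0 \<le> \<bar>q t\<bar> * (LINT x|lborel. \<bar>k x t\<bar>)" by simp
      then show "norm (\<bar>q t\<bar> * (LINT x|lborel. \<bar>k x t\<bar>)) \<le> norm ((C * ((b - a) powr \<gamma> / \<gamma>)) * \<bar>q t\<bar>)"
        using kb[of t] unfolding real_norm_def by linarith
    qed
  qed
  have l: "(LINT t|lborel. k x t * q t) = M x * conv_left \<gamma> q x" for x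
    unfolding k_def conv_left_def by (simp add: mult.assoc)
  have r: "(LINT x|lborel. k x t) = conv_right \<gamma> M t" for t
    unfolding k_def conv_right_def by (simp add: mult.commute)
  show "integrable lborel (\<lambda>x. M x * conv_left \<gamma> q x)" "integrable lborel (\<lambda>t. q t * conv_right \<gamma> M t)"
    "(LINT x|lborel. M x * conv_left \<gamma> q x) = (LINT t|lborel. q t * conv_right \<gamma> M t)"
    using Fubini_kernel[OF km qm ki int] unfolding l r by auto
qed

lemma frac_kernel_scale:
  assumes "0 < c"
  shows "frac_kernel \<gamma> (c * r) = c powr (\<gamma> - 1) * frac_kernel \<gamma> r"
  using assms unfolding frac_kernel_def by (auto simp: powr_mult zero_less_mult_iff)

text \<open>Under \<open>s = t + c * u\<close> with \<open>c = x - t\<close> the kernels contribute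
  \<open>c powr (\<alpha> - 1) * c powr (- \<alpha>)\<close>, the inverse of the Jacobian. The value
  is therefore the same for all \<open>t < x\<close>, which makes the two fractional integrals
  compose to an ordinary one.\<close>

lemma Beta_kernel_integral:
  assumes "0 < \<alpha>" "\<alpha> < 1" "t < x"
  shows "integrable lborel (\<lambda>s. frac_kernel \<alpha> (x - s) * frac_kernel (1 - \<alpha>) (s - t))"
    and "(LINT s|lborel. frac_kernel \<alpha> (x - s) * frac_kernel (1 - \<alpha>) (s - t)) = Beta (1 - \<alpha>) \<alpha>"
proof -
  let ?g = "\<lambda>u. frac_kernel \<alpha> (1 - u) * frac_kernel (1 - \<alpha>) u"
  have "((\<lambda>u. u powr ((1 - \<alpha>) - 1) * (1 - u) powr (\<alpha> - 1)) has_integral Beta (1 - \<alpha>) \<alpha>) {0..1}"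
    using assms by (intro has_integral_Beta_real) auto
  then have h: "(?g has_integral Beta (1 - \<alpha>) \<alpha>) {0..1}"
    by (rule has_integral_spike[of "{0, 1}", rotated 2]) (auto simp: frac_kernel_def)
  have e: "indicator {0..1} u * ?g u = ?g u" for u :: real
    by (auto simp: indicator_def frac_kernel_def)
  have g: "integrable lborel ?g" "(LINT u|lborel. ?g u) = Beta (1 - \<alpha>) \<alpha>"
    using integrable_lborel_nonneg[OF _ _ h] unfolding set_integrable_def set_lebesgue_integral_def
    by (auto simp: e)
  define c where "c = x - t"
  have c: "0 < c" using assms unfolding c_def by simp
  have "frac_kernel \<alpha> (x - (t + c * u)) * frac_kernel (1 - \<alpha>) (t + c * u - t) = inverse c * ?g u" for u
  proof -
    have "x - (t + c * u) = c * (1 - u)" unfolding c_def by (simp add: algebra_simps)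
    moreover have "c powr (\<alpha> - 1) * c powr (- \<alpha>) = inverse c"
    proof -
      have "c powr (\<alpha> - 1) * c powr (- \<alpha>) = c powr (- 1)"
        by (subst powr_add[symmetric]) simp
      also have "\<dots> = inverse c" using c by (simp add: powr_minus)
      finally show ?thesis .
    qed
    moreover have "frac_kernel \<alpha> (c * (1 - u)) * frac_kernel (1 - \<alpha>) (c * u)
        = (c powr (\<alpha> - 1) * c powr (- \<alpha>)) * ?g u"
      unfolding frac_kernel_scale[OF c] by simp
    ultimately show ?thesis by simp
  qed
  note e2 = this
  show "integrable lborel (\<lambda>s. frac_kernel \<alpha> (x - s) * frac_kernel (1 - \<alpha>) (s - t))"
  proof (subst lborel_integrable_real_affine_iff[symmetric, of c _ t])
    show "integrable lborel (\<lambda>u. frac_kernel \<alpha> (x - (t + c * u)) * frac_kernel (1 - \<alpha>) (t + c * u - t))"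
      unfolding e2 using g by simp
  qed (use c in simp)
  have "(LINT s|lborel. frac_kernel \<alpha> (x - s) * frac_kernel (1 - \<alpha>) (s - t))
      = \<bar>c\<bar> *\<^sub>R (LINT u|lborel. frac_kernel \<alpha> (x - (t + c * u)) * frac_kernel (1 - \<alpha>) (t + c * u - t))"
    using c by (intro lborel_integral_real_affine) auto
  also have "\<dots> = Beta (1 - \<alpha>) \<alpha>" unfolding e2 using g(2) c by simp
  finally show "(LINT s|lborel. frac_kernel \<alpha> (x - s) * frac_kernel (1 - \<alpha>) (s - t)) = Beta (1 - \<alpha>) \<alpha>" .
qed

text \<open>Fubini reduces the composition to the kernel integral above; the Beta constant appears
  because \<open>conv_left\<close> omits the factors \<open>1 / Gamma\<close>.\<close>

lemma conv_left_semigroup: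
  assumes "0 < \<alpha>" "\<alpha> < 1" and q: "integrable lborel q"
  shows "conv_left \<alpha> (conv_left (1 - \<alpha>) q) x = Beta (1 - \<alpha>) \<alpha> * (LINT t:{..<x}|lborel. q t)"
proof -
  have qm[measurable]: "q \<in> borel_measurable borel" using q by auto
  define k where "k s t = frac_kernel \<alpha> (x - s) * frac_kernel (1 - \<alpha>) (s - t)" for s t
  have km: "(\<lambda>(s,t). k s t) \<in> borel_measurable (borel \<Otimes>\<^sub>M borel)" unfolding k_def by measurable
  have k0: "k s t = 0" if "x \<le> t" for s t
    using that unfolding k_def frac_kernel_def by auto
  have ki: "integrable lborel (\<lambda>s. k s t)" for t
  proof (cases "t < x")
    case True
    then show ?thesis using Beta_kernel_integral(1)[OF assms(1,2)] unfolding k_def by simp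
  next
    case False
    then have "(\<lambda>s. k s t) = (\<lambda>s. 0)" using k0 by auto
    then show ?thesis by simp
  qed
  have kv: "(LINT s|lborel. k s t) = indicator {..<x} t * Beta (1 - \<alpha>) \<alpha>" for t
  proof (cases "t < x")
    case True
    then show ?thesis using Beta_kernel_integral(2)[OF assms(1,2)] unfolding k_def by simp
  next
    case False
    then have "(\<lambda>s. k s t) = (\<lambda>s. 0)" using k0 by auto
    then show ?thesis using False by simp
  qed
  have ka: "\<bar>k s t\<bar> = k s t" for s t unfolding k_def by simp
  have int: "integrable lborel (\<lambda>t. \<bar>q t\<bar> * (LINT s|lborel. \<bar>k s t\<bar>))"
    unfolding ka kv using integrable_mult_indicator[of "{..<x}" lborel "\<lambda>t. \<bar>q t\<bar> * Beta (1 - \<alpha>) \<alpha>"] q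
    by (simp add: mult_ac)
  have "conv_left \<alpha> (conv_left (1 - \<alpha>) q) x = (LINT s|lborel. LINT t|lborel. k s t * q t)"
    unfolding conv_left_def k_def by (simp add: mult.assoc)
  also have "\<dots> = (LINT t|lborel. q t * (LINT s|lborel. k s t))"
    by (rule Fubini_kernel(3)[OF km qm ki int])
  also have "\<dots> = (LINT t|lborel. Beta (1 - \<alpha>) \<alpha> * (indicator {..<x} t * q t))"
    unfolding kv by (simp add: mult_ac)
  also have "\<dots> = Beta (1 - \<alpha>) \<alpha> * (LINT t:{..<x}|lborel. q t)"
    unfolding set_lebesgue_integral_def by simp
  finally show ?thesis .
qed

text \<open>For \<open>\<gamma> \<le> 1\<close> the kernel decreases, so left of \<open>x\<close>
  the difference of the two kernels has a known sign and is integrated exactly. On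
  \<open>[x,z)\<close> only the kernel of \<open>z\<close> is present, and adding it twice corrects
  its sign.\<close>

lemma conv_left_Hoelder:
  assumes "0 < \<gamma>" "\<gamma> \<le> 1" and v: "v \<in> borel_measurable borel" "\<And>t. t < a \<Longrightarrow> v t = 0" "\<And>t. \<bar>v t\<bar> \<le> V"
    and x: "a \<le> x" "x \<le> z"
  shows "\<bar>conv_left \<gamma> v z - conv_left \<gamma> v x\<bar> \<le> V * (2 / \<gamma>) * (z - x) powr \<gamma>"
proof -
  note v(1)[measurable]
  have V: "0 \<le> V" using v(3)[of 0] by linarith
  have vi: "integrable lborel (\<lambda>t. frac_kernel \<gamma> (y - t) * v t)" if "a \<le> y" for y
  proof (rule Bochner_Integration.integrable_bound[where f = "\<lambda>t. V * (indicator {a..} t * frac_kernel \<gamma> (y - t))"])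
    show "integrable lborel (\<lambda>t. V * (indicator {a..} t * frac_kernel \<gamma> (y - t)))"
      using frac_kernel_integral_left(1)[OF assms(1) that] by simp
    show "AE t in lborel. norm (frac_kernel \<gamma> (y - t) * v t) \<le> norm (V * (indicator {a..} t * frac_kernel \<gamma> (y - t)))"
    proof (rule AE_I2)
      fix t
      show "norm (frac_kernel \<gamma> (y - t) * v t) \<le> norm (V * (indicator {a..} t * frac_kernel \<gamma> (y - t)))"
        using v(2)[of t] mult_right_mono[OF v(3)[of t] frac_kernel_nonneg[of \<gamma> "y - t"]] V
        by (cases "t < a") (auto simp: abs_mult mult.commute)
    qed
  qed measurable
  have pt: "\<bar>frac_kernel \<gamma> (z - t) * v t - frac_kernel \<gamma> (x - t) * v t\<bar>
     \<le> V * (indicator {a..} t * frac_kernel \<gamma> (x - t) - indicator {a..} t * frac_kernel \<gamma> (z - t)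
          + 2 * (indicator {x..} t * frac_kernel \<gamma> (z - t)))" for t
  proof (cases "t < a")
    case True
    then show ?thesis using v(2)[OF True] x by simp
  next
    case False
    have "\<bar>frac_kernel \<gamma> (z - t) - frac_kernel \<gamma> (x - t)\<bar>
      \<le> frac_kernel \<gamma> (x - t) - frac_kernel \<gamma> (z - t) + 2 * (indicator {x..} t * frac_kernel \<gamma> (z - t))"
    proof (cases "t < x")
      case True
      then have "frac_kernel \<gamma> (z - t) \<le> frac_kernel \<gamma> (x - t)"
        using x assms(2) unfolding frac_kernel_def by (auto intro!: powr_mono2')
      then show ?thesis using True by simp
    next
      case False
      then show ?thesis using frac_kernel_nonneg[of \<gamma> "z - t"] by (simp add: frac_kernel_def)
    qed
    then have "V * \<bar>frac_kernel \<gamma> (z - t) - frac_kernel \<gamma> (x - t)\<bar>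
      \<le> V * (frac_kernel \<gamma> (x - t) - frac_kernel \<gamma> (z - t) + 2 * (indicator {x..} t * frac_kernel \<gamma> (z - t)))"
      using V by (rule mult_left_mono)
    moreover have "\<bar>frac_kernel \<gamma> (z - t) * v t - frac_kernel \<gamma> (x - t) * v t\<bar>
        \<le> V * \<bar>frac_kernel \<gamma> (z - t) - frac_kernel \<gamma> (x - t)\<bar>"
      using mult_right_mono[OF v(3)[of t], of "\<bar>frac_kernel \<gamma> (z - t) - frac_kernel \<gamma> (x - t)\<bar>"]
      by (simp add: abs_mult[symmetric] algebra_simps)
    ultimately show ?thesis using False by simp
  qed
  note i1 = frac_kernel_integral_left[OF assms(1), of a x] frac_kernel_integral_left[OF assms(1), of a z]
    frac_kernel_integral_left[OF assms(1), of x z]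
  have "\<bar>conv_left \<gamma> v z - conv_left \<gamma> v x\<bar>
      = norm (LINT t|lborel. frac_kernel \<gamma> (z - t) * v t - frac_kernel \<gamma> (x - t) * v t)"
    unfolding conv_left_def using vi x by simp
  also have "\<dots> \<le> (LINT t|lborel. norm (frac_kernel \<gamma> (z - t) * v t - frac_kernel \<gamma> (x - t) * v t))"
    by (rule integral_norm_bound)
  also have "\<dots> \<le> (LINT t|lborel. V * (indicator {a..} t * frac_kernel \<gamma> (x - t) - indicator {a..} t * frac_kernel \<gamma> (z - t)
          + 2 * (indicator {x..} t * frac_kernel \<gamma> (z - t))))"
    using x vi i1 pt by (intro integral_mono integrable_norm Bochner_Integration.integrable_diff
      integrable_mult_right Bochner_Integration.integrable_add) auto
  also have "\<dots> = V * ((x - a) powr \<gamma> / \<gamma> - (z - a) powr \<gamma> / \<gamma> + 2 * ((z - x) powr \<gamma> / \<gamma>))"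
    using x i1 by simp
  \<comment> \<open>The first two terms have a sum \<open>\<le> 0\<close>, because
    \<open>x \<le> z\<close>.\<close>
  also have "\<dots> \<le> V * (2 * ((z - x) powr \<gamma> / \<gamma>))"
    using x V assms by (intro mult_left_mono) (auto simp: divide_right_mono powr_mono2)
  finally show ?thesis by (simp add: field_simps)
qed

text \<open>For \<open>a \<le> s < x\<close> the kernel \<open>(x - s) powr (- \<alpha>)\<close> is
  its value at \<open>s = a\<close> plus the integral over \<open>[a,s]\<close> of its derivative
  \<open>\<alpha> * (x - t) powr (- \<alpha> - 1)\<close>. Exchanging the integrals replaces
  \<open>r\<close> by its tail integral \<open>- \<rho> t\<close>. Fubini applies because the added
  part is nonnegative and its product with \<open>r\<close> is a difference of two integrable
  functions.\<close>

lemma conv_left_by_parts: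
  assumes \<alpha>: "0 < \<alpha>" "\<alpha> < 1" and "a < x" and r: "integrable lborel r" "\<And>s. s < a \<Longrightarrow> r s = 0"
    and ri: "integrable lborel (\<lambda>s. frac_kernel (1 - \<alpha>) (x - s) * r s)"
    and \<rho>: "\<And>t. t \<in> {a..x} \<Longrightarrow> \<rho> t = - (LINT s:{t..x}|lborel. r s)"
  shows "conv_left (1 - \<alpha>) r x = - ((x - a) powr (- \<alpha>) * \<rho> a)
     - \<alpha> * (LINT t|lborel. indicator {a..<x} t * ((x - t) powr (- \<alpha> - 1) * \<rho> t))"
proof -
  have rm[measurable]: "r \<in> borel_measurable borel" using r(1) by auto
  define k where "k t s = (if a \<le> t \<and> t \<le> s \<and> s < x then \<alpha> * (x - t) powr (- \<alpha> - 1) else 0)" for t s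
  have km: "(\<lambda>(t,s). k t s) \<in> borel_measurable (borel \<Otimes>\<^sub>M borel)" unfolding k_def by measurable
  have k0: "k t s = 0" if "s < a \<or> x \<le> s" for t s using that unfolding k_def by auto
  have k1: "integrable lborel (\<lambda>t. k t s)" "(LINT t|lborel. k t s) = (x - s) powr (- \<alpha>) - (x - a) powr (- \<alpha>)"
    if s: "a \<le> s" "s < x" for s
  proof -
    have "((\<lambda>t. \<alpha> * (x - t) powr (- \<alpha> - 1)) has_integral ((x - s) powr (- \<alpha>) - (x - a) powr (- \<alpha>))) {a..s}"
    proof (rule fundamental_theorem_of_calculus[OF s(1)])
      fix t assume "t \<in> {a..s}"
      then have "((\<lambda>t. (x - t) powr (- \<alpha>)) has_real_derivative \<alpha> * (x - t) powr (- \<alpha> - 1)) (at t)"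
        using s(2) by (auto intro!: derivative_eq_intros)
      then show "((\<lambda>t. (x - t) powr (- \<alpha>)) has_vector_derivative \<alpha> * (x - t) powr (- \<alpha> - 1)) (at t within {a..s})"
        by (simp add: has_real_derivative_iff_has_vector_derivative has_vector_derivative_at_within)
    qed
    note h = integrable_lborel_nonneg[OF _ _ this]
    have e: "indicator {a..s} t *\<^sub>R (\<alpha> * (x - t) powr (- \<alpha> - 1)) = k t s" for t
      using s unfolding k_def by (auto simp: indicator_def)
    show "integrable lborel (\<lambda>t. k t s)" "(LINT t|lborel. k t s) = (x - s) powr (- \<alpha>) - (x - a) powr (- \<alpha>)"
      using h \<alpha> unfolding set_integrable_def set_lebesgue_integral_def e by auto
  qed
  have ki: "integrable lborel (\<lambda>t. k t s)" for s
    using k1(1)[of s] k0[of s] by (cases "s < a \<or> x \<le> s") auto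
  have ka: "\<bar>k t s\<bar> = k t s" for t s using \<alpha> unfolding k_def by auto
  let ?I = "\<lambda>s. frac_kernel (1 - \<alpha>) (x - s) * r s"
  have kr: "r s * (LINT t|lborel. k t s) = ?I s - (x - a) powr (- \<alpha>) * (indicator {a..<x} s * r s)" for s
  proof (cases "a \<le> s \<and> s < x")
    case True
    then have "(LINT t|lborel. k t s) = (x - s) powr (- \<alpha>) - (x - a) powr (- \<alpha>)" using k1(2) by blast
    then show ?thesis using True by (simp add: frac_kernel_def right_diff_distrib mult.commute)
  next
    case False
    then have "s < a \<or> x \<le> s" by auto
    then show ?thesis using k0[of s] r(2)[of s] by (auto simp: frac_kernel_def)
  qed
  have ii: "integrable lborel (\<lambda>s. indicator {a..<x} s * r s)"
    using integrable_mult_indicator[of "{a..<x}" lborel r] r(1) by simp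
  have int: "integrable lborel (\<lambda>s. \<bar>r s\<bar> * (LINT t|lborel. \<bar>k t s\<bar>))"
  proof -
    have nn: "0 \<le> (LINT t|lborel. k t s)" for s
      using ka by (intro integral_nonneg_AE AE_I2) (metis abs_ge_zero)
    have "integrable lborel (\<lambda>s. \<bar>r s * (LINT t|lborel. k t s)\<bar>)"
      unfolding kr using ri ii by (intro integrable_abs Bochner_Integration.integrable_diff integrable_mult_right) auto
    then show ?thesis unfolding ka abs_mult using nn by simp
  qed
  have inner: "(LINT s|lborel. k t s * r s) = - (\<alpha> * (indicator {a..<x} t * ((x - t) powr (- \<alpha> - 1) * \<rho> t)))" for t
  proof (cases "a \<le> t \<and> t < x")
    case True
    have "(LINT s|lborel. k t s * r s) = (LINT s|lborel. \<alpha> * (x - t) powr (- \<alpha> - 1) * (indicator {t..<x} s * r s))"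
      using True unfolding k_def by (intro Bochner_Integration.integral_cong) (auto simp: indicator_def)
    also have "\<dots> = \<alpha> * (x - t) powr (- \<alpha> - 1) * (LINT s|lborel. indicator {t..<x} s * r s)" by simp
    also have "(LINT s|lborel. indicator {t..<x} s * r s) = (LINT s:{t..x}|lborel. r s)"
      unfolding set_lebesgue_integral_def
    proof (rule integral_cong_AE)
      show "AE s in lborel. indicator {t..<x} s * r s = indicator {t..x} s *\<^sub>R r s"
        using AE_lborel_singleton[of x] by eventually_elim (auto simp: indicator_def)
    qed measurable
    also have "\<dots> = - \<rho> t" using \<rho>[of t] True by simp
    finally show ?thesis using True by simp
  next
    case False
    then have "k t s = 0" for s unfolding k_def by auto
    then show ?thesis using False by simp
  qed
  have a: "(LINT s|lborel. indicator {a..<x} s * r s) = - \<rho> a"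
  proof -
    have "(LINT s|lborel. indicator {a..<x} s * r s) = (LINT s:{a..x}|lborel. r s)"
      unfolding set_lebesgue_integral_def
    proof (rule integral_cong_AE)
      show "AE s in lborel. indicator {a..<x} s * r s = indicator {a..x} s *\<^sub>R r s"
        using AE_lborel_singleton[of x] by eventually_elim (auto simp: indicator_def)
    qed measurable
    then show ?thesis using \<rho>[of a] \<open>a < x\<close> by simp
  qed
  have "- \<alpha> * (LINT t|lborel. indicator {a..<x} t * ((x - t) powr (- \<alpha> - 1) * \<rho> t))
      = (LINT t|lborel. LINT s|lborel. k t s * r s)"
    unfolding inner by simp
  also have "\<dots> = (LINT s|lborel. r s * (LINT t|lborel. k t s))"
    by (rule Fubini_kernel(3)[OF km rm ki int])
  also have "\<dots> = conv_left (1 - \<alpha>) r x - (x - a) powr (- \<alpha>) * (LINT s|lborel. indicator {a..<x} s * r s)"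
    unfolding kr conv_left_def using ri ii by simp
  finally show ?thesis unfolding a by simp
qed

section \<open>From the convolutions back to the integrals in the definitions\<close>

lemma frac_integral_left_eq:
  assumes N: "negligible N" "\<And>t. t \<in> {a..b} - N \<Longrightarrow> f t = q t"
    and q: "q \<in> borel_measurable borel" "\<And>t. t \<notin> {a..b} \<Longrightarrow> q t = 0" and x: "x \<in> {a..b}"
  shows "set_integrable lebesgue {a..x} (\<lambda>t. (x - t) powr (\<gamma> - 1) * f t) \<longleftrightarrow>
      integrable lborel (\<lambda>t. frac_kernel \<gamma> (x - t) * q t)"
    and "(LINT t:{a..x}|lebesgue. (x - t) powr (\<gamma> - 1) * f t) = conv_left \<gamma> q x"
proof -
  note q(1)[measurable]
  have m: "(\<lambda>t. frac_kernel \<gamma> (x - t) * q t) \<in> borel_measurable borel" by measurable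
  have eq: "(x - t) powr (\<gamma> - 1) * f t = frac_kernel \<gamma> (x - t) * q t" if "t \<in> {a..x} - N" for t
    using that N(2)[of t] x by (cases "t = x") (auto simp: frac_kernel_def)
  have e: "indicator {a..x} t *\<^sub>R (frac_kernel \<gamma> (x - t) * q t) = frac_kernel \<gamma> (x - t) * q t" for t
    using q(2)[of t] by (auto simp: indicator_def frac_kernel_def)
  show "set_integrable lebesgue {a..x} (\<lambda>t. (x - t) powr (\<gamma> - 1) * f t) \<longleftrightarrow>
      integrable lborel (\<lambda>t. frac_kernel \<gamma> (x - t) * q t)"
    using integral_spike_lborel(1)[OF N(1) eq m, of "{a..x}"] unfolding set_integrable_def e by simp
  show "(LINT t:{a..x}|lebesgue. (x - t) powr (\<gamma> - 1) * f t) = conv_left \<gamma> q x"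
    using integral_spike_lborel(2)[OF N(1) eq m, of "{a..x}"]
    unfolding set_lebesgue_integral_def e conv_left_def by simp
qed

lemma frac_integral_right_eq:
  assumes M: "\<And>t. t \<in> {a..b} \<Longrightarrow> f t = M t"
    "M \<in> borel_measurable borel" "\<And>t. t \<notin> {a..b} \<Longrightarrow> M t = 0" and x: "x \<in> {a..b}"
  shows "set_integrable lebesgue {x..b} (\<lambda>t. (t - x) powr (\<gamma> - 1) * f t) \<longleftrightarrow>
      integrable lborel (\<lambda>t. frac_kernel \<gamma> (t - x) * M t)"
    and "(LINT t:{x..b}|lebesgue. (t - x) powr (\<gamma> - 1) * f t) = conv_right \<gamma> M x"
proof -
  note M(2)[measurable]
  have m: "(\<lambda>t. frac_kernel \<gamma> (t - x) * M t) \<in> borel_measurable borel" by measurable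
  have eq: "(t - x) powr (\<gamma> - 1) * f t = frac_kernel \<gamma> (t - x) * M t" if "t \<in> {x..b} - {}" for t
    using that M(1)[of t] x by (cases "t = x") (auto simp: frac_kernel_def)
  have e: "indicator {x..b} t *\<^sub>R (frac_kernel \<gamma> (t - x) * M t) = frac_kernel \<gamma> (t - x) * M t" for t
    using M(3)[of t] by (auto simp: indicator_def frac_kernel_def)
  show "set_integrable lebesgue {x..b} (\<lambda>t. (t - x) powr (\<gamma> - 1) * f t) \<longleftrightarrow>
      integrable lborel (\<lambda>t. frac_kernel \<gamma> (t - x) * M t)"
    using integral_spike_lborel(1)[OF negligible_empty eq m, of "{x..b}"] unfolding set_integrable_def e by simp
  show "(LINT t:{x..b}|lebesgue. (t - x) powr (\<gamma> - 1) * f t) = conv_right \<gamma> M x"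
    using integral_spike_lborel(2)[OF negligible_empty eq m, of "{x..b}"]
    unfolding set_lebesgue_integral_def e conv_right_def by simp
qed

section \<open>Smooth functions\<close>

text \<open>Written through partial derivatives, so that continuity in \<open>p\<close> is inherited
  from \<open>Ck_on\<close>; for differentiable \<open>h\<close> it is the Frechet
  derivative.\<close>

definition grad :: "('a::euclidean_space \<Rightarrow> real) \<Rightarrow> 'a \<Rightarrow> 'a \<Rightarrow> real" where
  "grad h p d = (\<Sum>e\<in>Basis. (d \<bullet> e) * partial_deriv e h p)"

lemma grad_linear: "bounded_linear (grad h p)"
  unfolding grad_def by (intro bounded_linear_sum bounded_linear_mult_left[THEN bounded_linear_compose] bounded_linear_inner_left)

lemma has_real_derivative_line:
  assumes "(h has_derivative h') (at p)"
  shows "((\<lambda>s. h (p + s *\<^sub>R e)) has_real_derivative h' e) (at 0)"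
proof -
  have "((\<lambda>s. p + s *\<^sub>R e) has_derivative (\<lambda>s. s *\<^sub>R e)) (at 0)"
    by (auto intro!: derivative_eq_intros)
  moreover have "(h has_derivative h') (at (p + 0 *\<^sub>R e))" using assms by simp
  ultimately have "((\<lambda>s. h (p + s *\<^sub>R e)) has_derivative (\<lambda>s. h' (s *\<^sub>R e))) (at 0)"
    using has_derivative_compose by fast
  moreover have "(\<lambda>s. h' (s *\<^sub>R e)) = (\<lambda>s. h' e * s)"
    using linear_scale[OF has_derivative_linear[OF assms]] by (auto simp: mult.commute)
  ultimately show ?thesis by (simp add: has_field_derivative_def)
qed

lemma partial_deriv_eqI: "(h has_derivative h') (at p) \<Longrightarrow> partial_deriv e h p = h' e"
  unfolding partial_deriv_def by (rule DERIV_imp_deriv[OF has_real_derivative_line])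

lemma Ck_on_has_derivative:
  assumes "open U" "Ck_on (Suc k) h U" "p \<in> U"
  shows "(h has_derivative grad h p) (at p)"
proof -
  have "h differentiable (at p)"
    using assms by (simp add: differentiable_on_eq_differentiable_at)
  then obtain h' where h': "(h has_derivative h') (at p)" unfolding differentiable_def by blast
  have "h' d = grad h p d" for d
  proof -
    have "h' d = h' (\<Sum>e\<in>Basis. (d \<bullet> e) *\<^sub>R e)" by (simp add: euclidean_representation)
    also have "\<dots> = (\<Sum>e\<in>Basis. (d \<bullet> e) *\<^sub>R h' e)"
      using has_derivative_linear[OF h'] by (simp add: linear_sum linear_scale)
    also have "\<dots> = grad h p d" unfolding grad_def partial_deriv_eqI[OF h'] by simp
    finally show ?thesis .
  qed
  then show ?thesis using h' by presburger
qed

lemma Ck_on_continuous_on: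
  assumes "open U" "Ck_on k h U"
  shows "continuous_on U h"
  using assms by (cases k) (auto intro: differentiable_imp_continuous_on)

lemma Ck_on_partial_continuous_on:
  assumes "open U" "Ck_on (Suc k) h U" "e \<in> Basis"
  shows "continuous_on U (partial_deriv e h)"
  using assms Ck_on_continuous_on by auto

lemma continuous_on_grad:
  assumes U: "open U" "Ck_on (Suc k) h U" and c: "continuous_on S P" "P ` S \<subseteq> U" "continuous_on S D"
  shows "continuous_on S (\<lambda>x. grad h (P x) (D x))"
  unfolding grad_def
  by (intro continuous_intros c continuous_on_compose2[OF Ck_on_partial_continuous_on[OF U] c(1,2)])

text \<open>Compactness bounds the partial derivatives, and convexity makes the mean value
  inequality available.\<close>

lemma Ck_on_Lipschitz:
  assumes U: "open U" "Ck_on (Suc k) h U" and K: "compact K" "convex K" "K \<subseteq> U"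
  obtains C where "0 \<le> C" "\<And>p q. p \<in> K \<Longrightarrow> q \<in> K \<Longrightarrow> \<bar>h q - h p\<bar> \<le> C * norm (q - p)"
proof -
  have "\<exists>C. \<forall>p\<in>K. \<bar>partial_deriv e h p\<bar> \<le> C" if "e \<in> Basis" for e
  proof -
    have "compact (partial_deriv e h ` K)"
      using Ck_on_partial_continuous_on[OF U that] K
      by (intro compact_continuous_image) (auto intro: continuous_on_subset)
    then have "bounded (partial_deriv e h ` K)" by (rule compact_imp_bounded)
    then show ?thesis unfolding bounded_iff by auto
  qed
  then obtain B where B: "\<And>e p. e \<in> Basis \<Longrightarrow> p \<in> K \<Longrightarrow> \<bar>partial_deriv e h p\<bar> \<le> B e" by metis
  define C where "C = (\<Sum>e\<in>Basis. \<bar>B e\<bar>)"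
  have C: "\<bar>grad h p d\<bar> \<le> C * norm d" if "p \<in> K" for p d
  proof -
    have "\<bar>grad h p d\<bar> \<le> (\<Sum>e\<in>Basis. \<bar>(d \<bullet> e) * partial_deriv e h p\<bar>)"
      unfolding grad_def by (rule sum_abs)
    also have "\<dots> \<le> (\<Sum>e\<in>Basis. \<bar>B e\<bar> * norm d)"
      using B[OF _ that] Basis_le_norm[of _ d]
      by (intro sum_mono) (auto simp: abs_mult mult.commute intro!: mult_mono intro: order_trans[OF _ abs_ge_self])
    finally show ?thesis unfolding C_def by (simp add: sum_distrib_right)
  qed
  show thesis
  proof (rule that[of C])
    show "0 \<le> C" unfolding C_def by (intro sum_nonneg) auto
    show "\<bar>h q - h p\<bar> \<le> C * norm (q - p)" if "p \<in> K" "q \<in> K" for p q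
    proof -
      have "norm (h q - h p) \<le> C * norm (q - p)"
      proof (rule differentiable_bound[OF K(2), of h "grad h"])
        show "(h has_derivative grad h x) (at x within K)" if "x \<in> K" for x
          using Ck_on_has_derivative[OF U] K that by (auto intro: has_derivative_at_withinI)
        show "onorm (grad h x) \<le> C" if "x \<in> K" for x
          using C[OF that] by (intro onorm_le) simp
      qed (use that in auto)
      then show ?thesis by simp
    qed
  qed
qed

text \<open>The mean value inequality is applied to \<open>h\<close> minus its linearisation at
  \<open>p\<close> on the segment from \<open>p\<close> to \<open>q\<close>. The derivative of that
  difference is at most \<open>C * norm (q - p)\<close> there, since the partial derivatives are
  themselves Lipschitz.\<close>

lemma Ck_on_Taylor:
  assumes U: "open U" "Ck_on (Suc (Suc k)) h U" and K: "compact K" "convex K" "K \<subseteq> U"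
  obtains C where "0 \<le> C" "\<And>p q. p \<in> K \<Longrightarrow> q \<in> K \<Longrightarrow> \<bar>h q - h p - grad h p (q - p)\<bar> \<le> C * (norm (q - p))\<^sup>2"
proof -
  have "\<exists>C\<ge>0. \<forall>p\<in>K. \<forall>q\<in>K. \<bar>partial_deriv e h q - partial_deriv e h p\<bar> \<le> C * norm (q - p)" if "e \<in> Basis" for e
    using Ck_on_Lipschitz[OF U(1) _ K, of k "partial_deriv e h"] U(2) that by (metis Ck_on.simps(2))
  then obtain B where B: "\<And>e. e \<in> Basis \<Longrightarrow> 0 \<le> B e"
    "\<And>(e::'a) p q. e \<in> Basis \<Longrightarrow> p \<in> K \<Longrightarrow> q \<in> K \<Longrightarrow> \<bar>partial_deriv e h q - partial_deriv e h p\<bar> \<le> B e * norm (q - p)"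
    by metis
  define C where "C = (\<Sum>e\<in>Basis. B e)"
  have C0: "0 \<le> C" unfolding C_def using B(1) by (intro sum_nonneg) auto
  have C: "\<bar>grad h q d - grad h p d\<bar> \<le> C * norm (q - p) * norm d" if "p \<in> K" "q \<in> K" for p q d
  proof -
    have "\<bar>grad h q d - grad h p d\<bar> \<le> (\<Sum>e\<in>Basis. \<bar>(d \<bullet> e) * (partial_deriv e h q - partial_deriv e h p)\<bar>)"
      unfolding grad_def sum_subtractf[symmetric] right_diff_distrib[symmetric] by (rule sum_abs)
    also have "\<dots> \<le> (\<Sum>e\<in>Basis. norm d * (B e * norm (q - p)))"
      unfolding abs_mult using B that Basis_le_norm[of _ d] by (intro sum_mono mult_mono) auto
    also have "\<dots> = C * norm (q - p) * norm d"
      unfolding C_def by (simp add: sum_distrib_right sum_distrib_left mult_ac)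
    finally show ?thesis .
  qed
  show thesis
  proof (rule that[OF C0])
    show "\<bar>h q - h p - grad h p (q - p)\<bar> \<le> C * (norm (q - p))\<^sup>2" if pq: "p \<in> K" "q \<in> K" for p q
    proof -
      have seg: "closed_segment p q \<subseteq> K" using K(2) pq by (simp add: closed_segment_subset)
      interpret g: bounded_linear "grad h p" by (rule grad_linear)
      have "norm ((h q - grad h p q) - (h p - grad h p p)) \<le> (C * norm (q - p)) * norm (q - p)"
      proof (rule differentiable_bound[OF convex_closed_segment, of p q _ "\<lambda>z d. grad h z d - grad h p d"])
        show "((\<lambda>z. h z - grad h p z) has_derivative (\<lambda>d. grad h x d - grad h p d)) (at x within closed_segment p q)"
          if "x \<in> closed_segment p q" for x
          using Ck_on_has_derivative[OF U] that seg K(3)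
          by (intro has_derivative_diff has_derivative_at_withinI[OF Ck_on_has_derivative[OF U]]
              bounded_linear_imp_has_derivative grad_linear) auto
        show "onorm (\<lambda>d. grad h x d - grad h p d) \<le> C * norm (q - p)" if x: "x \<in> closed_segment p q" for x
        proof (rule onorm_le)
          fix d :: 'a
          have "norm (x - p) \<le> norm (q - p)"
            using segment_bound(1)[OF x] by (simp add: norm_minus_commute)
          then have "C * norm (x - p) * norm d \<le> C * norm (q - p) * norm d"
            using C0 by (intro mult_right_mono mult_left_mono) auto
          then show "norm (grad h x d - grad h p d) \<le> C * norm (q - p) * norm d"
            using C[OF pq(1) subsetD[OF seg x], of d] unfolding real_norm_def by linarith
        qed
      qed auto
      then show ?thesis by (simp add: g.diff power2_eq_square algebra_simps)
    qed
  qed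
qed

section \<open>Trajectories\<close>

lemma abs_continuous_on_dominated:
  assumes f: "abs_continuous_on a b f" and "0 \<le> C"
    and dom: "\<And>s t. s \<in> {a..b} \<Longrightarrow> t \<in> {a..b} \<Longrightarrow> s \<le> t \<Longrightarrow> \<bar>g t - g s\<bar> \<le> C * (\<bar>f t - f s\<bar> + (t - s))"
  shows "abs_continuous_on a b g"
  unfolding abs_continuous_on_def
proof (intro allI impI)
  fix e :: real assume e: "0 < e"
  \<comment> \<open>Two sums, of increments and of lengths, are each kept below \<open>e'\<close>;
    the factor \<open>C + 1\<close> also covers \<open>C = 0\<close>.\<close>
  define e' where "e' = e / (2 * (C + 1))"
  have e': "0 < e'" using e \<open>0 \<le> C\<close> unfolding e'_def by simp
  obtain \<delta> where \<delta>: "0 < \<delta>" "\<And>d S. d division_of S \<and> S \<subseteq> {a..b} \<and> (\<Sum>k\<in>d. Sup k - Inf k) < \<delta> \<longrightarrow>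
     (\<Sum>k\<in>d. \<bar>f (Sup k) - f (Inf k)\<bar>) < e'" using f e' unfolding abs_continuous_on_def by meson
  show "\<exists>\<delta>>0. \<forall>d S. d division_of S \<and> S \<subseteq> {a..b} \<and> (\<Sum>k\<in>d. Sup k - Inf k) < \<delta> \<longrightarrow>
     (\<Sum>k\<in>d. \<bar>g (Sup k) - g (Inf k)\<bar>) < e"
  proof (intro exI[of _ "min \<delta> e'"] conjI allI impI)
    fix d S assume d: "d division_of S \<and> S \<subseteq> {a..b} \<and> (\<Sum>k\<in>d. Sup k - Inf k) < min \<delta> e'"
    have "(\<Sum>k\<in>d. \<bar>g (Sup k) - g (Inf k)\<bar>) \<le> (\<Sum>k\<in>d. C * (\<bar>f (Sup k) - f (Inf k)\<bar> + (Sup k - Inf k)))"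
    proof (rule sum_mono)
      fix k assume "k \<in> d"
      then obtain u v where "u \<le> v" "k = {u..v}" "{u..v} \<subseteq> S" using d by (meson division_member_real)
      then show "\<bar>g (Sup k) - g (Inf k)\<bar> \<le> C * (\<bar>f (Sup k) - f (Inf k)\<bar> + (Sup k - Inf k))"
        using dom[of u v] d by (auto simp: subset_iff)
    qed
    also have "\<dots> = C * ((\<Sum>k\<in>d. \<bar>f (Sup k) - f (Inf k)\<bar>) + (\<Sum>k\<in>d. Sup k - Inf k))"
      by (simp only: sum.distrib[symmetric] sum_distrib_left)
    also have "\<dots> \<le> C * (e' + e')"
      using \<delta>(2)[of d S] d \<open>0 \<le> C\<close> by (intro mult_left_mono add_mono) auto
    also have "\<dots> < (C + 1) * (e' + e')" using e' by (intro mult_strict_right_mono) auto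
    also have "\<dots> = (2 * (C + 1)) * e'" by (simp add: algebra_simps)
    also have "\<dots> = e" unfolding e'_def using \<open>0 \<le> C\<close> by (intro nonzero_mult_div_cancel_left[of "2 * (C + 1)" e, folded times_divide_eq_right]) auto
    finally show "(\<Sum>k\<in>d. \<bar>g (Sup k) - g (Inf k)\<bar>) < e" .
  qed (use \<delta> e' in auto)
qed

lemma conv_left_at_start: "(\<And>t. t < a \<Longrightarrow> q t = 0) \<Longrightarrow> conv_left \<gamma> q a = 0"
  unfolding conv_left_def
  by (rule integral_eq_zero_AE) (auto simp: frac_kernel_def not_less intro!: AE_I2)

text \<open>If \<open>u\<^sub>2\<close> differs from a multiple of \<open>u\<^sub>1\<close> with frozen coefficient by an increment of order
  \<open>\<kappa> > \<alpha>\<close>, the fractional derivative of \<open>u\<^sub>2\<close> is that multiple of the one of \<open>u\<^sub>1\<close> up to an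
  absolutely convergent integral. This is what makes the class of trajectories stable under nonlinear
  substitutions.\<close>

lemma conv_left_frozen_coefficient:
  fixes m u1 u2 :: "real \<Rightarrow> real"
  assumes \<alpha>: "0 < \<alpha>" "\<alpha> < 1" "\<alpha> < \<kappa>" and ab: "a < b"
    and q: "has_density a b u1 q" "abs_continuous_on a b u1"
    and r: "has_density a b u2 r" "abs_continuous_on a b u2"
    and qi: "\<And>x. x \<in> {a..b} \<Longrightarrow> integrable lborel (\<lambda>t. frac_kernel (1 - \<alpha>) (x - t) * q t)"
    and ri: "\<And>x. x \<in> {a..b} \<Longrightarrow> integrable lborel (\<lambda>t. frac_kernel (1 - \<alpha>) (x - t) * r t)"
    and m: "continuous_on {a..b} m" and qc: "continuous_on {a..b} (conv_left (1 - \<alpha>) q)"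
    and bnd: "\<And>t x. a \<le> t \<Longrightarrow> t < x \<Longrightarrow> x \<le> b \<Longrightarrow>
      \<bar>u2 x - u2 t - m x * (u1 x - u1 t)\<bar> \<le> C * (x - t) powr \<kappa>"
  shows "continuous_on {a..b} (conv_left (1 - \<alpha>) r)"
    and "\<And>x. x \<in> {a..b} \<Longrightarrow> \<bar>conv_left (1 - \<alpha>) r x - m x * conv_left (1 - \<alpha>) q x\<bar>
      \<le> C * (b - a) powr (\<kappa> - \<alpha>) * (1 + \<alpha> / (\<kappa> - \<alpha>))"
proof -
  have qL: "integrable lborel q" "\<And>t. t \<notin> {a..b} \<Longrightarrow> q t = 0" and rL: "integrable lborel r" "\<And>t. t \<notin> {a..b} \<Longrightarrow> r t = 0"
    using q(1) r(1) unfolding has_density_def by auto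
  have u1c: "continuous_on {a..b} u1" and u2c: "continuous_on {a..b} u2"
    using abs_continuous_on_imp_continuous q(2) r(2) by blast+
  \<comment> \<open>For fixed \<open>x\<close>, \<open>\<rho> x\<close> is the primitive of
    \<open>r - m x * q\<close> that vanishes at \<open>x\<close>, and by \<open>bnd\<close> it
    vanishes there to order \<kappa>.\<close>
  define \<rho> where "\<rho> x t = u2 t - u2 x - m x * (u1 t - u1 x)" for x t
  define K where "K x t = (x - t) powr (- \<alpha> - 1) * \<rho> x t" for x t
  define D where "D x = (x - a) powr (- \<alpha>) * \<rho> x a" for x
  define T where "T x = (LINT t|lborel. indicator {a..<x} t * K x t)" for x
  have \<rho>b: "\<bar>\<rho> x t\<bar> \<le> C * (x - t) powr \<kappa>" if "a \<le> t" "t < x" "x \<le> b" for x t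
    using bnd[OF that] unfolding \<rho>_def by (simp add: abs_minus_commute[of "u2 t - u2 x - _"] algebra_simps)
  have C0: "0 \<le> C" using \<rho>b[of a b] ab by (auto simp: zero_le_mult_iff intro: ccontr dest: order_trans[OF abs_ge_zero])
  have formula: "conv_left (1 - \<alpha>) r x = m x * conv_left (1 - \<alpha>) q x - D x - \<alpha> * T x" if x: "x \<in> {a..b}" for x
  proof (cases "x = a")
    case True
    then show ?thesis using conv_left_at_start[of a r] conv_left_at_start[of a q] qL(2) rL(2)
      by (simp add: D_def T_def)
  next
    case False
    then have ax: "a < x" using x by simp
    let ?r = "\<lambda>t. r t - m x * q t"
    have "conv_left (1 - \<alpha>) ?r x = - ((x - a) powr (- \<alpha>) * \<rho> x a)
      - \<alpha> * (LINT t|lborel. indicator {a..<x} t * ((x - t) powr (- \<alpha> - 1) * \<rho> x t))"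
    proof (rule conv_left_by_parts[OF \<alpha>(1,2) ax])
      show "integrable lborel ?r" using qL rL by simp
      show "?r s = 0" if "s < a" for s using that qL rL by simp
      show "integrable lborel (\<lambda>s. frac_kernel (1 - \<alpha>) (x - s) * ?r s)"
        using ri[OF x] integrable_mult_right[OF qi[OF x], of "m x"] by (simp add: right_diff_distrib mult_ac)
      show "\<rho> x t = - (LINT s:{t..x}|lborel. ?r s)" if t: "t \<in> {a..x}" for t
      proof -
        have "u1 x - u1 t = (LINT s:{t..x}|lborel. q s)" "u2 x - u2 t = (LINT s:{t..x}|lborel. r s)"
          using has_density_integral[OF q] has_density_integral[OF r] t x by auto
        moreover have "(LINT s:{t..x}|lborel. ?r s) = (LINT s:{t..x}|lborel. r s) - m x * (LINT s:{t..x}|lborel. q s)"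
        proof -
          have "integrable lborel (\<lambda>s. indicator {t..x} s *\<^sub>R q s)" "integrable lborel (\<lambda>s. indicator {t..x} s *\<^sub>R r s)"
            by (rule integrable_mult_indicator[OF _ qL(1)], simp, rule integrable_mult_indicator[OF _ rL(1)], simp)
          then show ?thesis unfolding set_lebesgue_integral_def
            by (simp add: right_diff_distrib mult.left_commute[of _ "m x"])
        qed
        ultimately show ?thesis unfolding \<rho>_def by (simp add: algebra_simps)
      qed
    qed
    moreover have "conv_left (1 - \<alpha>) ?r x = conv_left (1 - \<alpha>) r x - m x * conv_left (1 - \<alpha>) q x"
      using ri[OF x] qi[OF x] unfolding conv_left_def
      by (simp add: right_diff_distrib mult.left_commute[of _ "m x"])
    ultimately show ?thesis unfolding D_def T_def K_def by simp
  qed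
  have \<gamma>: "0 < \<kappa> - \<alpha>" using \<alpha> by simp
  \<comment> \<open>The exponent \<open>\<kappa> - \<alpha> - 1\<close> is that of a fractional
    kernel of positive order \<open>\<kappa> - \<alpha>\<close>, so the integral of \<open>K\<close>
    converges absolutely.\<close>
  have Kb: "\<bar>K x t\<bar> \<le> C * frac_kernel (\<kappa> - \<alpha>) (x - t)" if "x \<in> {a..b}" "a \<le> t" "t < x" for x t
  proof -
    have "\<bar>K x t\<bar> \<le> (x - t) powr (- \<alpha> - 1) * (C * (x - t) powr \<kappa>)"
      unfolding K_def abs_mult using \<rho>b[of t x] that by (intro mult_mono) auto
    also have "\<dots> = C * ((x - t) powr (- \<alpha> - 1) * (x - t) powr \<kappa>)" by simp
    also have "(x - t) powr (- \<alpha> - 1) * (x - t) powr \<kappa> = frac_kernel (\<kappa> - \<alpha>) (x - t)"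
      using that unfolding frac_kernel_def by (simp add: powr_add[symmetric] algebra_simps)
    finally show ?thesis .
  qed
  have Km: "(\<lambda>t. indicator {a..<x} t * K x t) \<in> borel_measurable borel" if x: "x \<in> {a..b}" for x
  proof -
    have "continuous_on {a..<x} (K x)"
      unfolding K_def \<rho>_def using x
      by (intro continuous_intros continuous_on_subset[OF u1c] continuous_on_subset[OF u2c]) auto
    then show ?thesis
      using borel_measurable_continuous_on_indicator[of "{a..<x}" "K x"] by simp
  qed
  have Kc: "continuous_on {a+s..b} (\<lambda>x. K x (x - s))" if s: "0 < s" for s
  proof -
    have "continuous_on {a+s..b} (\<lambda>x. f (x - s))" if "continuous_on {a..b} f" for f :: "real \<Rightarrow> real"
      using s by (intro continuous_on_compose2[OF that]) (auto intro!: continuous_intros)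
    moreover have "continuous_on {a+s..b} f" if "continuous_on {a..b} f" for f :: "real \<Rightarrow> real"
      using s by (intro continuous_on_subset[OF that]) auto
    ultimately show ?thesis unfolding K_def \<rho>_def using u1c u2c m s
      by (intro continuous_intros) auto
  qed
  have Tc: "continuous_on {a..b} T" and Tb: "\<And>x. x \<in> {a..b} \<Longrightarrow> \<bar>T x\<bar> \<le> C * ((x - a) powr (\<kappa> - \<alpha>) / (\<kappa> - \<alpha>))"
    unfolding T_def using continuous_on_kernel_integral[OF \<gamma> Km Kb Kc] by blast+
  have Db: "\<bar>D x\<bar> \<le> C * (x - a) powr (\<kappa> - \<alpha>)" if x: "x \<in> {a..b}" for x
  proof (cases "x = a")
    case False
    then have "\<bar>D x\<bar> \<le> (x - a) powr (- \<alpha>) * (C * (x - a) powr \<kappa>)"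
      unfolding D_def abs_mult using \<rho>b[of a x] x by (intro mult_mono) auto
    also have "\<dots> = C * ((x - a) powr (- \<alpha>) * (x - a) powr \<kappa>)" by simp
    also have "(x - a) powr (- \<alpha>) * (x - a) powr \<kappa> = (x - a) powr (\<kappa> - \<alpha>)"
      by (simp add: powr_add[symmetric])
    finally show ?thesis .
  qed (simp add: D_def)
  \<comment> \<open>The factor \<open>(x - a) powr (- \<alpha>)\<close> is singular at
    \<open>a\<close>; continuity there comes from the bound \<open>Db\<close>, whose exponent is
    positive.\<close>
  have Dc: "continuous_on {a..b} D"
    unfolding continuous_on_eq_continuous_within
  proof
    fix x assume x: "x \<in> {a..b}"
    show "continuous (at x within {a..b}) D"
    proof (cases "x = a")
      case False
      have "continuous_on {a<..b} D"
        unfolding D_def \<rho>_def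
        by (intro continuous_intros continuous_on_subset[OF u1c] continuous_on_subset[OF u2c] continuous_on_subset[OF m]) auto
      then have "continuous (at x within {a<..b}) D" using x False by (simp add: continuous_on_eq_continuous_within)
      moreover have "at x within {a<..b} = at x within {a..b}"
      proof (rule at_within_nhd[of x "{a<..}"])
        show "{a<..b} \<inter> {a<..} - {x} = {a..b} \<inter> {a<..} - {x}" by auto
      qed (use x False in auto)
      ultimately show ?thesis by (simp add: continuous_within)
    next
      case True
      have "continuous_on {a..b} (\<lambda>x. C * (x - a) powr (\<kappa> - \<alpha>))"
        using \<gamma> by (intro continuous_on_mult continuous_on_powr' continuous_intros) auto
      then have "((\<lambda>x. C * (x - a) powr (\<kappa> - \<alpha>)) \<longlongrightarrow> C * (a - a) powr (\<kappa> - \<alpha>)) (at a within {a..b})"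
        using ab unfolding continuous_on_def by (metis atLeastAtMost_iff less_imp_le order_refl)
      then have lim: "((\<lambda>x. C * (x - a) powr (\<kappa> - \<alpha>)) \<longlongrightarrow> 0) (at a within {a..b})" by simp
      have "(D \<longlongrightarrow> 0) (at a within {a..b})"
        using Db by (intro Lim_null_comparison[OF _ lim]) (auto simp: eventually_at_filter)
      moreover have "D a = 0" by (simp add: D_def)
      ultimately show ?thesis using True by (simp add: continuous_within)
    qed
  qed
  have "continuous_on {a..b} (\<lambda>x. m x * conv_left (1 - \<alpha>) q x - D x - \<alpha> * T x)"
    by (intro continuous_intros m qc Dc Tc)
  then show "continuous_on {a..b} (conv_left (1 - \<alpha>) r)"
    by (rule continuous_on_eq) (simp add: formula)
  show "\<bar>conv_left (1 - \<alpha>) r x - m x * conv_left (1 - \<alpha>) q x\<bar>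
      \<le> C * (b - a) powr (\<kappa> - \<alpha>) * (1 + \<alpha> / (\<kappa> - \<alpha>))" if x: "x \<in> {a..b}" for x
  proof -
    have p: "(x - a) powr (\<kappa> - \<alpha>) \<le> (b - a) powr (\<kappa> - \<alpha>)" using x \<gamma> by (intro powr_mono2) auto
    have "\<bar>conv_left (1 - \<alpha>) r x - m x * conv_left (1 - \<alpha>) q x\<bar> \<le> \<bar>D x\<bar> + \<alpha> * \<bar>T x\<bar>"
      unfolding formula[OF x] using \<alpha>(1) abs_triangle_ineq[of "D x" "\<alpha> * T x"] by (simp add: abs_mult)
    also have "\<dots> \<le> C * (x - a) powr (\<kappa> - \<alpha>) + \<alpha> * (C * ((x - a) powr (\<kappa> - \<alpha>) / (\<kappa> - \<alpha>)))"
      using Db[OF x] Tb[OF x] \<alpha>(1) by (intro add_mono mult_left_mono) auto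
    also have "\<dots> = (C * (1 + \<alpha> / (\<kappa> - \<alpha>))) * (x - a) powr (\<kappa> - \<alpha>)" by (simp add: algebra_simps)
    also have "\<dots> \<le> (C * (1 + \<alpha> / (\<kappa> - \<alpha>))) * (b - a) powr (\<kappa> - \<alpha>)"
      using p C0 \<alpha>(1) \<gamma> by (intro mult_left_mono) auto
    finally show ?thesis by (simp add: mult_ac)
  qed
qed

text \<open>A chain rule along a sequence: the only information on \<open>X\<close> is the limit of
  its difference quotients, which is all that the variations provide.\<close>

lemma directional_limit:
  fixes f :: "'a::real_normed_vector \<Rightarrow> real"
  assumes f: "(f has_derivative f') (at p)" and e: "e \<longlonglongrightarrow> 0" "\<And>n. e n \<noteq> (0::real)"
    and X: "(\<lambda>n. (X n - p) /\<^sub>R e n) \<longlonglongrightarrow> w"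
  shows "(\<lambda>n. (f (X n) - f p) / e n) \<longlonglongrightarrow> f' w"
proof -
  interpret f': bounded_linear f' using f by (rule has_derivative_bounded_linear)
  let ?w = "\<lambda>n. (X n - p) /\<^sub>R e n"
  have "(\<lambda>n. p + e n *\<^sub>R ?w n) \<longlonglongrightarrow> p + 0 *\<^sub>R w" by (intro tendsto_intros e X)
  moreover have "p + e n *\<^sub>R ?w n = X n" for n using e(2)[of n] by simp
  ultimately have Xp: "X \<longlonglongrightarrow> p" by simp
  \<comment> \<open>The normalised remainder of the linearisation. The value 0 at \<open>p\<close>
    makes it continuous there and covers indices with \<open>X n = p\<close>.\<close>
  define r where "r z = (if z = p then 0 else (f z - f p - f' (z - p)) / norm (z - p))" for z
  have "(r \<longlongrightarrow> 0) (at p)"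
  proof (rule Lim_transform_eventually)
    show "((\<lambda>z. (f z - f p - f' (z - p)) /\<^sub>R norm (z - p)) \<longlongrightarrow> 0) (at p)"
      using f by (simp add: has_derivative_at_within has_derivative_at)
    show "\<forall>\<^sub>F z in at p. (f z - f p - f' (z - p)) /\<^sub>R norm (z - p) = r z"
      by (auto simp: eventually_at_filter r_def divide_inverse mult.commute)
  qed
  then have "isCont r p" by (simp add: isCont_def r_def)
  then have rX: "(\<lambda>n. r (X n)) \<longlonglongrightarrow> 0" using isCont_tendsto_compose[OF _ Xp] by (fastforce simp: r_def)
  have "(f (X n) - f p) / e n = f' (?w n) + r (X n) * (norm (?w n) * sgn (e n))" for n
  proof -
    have "f (X n) - f p = f' (X n - p) + r (X n) * norm (X n - p)" unfolding r_def by (simp add: f'.zero)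
    also have "X n - p = e n *\<^sub>R ?w n" using e(2)[of n] by simp
    finally have "f (X n) - f p = e n * f' (?w n) + r (X n) * (\<bar>e n\<bar> * norm (?w n))"
      by (simp only: f'.scaleR norm_scaleR real_scaleR_def)
    then have "(f (X n) - f p) / e n = (e n * f' (?w n) + r (X n) * (\<bar>e n\<bar> * norm (?w n))) / e n" by simp
    also have "\<dots> = f' (?w n) + r (X n) * (norm (?w n) * (\<bar>e n\<bar> / e n))"
    proof -
      have "(e n * A + R * (\<bar>e n\<bar> * B)) / e n = A + R * (B * (\<bar>e n\<bar> / e n))" for A R B :: real
        using e(2)[of n] by (simp add: field_simps)
      then show ?thesis .
    qed
    also have "\<bar>e n\<bar> / e n = sgn (e n)" using e(2)[of n] by (simp add: sgn_real_def abs_if)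
    finally show ?thesis .
  qed
  moreover have "(\<lambda>n. f' (?w n) + r (X n) * (norm (?w n) * sgn (e n))) \<longlonglongrightarrow> f' w"
  proof -
    have "(\<lambda>n. r (X n) * norm (?w n)) \<longlonglongrightarrow> 0 * norm w" by (intro tendsto_intros rX X)
    then have z: "(\<lambda>n. norm (r (X n) * norm (?w n))) \<longlonglongrightarrow> 0"
      unfolding mult_zero_left by (rule tendsto_norm_zero)
    have "(\<lambda>n. r (X n) * (norm (?w n) * sgn (e n))) \<longlonglongrightarrow> 0"
      by (rule Lim_null_comparison[OF _ z]) (auto simp: abs_mult sgn_real_def)
    then show ?thesis using tendsto_add[OF f'.tendsto[OF X]] by fastforce
  qed
  ultimately show ?thesis by simp
qed

lemma has_density_caputo:
  assumes d: "has_density a b f q" and x: "x \<in> {a..b}"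
  shows "set_integrable lebesgue {a..x} (\<lambda>t. (x - t) powr (- \<alpha>) * deriv f t) \<longleftrightarrow>
      integrable lborel (\<lambda>t. frac_kernel (1 - \<alpha>) (x - t) * q t)"
    and "caputo_left \<alpha> a f x = conv_left (1 - \<alpha>) q x / Gamma (1 - \<alpha>)"
proof -
  define N where "N = {x\<in>{a..b}. \<not> (f has_real_derivative q x) (at x)}"
  have N: "negligible N" "\<And>t. t \<in> {a..b} - N \<Longrightarrow> deriv f t = q t"
    using d DERIV_imp_deriv unfolding has_density_def N_def by auto
  have q: "q \<in> borel_measurable borel" "\<And>t. t \<notin> {a..b} \<Longrightarrow> q t = 0"
    using d unfolding has_density_def by auto
  have e: "1 - \<alpha> - 1 = - \<alpha>" by simp
  show "set_integrable lebesgue {a..x} (\<lambda>t. (x - t) powr (- \<alpha>) * deriv f t) \<longleftrightarrow>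
      integrable lborel (\<lambda>t. frac_kernel (1 - \<alpha>) (x - t) * q t)"
    "caputo_left \<alpha> a f x = conv_left (1 - \<alpha>) q x / Gamma (1 - \<alpha>)"
    using frac_integral_left_eq[OF N q x, of "1 - \<alpha>", unfolded e] unfolding caputo_left_def by auto
qed

lemma conv_left_continuous:
  assumes "0 < \<gamma>" and f: "continuous_on {a..b} f" "\<And>t. t \<notin> {a..b} \<Longrightarrow> f t = 0"
  shows "continuous_on {a..b} (conv_left \<gamma> f)"
    and "\<And>x. x \<in> {a..b} \<Longrightarrow> integrable lborel (\<lambda>t. frac_kernel \<gamma> (x - t) * f t)"
proof -
  have "bounded (f ` {a..b})" using f(1) by (intro compact_imp_bounded compact_continuous_image) auto
  then obtain V where "\<forall>y\<in>f ` {a..b}. norm y \<le> V" unfolding bounded_iff by blast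
  then have V: "\<And>t. t \<in> {a..b} \<Longrightarrow> \<bar>f t\<bar> \<le> V" by simp
  have fm[measurable]: "f \<in> borel_measurable borel"
  proof -
    have "f = (\<lambda>t. indicator {a..b} t *\<^sub>R f t)"
    proof
      fix t show "f t = indicator {a..b} t *\<^sub>R f t" using f(2)[of t] by (cases "t \<in> {a..b}") simp_all
    qed
    then show ?thesis using borel_measurable_continuous_on_indicator[OF _ f(1)] by simp
  qed
  have e: "indicator {a..<x} t * (frac_kernel \<gamma> (x - t) * f t) = frac_kernel \<gamma> (x - t) * f t" for x t
    using f(2)[of t] by (auto simp: indicator_def frac_kernel_def)
  note K = continuous_on_kernel_integral[of \<gamma> a b "\<lambda>x t. frac_kernel \<gamma> (x - t) * f t" V, unfolded e, folded conv_left_def]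
  have 1: "(\<lambda>t. frac_kernel \<gamma> (x - t) * f t) \<in> borel_measurable borel" for x by measurable
  have 2: "\<bar>frac_kernel \<gamma> (x - t) * f t\<bar> \<le> V * frac_kernel \<gamma> (x - t)" if "x \<in> {a..b}" "a \<le> t" "t < x" for x t
    using mult_right_mono[OF V[of t] frac_kernel_nonneg[of \<gamma> "x - t"]] that by (simp add: abs_mult mult.commute)
  have 3: "continuous_on {a+s..b} (\<lambda>x. frac_kernel \<gamma> (x - (x - s)) * f (x - s))" if "0 < s" for s
    using that by (intro continuous_intros continuous_on_compose2[OF f(1)]) (auto intro!: continuous_intros)
  show "continuous_on {a..b} (conv_left \<gamma> f)"
    using K(1)[OF assms(1) 1 2 3] unfolding conv_left_def[abs_def] by blast
  show "integrable lborel (\<lambda>t. frac_kernel \<gamma> (x - t) * f t)" if "x \<in> {a..b}" for x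
    using K(2)[OF assms(1) 1 2 3 that] by blast
qed

lemma conv_right_eq_conv_left: "conv_right \<gamma> M t = conv_left \<gamma> (\<lambda>y. M (- y)) (- t)"
proof -
  have "(LINT x|lborel. frac_kernel \<gamma> (x - t) * M x) = (LINT y|lborel. frac_kernel \<gamma> (- y - t) * M (- y))"
    using lborel_integral_real_affine[of "-1" "\<lambda>x. frac_kernel \<gamma> (x - t) * M x" 0] by simp
  moreover have "frac_kernel \<gamma> (- y - t) = frac_kernel \<gamma> (- t - y)" for y by (rule arg_cong) simp
  ultimately show ?thesis unfolding conv_left_def conv_right_def by (simp only:)
qed

lemma conv_right_continuous:
  assumes "0 < \<gamma>" and M: "continuous_on {a..b} M" "\<And>t. t \<notin> {a..b} \<Longrightarrow> M t = 0"
  shows "continuous_on {a..b} (conv_right \<gamma> M)"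
proof -
  have "continuous_on {-b..-a} (\<lambda>y. M (- y))"
    by (intro continuous_on_compose2[OF M(1)]) (auto intro!: continuous_intros)
  then have "continuous_on {-b..-a} (conv_left \<gamma> (\<lambda>y. M (- y)))"
    using M(2) by (intro conv_left_continuous assms(1)) auto
  then show ?thesis unfolding conv_right_eq_conv_left
    by (rule continuous_on_compose2) (auto intro!: continuous_intros)
qed

section \<open>Extension by zero and the class of trajectories\<close>

definition zero_ext :: "real \<Rightarrow> real \<Rightarrow> (real \<Rightarrow> real) \<Rightarrow> real \<Rightarrow> real" where
  "zero_ext a b f t = (if t \<in> {a..b} then f t else 0)"

lemma zero_ext_simps: "t \<in> {a..b} \<Longrightarrow> zero_ext a b f t = f t" "t \<notin> {a..b} \<Longrightarrow> zero_ext a b f t = 0"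
  unfolding zero_ext_def by auto

lemma zero_ext_continuous: "continuous_on {a..b} f \<Longrightarrow> continuous_on {a..b} (zero_ext a b f)"
  by (rule continuous_on_eq) (simp_all add: zero_ext_def)

lemma zero_ext_measurable:
  assumes "continuous_on {a..b} f"
  shows "zero_ext a b f \<in> borel_measurable borel"
proof -
  have "zero_ext a b f = (\<lambda>t. indicator {a..b} t *\<^sub>R f t)" by (auto simp: zero_ext_def fun_eq_iff)
  then show ?thesis using borel_measurable_continuous_on_indicator[OF _ assms] by simp
qed

lemma zero_ext_bounded:
  assumes "continuous_on {a..b} f"
  obtains V where "0 \<le> V" "\<And>t. \<bar>zero_ext a b f t\<bar> \<le> V"
proof -
  have "bounded (f ` {a..b})" using assms by (intro compact_imp_bounded compact_continuous_image) auto
  then obtain V where "\<forall>y\<in>f ` {a..b}. norm y \<le> V" unfolding bounded_iff by blast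
  then have V: "\<And>t. t \<in> {a..b} \<Longrightarrow> \<bar>f t\<bar> \<le> V" by simp
  have "\<bar>zero_ext a b f t\<bar> \<le> \<bar>V\<bar>" for t
    using V[of t] by (cases "t \<in> {a..b}") (auto simp: zero_ext_def intro: order_trans[OF _ abs_ge_self])
  then show thesis using that[of "\<bar>V\<bar>"] by auto
qed

lemma zero_ext_integrable:
  assumes "continuous_on {a..b} f"
  shows "integrable lborel (zero_ext a b f)"
proof -
  have "integrable lborel (\<lambda>t. indicator {a..b} t *\<^sub>R f t)"
    using borel_integrable_atLeastAtMost'[OF assms] unfolding set_integrable_def .
  also have "(\<lambda>t. indicator {a..b} t *\<^sub>R f t) = zero_ext a b f" by (auto simp: zero_ext_def fun_eq_iff)
  finally show ?thesis .
qed

lemma rl_int_left_continuous: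
  assumes "0 < \<beta>" and f: "continuous_on {a..b} f"
  shows "\<And>x. x \<in> {a..b} \<Longrightarrow> set_integrable lebesgue {a..x} (\<lambda>t. (x - t) powr (\<beta> - 1) * f t)"
    and "\<And>x. x \<in> {a..b} \<Longrightarrow> rl_int_left \<beta> a f x = conv_left \<beta> (zero_ext a b f) x / Gamma \<beta>"
    and "continuous_on {a..b} (rl_int_left \<beta> a f)"
proof -
  note C = conv_left_continuous[OF assms(1) zero_ext_continuous[OF f] zero_ext_simps(2)]
  note E = frac_integral_left_eq[OF negligible_empty, of a b f "zero_ext a b f", OF zero_ext_simps(1)[symmetric] zero_ext_measurable[OF f] zero_ext_simps(2)]
  show "set_integrable lebesgue {a..x} (\<lambda>t. (x - t) powr (\<beta> - 1) * f t)" if "x \<in> {a..b}" for x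
    using E(1) C(2) that by auto
  show eq: "rl_int_left \<beta> a f x = conv_left \<beta> (zero_ext a b f) x / Gamma \<beta>" if "x \<in> {a..b}" for x
    using E(2) that unfolding rl_int_left_def by auto
  have "continuous_on {a..b} (\<lambda>x. conv_left \<beta> (zero_ext a b f) x / Gamma \<beta>)"
    using C(1) Gamma_real_pos[OF assms(1)] by (intro continuous_intros) auto
  then show "continuous_on {a..b} (rl_int_left \<beta> a f)"
    by (rule continuous_on_eq) (simp add: eq)
qed

lemma rl_int_right_conv:
  assumes f: "continuous_on {a..b} f" and x: "x \<in> {a..b}"
  shows "rl_int_right \<beta> b f x = conv_right \<beta> (zero_ext a b f) x / Gamma \<beta>"
  using frac_integral_right_eq(2)[OF zero_ext_simps(1)[symmetric] zero_ext_measurable[OF f] zero_ext_simps(2) x, of \<beta>]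
  unfolding rl_int_right_def by simp

lemma traj_classI:
  assumes "0 < \<alpha>" "\<alpha> < 1" "0 < \<beta>" and d: "has_density a b f q" "abs_continuous_on a b f"
    and "\<And>x. x \<in> {a..b} \<Longrightarrow> integrable lborel (\<lambda>t. frac_kernel (1 - \<alpha>) (x - t) * q t)"
    and c: "continuous_on {a..b} (conv_left (1 - \<alpha>) q)"
  shows "f \<in> traj_class \<alpha> \<beta> a b"
proof -
  have G: "0 < Gamma (1 - \<alpha>)" using assms(2) by (intro Gamma_real_pos) simp
  have "continuous_on {a..b} (\<lambda>x. conv_left (1 - \<alpha>) q x / Gamma (1 - \<alpha>))"
    using c G by (intro continuous_intros) auto
  then have "continuous_on {a..b} (caputo_left \<alpha> a f)"
    by (rule continuous_on_eq) (simp add: has_density_caputo(2)[OF d(1)])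
  then show ?thesis
    unfolding traj_class_def
    using assms has_density_caputo(1)[OF d(1)] rl_int_left_continuous[OF assms(3) abs_continuous_on_imp_continuous[OF d(2)]]
    by auto
qed

text \<open>Integrability of the derivative is extracted from the Caputo integral at
  \<open>x = b\<close>: multiplication by the bounded function \<open>(b - t) powr \<alpha>\<close>
  removes the weight.\<close>

lemma traj_class_density:
  assumes "a < b" "0 < \<alpha>" "\<alpha> < 1" and f: "f \<in> traj_class \<alpha> \<beta> a b"
  obtains q where "has_density a b f q"
    "\<And>x. x \<in> {a..b} \<Longrightarrow> integrable lborel (\<lambda>t. frac_kernel (1 - \<alpha>) (x - t) * q t)"
    "continuous_on {a..b} (conv_left (1 - \<alpha>) q)"
proof -
  have ac: "abs_continuous_on a b f" using f unfolding traj_class_def by simp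
  have si: "set_integrable lebesgue {a..b} (\<lambda>t. (b - t) powr (- \<alpha>) * deriv f t)"
    using f \<open>a < b\<close> unfolding traj_class_def by auto
  let ?h = "\<lambda>t. indicator {a..b} t * ((b - t) powr (- \<alpha>) * deriv f t)"
  let ?g = "\<lambda>t. (indicator {a..b} t * (b - t) powr \<alpha>) * ?h t"
  have hi: "integrable lebesgue ?h" using si unfolding set_integrable_def by simp
  have "integrable lebesgue ?g"
  proof (rule Bochner_Integration.integrable_bound[where f = "\<lambda>t. (b - a) powr \<alpha> * ?h t"])
    show "integrable lebesgue (\<lambda>t. (b - a) powr \<alpha> * ?h t)" using hi by simp
    have "(\<lambda>t. indicator {a..b} t * (b - t) powr \<alpha>) \<in> borel_measurable lebesgue"
      by (rule measurable_completion) measurable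
    then show "?g \<in> borel_measurable lebesgue"
      using borel_measurable_integrable[OF hi] by (rule borel_measurable_times)
    show "AE t in lebesgue. norm (?g t) \<le> norm ((b - a) powr \<alpha> * ?h t)"
    proof (rule AE_I2)
      fix t
      have "t \<in> {a..b} \<Longrightarrow> (b - t) powr \<alpha> \<le> (b - a) powr \<alpha>"
        using assms(2) by (intro powr_mono2) auto
      then show "norm (?g t) \<le> norm ((b - a) powr \<alpha> * ?h t)"
        by (cases "t \<in> {a..b}") (auto simp: abs_mult intro!: mult_right_mono)
    qed
  qed
  then have "set_integrable lebesgue {a..b} (\<lambda>t. (b - t) powr \<alpha> * ((b - t) powr (- \<alpha>) * deriv f t))"
    unfolding set_integrable_def by (rule Bochner_Integration.integrable_cong[THEN iffD1, rotated 2]) (auto simp: indicator_def)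
  then have "set_integrable lebesgue {a..b} (deriv f)"
  \<comment> \<open>At \<open>t = b\<close> the two powers multiply to 0 instead of 1, hence the
    exceptional point.\<close>
  proof (rule absolutely_integrable_spike[OF _ negligible_sing[of b]])
    fix t assume "t \<in> {a..b} - {b}"
    then have "(b - t) powr \<alpha> * (b - t) powr (- \<alpha>) = 1" by (auto simp: powr_minus)
    then show "deriv f t = (b - t) powr \<alpha> * ((b - t) powr (- \<alpha>) * deriv f t)"
      by (simp add: mult.assoc[symmetric])
  qed
  then obtain q where q: "has_density a b f q" using abs_continuous_has_density[OF ac \<open>a < b\<close>] by blast
  have i: "integrable lborel (\<lambda>t. frac_kernel (1 - \<alpha>) (x - t) * q t)" if "x \<in> {a..b}" for x
    using has_density_caputo(1)[OF q that, of \<alpha>] f that unfolding traj_class_def by auto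
  have G: "0 < Gamma (1 - \<alpha>)" using assms(3) by (intro Gamma_real_pos) simp
  have "continuous_on {a..b} (\<lambda>x. Gamma (1 - \<alpha>) * caputo_left \<alpha> a f x)"
    using f unfolding traj_class_def by (intro continuous_intros) auto
  then have "continuous_on {a..b} (conv_left (1 - \<alpha>) q)"
    by (rule continuous_on_eq) (use G in \<open>simp add: has_density_caputo(2)[OF q]\<close>)
  then show thesis using that q i by blast
qed

text \<open>The semigroup law recovers \<open>f x - f a\<close>, up to the Beta constant, as the
  fractional integral of order \<alpha> of \<open>conv_left (1 - \<alpha>) q\<close>. The latter is
  bounded on \<open>[a,b]\<close> by continuity, and fractional integrals of bounded functions are
  Hoelder of that order.\<close>

lemma has_density_Hoelder:
  assumes "a < b" "0 < \<alpha>" "\<alpha> < 1" and d: "has_density a b f q" "abs_continuous_on a b f"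
    and c: "continuous_on {a..b} (conv_left (1 - \<alpha>) q)"
  obtains H where "0 \<le> H" "\<And>x z. a \<le> x \<Longrightarrow> x \<le> z \<Longrightarrow> z \<le> b \<Longrightarrow> \<bar>f z - f x\<bar> \<le> H * (z - x) powr \<alpha>"
proof -
  let ?v = "zero_ext a b (conv_left (1 - \<alpha>) q)"
  have qi: "integrable lborel q" "\<And>t. t \<notin> {a..b} \<Longrightarrow> q t = 0" using d(1) unfolding has_density_def by auto
  obtain V where V: "0 \<le> V" "\<And>t. \<bar>?v t\<bar> \<le> V" using zero_ext_bounded[OF c] by blast
  define B where "B = Beta (1 - \<alpha>) \<alpha>"
  have B: "0 < B" unfolding B_def Beta_def using assms by (simp add: Gamma_real_pos)
  have v0: "conv_left (1 - \<alpha>) q t = 0" if "t < a" for t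
    unfolding conv_left_def using qi(2) that
    by (intro integral_eq_zero_AE AE_I2) (auto simp: frac_kernel_def)
  have inc: "B * (f x - f a) = conv_left \<alpha> ?v x" if x: "x \<in> {a..b}" for x
  proof -
    have "(LINT t:{..<x}|lborel. q t) = (LINT t:{a..x}|lborel. q t)"
      unfolding set_lebesgue_integral_def
    proof (rule integral_cong_AE)
      show "AE t in lborel. indicator {..<x} t *\<^sub>R q t = indicator {a..x} t *\<^sub>R q t"
        using AE_lborel_singleton[of x] qi(2) by (auto simp: indicator_def)
    qed (use qi(1) in measurable)
    moreover have "f x - f a = (LINT t:{a..x}|lborel. q t)" using has_density_integral[OF d] x by auto
    ultimately have "B * (f x - f a) = conv_left \<alpha> (conv_left (1 - \<alpha>) q) x"
      using conv_left_semigroup[OF assms(2,3) qi(1), of x] unfolding B_def by simp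
    \<comment> \<open>Cutting off outside \<open>[a,b]\<close> changes nothing: left of
      \<open>a\<close> the inner convolution vanishes, right of \<open>x\<close> the outer kernel
      does.\<close>
    also have "\<dots> = conv_left \<alpha> ?v x"
      unfolding conv_left_def[of \<alpha>]
    proof (rule Bochner_Integration.integral_cong)
      fix t
      show "frac_kernel \<alpha> (x - t) * conv_left (1 - \<alpha>) q t = frac_kernel \<alpha> (x - t) * ?v t"
        using v0[of t] x by (cases "t < a"; cases "t < x") (auto simp: zero_ext_def frac_kernel_def)
    qed simp
    finally show ?thesis .
  qed
  show thesis
  proof (rule that[of "V * (2 / \<alpha>) / B"])
    show "0 \<le> V * (2 / \<alpha>) / B" using V B assms by simp
    fix x z assume xz: "a \<le> x" "x \<le> z" "z \<le> b"
    have "B * \<bar>f z - f x\<bar> = \<bar>B * (f z - f a) - B * (f x - f a)\<bar>"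
    proof -
      have "B * (f z - f a) - B * (f x - f a) = B * (f z - f x)" by (simp add: algebra_simps)
      then show ?thesis using B by (simp add: abs_mult)
    qed
    also have "\<dots> = \<bar>conv_left \<alpha> ?v z - conv_left \<alpha> ?v x\<bar>" using inc xz by simp
    also have "\<dots> \<le> V * (2 / \<alpha>) * (z - x) powr \<alpha>"
      using xz assms V by (intro conv_left_Hoelder[where a = a] zero_ext_measurable c) (auto simp: zero_ext_def)
    finally have "\<bar>f z - f x\<bar> \<le> (V * (2 / \<alpha>) * (z - x) powr \<alpha>) / B"
      using B by (simp only: pos_le_divide_eq mult.commute)
    then show "\<bar>f z - f x\<bar> \<le> V * (2 / \<alpha>) / B * (z - x) powr \<alpha>" by simp
  qed
qed

section \<open>The holonomic constraint\<close>

lemma mean_value_lower_bound: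
  fixes \<phi> \<phi>' :: "real \<Rightarrow> real"
  assumes "\<And>z. z \<in> {min s t..max s t} \<Longrightarrow> (\<phi> has_real_derivative \<phi>' z) (at z)"
    and "\<And>z. z \<in> {min s t..max s t} \<Longrightarrow> m \<le> \<bar>\<phi>' z\<bar>"
  shows "m * \<bar>t - s\<bar> \<le> \<bar>\<phi> t - \<phi> s\<bar>"
proof -
  have *: "m * \<bar>t - s\<bar> \<le> \<bar>\<phi> t - \<phi> s\<bar>" if st: "s < t" "\<And>z. z \<in> {s..t} \<Longrightarrow> (\<phi> has_real_derivative \<phi>' z) (at z)"
    "\<And>z. z \<in> {s..t} \<Longrightarrow> m \<le> \<bar>\<phi>' z\<bar>" for s t
  proof -
    obtain z where z: "s < z" "z < t" "\<phi> t - \<phi> s = (t - s) * \<phi>' z"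
      using MVT2[of s t \<phi> \<phi>'] st(1,2) by auto
    then have "m * \<bar>t - s\<bar> \<le> \<bar>\<phi>' z\<bar> * \<bar>t - s\<bar>" using st(3)[of z] by (intro mult_right_mono) auto
    then show ?thesis using z(3) by (simp add: abs_mult mult.commute)
  qed
  consider "s < t" | "s = t" | "t < s" by linarith
  then show ?thesis
  proof cases
    case 1
    then show ?thesis using *[of s t] assms by (simp add: min_def max_def)
  next
    case 3
    then show ?thesis using *[of t s] assms by (simp add: min_def max_def abs_minus_commute)
  qed simp
qed

text \<open>A continuous derivative bounded away from 0 has constant sign, by connectedness, so
  \<phi> is monotone with slope at least \<open>m\<close> in absolute value. Starting from
  \<open>\<bar>\<phi> c\<bar> \<le> m * r\<close> it must reach 0 within distance
  \<open>r\<close>.\<close>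

lemma root_near:
  fixes \<phi> \<phi>' :: "real \<Rightarrow> real"
  assumes m: "0 < m" and r: "0 \<le> r" and der: "\<And>z. z \<in> {c - r..c + r} \<Longrightarrow> (\<phi> has_real_derivative \<phi>' z) (at z)"
    and cont: "continuous_on {c - r..c + r} \<phi>'" and low: "\<And>z. z \<in> {c - r..c + r} \<Longrightarrow> m \<le> \<bar>\<phi>' z\<bar>"
    and small: "\<bar>\<phi> c\<bar> \<le> m * r"
  shows "\<exists>s\<in>{c - r..c + r}. \<phi> s = 0"
proof -
  have *: "\<exists>s\<in>{c - r..c + r}. \<psi> s = 0"
    if der: "\<And>z. z \<in> {c - r..c + r} \<Longrightarrow> (\<psi> has_real_derivative \<psi>' z) (at z)"
      and cont: "continuous_on {c - r..c + r} \<psi>'" and low: "\<And>z. z \<in> {c - r..c + r} \<Longrightarrow> m \<le> \<bar>\<psi>' z\<bar>"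
      and small: "\<bar>\<psi> c\<bar> \<le> m * r" and pos: "0 < \<psi>' c" for \<psi> \<psi>' :: "real \<Rightarrow> real"
  proof -
    have ge: "0 < \<psi>' z" if z: "z \<in> {c - r..c + r}" for z
    proof (rule ccontr)
      assume n: "\<not> 0 < \<psi>' z"
      have "connected (\<psi>' ` {c - r..c + r})" using cont by (intro connected_continuous_image) auto
      moreover have "\<psi>' z \<in> \<psi>' ` {c - r..c + r}" "\<psi>' c \<in> \<psi>' ` {c - r..c + r}" using z r by auto
      ultimately have "0 \<in> \<psi>' ` {c - r..c + r}"
        using n pos unfolding connected_iff_interval by (metis less_imp_le not_less)
      then show False using low m by force
    qed
    have inc: "\<psi> s + m * (t - s) \<le> \<psi> t" if st: "c - r \<le> s" "s \<le> t" "t \<le> c + r" for s t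
    proof (cases "s = t")
      case False
      then obtain z where z: "s < z" "z < t" "\<psi> t - \<psi> s = (t - s) * \<psi>' z"
        using MVT2[of s t \<psi> \<psi>'] der st by fastforce
      have "m \<le> \<psi>' z" using low[of z] ge[of z] z st by auto
      then have "(t - s) * m \<le> (t - s) * \<psi>' z" using st by (intro mult_left_mono) auto
      then show ?thesis using z(3) by (simp add: mult.commute)
    qed simp
    have "\<psi> (c - r) \<le> 0" "0 \<le> \<psi> (c + r)"
      using inc[of "c - r" c] inc[of c "c + r"] small r by (auto simp: abs_le_iff)
    moreover have "continuous_on {c - r..c + r} \<psi>"
      using der by (intro continuous_at_imp_continuous_on ballI DERIV_isCont)
    ultimately show ?thesis using IVT'[of \<psi> "c - r" 0 "c + r"] r by auto
  qed
  have c: "c \<in> {c - r..c + r}" using r by simp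
  consider "0 < \<phi>' c" | "0 < - \<phi>' c" using low[OF c] m by fastforce
  then show ?thesis
  proof cases
    case 1
    then show ?thesis using *[of \<phi> \<phi>'] assms by blast
  next
    case 2
    have "\<exists>s\<in>{c - r..c + r}. - \<phi> s = 0"
    proof (rule *[of "\<lambda>z. - \<phi> z" "\<lambda>z. - \<phi>' z"])
      show "((\<lambda>z. - \<phi> z) has_real_derivative - \<phi>' z) (at z)" if "z \<in> {c - r..c + r}" for z
        using der[OF that] by (rule DERIV_minus)
      show "continuous_on {c - r..c + r} (\<lambda>z. - \<phi>' z)" using cont by (intro continuous_intros)
    qed (use low small 2 in auto)
    then show ?thesis by simp
  qed
qed

lemma norm_state_le: "norm ((s, d) :: real \<times> (real^2)) \<le> \<bar>s\<bar> + \<bar>d $ 1\<bar> + \<bar>d $ 2\<bar>"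
proof -
  have "norm (s, d) \<le> norm s + norm d" by (rule norm_Pair_le)
  moreover have "norm d \<le> (\<Sum>i\<in>UNIV. \<bar>d $ i\<bar>)" by (rule norm_le_l1_cart)
  ultimately show ?thesis by (simp add: sum_2)
qed

text \<open>\<open>G\<close> stands for a smooth extension of the constraint function to an open
  neighbourhood \<open>U\<close> of the strip, so that derivatives make sense at the endpoints
  too.\<close>

locale constraint =
  fixes a b :: real and G :: "real \<times> (real^2) \<Rightarrow> real" and U :: "(real \<times> (real^2)) set"
  assumes ab: "a < b" and open_U: "open U" and strip_subset: "{a..b} \<times> UNIV \<subseteq> U"
    and smooth: "\<And>k. Ck_on k G U"
    and nondegenerate: "\<And>x Y. x \<in> {a..b} \<Longrightarrow> partial_deriv (0, axis 2 1) G (x, Y) \<noteq> 0"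
begin

definition "dG0 = partial_deriv (1, 0) G"
definition "dG1 = partial_deriv (0, axis 1 1) G"
definition "dG2 = partial_deriv (0, axis 2 1) G"

text \<open>On the constraint set, \<open>dY\<^sub>2 = slope0 dx + slope1 dY\<^sub>1\<close>.\<close>

definition "slope0 p = - dG0 p / dG2 p"
definition "slope1 p = - dG1 p / dG2 p"

text \<open>A compact convex set, as the Lipschitz and Taylor estimates require; constants obtained
  on it are common to all curves inside.\<close>

definition tube :: "real \<Rightarrow> (real \<times> (real^2)) set" where
  "tube R = {a..b} \<times> cbox (\<chi> i. - R) (\<chi> i. R)"

lemma mem_tube: "(x, Y) \<in> tube R \<longleftrightarrow> x \<in> {a..b} \<and> \<bar>Y $ 1\<bar> \<le> R \<and> \<bar>Y $ 2\<bar> \<le> R"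
  unfolding tube_def by (auto simp: mem_box_cart forall_2 abs_le_iff)

lemma tube: "compact (tube R)" "convex (tube R)" "tube R \<subseteq> U"
  using strip_subset unfolding tube_def by (auto intro!: compact_Times convex_Times)

lemma Basis_mem: "(1, 0) \<in> (Basis :: (real \<times> (real^2)) set)" "(0, axis i 1) \<in> (Basis :: (real \<times> (real^2)) set)"
  by (auto simp: Basis_prod_def axis_in_Basis_iff)

lemma G_derivative: "p \<in> U \<Longrightarrow> (G has_derivative grad G p) (at p)"
  using Ck_on_has_derivative[OF open_U smooth] .

lemma grad_eq: "p \<in> U \<Longrightarrow> grad G p (s, d) = s * dG0 p + d $ 1 * dG1 p + d $ 2 * dG2 p"
proof -
  assume p: "p \<in> U"
  interpret g: bounded_linear "grad G p" by (rule grad_linear)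
  have "(s, d) = s *\<^sub>R (1, 0) + (d $ 1) *\<^sub>R (0, axis 1 1) + (d $ 2) *\<^sub>R (0, axis 2 1)"
    by (auto simp: vec_eq_iff forall_2 axis_def)
  then show ?thesis
    using partial_deriv_eqI[OF G_derivative[OF p]] unfolding dG0_def dG1_def dG2_def
    by (simp only: g.add g.scaleR real_scaleR_def)
qed

lemma partials_Ck: "Ck_on k dG0 U" "Ck_on k dG1 U" "Ck_on k dG2 U"
  using smooth[of "Suc k"] Basis_mem unfolding dG0_def dG1_def dG2_def by auto

lemma partials_continuous: "continuous_on U dG0" "continuous_on U dG1" "continuous_on U dG2"
  using partials_Ck[THEN Ck_on_continuous_on[OF open_U]] by blast+

lemma dG2_nonzero: "x \<in> {a..b} \<Longrightarrow> dG2 (x, Y) \<noteq> 0"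
  unfolding dG2_def by (rule nondegenerate)

lemma slope_continuous: "continuous_on ({a..b} \<times> UNIV) slope0" "continuous_on ({a..b} \<times> UNIV) slope1"
  unfolding slope0_def slope1_def using dG2_nonzero
  by (auto intro!: continuous_intros continuous_on_subset[OF partials_continuous(1) strip_subset]
    continuous_on_subset[OF partials_continuous(2) strip_subset] continuous_on_subset[OF partials_continuous(3) strip_subset])

lemma slope_differentiable:
  assumes "x \<in> {a..b}"
  shows "\<exists>D. (slope0 has_derivative D) (at (x, Y))" "\<exists>D. (slope1 has_derivative D) (at (x, Y))"
proof -
  have p: "(x, Y) \<in> U" using assms strip_subset by auto
  have "(f has_derivative grad f (x, Y)) (at (x, Y))" if "\<And>k. Ck_on k f U" for f
    using Ck_on_has_derivative[OF open_U that p] .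
  note d = this[OF partials_Ck(1)] this[OF partials_Ck(2)] this[OF partials_Ck(3)]
  show "\<exists>D. (slope0 has_derivative D) (at (x, Y))" "\<exists>D. (slope1 has_derivative D) (at (x, Y))"
    unfolding slope0_def[abs_def] slope1_def[abs_def]
    using has_derivative_divide[OF has_derivative_minus[OF d(1)] d(3) dG2_nonzero[OF assms]]
      has_derivative_divide[OF has_derivative_minus[OF d(2)] d(3) dG2_nonzero[OF assms]] by blast+
qed

lemma dG2_lower:
  obtains m where "0 < m" "\<And>p. p \<in> tube R \<Longrightarrow> m \<le> \<bar>dG2 p\<bar>"
proof (cases "tube R = {}")
  case False
  have "continuous_on (tube R) (\<lambda>p. \<bar>dG2 p\<bar>)"
    using continuous_on_subset[OF partials_continuous(3) tube(3)] by (intro continuous_intros)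
  then obtain p where p: "p \<in> tube R" "\<And>q. q \<in> tube R \<Longrightarrow> \<bar>dG2 p\<bar> \<le> \<bar>dG2 q\<bar>"
    using continuous_attains_inf[OF tube(1) False] by blast
  moreover have "dG2 p \<noteq> 0" using p(1) dG2_nonzero unfolding tube_def by (cases p) auto
  ultimately show thesis using that[of "\<bar>dG2 p\<bar>"] by auto
qed (use that[of 1] in auto)

lemma slope_Lipschitz:
  obtains C where "0 \<le> C" "\<And>p. p \<in> tube R \<Longrightarrow> \<bar>slope0 p\<bar> \<le> C" "\<And>p. p \<in> tube R \<Longrightarrow> \<bar>slope1 p\<bar> \<le> C"
    "\<And>p q. p \<in> tube R \<Longrightarrow> q \<in> tube R \<Longrightarrow> \<bar>slope0 q - slope0 p\<bar> \<le> C * norm (q - p)"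
    "\<And>p q. p \<in> tube R \<Longrightarrow> q \<in> tube R \<Longrightarrow> \<bar>slope1 q - slope1 p\<bar> \<le> C * norm (q - p)"
proof -
  obtain m where m: "0 < m" "\<And>p. p \<in> tube R \<Longrightarrow> m \<le> \<bar>dG2 p\<bar>" using dG2_lower[of R] by blast
  obtain C2 where C2: "0 \<le> C2" "\<And>p q. p \<in> tube R \<Longrightarrow> q \<in> tube R \<Longrightarrow> \<bar>dG2 q - dG2 p\<bar> \<le> C2 * norm (q - p)"
    using Ck_on_Lipschitz[OF open_U partials_Ck(3)[of "Suc 0"] tube[of R]] by blast
  have ex: "\<exists>C\<ge>0. (\<forall>p\<in>tube R. \<bar>- f p / dG2 p\<bar> \<le> C) \<and>
      (\<forall>p\<in>tube R. \<forall>q\<in>tube R. \<bar>- f q / dG2 q - - f p / dG2 p\<bar> \<le> C * norm (q - p))"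
    if f: "\<And>k. Ck_on k f U" for f
  proof -
    obtain C1 where C1: "0 \<le> C1" "\<And>p q. p \<in> tube R \<Longrightarrow> q \<in> tube R \<Longrightarrow> \<bar>f q - f p\<bar> \<le> C1 * norm (q - p)"
      using Ck_on_Lipschitz[OF open_U f[of "Suc 0"] tube[of R]] by blast
    have "continuous_on (tube R) f"
      using continuous_on_subset[OF Ck_on_continuous_on[OF open_U f] tube(3)] .
    then have "bounded (f ` tube R)" by (intro compact_imp_bounded compact_continuous_image tube(1))
    then obtain B where "\<forall>z\<in>f ` tube R. norm z \<le> B" unfolding bounded_iff by blast
    then have B: "\<And>p. p \<in> tube R \<Longrightarrow> \<bar>f p\<bar> \<le> \<bar>B\<bar>" by force
    \<comment> \<open>The first term bounds the quotient itself, the bracket bounds its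
      increments.\<close>
    define C where "C = \<bar>B\<bar> / m + (C1 / m + \<bar>B\<bar> * C2 / (m * m))"
    have parts: "0 \<le> \<bar>B\<bar> / m" "0 \<le> C1 / m + \<bar>B\<bar> * C2 / (m * m)" using m C1 C2 by auto
    show ?thesis
    proof (intro exI[of _ C] conjI ballI)
      show "0 \<le> C" unfolding C_def using parts by linarith
      fix p assume p: "p \<in> tube R"
      have "\<bar>f p\<bar> / \<bar>dG2 p\<bar> \<le> \<bar>B\<bar> / m" using B[OF p] m(1) m(2)[OF p] by (intro frac_le) auto
      then show "\<bar>- f p / dG2 p\<bar> \<le> C" unfolding C_def using parts by (simp add: abs_divide)
      fix q assume q: "q \<in> tube R"
      have nz: "dG2 p \<noteq> 0" "dG2 q \<noteq> 0" using m(1) m(2)[OF p] m(2)[OF q] by auto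
      have "- f q / dG2 q - - f p / dG2 p = - (f q - f p) / dG2 q + f p * (dG2 q - dG2 p) / (dG2 p * dG2 q)"
        using nz by (simp add: field_simps)
      then have "\<bar>- f q / dG2 q - - f p / dG2 p\<bar>
          \<le> \<bar>f q - f p\<bar> / \<bar>dG2 q\<bar> + \<bar>f p\<bar> * \<bar>dG2 q - dG2 p\<bar> / (\<bar>dG2 p\<bar> * \<bar>dG2 q\<bar>)"
        using abs_triangle_ineq[of "- (f q - f p) / dG2 q" "f p * (dG2 q - dG2 p) / (dG2 p * dG2 q)"]
        by (simp add: abs_mult abs_divide abs_minus_commute)
      also have "\<dots> \<le> C1 * norm (q - p) / m + \<bar>B\<bar> * (C2 * norm (q - p)) / (m * m)"
        using B[OF p] m(1) m(2)[OF p] m(2)[OF q] C1 C2 p q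
        by (intro add_mono frac_le mult_mono) auto
      also have "\<dots> = (C1 / m + \<bar>B\<bar> * C2 / (m * m)) * norm (q - p)" by (simp add: algebra_simps)
      also have "\<dots> \<le> C * norm (q - p)" unfolding C_def using parts by (intro mult_right_mono) auto
      finally show "\<bar>- f q / dG2 q - - f p / dG2 p\<bar> \<le> C * norm (q - p)" .
    qed
  qed
  obtain C0 where C0: "0 \<le> C0" "\<forall>p\<in>tube R. \<bar>slope0 p\<bar> \<le> C0"
      "\<forall>p\<in>tube R. \<forall>q\<in>tube R. \<bar>slope0 q - slope0 p\<bar> \<le> C0 * norm (q - p)"
    using ex[OF partials_Ck(1)] unfolding slope0_def by blast
  obtain C1 where C1: "0 \<le> C1" "\<forall>p\<in>tube R. \<bar>slope1 p\<bar> \<le> C1"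
      "\<forall>p\<in>tube R. \<forall>q\<in>tube R. \<bar>slope1 q - slope1 p\<bar> \<le> C1 * norm (q - p)"
    using ex[OF partials_Ck(2)] unfolding slope1_def by blast
  have mono: "z \<le> (C0 + C1) * norm d" if "z \<le> C0 * norm d \<or> z \<le> C1 * norm d" for z and d :: "real \<times> (real^2)"
    using that mult_nonneg_nonneg[OF C0(1) norm_ge_zero[of d]] mult_nonneg_nonneg[OF C1(1) norm_ge_zero[of d]]
    by (auto simp: distrib_right)
  show thesis
    by (rule that[of "C0 + C1"]) (use C0 C1 mono in \<open>auto intro: add_increasing2 add_increasing\<close>)
qed

text \<open>First estimate: on the vertical line through \<open>(t, Y')\<close> the function
  \<open>G\<close> changes at least at rate \<open>m\<close>, so the height difference is controlled
  by the Lipschitz constant of \<open>G\<close> in the remaining variables. Second: in the Taylor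
  formula at \<open>(x, Y)\<close> both values of \<open>G\<close> are 0, and division by
  \<open>dG2\<close> leaves the linear relation with a quadratic error.\<close>

lemma constraint_estimates:
  obtains C where "0 \<le> C"
    "\<And>x Y t Y'. (x, Y) \<in> tube R \<Longrightarrow> (t, Y') \<in> tube R \<Longrightarrow> G (x, Y) = 0 \<Longrightarrow> G (t, Y') = 0 \<Longrightarrow>
       \<bar>Y' $ 2 - Y $ 2\<bar> \<le> C * (\<bar>t - x\<bar> + \<bar>Y' $ 1 - Y $ 1\<bar>)"
    "\<And>x Y t Y'. (x, Y) \<in> tube R \<Longrightarrow> (t, Y') \<in> tube R \<Longrightarrow> G (x, Y) = 0 \<Longrightarrow> G (t, Y') = 0 \<Longrightarrow>
       \<bar>Y' $ 2 - Y $ 2 - slope1 (x, Y) * (Y' $ 1 - Y $ 1) - slope0 (x, Y) * (t - x)\<bar>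
         \<le> C * (\<bar>t - x\<bar> + \<bar>Y' $ 1 - Y $ 1\<bar>)\<^sup>2"
proof -
  obtain m where m: "0 < m" "\<And>p. p \<in> tube R \<Longrightarrow> m \<le> \<bar>dG2 p\<bar>" using dG2_lower[of R] by blast
  obtain C1 where C1: "0 \<le> C1" "\<And>p q. p \<in> tube R \<Longrightarrow> q \<in> tube R \<Longrightarrow> \<bar>G q - G p\<bar> \<le> C1 * norm (q - p)"
    using Ck_on_Lipschitz[OF open_U smooth[of "Suc 0"] tube[of R]] by blast
  obtain C2 where C2: "0 \<le> C2" "\<And>p q. p \<in> tube R \<Longrightarrow> q \<in> tube R \<Longrightarrow>
      \<bar>G q - G p - grad G p (q - p)\<bar> \<le> C2 * (norm (q - p))\<^sup>2"
    using Ck_on_Taylor[OF open_U smooth[of "Suc (Suc 0)"] tube[of R]] by blast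
  define A where "A = C1 / m"
  \<comment> \<open>With the height difference at most \<open>A * D\<close>, the two points are at
    distance at most \<open>(1 + A) * D\<close>; this distance enters the Taylor error
    squared.\<close>
  define C where "C = A + C2 / m * (1 + A)\<^sup>2"
  have A: "0 \<le> A" "0 \<le> C2 / m * (1 + A)\<^sup>2" unfolding A_def using C1 C2 m by auto
  have lip: "\<bar>Y' $ 2 - Y $ 2\<bar> \<le> A * (\<bar>t - x\<bar> + \<bar>Y' $ 1 - Y $ 1\<bar>)"
    if p: "(x, Y) \<in> tube R" and q: "(t, Y') \<in> tube R" and z: "G (x, Y) = 0" "G (t, Y') = 0" for x Y t Y'
  proof -
    define \<phi> where "\<phi> s = G (t, vector [Y' $ 1, s])" for s
    have Y': "vector [Y' $ 1, Y' $ 2] = Y'" by (simp add: vec_eq_iff forall_2)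
    have inbox: "(t, vector [Y' $ 1, s]) \<in> tube R" if "s \<in> {min (Y $ 2) (Y' $ 2)..max (Y $ 2) (Y' $ 2)}" for s
      using p q that unfolding mem_tube by (auto simp: abs_le_iff min_def max_def split: if_splits)
    have "m * \<bar>Y' $ 2 - Y $ 2\<bar> \<le> \<bar>\<phi> (Y' $ 2) - \<phi> (Y $ 2)\<bar>"
    proof (rule mean_value_lower_bound)
      fix s assume s: "s \<in> {min (Y $ 2) (Y' $ 2)..max (Y $ 2) (Y' $ 2)}"
      show "m \<le> \<bar>dG2 (t, vector [Y' $ 1, s])\<bar>" using m(2) inbox[OF s] by blast
      have pU: "(t, vector [Y' $ 1, s]) \<in> U" using inbox[OF s] tube(3) by blast
      have v: "vector [Y' $ 1, s] = Y' + (s - Y' $ 2) *\<^sub>R axis 2 1" for s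
        by (simp add: vec_eq_iff forall_2 axis_def)
      have "((\<lambda>s. (t, Y' + (s - Y' $ 2) *\<^sub>R axis 2 1)) has_derivative (\<lambda>d. (0, d *\<^sub>R axis 2 1))) (at s)"
        by (auto intro!: derivative_eq_intros)
      then have "(\<phi> has_derivative (\<lambda>d. grad G (t, vector [Y' $ 1, s]) (0, d *\<^sub>R axis 2 1))) (at s)"
        unfolding \<phi>_def v
        by (rule has_derivative_compose) (use G_derivative[OF pU] in \<open>simp add: v\<close>)
      then show "(\<phi> has_real_derivative dG2 (t, vector [Y' $ 1, s])) (at s)"
        unfolding has_field_derivative_def grad_eq[OF pU] by (simp add: axis_def mult_commute_abs)
    qed
    \<comment> \<open>One zero of \<open>G\<close> is exchanged for the other; the two points now
      have the same height.\<close>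
    also have "\<dots> = \<bar>G (t, vector [Y' $ 1, Y $ 2]) - G (x, Y)\<bar>" unfolding \<phi>_def Y' using z by simp
    also have "\<dots> \<le> C1 * norm ((t, vector [Y' $ 1, Y $ 2]) - (x, Y))"
      using inbox[of "Y $ 2"] by (intro C1(2) p) auto
    also have "\<dots> \<le> C1 * (\<bar>t - x\<bar> + \<bar>Y' $ 1 - Y $ 1\<bar>)"
      using norm_state_le[of "t - x" "vector [Y' $ 1, Y $ 2] - Y"] C1(1) by (intro mult_left_mono) auto
    finally have "\<bar>Y' $ 2 - Y $ 2\<bar> \<le> (C1 * (\<bar>t - x\<bar> + \<bar>Y' $ 1 - Y $ 1\<bar>)) / m"
      using m(1) by (simp only: pos_le_divide_eq mult.commute)
    then show ?thesis unfolding A_def by simp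
  qed
  show thesis
  proof (rule that[of C])
    show "0 \<le> C" unfolding C_def using A by linarith
    fix x Y t Y' assume p: "(x, Y) \<in> tube R" and q: "(t, Y') \<in> tube R" and z: "G (x, Y) = 0" "G (t, Y') = 0"
    define D where "D = \<bar>t - x\<bar> + \<bar>Y' $ 1 - Y $ 1\<bar>"
    have D: "0 \<le> D" unfolding D_def by simp
    have l: "\<bar>Y' $ 2 - Y $ 2\<bar> \<le> A * D" using lip[OF p q z] unfolding D_def .
    have "A * D \<le> C * D" unfolding C_def using A D by (intro mult_right_mono) auto
    then show "\<bar>Y' $ 2 - Y $ 2\<bar> \<le> C * (\<bar>t - x\<bar> + \<bar>Y' $ 1 - Y $ 1\<bar>)" using l unfolding D_def by linarith
    have pU: "(x, Y) \<in> U" using p tube(3) by blast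
    have nz: "0 < \<bar>dG2 (x, Y)\<bar>" using m(1) m(2)[OF p] by linarith
    let ?E = "(t - x) * dG0 (x, Y) + (Y' $ 1 - Y $ 1) * dG1 (x, Y) + (Y' $ 2 - Y $ 2) * dG2 (x, Y)"
    have "norm ((t, Y') - (x, Y)) \<le> (1 + A) * D"
      using norm_state_le[of "t - x" "Y' - Y"] l unfolding D_def by (simp add: algebra_simps)
    then have n2: "(norm ((t, Y') - (x, Y)))\<^sup>2 \<le> ((1 + A) * D)\<^sup>2" by (intro power_mono) auto
    have "\<bar>?E\<bar> \<le> C2 * (norm ((t, Y') - (x, Y)))\<^sup>2"
      using C2(2)[OF p q] z grad_eq[OF pU, of "t - x" "Y' - Y"] by simp
    also have "\<dots> \<le> C2 * ((1 + A) * D)\<^sup>2" using n2 C2(1) by (rule mult_left_mono)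
    finally have E: "\<bar>?E\<bar> \<le> C2 * ((1 + A) * D)\<^sup>2" .
    have "\<bar>?E\<bar> / \<bar>dG2 (x, Y)\<bar> \<le> C2 * ((1 + A) * D)\<^sup>2 / m"
      using E m(1) m(2)[OF p] by (intro frac_le) auto
    also have "\<dots> = C2 / m * (1 + A)\<^sup>2 * D\<^sup>2" by (simp add: power_mult_distrib)
    also have "\<dots> \<le> C * D\<^sup>2" unfolding C_def using A by (intro mult_right_mono) auto
    finally have "\<bar>?E / dG2 (x, Y)\<bar> \<le> C * D\<^sup>2" by (simp add: abs_divide)
    moreover have "?E / dG2 (x, Y) = Y' $ 2 - Y $ 2 - slope1 (x, Y) * (Y' $ 1 - Y $ 1) - slope0 (x, Y) * (t - x)"
      using nz unfolding slope0_def slope1_def by (simp add: field_simps)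
    ultimately show "\<bar>Y' $ 2 - Y $ 2 - slope1 (x, Y) * (Y' $ 1 - Y $ 1) - slope0 (x, Y) * (t - x)\<bar>
         \<le> C * (\<bar>t - x\<bar> + \<bar>Y' $ 1 - Y $ 1\<bar>)\<^sup>2" unfolding D_def by simp
  qed
qed

text \<open>Moving the first component by \<open>d\<close> at fixed \<open>x\<close> spoils the
  constraint by at most \<open>C1 * \<bar>d\<bar>\<close>, which \<open>root_near\<close> repairs by
  moving the second one at most \<open>C1 / m * \<bar>d\<bar>\<close>. The range \<delta> does not
  depend on the point, so a whole curve can be perturbed at once.\<close>

lemma constraint_solvable:
  assumes "0 \<le> R"
  obtains C \<delta> where "0 \<le> C" "0 < \<delta>"
    "\<And>x Y d. (x, Y) \<in> tube R \<Longrightarrow> G (x, Y) = 0 \<Longrightarrow> \<bar>d\<bar> \<le> \<delta> \<Longrightarrow>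
       \<exists>s. G (x, vector [Y $ 1 + d, s]) = 0 \<and> \<bar>s - Y $ 2\<bar> \<le> C * \<bar>d\<bar> \<and> (x, vector [Y $ 1 + d, s]) \<in> tube (R + 1)"
proof -
  obtain m where m: "0 < m" "\<And>p. p \<in> tube (R + 1) \<Longrightarrow> m \<le> \<bar>dG2 p\<bar>" using dG2_lower[of "R + 1"] by blast
  obtain C1 where C1: "0 \<le> C1" "\<And>p q. p \<in> tube (R + 1) \<Longrightarrow> q \<in> tube (R + 1) \<Longrightarrow> \<bar>G q - G p\<bar> \<le> C1 * norm (q - p)"
    using Ck_on_Lipschitz[OF open_U smooth[of "Suc 0"] tube[of "R + 1"]] by blast
  define C where "C = C1 / m"
  have C: "0 \<le> C" unfolding C_def using C1 m by simp
  \<comment> \<open>Keeps both \<open>\<bar>d\<bar>\<close> and \<open>C * \<bar>d\<bar>\<close> at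
    most 1, so that nothing leaves \<open>tube (R + 1)\<close>.\<close>
  define \<delta> where "\<delta> = 1 / (C + 1)"
  have \<delta>: "0 < \<delta>" "\<delta> \<le> 1" "C * \<delta> \<le> 1" unfolding \<delta>_def using C by (auto simp: field_simps)
  show thesis
  proof (rule that[OF C \<delta>(1)])
    fix x Y d assume p: "(x, Y) \<in> tube R" and z: "G (x, Y) = 0" and d: "\<bar>d\<bar> \<le> \<delta>"
    define r where "r = C * \<bar>d\<bar>"
    have r: "0 \<le> r" "r \<le> 1" unfolding r_def using C d \<delta>(3) mult_left_mono[OF d C] by auto
    define \<phi> where "\<phi> s = G (x, vector [Y $ 1 + d, s])" for s
    have inbox: "(x, vector [Y $ 1 + d, s]) \<in> tube (R + 1)" if "s \<in> {Y $ 2 - r..Y $ 2 + r}" for s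
      using p that d \<delta>(2) r unfolding mem_tube by (auto simp: abs_le_iff)
    have pU: "(x, Z) \<in> U" for Z using p strip_subset unfolding mem_tube by auto
    define w :: "real^2" where "w = vector [Y $ 1 + d, 0]"
    have v: "vector [Y $ 1 + d, s] = (w + s *\<^sub>R axis 2 1 :: real^2)" for s :: real
      by (simp add: w_def vec_eq_iff forall_2 axis_def)
    have "\<exists>s\<in>{Y $ 2 - r..Y $ 2 + r}. \<phi> s = 0"
    proof (rule root_near[OF m(1) r(1), of _ _ "\<lambda>s. dG2 (x, vector [Y $ 1 + d, s])"])
      fix s assume s: "s \<in> {Y $ 2 - r..Y $ 2 + r}"
      show "m \<le> \<bar>dG2 (x, vector [Y $ 1 + d, s])\<bar>" using m(2) inbox[OF s] by blast
      have "((\<lambda>s. (x, w + s *\<^sub>R axis 2 1 :: real^2)) has_derivative (\<lambda>e. (0, e *\<^sub>R axis 2 1))) (at s)"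
        by (auto intro!: derivative_eq_intros)
      then have "(\<phi> has_derivative (\<lambda>e. grad G (x, vector [Y $ 1 + d, s]) (0, e *\<^sub>R axis 2 1))) (at s)"
        unfolding \<phi>_def v by (rule has_derivative_compose) (rule G_derivative[OF pU])
      then show "(\<phi> has_real_derivative dG2 (x, vector [Y $ 1 + d, s])) (at s)"
        unfolding has_field_derivative_def grad_eq[OF pU] by (simp add: axis_def mult_commute_abs)
    next
      show "continuous_on {Y $ 2 - r..Y $ 2 + r} (\<lambda>s. dG2 (x, vector [Y $ 1 + d, s]))"
        unfolding v using pU
        by (intro continuous_on_compose2[OF partials_continuous(3)] continuous_intros) auto
      have "\<bar>\<phi> (Y $ 2)\<bar> = \<bar>G (x, vector [Y $ 1 + d, Y $ 2]) - G (x, Y)\<bar>" unfolding \<phi>_def using z by simp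
      also have "\<dots> \<le> C1 * norm ((x, vector [Y $ 1 + d, Y $ 2]) - (x, Y))"
        using inbox[of "Y $ 2"] r p by (intro C1(2)) (auto simp: mem_tube)
      also have "\<dots> \<le> C1 * \<bar>d\<bar>"
        using norm_state_le[of 0 "vector [Y $ 1 + d, Y $ 2] - Y"] C1(1) by (intro mult_left_mono) auto
      also have "\<dots> = m * r" unfolding r_def C_def using m(1) by simp
      finally show "\<bar>\<phi> (Y $ 2)\<bar> \<le> m * r" .
    qed
    then obtain s where s: "s \<in> {Y $ 2 - r..Y $ 2 + r}" "\<phi> s = 0" by blast
    then show "\<exists>s. G (x, vector [Y $ 1 + d, s]) = 0 \<and> \<bar>s - Y $ 2\<bar> \<le> C * \<bar>d\<bar> \<and>
        (x, vector [Y $ 1 + d, s]) \<in> tube (R + 1)"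
      using inbox[OF s(1)] unfolding \<phi>_def r_def by (intro exI[of _ s]) (auto simp: abs_le_iff)
  qed
qed

end

text \<open>The difference quotient of \<phi> is at most \<open>C * \<bar>s - t\<bar>\<close> times
  a quantity that stays bounded. Applied to the remainder in the constraint, this makes the second
  component differentiable at every interior point where the first one is.\<close>

lemma quadratic_increment_derivative:
  fixes \<phi> \<psi> :: "real \<Rightarrow> real"
  assumes t: "t \<in> {a<..<b}" and \<psi>: "(\<psi> has_real_derivative D) (at t)"
    and bnd: "\<And>s. s \<in> {a..b} \<Longrightarrow> \<bar>\<phi> s - \<phi> t\<bar> \<le> C * (\<bar>s - t\<bar> + \<bar>\<psi> s - \<psi> t\<bar>)\<^sup>2"
  shows "(\<phi> has_real_derivative 0) (at t)"
  unfolding has_field_derivative_iff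
proof (rule Lim_null_comparison)
  have "((\<lambda>s. (\<psi> s - \<psi> t) / (s - t)) \<longlongrightarrow> D) (at t)" using \<psi> by (simp add: has_field_derivative_iff)
  moreover have "((\<lambda>s. \<bar>s - t\<bar>) \<longlongrightarrow> \<bar>t - t\<bar>) (at t)" by (intro tendsto_intros)
  ultimately have "((\<lambda>s. C * (\<bar>s - t\<bar> * (1 + \<bar>(\<psi> s - \<psi> t) / (s - t)\<bar>)\<^sup>2)) \<longlongrightarrow> C * (\<bar>t - t\<bar> * (1 + \<bar>D\<bar>)\<^sup>2)) (at t)"
    by (intro tendsto_intros)
  then show "((\<lambda>s. C * (\<bar>s - t\<bar> * (1 + \<bar>(\<psi> s - \<psi> t) / (s - t)\<bar>)\<^sup>2)) \<longlongrightarrow> 0) (at t)" by simp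
  have "eventually (\<lambda>s. s \<in> {a<..<b}) (at t)" using t by (intro eventually_at_in_open') auto
  then show "\<forall>\<^sub>F s in at t. norm ((\<phi> s - \<phi> t) / (s - t)) \<le> C * (\<bar>s - t\<bar> * (1 + \<bar>(\<psi> s - \<psi> t) / (s - t)\<bar>)\<^sup>2)"
    using eventually_neq_at_within[of t t UNIV]
  proof eventually_elim
    case (elim s)
    define d where "d = \<bar>s - t\<bar>"
    have d: "0 < d" using elim unfolding d_def by simp
    have e: "d + \<bar>\<psi> s - \<psi> t\<bar> = d * (1 + \<bar>(\<psi> s - \<psi> t) / (s - t)\<bar>)"
      using d unfolding abs_divide d_def[symmetric] by (simp add: field_simps)
    have "\<bar>\<phi> s - \<phi> t\<bar> \<le> C * (d * (1 + \<bar>(\<psi> s - \<psi> t) / (s - t)\<bar>))\<^sup>2"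
      using bnd[of s] elim unfolding d_def[symmetric] e by simp
    then have "\<bar>\<phi> s - \<phi> t\<bar> / d \<le> (C * (d * (1 + \<bar>(\<psi> s - \<psi> t) / (s - t)\<bar>))\<^sup>2) / d"
      using d by (simp add: divide_right_mono)
    also have "\<dots> = C * (d * (1 + \<bar>(\<psi> s - \<psi> t) / (s - t)\<bar>)\<^sup>2)"
      using d by (simp add: power2_eq_square)
    finally show ?case by (simp add: abs_divide d_def)
  qed
qed

lemma integrable_bounded_mult:
  fixes f g :: "real \<Rightarrow> real"
  assumes "integrable lborel f" "g \<in> borel_measurable borel" "\<And>t. \<bar>g t\<bar> \<le> B"
  shows "integrable lborel (\<lambda>t. g t * f t)"
proof (rule Bochner_Integration.integrable_bound[where f = "\<lambda>t. B * f t"])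
  show "integrable lborel (\<lambda>t. B * f t)" using assms(1) by simp
  show "(\<lambda>t. g t * f t) \<in> borel_measurable lborel" using assms(1,2) by measurable
  have "\<bar>g t\<bar> * \<bar>f t\<bar> \<le> \<bar>B\<bar> * \<bar>f t\<bar>" for t
    using assms(3)[of t] by (intro mult_right_mono) auto
  then show "AE t in lborel. norm (g t * f t) \<le> norm (B * f t)" by (simp add: abs_mult)
qed

text \<open>Terms of order \<open>d\<close> and \<open>(d + X)^2\<close>, with \<open>X\<close> of
  order \<open>d powr \<alpha>\<close>, are absorbed into \<open>d powr \<kappa>\<close>; surplus
  powers of \<open>d\<close> are replaced by powers of its bound \<open>c\<close>.\<close>

lemma Hoelder_square:
  fixes d c H S C X \<alpha> \<kappa> :: real
  assumes "0 < \<alpha>" "\<alpha> < 1" "0 < d" "d \<le> c" "0 \<le> H" "0 \<le> S" "0 \<le> C" and \<kappa>: "\<kappa> = min 1 (2 * \<alpha>)"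
    and X: "0 \<le> X" "X \<le> H * d powr \<alpha>"
  shows "S * d + C * (d + X)\<^sup>2
    \<le> (S * c powr (1 - \<kappa>) + C * ((c powr (1 - \<alpha>) + H)\<^sup>2 * c powr (2 * \<alpha> - \<kappa>))) * d powr \<kappa>"
proof -
  have d1: "d \<le> c powr (1 - \<kappa>) * d powr \<kappa>"
  proof -
    have "d = d powr (1 - \<kappa>) * d powr \<kappa>" using assms(3) by (subst powr_add[symmetric]) simp
    also have "\<dots> \<le> c powr (1 - \<kappa>) * d powr \<kappa>"
      using assms by (intro mult_right_mono powr_mono2) auto
    finally show ?thesis .
  qed
  have "d + X \<le> (c powr (1 - \<alpha>) + H) * d powr \<alpha>"
  proof -
    have "d = d powr (1 - \<alpha>) * d powr \<alpha>" using assms(3) by (subst powr_add[symmetric]) simp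
    also have "\<dots> \<le> c powr (1 - \<alpha>) * d powr \<alpha>"
      using assms by (intro mult_right_mono powr_mono2) auto
    finally show ?thesis using X(2) by (simp add: distrib_right)
  qed
  then have "(d + X)\<^sup>2 \<le> ((c powr (1 - \<alpha>) + H) * d powr \<alpha>)\<^sup>2"
    using X assms by (intro power_mono) auto
  also have "\<dots> = (c powr (1 - \<alpha>) + H)\<^sup>2 * d powr (2 * \<alpha>)"
  proof -
    have "d powr \<alpha> * d powr \<alpha> = d powr (\<alpha> + \<alpha>)" by (rule powr_add[symmetric])
    then show ?thesis by (simp add: power_mult_distrib power2_eq_square)
  qed
  also have "d powr (2 * \<alpha>) = d powr (2 * \<alpha> - \<kappa>) * d powr \<kappa>" by (subst powr_add[symmetric]) simp
  also have "(c powr (1 - \<alpha>) + H)\<^sup>2 * (d powr (2 * \<alpha> - \<kappa>) * d powr \<kappa>)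
      \<le> (c powr (1 - \<alpha>) + H)\<^sup>2 * (c powr (2 * \<alpha> - \<kappa>) * d powr \<kappa>)"
    using assms by (intro mult_left_mono mult_right_mono powr_mono2) auto
  finally have d2: "(d + X)\<^sup>2 \<le> (c powr (1 - \<alpha>) + H)\<^sup>2 * (c powr (2 * \<alpha> - \<kappa>) * d powr \<kappa>)" .
  have "S * d + C * (d + X)\<^sup>2 \<le> S * (c powr (1 - \<kappa>) * d powr \<kappa>)
      + C * ((c powr (1 - \<alpha>) + H)\<^sup>2 * (c powr (2 * \<alpha> - \<kappa>) * d powr \<kappa>))"
    using assms d1 d2 by (intro add_mono mult_left_mono)
  then show ?thesis by (simp add: algebra_simps)
qed

context constraint
begin

text \<open>The chain rule along the constraint for the derivative of the second component, with
  \<open>q\<close> in the role of the derivative of the first.\<close>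

definition curve_density :: "(real \<Rightarrow> real^2) \<Rightarrow> (real \<Rightarrow> real) \<Rightarrow> real \<Rightarrow> real" where
  "curve_density u q t = zero_ext a b (\<lambda>t. slope0 (t, u t)) t + zero_ext a b (\<lambda>t. slope1 (t, u t)) t * q t"

lemma curve_slope_continuous:
  assumes "continuous_on {a..b} u"
  shows "continuous_on {a..b} (\<lambda>t. slope0 (t, u t))" "continuous_on {a..b} (\<lambda>t. slope1 (t, u t))"
  by (rule continuous_on_compose2[OF slope_continuous(1)] continuous_on_compose2[OF slope_continuous(2)];
    use assms in \<open>auto intro!: continuous_intros\<close>)+

lemma curve_regularity:
  assumes \<alpha>: "0 < \<alpha>" "\<alpha> < 1" and "0 \<le> H"
  obtains B where "0 \<le> B"
    "\<And>u q. (\<And>x. x \<in> {a..b} \<Longrightarrow> (x, u x) \<in> tube R \<and> G (x, u x) = 0) \<Longrightarrow>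
       has_density a b (\<lambda>x. u x $ 1) q \<Longrightarrow> abs_continuous_on a b (\<lambda>x. u x $ 1) \<Longrightarrow>
       (\<And>x. x \<in> {a..b} \<Longrightarrow> integrable lborel (\<lambda>t. frac_kernel (1 - \<alpha>) (x - t) * q t)) \<Longrightarrow>
       continuous_on {a..b} (conv_left (1 - \<alpha>) q) \<Longrightarrow>
       (\<And>t x. a \<le> t \<Longrightarrow> t \<le> x \<Longrightarrow> x \<le> b \<Longrightarrow> \<bar>u x $ 1 - u t $ 1\<bar> \<le> H * (x - t) powr \<alpha>) \<Longrightarrow>
       continuous_on {a..b} u \<and> has_density a b (\<lambda>x. u x $ 2) (curve_density u q) \<and>
       abs_continuous_on a b (\<lambda>x. u x $ 2) \<and>
       (\<forall>x\<in>{a..b}. integrable lborel (\<lambda>t. frac_kernel (1 - \<alpha>) (x - t) * curve_density u q t)) \<and>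
       continuous_on {a..b} (conv_left (1 - \<alpha>) (curve_density u q)) \<and>
       (\<forall>x\<in>{a..b}. \<bar>conv_left (1 - \<alpha>) (curve_density u q) x - slope1 (x, u x) * conv_left (1 - \<alpha>) q x\<bar> \<le> B)"
proof -
  obtain C where C: "0 \<le> C"
    "\<And>x Y t Y'. (x, Y) \<in> tube R \<Longrightarrow> (t, Y') \<in> tube R \<Longrightarrow> G (x, Y) = 0 \<Longrightarrow> G (t, Y') = 0 \<Longrightarrow>
       \<bar>Y' $ 2 - Y $ 2\<bar> \<le> C * (\<bar>t - x\<bar> + \<bar>Y' $ 1 - Y $ 1\<bar>)"
    "\<And>x Y t Y'. (x, Y) \<in> tube R \<Longrightarrow> (t, Y') \<in> tube R \<Longrightarrow> G (x, Y) = 0 \<Longrightarrow> G (t, Y') = 0 \<Longrightarrow>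
       \<bar>Y' $ 2 - Y $ 2 - slope1 (x, Y) * (Y' $ 1 - Y $ 1) - slope0 (x, Y) * (t - x)\<bar>
         \<le> C * (\<bar>t - x\<bar> + \<bar>Y' $ 1 - Y $ 1\<bar>)\<^sup>2"
    using constraint_estimates[of R] by blast
  obtain S where S: "0 \<le> S" "\<And>p. p \<in> tube R \<Longrightarrow> \<bar>slope0 p\<bar> \<le> S" "\<And>p. p \<in> tube R \<Longrightarrow> \<bar>slope1 p\<bar> \<le> S"
    by (rule slope_Lipschitz[of R]) (rule that)
  define \<kappa> where "\<kappa> = min 1 (2 * \<alpha>)"
  have \<kappa>: "\<alpha> < \<kappa>" unfolding \<kappa>_def using \<alpha> by auto
  \<comment> \<open>The constant of \<open>Hoelder_square\<close> for increments of length at most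
    \<open>b - a\<close>; \<open>B\<close> is then the bound of
    \<open>conv_left_frozen_coefficient\<close> with this constant.\<close>
  define A where "A = S * (b - a) powr (1 - \<kappa>)
      + C * (((b - a) powr (1 - \<alpha>) + H)\<^sup>2 * (b - a) powr (2 * \<alpha> - \<kappa>))"
  have A: "0 \<le> A" unfolding A_def using C S by simp
  define B where "B = A * (b - a) powr (\<kappa> - \<alpha>) * (1 + \<alpha> / (\<kappa> - \<alpha>))"
  show thesis
  proof (rule that[of B])
    show "0 \<le> B" unfolding B_def using A \<alpha> \<kappa> by simp
    fix u :: "real \<Rightarrow> real^2" and q
    assume u: "\<And>x. x \<in> {a..b} \<Longrightarrow> (x, u x) \<in> tube R \<and> G (x, u x) = 0"
      and q: "has_density a b (\<lambda>x. u x $ 1) q" and ac1: "abs_continuous_on a b (\<lambda>x. u x $ 1)"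
      and qi: "\<And>x. x \<in> {a..b} \<Longrightarrow> integrable lborel (\<lambda>t. frac_kernel (1 - \<alpha>) (x - t) * q t)"
      and qc: "continuous_on {a..b} (conv_left (1 - \<alpha>) q)"
      and hoel: "\<And>t x. a \<le> t \<Longrightarrow> t \<le> x \<Longrightarrow> x \<le> b \<Longrightarrow> \<bar>u x $ 1 - u t $ 1\<bar> \<le> H * (x - t) powr \<alpha>"
    have ac2: "abs_continuous_on a b (\<lambda>x. u x $ 2)"
    proof (rule abs_continuous_on_dominated[OF ac1 C(1)])
      fix s t assume st: "s \<in> {a..b}" "t \<in> {a..b}" "s \<le> t"
      show "\<bar>u t $ 2 - u s $ 2\<bar> \<le> C * (\<bar>u t $ 1 - u s $ 1\<bar> + (t - s))"
        using C(2)[of s "u s" t "u t"] u[OF st(1)] u[OF st(2)] st by (simp add: add.commute)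
    qed
    have uc: "continuous_on {a..b} u"
    proof -
      have "continuous_on {a..b} (\<lambda>x. u x $ i)" for i
        using abs_continuous_on_imp_continuous[OF ac1] abs_continuous_on_imp_continuous[OF ac2]
        exhaust_2[of i] by auto
      then have "continuous_on {a..b} (\<lambda>x. \<chi> i. u x $ i)" by (intro continuous_on_vec_lambda)
      then show ?thesis by simp
    qed
    let ?f0 = "zero_ext a b (\<lambda>t. slope0 (t, u t))" and ?f1 = "zero_ext a b (\<lambda>t. slope1 (t, u t))"
    note sc = curve_slope_continuous[OF uc]
    have f1: "?f1 \<in> borel_measurable borel" "\<And>t. \<bar>?f1 t\<bar> \<le> S"
      using zero_ext_measurable[OF sc(2)] S(1) S(3) u by (auto simp: zero_ext_def)
    have qL: "q \<in> borel_measurable borel" "integrable lborel q" "\<And>x. x \<notin> {a..b} \<Longrightarrow> q x = 0"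
      using q unfolding has_density_def by auto
    have dens: "has_density a b (\<lambda>x. u x $ 2) (curve_density u q)"
      unfolding has_density_def
    proof (intro conjI)
      show "curve_density u q \<in> borel_measurable borel"
        unfolding curve_density_def[abs_def]
        by (intro borel_measurable_add borel_measurable_times zero_ext_measurable sc qL)
      show "integrable lborel (curve_density u q)"
        unfolding curve_density_def[abs_def]
        by (intro Bochner_Integration.integrable_add zero_ext_integrable sc integrable_bounded_mult[OF qL(2) f1])
      show "\<forall>x. x \<notin> {a..b} \<longrightarrow> curve_density u q x = 0" by (simp add: curve_density_def zero_ext_def)
      have "{x \<in> {a..b}. \<not> ((\<lambda>x. u x $ 2) has_real_derivative curve_density u q x) (at x)}
         \<subseteq> {a, b} \<union> {x \<in> {a..b}. \<not> ((\<lambda>x. u x $ 1) has_real_derivative q x) (at x)}" (is "?A \<subseteq> ?B")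
      proof (rule subsetI, rule ccontr)
        fix t assume t: "t \<in> ?A" "t \<notin> ?B"
        then have tab: "t \<in> {a<..<b}" and d1: "((\<lambda>x. u x $ 1) has_real_derivative q t) (at t)" by auto
        let ?s0 = "slope0 (t, u t)" and ?s1 = "slope1 (t, u t)"
        \<comment> \<open>With the coefficients frozen at \<open>t\<close> the increments from
          \<open>t\<close> are quadratic, so the derivative there is 0.\<close>
        let ?\<phi> = "\<lambda>s. u s $ 2 - ?s1 * u s $ 1 - ?s0 * s"
        have "(?\<phi> has_real_derivative 0) (at t)"
        proof (rule quadratic_increment_derivative[OF tab d1])
          fix s assume s: "s \<in> {a..b}"
          have "?\<phi> s - ?\<phi> t = u s $ 2 - u t $ 2 - ?s1 * (u s $ 1 - u t $ 1) - ?s0 * (s - t)"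
            by (simp add: algebra_simps)
          then show "\<bar>?\<phi> s - ?\<phi> t\<bar> \<le> C * (\<bar>s - t\<bar> + \<bar>u s $ 1 - u t $ 1\<bar>)\<^sup>2"
            using C(3)[of t "u t" s "u s"] u[OF s] u[of t] tab by simp
        qed
        then have "((\<lambda>s. ?\<phi> s + (?s1 * u s $ 1 + ?s0 * s)) has_real_derivative 0 + (?s1 * q t + ?s0 * 1)) (at t)"
          by (intro DERIV_add DERIV_cmult d1 DERIV_ident)
        moreover have "0 + (?s1 * q t + ?s0 * 1) = curve_density u q t"
          using tab by (simp add: curve_density_def zero_ext_def)
        ultimately have "((\<lambda>s. u s $ 2) has_real_derivative curve_density u q t) (at t)" by simp
        then show False using t by simp
      qed
      moreover have "negligible ?B"
        using q unfolding has_density_def by (intro negligible_Un) auto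
      ultimately show "negligible ?A" by (rule negligible_subset[rotated])
    qed
    have ri: "integrable lborel (\<lambda>t. frac_kernel (1 - \<alpha>) (x - t) * curve_density u q t)" if x: "x \<in> {a..b}" for x
    proof -
      have "0 < 1 - \<alpha>" using \<alpha> by simp
      then have "integrable lborel (\<lambda>t. frac_kernel (1 - \<alpha>) (x - t) * ?f0 t)"
        using conv_left_continuous(2)[OF _ zero_ext_continuous[OF sc(1)] zero_ext_simps(2) x] by blast
      moreover have "integrable lborel (\<lambda>t. ?f1 t * (frac_kernel (1 - \<alpha>) (x - t) * q t))"
        by (rule integrable_bounded_mult[OF qi[OF x] f1])
      ultimately have "integrable lborel (\<lambda>t. frac_kernel (1 - \<alpha>) (x - t) * ?f0 t
          + ?f1 t * (frac_kernel (1 - \<alpha>) (x - t) * q t))" by (rule Bochner_Integration.integrable_add)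
      then show ?thesis unfolding curve_density_def by (simp add: algebra_simps)
    qed
    have bnd: "\<bar>u x $ 2 - u t $ 2 - slope1 (x, u x) * (u x $ 1 - u t $ 1)\<bar> \<le> A * (x - t) powr \<kappa>"
      if tx: "a \<le> t" "t < x" "x \<le> b" for t x
    proof -
      let ?X = "\<bar>u t $ 1 - u x $ 1\<bar>"
      have m: "(x, u x) \<in> tube R" "(t, u t) \<in> tube R" "G (x, u x) = 0" "G (t, u t) = 0" using u tx by auto
      have "\<bar>u t $ 2 - u x $ 2 - slope1 (x, u x) * (u t $ 1 - u x $ 1) - slope0 (x, u x) * (t - x)\<bar>
          \<le> C * ((x - t) + ?X)\<^sup>2" using C(3)[OF m] tx by simp
      moreover have "\<bar>slope0 (x, u x) * (t - x)\<bar> \<le> S * (x - t)"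
        unfolding abs_mult using S(2)[OF m(1)] tx by (intro mult_mono) auto
      moreover have "u x $ 2 - u t $ 2 - slope1 (x, u x) * (u x $ 1 - u t $ 1)
          = - (u t $ 2 - u x $ 2 - slope1 (x, u x) * (u t $ 1 - u x $ 1) - slope0 (x, u x) * (t - x))
            - slope0 (x, u x) * (t - x)" by (simp add: algebra_simps)
      ultimately have "\<bar>u x $ 2 - u t $ 2 - slope1 (x, u x) * (u x $ 1 - u t $ 1)\<bar>
          \<le> S * (x - t) + C * ((x - t) + ?X)\<^sup>2" by linarith
      also have "\<dots> \<le> A * (x - t) powr \<kappa>"
        unfolding A_def using hoel[of t x] tx C(1) S(1) \<alpha> \<open>0 \<le> H\<close>
        by (intro Hoelder_square \<kappa>_def) (auto simp: abs_minus_commute)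
      finally show ?thesis .
    qed
    note fr = conv_left_frozen_coefficient[OF \<alpha> \<kappa> ab q ac1 dens ac2 qi ri sc(2) qc bnd]
    show "continuous_on {a..b} u \<and> has_density a b (\<lambda>x. u x $ 2) (curve_density u q) \<and>
       abs_continuous_on a b (\<lambda>x. u x $ 2) \<and>
       (\<forall>x\<in>{a..b}. integrable lborel (\<lambda>t. frac_kernel (1 - \<alpha>) (x - t) * curve_density u q t)) \<and>
       continuous_on {a..b} (conv_left (1 - \<alpha>) (curve_density u q)) \<and>
       (\<forall>x\<in>{a..b}. \<bar>conv_left (1 - \<alpha>) (curve_density u q) x - slope1 (x, u x) * conv_left (1 - \<alpha>) q x\<bar> \<le> B)"
      using uc dens ac2 ri fr unfolding B_def by (intro conjI ballI) auto
  qed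
qed

end

section \<open>Variations along the constraint\<close>

lemma has_density_add:
  assumes "has_density a b f p" "has_density a b g q"
  shows "has_density a b (\<lambda>x. f x + c * g x) (\<lambda>t. p t + c * q t)"
  unfolding has_density_def
proof (intro conjI)
  have "{x \<in> {a..b}. \<not> ((\<lambda>x. f x + c * g x) has_real_derivative p x + c * q x) (at x)}
      \<subseteq> {x \<in> {a..b}. \<not> (f has_real_derivative p x) (at x)} \<union> {x \<in> {a..b}. \<not> (g has_real_derivative q x) (at x)}"
    by (auto intro: DERIV_add DERIV_cmult)
  then show "negligible {x \<in> {a..b}. \<not> ((\<lambda>x. f x + c * g x) has_real_derivative p x + c * q x) (at x)}"
    using assms unfolding has_density_def by (meson negligible_Un negligible_subset)
qed (use assms in \<open>auto simp: has_density_def\<close>)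

lemma has_density_primitive:
  assumes "a < b" and \<kappa>: "continuous_on {a..b} \<kappa>" and V: "\<And>t. \<bar>zero_ext a b \<kappa> t\<bar> \<le> V"
  defines "\<eta> \<equiv> \<lambda>x. LINT t:{a..x}|lborel. zero_ext a b \<kappa> t"
  shows "has_density a b \<eta> (zero_ext a b \<kappa>)"
    and "\<And>s t. s \<in> {a..b} \<Longrightarrow> t \<in> {a..b} \<Longrightarrow> \<bar>\<eta> t - \<eta> s\<bar> \<le> V * \<bar>t - s\<bar>"
proof -
  have eq: "\<eta> x = integral {a..x} \<kappa>" if "x \<in> {a..b}" for x
  proof -
    have c: "continuous_on {a..x} \<kappa>" using \<kappa> that by (auto intro: continuous_on_subset)
    have "\<eta> x = (LINT t:{a..x}|lborel. \<kappa> t)"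
      unfolding \<eta>_def set_lebesgue_integral_def
      by (intro Bochner_Integration.integral_cong) (use that in \<open>auto simp: zero_ext_def indicator_def\<close>)
    also have "\<dots> = integral {a..x} \<kappa>"
      using borel_integrable_atLeastAtMost'[OF c] by (rule set_borel_integral_eq_integral(2))
    finally show ?thesis .
  qed
  have der: "(\<eta> has_real_derivative \<kappa> x) (at x within {a..b})" if x: "x \<in> {a..b}" for x
  proof -
    have "((\<lambda>u. integral {a..u} \<kappa>) has_real_derivative \<kappa> x) (at x within {a..b})"
      using integral_has_real_derivative[OF \<kappa> x] .
    then show ?thesis by (rule has_field_derivative_transform_within[OF _ zero_less_one x]) (simp add: eq)
  qed
  show "\<bar>\<eta> t - \<eta> s\<bar> \<le> V * \<bar>t - s\<bar>" if "s \<in> {a..b}" "t \<in> {a..b}" for s t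
  proof -
    have "norm (\<eta> t - \<eta> s) \<le> V * norm (t - s)"
    proof (rule field_differentiable_bound[OF _ der])
      show "norm (\<kappa> z) \<le> V" if "z \<in> {a..b}" for z using V[of z] that by (simp add: zero_ext_def)
    qed (use that in auto)
    then show ?thesis by simp
  qed
  have "{x \<in> {a..b}. \<not> (\<eta> has_real_derivative zero_ext a b \<kappa> x) (at x)} \<subseteq> {a, b}"
  proof
    fix x assume x: "x \<in> {x \<in> {a..b}. \<not> (\<eta> has_real_derivative zero_ext a b \<kappa> x) (at x)}"
    have "at x within {a..b} = at x" if "x \<in> {a<..<b}"
      using that by (intro at_within_interior) (auto simp: interior_atLeastAtMost_real)
    then show "x \<in> {a, b}" using x der[of x] by (force simp: zero_ext_def)
  qed
  then have "negligible {x \<in> {a..b}. \<not> (\<eta> has_real_derivative zero_ext a b \<kappa> x) (at x)}"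
    by (rule negligible_subset[rotated]) auto
  then show "has_density a b \<eta> (zero_ext a b \<kappa>)"
    unfolding has_density_def
    using zero_ext_measurable[OF \<kappa>] zero_ext_integrable[OF \<kappa>] by (simp add: zero_ext_def)
qed

text \<open>Increments and Caputo derivatives are both linear in the densities. The majorant
  \<open>\<bar>\<epsilon>\<bar> * P\<close>, integrable also against the kernel, lets the difference
  quotients in \<epsilon> converge under the integral.\<close>

lemma density_family_limit:
  fixes f p :: "real \<Rightarrow> real \<Rightarrow> real" and q :: "real \<Rightarrow> real"
  assumes "0 < \<alpha>" "\<alpha> < 1" "a < b" "0 < \<epsilon>0"
    and dens: "\<And>\<epsilon>. \<bar>\<epsilon>\<bar> \<le> \<epsilon>0 \<Longrightarrow> has_density a b (f \<epsilon>) (p \<epsilon>)" "\<And>\<epsilon>. \<bar>\<epsilon>\<bar> \<le> \<epsilon>0 \<Longrightarrow> abs_continuous_on a b (f \<epsilon>)"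
    and fi: "\<And>\<epsilon> x. \<bar>\<epsilon>\<bar> \<le> \<epsilon>0 \<Longrightarrow> x \<in> {a..b} \<Longrightarrow> integrable lborel (\<lambda>t. frac_kernel (1 - \<alpha>) (x - t) * p \<epsilon> t)"
    and start: "\<And>\<epsilon>. \<bar>\<epsilon>\<bar> \<le> \<epsilon>0 \<Longrightarrow> f \<epsilon> a = f 0 a"
    and P: "integrable lborel P" "\<And>x. x \<in> {a..b} \<Longrightarrow> integrable lborel (\<lambda>t. frac_kernel (1 - \<alpha>) (x - t) * P t)"
    and dom: "\<And>\<epsilon> t. \<bar>\<epsilon>\<bar> \<le> \<epsilon>0 \<Longrightarrow> \<bar>p \<epsilon> t - p 0 t\<bar> \<le> \<bar>\<epsilon>\<bar> * P t"
    and lim: "\<And>e t. e \<longlonglongrightarrow> 0 \<Longrightarrow> (\<And>n. e n \<noteq> 0) \<Longrightarrow> (\<And>n. \<bar>e n\<bar> \<le> \<epsilon>0) \<Longrightarrow> t \<in> {a..b} \<Longrightarrow>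
      (\<lambda>n. (p (e n) t - p 0 t) / e n) \<longlonglongrightarrow> q t"
    and q0: "\<And>t. t \<notin> {a..b} \<Longrightarrow> q t = 0"
  shows "integrable lborel q"
    and "\<And>\<epsilon> x. \<bar>\<epsilon>\<bar> \<le> \<epsilon>0 \<Longrightarrow> x \<in> {a..b} \<Longrightarrow>
      \<bar>caputo_left \<alpha> a (f \<epsilon>) x - caputo_left \<alpha> a (f 0) x\<bar> \<le> \<bar>\<epsilon>\<bar> * (conv_left (1 - \<alpha>) P x / Gamma (1 - \<alpha>))"
    and "\<And>e x. e \<longlonglongrightarrow> 0 \<Longrightarrow> (\<And>n. e n \<noteq> 0) \<Longrightarrow> (\<And>n. \<bar>e n\<bar> \<le> \<epsilon>0) \<Longrightarrow> x \<in> {a..b} \<Longrightarrow>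
      (\<lambda>n. (f (e n) x - f 0 x) / e n) \<longlonglongrightarrow> (LINT t:{a..x}|lborel. q t)"
    and "\<And>e x. e \<longlonglongrightarrow> 0 \<Longrightarrow> (\<And>n. e n \<noteq> 0) \<Longrightarrow> (\<And>n. \<bar>e n\<bar> \<le> \<epsilon>0) \<Longrightarrow> x \<in> {a..b} \<Longrightarrow>
      (\<lambda>n. (caputo_left \<alpha> a (f (e n)) x - caputo_left \<alpha> a (f 0) x) / e n) \<longlonglongrightarrow> conv_left (1 - \<alpha>) q x / Gamma (1 - \<alpha>)"
proof -
  have G: "0 < Gamma (1 - \<alpha>)" using assms by (intro Gamma_real_pos) simp
  have z: "\<bar>0::real\<bar> \<le> \<epsilon>0" using \<open>0 < \<epsilon>0\<close> by simp
  have pL: "integrable lborel (p \<epsilon>)" "p \<epsilon> \<in> borel_measurable borel" "t \<notin> {a..b} \<Longrightarrow> p \<epsilon> t = 0"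
    if "\<bar>\<epsilon>\<bar> \<le> \<epsilon>0" for \<epsilon> t
    using dens(1)[OF that] unfolding has_density_def by auto
  have P0: "0 \<le> P t" for t
  proof -
    have "0 \<le> \<bar>\<epsilon>0\<bar> * P t" using dom[of \<epsilon>0 t] \<open>0 < \<epsilon>0\<close> by (auto intro: order_trans[OF abs_ge_zero])
    then show ?thesis using \<open>0 < \<epsilon>0\<close> by (simp add: zero_le_mult_iff)
  qed
  have Pm[measurable]: "P \<in> borel_measurable borel" using P(1) by auto
  define D where "D \<epsilon> t = (p \<epsilon> t - p 0 t) / \<epsilon>" for \<epsilon> t
  have Dm: "D \<epsilon> \<in> borel_measurable borel" if "\<bar>\<epsilon>\<bar> \<le> \<epsilon>0" for \<epsilon>
    unfolding D_def[abs_def] using pL(2)[OF that] pL(2)[OF z] by measurable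
  have Db: "\<bar>D \<epsilon> t\<bar> \<le> P t" if "\<bar>\<epsilon>\<bar> \<le> \<epsilon>0" for \<epsilon> t
  proof (cases "\<epsilon> = 0")
    case True
    then show ?thesis using P0 by (simp add: D_def)
  next
    case False
    then show ?thesis using dom[OF that, of t] unfolding D_def by (simp add: abs_divide field_simps)
  qed
  have Dlim: "(\<lambda>n. D (e n) t) \<longlonglongrightarrow> q t"
    if "e \<longlonglongrightarrow> 0" "\<And>n. e n \<noteq> 0" "\<And>n. \<bar>e n\<bar> \<le> \<epsilon>0" for e t
  proof (cases "t \<in> {a..b}")
    case True
    then show ?thesis using lim[OF that] unfolding D_def by simp
  next
    case False
    then show ?thesis using pL(3)[OF that(3) False] pL(3)[OF z False] q0 by (simp add: D_def)
  qed
  \<comment> \<open>One admissible sequence suffices to transfer measurability and the bound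
    \<open>P\<close> from the quotients to \<open>q\<close>.\<close>
  define e0 where "e0 n = \<epsilon>0 / real (Suc n)" for n
  have e0: "e0 \<longlonglongrightarrow> 0" "e0 n \<noteq> 0" "\<bar>e0 n\<bar> \<le> \<epsilon>0" for n
  proof -
    show "e0 \<longlonglongrightarrow> 0" unfolding e0_def by (rule LIMSEQ_Suc[OF lim_const_over_n])
    show "e0 n \<noteq> 0" "\<bar>e0 n\<bar> \<le> \<epsilon>0" using \<open>0 < \<epsilon>0\<close> unfolding e0_def by (auto simp: field_simps)
  qed
  have qm[measurable]: "q \<in> borel_measurable borel"
  proof (rule borel_measurable_LIMSEQ_real[where u = "\<lambda>n. D (e0 n)"])
    show "(\<lambda>n. D (e0 n) t) \<longlonglongrightarrow> q t" for t by (rule Dlim) (rule e0)+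
    show "D (e0 n) \<in> borel_measurable borel" for n by (rule Dm[OF e0(3)])
  qed
  have qb: "\<bar>q t\<bar> \<le> P t" for t
  proof (rule LIMSEQ_le_const2)
    show "(\<lambda>n. \<bar>D (e0 n) t\<bar>) \<longlonglongrightarrow> \<bar>q t\<bar>" by (intro tendsto_rabs Dlim e0)
    show "\<exists>N. \<forall>n\<ge>N. \<bar>D (e0 n) t\<bar> \<le> P t" using Db[OF e0(3)] by blast
  qed
  show qi: "integrable lborel q"
    using P(1) qb by (intro Bochner_Integration.integrable_bound[where f = P and g = q]) (auto intro!: AE_I2 order_trans[OF qb abs_ge_self])
  have cd: "caputo_left \<alpha> a (f \<epsilon>) x - caputo_left \<alpha> a (f 0) x
      = (LINT t|lborel. frac_kernel (1 - \<alpha>) (x - t) * (p \<epsilon> t - p 0 t)) / Gamma (1 - \<alpha>)"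
    if "\<bar>\<epsilon>\<bar> \<le> \<epsilon>0" "x \<in> {a..b}" for \<epsilon> x
    unfolding has_density_caputo(2)[OF dens(1)[OF that(1)] that(2)] has_density_caputo(2)[OF dens(1)[OF z] that(2)] conv_left_def
    using fi[OF that] fi[OF z that(2)] by (simp add: right_diff_distrib diff_divide_distrib)
  show "\<bar>caputo_left \<alpha> a (f \<epsilon>) x - caputo_left \<alpha> a (f 0) x\<bar> \<le> \<bar>\<epsilon>\<bar> * (conv_left (1 - \<alpha>) P x / Gamma (1 - \<alpha>))"
    if \<epsilon>: "\<bar>\<epsilon>\<bar> \<le> \<epsilon>0" and x: "x \<in> {a..b}" for \<epsilon> x
  proof -
    have i: "integrable lborel (\<lambda>t. frac_kernel (1 - \<alpha>) (x - t) * (p \<epsilon> t - p 0 t))"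
      using fi[OF \<epsilon> x] fi[OF z x] by (simp add: right_diff_distrib)
    have "norm (LINT t|lborel. frac_kernel (1 - \<alpha>) (x - t) * (p \<epsilon> t - p 0 t))
        \<le> (LINT t|lborel. norm (frac_kernel (1 - \<alpha>) (x - t) * (p \<epsilon> t - p 0 t)))" by (rule integral_norm_bound)
    also have "\<dots> \<le> (LINT t|lborel. \<bar>\<epsilon>\<bar> * (frac_kernel (1 - \<alpha>) (x - t) * P t))"
    proof (rule integral_mono)
      fix t
      have "frac_kernel (1 - \<alpha>) (x - t) * \<bar>p \<epsilon> t - p 0 t\<bar> \<le> frac_kernel (1 - \<alpha>) (x - t) * (\<bar>\<epsilon>\<bar> * P t)"
        using dom[OF \<epsilon>] by (intro mult_left_mono) auto
      then show "norm (frac_kernel (1 - \<alpha>) (x - t) * (p \<epsilon> t - p 0 t)) \<le> \<bar>\<epsilon>\<bar> * (frac_kernel (1 - \<alpha>) (x - t) * P t)"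
        by (simp add: abs_mult mult_ac)
    qed (use i P(2)[OF x] in auto)
    also have "\<dots> = \<bar>\<epsilon>\<bar> * conv_left (1 - \<alpha>) P x" unfolding conv_left_def by simp
    finally show ?thesis unfolding cd[OF \<epsilon> x] using G by (simp add: abs_divide divide_right_mono)
  qed
  fix e :: "nat \<Rightarrow> real" and x assume e: "e \<longlonglongrightarrow> 0" "\<And>n. e n \<noteq> 0" "\<And>n. \<bar>e n\<bar> \<le> \<epsilon>0" and x: "x \<in> {a..b}"
  have "(f (e n) x - f 0 x) / e n = (LINT t:{a..x}|lborel. D (e n) t)" for n
  proof -
    have "f (e n) x - f (e n) a = (LINT t:{a..x}|lborel. p (e n) t)" "f 0 x - f 0 a = (LINT t:{a..x}|lborel. p 0 t)"
      using has_density_integral[OF dens(1)[OF e(3)] dens(2)[OF e(3)]] has_density_integral[OF dens(1)[OF z] dens(2)[OF z]] x by auto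
    moreover have "(LINT t:{a..x}|lborel. D (e n) t) = ((LINT t:{a..x}|lborel. p (e n) t) - (LINT t:{a..x}|lborel. p 0 t)) / e n"
    proof -
      have i: "integrable lborel (\<lambda>t. indicator {a..x} t *\<^sub>R p (e n) t)" "integrable lborel (\<lambda>t. indicator {a..x} t *\<^sub>R p 0 t)"
        by (rule integrable_mult_indicator[OF _ pL(1)[OF e(3)]], simp, rule integrable_mult_indicator[OF _ pL(1)[OF z]], simp)
      then show ?thesis unfolding set_lebesgue_integral_def D_def
        by (simp add: right_diff_distrib diff_divide_distrib)
    qed
    ultimately show ?thesis using start[OF e(3), of n] by simp
  qed
  moreover have "(\<lambda>n. LINT t:{a..x}|lborel. D (e n) t) \<longlonglongrightarrow> (LINT t:{a..x}|lborel. q t)"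
    unfolding set_lebesgue_integral_def
  proof (rule integral_dominated_convergence[where w = P])
    show "AE t in lborel. (\<lambda>n. indicator {a..x} t *\<^sub>R D (e n) t) \<longlonglongrightarrow> indicator {a..x} t *\<^sub>R q t"
      using Dlim[OF e] by (intro AE_I2 tendsto_intros)
    show "AE t in lborel. norm (indicator {a..x} t *\<^sub>R D (e n) t) \<le> P t" for n
      using Db[OF e(3)] P0 by (intro AE_I2) (auto simp: indicator_def)
  qed (use Dm[OF e(3)] P(1) in auto)
  ultimately show "(\<lambda>n. (f (e n) x - f 0 x) / e n) \<longlonglongrightarrow> (LINT t:{a..x}|lborel. q t)" by simp
  have "(caputo_left \<alpha> a (f (e n)) x - caputo_left \<alpha> a (f 0) x) / e n
      = (LINT t|lborel. frac_kernel (1 - \<alpha>) (x - t) * D (e n) t) / Gamma (1 - \<alpha>)" for n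
    unfolding cd[OF e(3) x] D_def using fi[OF e(3) x] fi[OF z x] by (simp add: mult.commute)
  moreover have "(\<lambda>n. LINT t|lborel. frac_kernel (1 - \<alpha>) (x - t) * D (e n) t) \<longlonglongrightarrow> conv_left (1 - \<alpha>) q x"
    unfolding conv_left_def
  proof (rule integral_dominated_convergence[where w = "\<lambda>t. frac_kernel (1 - \<alpha>) (x - t) * P t"])
    show "AE t in lborel. (\<lambda>n. frac_kernel (1 - \<alpha>) (x - t) * D (e n) t) \<longlonglongrightarrow> frac_kernel (1 - \<alpha>) (x - t) * q t"
      using Dlim[OF e] by (intro AE_I2 tendsto_intros)
    show "AE t in lborel. norm (frac_kernel (1 - \<alpha>) (x - t) * D (e n) t) \<le> frac_kernel (1 - \<alpha>) (x - t) * P t" for n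
      using Db[OF e(3)] by (intro AE_I2) (simp add: abs_mult mult_left_mono)
  qed (use Dm[OF e(3)] P(2)[OF x] in auto)
  ultimately show "(\<lambda>n. (caputo_left \<alpha> a (f (e n)) x - caputo_left \<alpha> a (f 0) x) / e n) \<longlonglongrightarrow> conv_left (1 - \<alpha>) q x / Gamma (1 - \<alpha>)"
    using G by (simp add: tendsto_divide)
qed

context constraint
begin

text \<open>The first component of \<open>u \<epsilon>\<close> is \<open>y\<^sub>1 + \<epsilon> \<eta>\<close> with \<open>\<eta>' = \<kappa>\<close>, and the second one solves the constraint;
  it returns to \<open>y\<^sub>2\<close> at \<open>b\<close> because \<open>\<kappa>\<close> has mean 0. The \<open>q i\<close> are the derivatives of the components of
  \<open>du/d\<epsilon>\<close> at \<open>\<epsilon> = 0\<close>.\<close>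

lemma constrained_variation:
  assumes \<alpha>: "0 < \<alpha>" "\<alpha> < 1" "0 < \<beta>"
    and y_traj: "\<And>i. (\<lambda>x. y x $ i) \<in> traj_class \<alpha> \<beta> a b"
    and y_G: "\<And>x. x \<in> {a..b} \<Longrightarrow> G (x, y x) = 0"
    and \<kappa>: "continuous_on {a..b} \<kappa>" and mean: "(LINT t:{a..b}|lborel. zero_ext a b \<kappa> t) = 0"
  obtains \<epsilon>0 B :: real and u :: "real \<Rightarrow> real \<Rightarrow> real^2" and q :: "2 \<Rightarrow> real \<Rightarrow> real" and W :: "real \<Rightarrow> real"
  where "0 < \<epsilon>0" "u 0 = y"
    "\<And>\<epsilon> i. \<bar>\<epsilon>\<bar> \<le> \<epsilon>0 \<Longrightarrow> (\<lambda>x. u \<epsilon> x $ i) \<in> traj_class \<alpha> \<beta> a b"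
    "\<And>\<epsilon>. \<bar>\<epsilon>\<bar> \<le> \<epsilon>0 \<Longrightarrow> u \<epsilon> a = y a \<and> u \<epsilon> b = y b"
    "\<And>\<epsilon> x. \<bar>\<epsilon>\<bar> \<le> \<epsilon>0 \<Longrightarrow> x \<in> {a..b} \<Longrightarrow> G (x, u \<epsilon> x) = 0"
    "\<And>i. integrable lborel (q i)" "\<And>i t. t \<notin> {a..b} \<Longrightarrow> q i t = 0" "q 1 = zero_ext a b \<kappa>"
    "\<And>x. x \<in> {a..b} \<Longrightarrow> (LINT t:{a..x}|lborel. q 2 t) = slope1 (x, y x) * (LINT t:{a..x}|lborel. q 1 t)"
    "\<And>\<epsilon> x i. \<bar>\<epsilon>\<bar> \<le> \<epsilon>0 \<Longrightarrow> x \<in> {a..b} \<Longrightarrow> \<bar>u \<epsilon> x $ i\<bar> \<le> B"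
    "\<And>\<epsilon> x i. \<bar>\<epsilon>\<bar> \<le> \<epsilon>0 \<Longrightarrow> x \<in> {a..b} \<Longrightarrow> \<bar>caputo_left \<alpha> a (\<lambda>t. u \<epsilon> t $ i) x\<bar> \<le> B"
    "\<And>\<epsilon> x i. \<bar>\<epsilon>\<bar> \<le> \<epsilon>0 \<Longrightarrow> x \<in> {a..b} \<Longrightarrow> \<bar>u \<epsilon> x $ i - y x $ i\<bar> \<le> \<bar>\<epsilon>\<bar> * B"
    "\<And>\<epsilon> x i. \<bar>\<epsilon>\<bar> \<le> \<epsilon>0 \<Longrightarrow> x \<in> {a..b} \<Longrightarrow>
       \<bar>caputo_left \<alpha> a (\<lambda>t. u \<epsilon> t $ i) x - caputo_left \<alpha> a (\<lambda>t. y t $ i) x\<bar> \<le> \<bar>\<epsilon>\<bar> * W x"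
    "integrable lborel W" "\<And>x. x \<notin> {a..b} \<Longrightarrow> W x = 0"
    "\<And>e x i. e \<longlonglongrightarrow> 0 \<Longrightarrow> (\<And>n. e n \<noteq> 0) \<Longrightarrow> (\<And>n. \<bar>e n\<bar> \<le> \<epsilon>0) \<Longrightarrow> x \<in> {a..b} \<Longrightarrow>
       (\<lambda>n. (u (e n) x $ i - y x $ i) / e n) \<longlonglongrightarrow> (LINT t:{a..x}|lborel. q i t)"
    "\<And>e x i. e \<longlonglongrightarrow> 0 \<Longrightarrow> (\<And>n. e n \<noteq> 0) \<Longrightarrow> (\<And>n. \<bar>e n\<bar> \<le> \<epsilon>0) \<Longrightarrow> x \<in> {a..b} \<Longrightarrow>
       (\<lambda>n. (caputo_left \<alpha> a (\<lambda>t. u (e n) t $ i) x - caputo_left \<alpha> a (\<lambda>t. y t $ i) x) / e n)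
         \<longlonglongrightarrow> conv_left (1 - \<alpha>) (q i) x / Gamma (1 - \<alpha>)"
proof -
  have \<alpha>': "0 < 1 - \<alpha>" using \<alpha> by simp
  have Gam: "0 < Gamma (1 - \<alpha>)" using \<alpha>' by (rule Gamma_real_pos)
  define \<kappa>0 where "\<kappa>0 = zero_ext a b \<kappa>"
  obtain V where V: "0 \<le> V" "\<And>t. \<bar>zero_ext a b \<kappa> t\<bar> \<le> V" by (rule zero_ext_bounded[OF \<kappa>]) (rule that)
  define \<eta> where "\<eta> x = (LINT t:{a..x}|lborel. zero_ext a b \<kappa> t)" for x
  have \<eta>d: "has_density a b \<eta> \<kappa>0"
    unfolding \<eta>_def[abs_def] \<kappa>0_def by (rule has_density_primitive(1)[OF ab \<kappa> V(2)])
  have \<eta>L: "\<bar>\<eta> t - \<eta> s\<bar> \<le> V * \<bar>t - s\<bar>" if "s \<in> {a..b}" "t \<in> {a..b}" for s t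
    unfolding \<eta>_def by (rule has_density_primitive(2)[OF ab \<kappa> V(2) that])
  have \<eta>a: "\<eta> a = 0"
  proof -
    have "AE t in lborel. indicator {a..a} t *\<^sub>R zero_ext a b \<kappa> t = 0"
      using AE_lborel_singleton[of a] by eventually_elim (auto simp: indicator_def)
    then show ?thesis unfolding \<eta>_def set_lebesgue_integral_def by (rule integral_eq_zero_AE)
  qed
  have \<eta>b: "\<eta> b = 0" unfolding \<eta>_def by (rule mean)
  define E where "E = V * (b - a)"
  have E: "0 \<le> E" "\<And>x. x \<in> {a..b} \<Longrightarrow> \<bar>\<eta> x\<bar> \<le> E"
  proof -
    show "0 \<le> E" unfolding E_def using V ab by simp
    fix x assume x: "x \<in> {a..b}"
    have "\<bar>\<eta> x\<bar> \<le> V * \<bar>x - a\<bar>" using \<eta>L[of a x] \<eta>a x by simp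
    also have "\<dots> \<le> E" unfolding E_def using x V by (intro mult_left_mono) auto
    finally show "\<bar>\<eta> x\<bar> \<le> E" .
  qed
  have \<kappa>0: "\<kappa>0 \<in> borel_measurable borel" "integrable lborel \<kappa>0" "\<And>t. \<bar>\<kappa>0 t\<bar> \<le> V"
    "continuous_on {a..b} (conv_left (1 - \<alpha>) \<kappa>0)"
    "\<And>x. x \<in> {a..b} \<Longrightarrow> integrable lborel (\<lambda>t. frac_kernel (1 - \<alpha>) (x - t) * \<kappa>0 t)"
    unfolding \<kappa>0_def
    using zero_ext_measurable[OF \<kappa>] zero_ext_integrable[OF \<kappa>] V(2)
      conv_left_continuous[OF \<alpha>' zero_ext_continuous[OF \<kappa>] zero_ext_simps(2)] by blast+
  obtain q1 where q1: "has_density a b (\<lambda>x. y x $ 1) q1"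
    "\<And>x. x \<in> {a..b} \<Longrightarrow> integrable lborel (\<lambda>t. frac_kernel (1 - \<alpha>) (x - t) * q1 t)"
    "continuous_on {a..b} (conv_left (1 - \<alpha>) q1)"
    by (rule traj_class_density[OF ab \<alpha>(1,2) y_traj[of 1]]) (rule that)
  have yac: "abs_continuous_on a b (\<lambda>x. y x $ i)" for i using y_traj[of i] unfolding traj_class_def by blast
  have yc: "continuous_on {a..b} (\<lambda>x. y x $ i)" for i by (rule abs_continuous_on_imp_continuous[OF yac])
  obtain H1 where H1: "0 \<le> H1" "\<And>x z. a \<le> x \<Longrightarrow> x \<le> z \<Longrightarrow> z \<le> b \<Longrightarrow> \<bar>y z $ 1 - y x $ 1\<bar> \<le> H1 * (z - x) powr \<alpha>"
    by (rule has_density_Hoelder[OF ab \<alpha>(1,2) q1(1) yac q1(3)]) (rule that)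
  obtain R1 R2 where R: "0 \<le> R1" "\<And>t. \<bar>zero_ext a b (\<lambda>x. y x $ 1) t\<bar> \<le> R1"
      "0 \<le> R2" "\<And>t. \<bar>zero_ext a b (\<lambda>x. y x $ 2) t\<bar> \<le> R2"
    using zero_ext_bounded[OF yc[of 1]] zero_ext_bounded[OF yc[of 2]] by metis
  define R where "R = R1 + R2"
  have R0: "0 \<le> R" unfolding R_def using R by simp
  have ybox: "(x, y x) \<in> tube R" if "x \<in> {a..b}" for x
    using R(2)[of x] R(4)[of x] R(1,3) that unfolding mem_tube R_def by (simp add: zero_ext_def)
  obtain C3 \<delta> where C3: "0 \<le> C3" "0 < \<delta>"
    "\<And>x Y d. (x, Y) \<in> tube R \<Longrightarrow> G (x, Y) = 0 \<Longrightarrow> \<bar>d\<bar> \<le> \<delta> \<Longrightarrow>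
       \<exists>s. G (x, vector [Y $ 1 + d, s]) = 0 \<and> \<bar>s - Y $ 2\<bar> \<le> C3 * \<bar>d\<bar> \<and> (x, vector [Y $ 1 + d, s]) \<in> tube (R + 1)"
    by (rule constraint_solvable[OF R0]) (rule that)
  \<comment> \<open>The second bound keeps \<open>\<epsilon> * \<eta> x\<close> within the range of
    \<open>constraint_solvable\<close>, with \<open>E + 1\<close> in place of \<open>E\<close> to
    exclude division by 0; \<open>\<bar>\<epsilon>\<bar> \<le> 1\<close> frees later constants from
    \<epsilon>.\<close>
  define \<epsilon>0 where "\<epsilon>0 = min 1 (\<delta> / (E + 1))"
  have \<epsilon>0: "0 < \<epsilon>0" "\<epsilon>0 \<le> 1" unfolding \<epsilon>0_def using C3(2) E by auto
  have small: "\<bar>\<epsilon> * \<eta> x\<bar> \<le> \<delta>" if "\<bar>\<epsilon>\<bar> \<le> \<epsilon>0" "x \<in> {a..b}" for \<epsilon> x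
  proof -
    have "\<bar>\<epsilon> * \<eta> x\<bar> \<le> \<epsilon>0 * (E + 1)" unfolding abs_mult using that E by (intro mult_mono) (auto intro: order_trans[OF E(2)])
    also have "\<dots> \<le> \<delta> / (E + 1) * (E + 1)" unfolding \<epsilon>0_def using E by (intro mult_right_mono) auto
    also have "\<dots> = \<delta>" using E by simp
    finally show ?thesis .
  qed
  \<comment> \<open>The root is chosen separately at each \<open>x\<close>. Its regularity comes
    afterwards from \<open>curve_regularity\<close>, which applies to every such curve in the zero
    set.\<close>
  define s where "s \<epsilon> x = (SOME s. G (x, vector [y x $ 1 + \<epsilon> * \<eta> x, s]) = 0 \<and> \<bar>s - y x $ 2\<bar> \<le> C3 * \<bar>\<epsilon> * \<eta> x\<bar> \<and>
      (x, vector [y x $ 1 + \<epsilon> * \<eta> x, s]) \<in> tube (R + 1))" for \<epsilon> x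
  have s: "G (x, vector [y x $ 1 + \<epsilon> * \<eta> x, s \<epsilon> x]) = 0 \<and> \<bar>s \<epsilon> x - y x $ 2\<bar> \<le> C3 * \<bar>\<epsilon> * \<eta> x\<bar> \<and>
      (x, vector [y x $ 1 + \<epsilon> * \<eta> x, s \<epsilon> x]) \<in> tube (R + 1)" if "\<bar>\<epsilon>\<bar> \<le> \<epsilon>0" "x \<in> {a..b}" for \<epsilon> x
    unfolding s_def by (rule someI_ex) (rule C3(3)[OF ybox[OF that(2)] y_G[OF that(2)] small[OF that]])
  \<comment> \<open>Outside \<open>[a,b]\<close> the curve is left unchanged, so that
    \<open>u 0 = y\<close> holds as an equality of functions.\<close>
  define u :: "real \<Rightarrow> real \<Rightarrow> real^2" where
    "u \<epsilon> x = (if x \<in> {a..b} then vector [y x $ 1 + \<epsilon> * \<eta> x, s \<epsilon> x] else y x)" for \<epsilon> x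
  have u1: "u \<epsilon> x $ 1 = y x $ 1 + \<epsilon> * \<eta> x" if "x \<in> {a..b}" for \<epsilon> x using that by (simp add: u_def)
  have uG: "G (x, u \<epsilon> x) = 0" and ubox: "(x, u \<epsilon> x) \<in> tube (R + 1)"
    and u2: "\<bar>u \<epsilon> x $ 2 - y x $ 2\<bar> \<le> C3 * \<bar>\<epsilon> * \<eta> x\<bar>" if "\<bar>\<epsilon>\<bar> \<le> \<epsilon>0" "x \<in> {a..b}" for \<epsilon> x
    using s[OF that] that(2) by (simp_all add: u_def)
  have z0: "\<bar>0::real\<bar> \<le> \<epsilon>0" using \<epsilon>0 by simp
  \<comment> \<open>Where \<open>\<epsilon> * \<eta> x = 0\<close> the distance bound pins the
    chosen root to \<open>y x $ 2\<close>; this secures both \<open>u 0 = y\<close> and the boundary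
    values.\<close>
  have fixpt: "u \<epsilon> x = y x" if "\<bar>\<epsilon>\<bar> \<le> \<epsilon>0" "x \<in> {a..b}" "\<epsilon> * \<eta> x = 0" for \<epsilon> x
    using u1[OF that(2), of \<epsilon>] u2[OF that(1,2)] that(3) by (simp add: vec_eq_iff forall_2)
  have u0: "u 0 = y"
  proof
    fix x show "u 0 x = y x" using fixpt[OF z0, of x] by (cases "x \<in> {a..b}") (auto simp: u_def)
  qed
  have ends: "u \<epsilon> a = y a \<and> u \<epsilon> b = y b" if "\<bar>\<epsilon>\<bar> \<le> \<epsilon>0" for \<epsilon>
    using fixpt[OF that, of a] fixpt[OF that, of b] \<eta>a \<eta>b ab by simp
  have ydiff: "norm (u \<epsilon> x - y x) \<le> \<bar>\<epsilon>\<bar> * (E * (1 + C3))" if "\<bar>\<epsilon>\<bar> \<le> \<epsilon>0" "x \<in> {a..b}" for \<epsilon> x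
  proof -
    have "norm (u \<epsilon> x - y x) \<le> \<bar>u \<epsilon> x $ 1 - y x $ 1\<bar> + \<bar>u \<epsilon> x $ 2 - y x $ 2\<bar>"
      using norm_le_l1_cart[of "u \<epsilon> x - y x"] by (simp add: sum_2)
    also have "\<dots> \<le> \<bar>\<epsilon> * \<eta> x\<bar> + C3 * \<bar>\<epsilon> * \<eta> x\<bar>" using u1[OF that(2)] u2[OF that] by simp
    also have "\<dots> = (\<bar>\<epsilon>\<bar> * (1 + C3)) * \<bar>\<eta> x\<bar>" by (simp add: abs_mult algebra_simps)
    also have "\<dots> \<le> (\<bar>\<epsilon>\<bar> * (1 + C3)) * E" using E(2)[OF that(2)] C3(1) by (intro mult_left_mono) auto
    finally show ?thesis by (simp add: mult_ac)
  qed
  define p1 where "p1 \<epsilon> t = q1 t + \<epsilon> * \<kappa>0 t" for \<epsilon> t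
  have \<eta>ac: "abs_continuous_on a b (\<lambda>x. u \<epsilon> x $ 1)" if "\<bar>\<epsilon>\<bar> \<le> \<epsilon>0" for \<epsilon>
  proof (rule abs_continuous_on_dominated[OF yac[of 1], of "1 + V"])
    fix s t assume st: "s \<in> {a..b}" "t \<in> {a..b}" "s \<le> t"
    have "\<bar>\<epsilon> * (\<eta> t - \<eta> s)\<bar> \<le> 1 * (V * (t - s))"
      unfolding abs_mult using \<eta>L[OF st(1,2)] st(3) that \<epsilon>0(2) V(1) by (intro mult_mono) auto
    moreover have "0 \<le> V * \<bar>y t $ 1 - y s $ 1\<bar>" using V(1) by simp
    moreover have "u \<epsilon> t $ 1 - u \<epsilon> s $ 1 = (y t $ 1 - y s $ 1) + \<epsilon> * (\<eta> t - \<eta> s)"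
      unfolding u1[OF st(1)] u1[OF st(2)] by (simp add: algebra_simps)
    ultimately show "\<bar>u \<epsilon> t $ 1 - u \<epsilon> s $ 1\<bar> \<le> (1 + V) * (\<bar>y t $ 1 - y s $ 1\<bar> + (t - s))"
      using st(3) by (simp add: algebra_simps)
  qed (use V in simp)
  have p1d: "has_density a b (\<lambda>x. u \<epsilon> x $ 1) (p1 \<epsilon>)" for \<epsilon>
  proof -
    have d: "has_density a b (\<lambda>x. y x $ 1 + \<epsilon> * \<eta> x) (p1 \<epsilon>)"
      unfolding p1_def[abs_def] by (rule has_density_add[OF q1(1) \<eta>d])
    have "((\<lambda>x. u \<epsilon> x $ 1) has_real_derivative p1 \<epsilon> x) (at x)"
      if "((\<lambda>x. y x $ 1 + \<epsilon> * \<eta> x) has_real_derivative p1 \<epsilon> x) (at x)" "x \<in> {a<..<b}" for x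
      by (rule has_field_derivative_transform_within_open[OF that(1) _ that(2)]) (auto simp: u1)
    then have "{x \<in> {a..b}. \<not> ((\<lambda>x. u \<epsilon> x $ 1) has_real_derivative p1 \<epsilon> x) (at x)}
      \<subseteq> {a, b} \<union> {x \<in> {a..b}. \<not> ((\<lambda>x. y x $ 1 + \<epsilon> * \<eta> x) has_real_derivative p1 \<epsilon> x) (at x)}" by force
    moreover have "negligible ({a, b} \<union> {x \<in> {a..b}. \<not> ((\<lambda>x. y x $ 1 + \<epsilon> * \<eta> x) has_real_derivative p1 \<epsilon> x) (at x)})"
      using d unfolding has_density_def by (intro negligible_Un) auto
    ultimately have "negligible {x \<in> {a..b}. \<not> ((\<lambda>x. u \<epsilon> x $ 1) has_real_derivative p1 \<epsilon> x) (at x)}"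
      by (rule negligible_subset[rotated])
    then show ?thesis using d unfolding has_density_def by blast
  qed
  have p1i: "integrable lborel (\<lambda>t. frac_kernel (1 - \<alpha>) (x - t) * p1 \<epsilon> t)"
    and p1v: "conv_left (1 - \<alpha>) (p1 \<epsilon>) x = conv_left (1 - \<alpha>) q1 x + \<epsilon> * conv_left (1 - \<alpha>) \<kappa>0 x"
    if x: "x \<in> {a..b}" for x \<epsilon>
  proof -
    have e: "frac_kernel (1 - \<alpha>) (x - t) * p1 \<epsilon> t
        = frac_kernel (1 - \<alpha>) (x - t) * q1 t + \<epsilon> * (frac_kernel (1 - \<alpha>) (x - t) * \<kappa>0 t)" for t
      unfolding p1_def by (simp add: algebra_simps)
    show "integrable lborel (\<lambda>t. frac_kernel (1 - \<alpha>) (x - t) * p1 \<epsilon> t)"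
      unfolding e using q1(2)[OF x] \<kappa>0(5)[OF x] by simp
    show "conv_left (1 - \<alpha>) (p1 \<epsilon>) x = conv_left (1 - \<alpha>) q1 x + \<epsilon> * conv_left (1 - \<alpha>) \<kappa>0 x"
      unfolding conv_left_def e using q1(2)[OF x] \<kappa>0(5)[OF x] by simp
  qed
  have p1c: "continuous_on {a..b} (conv_left (1 - \<alpha>) (p1 \<epsilon>))" for \<epsilon>
  proof -
    have "continuous_on {a..b} (\<lambda>x. conv_left (1 - \<alpha>) q1 x + \<epsilon> * conv_left (1 - \<alpha>) \<kappa>0 x)"
      by (intro continuous_intros q1(3) \<kappa>0(4))
    then show ?thesis by (rule continuous_on_eq) (simp add: p1v)
  qed
  \<comment> \<open>The perturbation is Lipschitz with constant \<open>V\<close>, hence Hoelder on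
    \<open>[a,b]\<close> at the price of \<open>(b - a) powr (1 - \<alpha>)\<close>. One constant
    thus serves all \<epsilon>.\<close>
  define H where "H = H1 + V * (b - a) powr (1 - \<alpha>)"
  have H: "0 \<le> H" unfolding H_def using H1 V by simp
  have hoel: "\<bar>u \<epsilon> x $ 1 - u \<epsilon> t $ 1\<bar> \<le> H * (x - t) powr \<alpha>"
    if \<epsilon>: "\<bar>\<epsilon>\<bar> \<le> \<epsilon>0" and tx: "a \<le> t" "t \<le> x" "x \<le> b" for \<epsilon> x t
  proof (cases "t = x")
    case False
    have m: "t \<in> {a..b}" "x \<in> {a..b}" using tx by auto
    have "x - t = (x - t) powr (1 - \<alpha>) * (x - t) powr \<alpha>"
      using False tx by (subst powr_add[symmetric]) simp
    also have "\<dots> \<le> (b - a) powr (1 - \<alpha>) * (x - t) powr \<alpha>"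
      using tx \<alpha> by (intro mult_right_mono powr_mono2) auto
    finally have "V * (x - t) \<le> V * ((b - a) powr (1 - \<alpha>) * (x - t) powr \<alpha>)"
      using V(1) by (rule mult_left_mono)
    moreover have "\<bar>\<epsilon> * (\<eta> x - \<eta> t)\<bar> \<le> 1 * (V * (x - t))"
      unfolding abs_mult using \<eta>L[OF m] tx \<epsilon> \<epsilon>0(2) V(1) by (intro mult_mono) auto
    moreover have "u \<epsilon> x $ 1 - u \<epsilon> t $ 1 = (y x $ 1 - y t $ 1) + \<epsilon> * (\<eta> x - \<eta> t)"
      unfolding u1[OF m(1)] u1[OF m(2)] by (simp add: algebra_simps)
    ultimately show ?thesis using H1(2)[OF tx] unfolding H_def by (simp add: distrib_right mult.assoc)
  qed simp
  define p2 where "p2 \<epsilon> = curve_density (u \<epsilon>) (p1 \<epsilon>)" for \<epsilon>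
  obtain B2 where B2: "0 \<le> B2"
    "\<And>u q. (\<And>x. x \<in> {a..b} \<Longrightarrow> (x, u x) \<in> tube (R + 1) \<and> G (x, u x) = 0) \<Longrightarrow>
       has_density a b (\<lambda>x. u x $ 1) q \<Longrightarrow> abs_continuous_on a b (\<lambda>x. u x $ 1) \<Longrightarrow>
       (\<And>x. x \<in> {a..b} \<Longrightarrow> integrable lborel (\<lambda>t. frac_kernel (1 - \<alpha>) (x - t) * q t)) \<Longrightarrow>
       continuous_on {a..b} (conv_left (1 - \<alpha>) q) \<Longrightarrow>
       (\<And>t x. a \<le> t \<Longrightarrow> t \<le> x \<Longrightarrow> x \<le> b \<Longrightarrow> \<bar>u x $ 1 - u t $ 1\<bar> \<le> H * (x - t) powr \<alpha>) \<Longrightarrow>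
       continuous_on {a..b} u \<and> has_density a b (\<lambda>x. u x $ 2) (curve_density u q) \<and>
       abs_continuous_on a b (\<lambda>x. u x $ 2) \<and>
       (\<forall>x\<in>{a..b}. integrable lborel (\<lambda>t. frac_kernel (1 - \<alpha>) (x - t) * curve_density u q t)) \<and>
       continuous_on {a..b} (conv_left (1 - \<alpha>) (curve_density u q)) \<and>
       (\<forall>x\<in>{a..b}. \<bar>conv_left (1 - \<alpha>) (curve_density u q) x - slope1 (x, u x) * conv_left (1 - \<alpha>) q x\<bar> \<le> B2)"
  proof (rule curve_regularity[OF \<alpha>(1,2) H, of "R + 1"], goal_cases)
    case (1 B)
    show ?case by (rule that[OF 1(2)]) (fact 1(3))
  qed
  have reg: "continuous_on {a..b} (u \<epsilon>) \<and> has_density a b (\<lambda>x. u \<epsilon> x $ 2) (p2 \<epsilon>) \<and>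
       abs_continuous_on a b (\<lambda>x. u \<epsilon> x $ 2) \<and>
       (\<forall>x\<in>{a..b}. integrable lborel (\<lambda>t. frac_kernel (1 - \<alpha>) (x - t) * p2 \<epsilon> t)) \<and>
       continuous_on {a..b} (conv_left (1 - \<alpha>) (p2 \<epsilon>)) \<and>
       (\<forall>x\<in>{a..b}. \<bar>conv_left (1 - \<alpha>) (p2 \<epsilon>) x - slope1 (x, u \<epsilon> x) * conv_left (1 - \<alpha>) (p1 \<epsilon>) x\<bar> \<le> B2)"
    if \<epsilon>: "\<bar>\<epsilon>\<bar> \<le> \<epsilon>0" for \<epsilon>
    unfolding p2_def
    by (rule B2(2)) (use ubox[OF \<epsilon>] uG[OF \<epsilon>] p1d \<eta>ac[OF \<epsilon>] p1i p1c hoel[OF \<epsilon>] in blast)+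
  obtain S where S: "0 \<le> S" "\<And>p. p \<in> tube (R + 1) \<Longrightarrow> \<bar>slope0 p\<bar> \<le> S" "\<And>p. p \<in> tube (R + 1) \<Longrightarrow> \<bar>slope1 p\<bar> \<le> S"
    "\<And>p q. p \<in> tube (R + 1) \<Longrightarrow> q \<in> tube (R + 1) \<Longrightarrow> \<bar>slope0 q - slope0 p\<bar> \<le> S * norm (q - p)"
    "\<And>p q. p \<in> tube (R + 1) \<Longrightarrow> q \<in> tube (R + 1) \<Longrightarrow> \<bar>slope1 q - slope1 p\<bar> \<le> S * norm (q - p)"
    by (rule slope_Lipschitz[of "R + 1"]) (rule that)
  \<comment> \<open>At equal \<open>x\<close> the \<open>slope0\<close> term of the second
    constraint estimate drops out.\<close>
  obtain C4 where C4: "0 \<le> C4"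
    "\<And>x Y Y'. (x, Y) \<in> tube (R + 1) \<Longrightarrow> (x, Y') \<in> tube (R + 1) \<Longrightarrow> G (x, Y) = 0 \<Longrightarrow> G (x, Y') = 0 \<Longrightarrow>
       \<bar>Y' $ 2 - Y $ 2 - slope1 (x, Y) * (Y' $ 1 - Y $ 1)\<bar> \<le> C4 * (\<bar>Y' $ 1 - Y $ 1\<bar>)\<^sup>2"
  proof (rule constraint_estimates[of "R + 1"])
    fix C assume C: "0 \<le> C"
      "\<And>x Y t Y'. (x, Y) \<in> tube (R + 1) \<Longrightarrow> (t, Y') \<in> tube (R + 1) \<Longrightarrow> G (x, Y) = 0 \<Longrightarrow> G (t, Y') = 0 \<Longrightarrow>
       \<bar>Y' $ 2 - Y $ 2 - slope1 (x, Y) * (Y' $ 1 - Y $ 1) - slope0 (x, Y) * (t - x)\<bar>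
         \<le> C * (\<bar>t - x\<bar> + \<bar>Y' $ 1 - Y $ 1\<bar>)\<^sup>2"
    show thesis
    proof (rule that[OF C(1)])
      fix x Y Y' assume "(x, Y) \<in> tube (R + 1)" "(x, Y') \<in> tube (R + 1)" "G (x, Y) = 0" "G (x, Y') = 0"
      from C(2)[OF this] show "\<bar>Y' $ 2 - Y $ 2 - slope1 (x, Y) * (Y' $ 1 - Y $ 1)\<bar> \<le> C * (\<bar>Y' $ 1 - Y $ 1\<bar>)\<^sup>2"
        by simp
    qed
  qed
  \<comment> \<open>The \<epsilon>-derivative of the second component, from the constraint
    linearised at fixed \<open>x\<close>.\<close>
  define \<zeta> where "\<zeta> x = slope1 (x, y x) * \<eta> x" for x
  have \<zeta>lim: "(\<lambda>n. (u (e n) x $ 2 - y x $ 2) / e n) \<longlonglongrightarrow> \<zeta> x"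
    if e: "e \<longlonglongrightarrow> 0" "\<And>n. e n \<noteq> 0" "\<And>n. \<bar>e n\<bar> \<le> \<epsilon>0" and x: "x \<in> {a..b}" for e x
  proof (rule LIM_zero_cancel, rule Lim_null_comparison)
    have "(\<lambda>n. C4 * (\<bar>e n\<bar> * (\<eta> x)\<^sup>2)) \<longlonglongrightarrow> C4 * (\<bar>0\<bar> * (\<eta> x)\<^sup>2)" by (intro tendsto_intros e(1))
    then show "(\<lambda>n. C4 * (\<bar>e n\<bar> * (\<eta> x)\<^sup>2)) \<longlonglongrightarrow> 0" by simp
    have "norm ((u (e n) x $ 2 - y x $ 2) / e n - \<zeta> x) \<le> C4 * (\<bar>e n\<bar> * (\<eta> x)\<^sup>2)" for n
    proof -
      have yb: "(x, y x) \<in> tube (R + 1)" using ubox[OF z0 x] u0 by simp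
      have "\<bar>u (e n) x $ 2 - y x $ 2 - slope1 (x, y x) * (u (e n) x $ 1 - y x $ 1)\<bar> \<le> C4 * (\<bar>u (e n) x $ 1 - y x $ 1\<bar>)\<^sup>2"
        by (rule C4(2)[OF yb ubox[OF e(3) x] y_G[OF x] uG[OF e(3) x]])
      then have "\<bar>(u (e n) x $ 2 - y x $ 2) - e n * \<zeta> x\<bar> \<le> C4 * (e n * \<eta> x)\<^sup>2"
        using u1[OF x, of "e n"] unfolding \<zeta>_def by (simp add: mult_ac)
      then have "\<bar>(u (e n) x $ 2 - y x $ 2) - e n * \<zeta> x\<bar> / \<bar>e n\<bar> \<le> C4 * (e n * \<eta> x)\<^sup>2 / \<bar>e n\<bar>"
        by (rule divide_right_mono) simp
      also have "C4 * (e n * \<eta> x)\<^sup>2 / \<bar>e n\<bar> = C4 * (\<bar>e n\<bar> * (\<eta> x)\<^sup>2)"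
      proof -
        have "(e n * \<eta> x)\<^sup>2 = \<bar>e n\<bar> * (\<bar>e n\<bar> * (\<eta> x)\<^sup>2)" by (simp add: power2_eq_square mult_ac)
        then show ?thesis using e(2)[of n] by simp
      qed
      also have "\<bar>(u (e n) x $ 2 - y x $ 2) - e n * \<zeta> x\<bar> / \<bar>e n\<bar> = \<bar>(u (e n) x $ 2 - y x $ 2) / e n - \<zeta> x\<bar>"
        unfolding abs_divide[symmetric] using e(2)[of n] by (simp add: diff_divide_distrib)
      finally show ?thesis by simp
    qed
    then show "\<forall>\<^sub>F n in sequentially. norm ((u (e n) x $ 2 - y x $ 2) / e n - \<zeta> x) \<le> C4 * (\<bar>e n\<bar> * (\<eta> x)\<^sup>2)"
      by (rule always_eventually[OF allI])
  qed
  have "\<forall>x. \<exists>D. x \<in> {a..b} \<longrightarrow> (slope0 has_derivative D) (at (x, y x))"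
    "\<forall>x. \<exists>D. x \<in> {a..b} \<longrightarrow> (slope1 has_derivative D) (at (x, y x))"
    using slope_differentiable by blast+
  then obtain D0 D1 where D: "\<And>x. x \<in> {a..b} \<Longrightarrow> (slope0 has_derivative D0 x) (at (x, y x))"
    "\<And>x. x \<in> {a..b} \<Longrightarrow> (slope1 has_derivative D1 x) (at (x, y x))" by metis
  define w :: "real \<Rightarrow> real \<times> (real^2)" where "w x = (0, vector [\<eta> x, \<zeta> x])" for x
  have wlim: "(\<lambda>n. ((x, u (e n) x) - (x, y x)) /\<^sub>R e n) \<longlonglongrightarrow> w x"
    if e: "e \<longlonglongrightarrow> 0" "\<And>n. e n \<noteq> 0" "\<And>n. \<bar>e n\<bar> \<le> \<epsilon>0" and x: "x \<in> {a..b}" for e x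
  proof -
    have "(\<lambda>n. (u (e n) x - y x) /\<^sub>R e n) \<longlonglongrightarrow> vector [\<eta> x, \<zeta> x]"
    proof (rule vec_tendstoI)
      fix i :: 2
      show "(\<lambda>n. ((u (e n) x - y x) /\<^sub>R e n) $ i) \<longlonglongrightarrow> vector [\<eta> x, \<zeta> x] $ i"
      proof (cases "i = 1")
        case True
        have "((u (e n) x - y x) /\<^sub>R e n) $ i = \<eta> x" for n using e(2)[of n] u1[OF x] True by simp
        then show ?thesis using True by simp
      next
        case False
        then have "i = 2" using exhaust_2[of i] by blast
        then show ?thesis using \<zeta>lim[OF e x] by (simp add: divide_inverse mult.commute)
      qed
    qed
    then show ?thesis unfolding w_def by (simp add: tendsto_Pair)
  qed
  \<comment> \<open>For \<open>i = 2\<close> this is the \<epsilon>-derivative at 0 of \<open>slope0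
    (t, u \<epsilon> t) + slope1 (t, u \<epsilon> t) * (q1 t + \<epsilon> * \<kappa>0 t)\<close>,
    with \<open>w t\<close> the direction in which \<open>(t, u \<epsilon> t)\<close> moves.\<close>
  define q where "q i = (if i = (1::2) then \<kappa>0 else (\<lambda>t. zero_ext a b (\<lambda>t. D0 t (w t)) t
      + zero_ext a b (\<lambda>t. D1 t (w t)) t * q1 t + zero_ext a b (\<lambda>t. slope1 (t, y t)) t * \<kappa>0 t))" for i
  \<comment> \<open>The three summands account for the Lipschitz change of the slopes along
    \<open>u \<epsilon>\<close>, for the term \<open>slope1 * \<kappa>0\<close>, and for \<kappa>0
    itself in the first component.\<close>
  define K where "K = S * (E * (1 + C3)) + S * V + V"
  have K0: "0 \<le> S * (E * (1 + C3))" "0 \<le> S * V" "0 \<le> K" unfolding K_def using S V E C3 by auto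
  define P where "P t = K * (indicator {a..b} t + \<bar>q1 t\<bar>)" for t
  have q1L: "integrable lborel q1" "q1 \<in> borel_measurable borel" "\<And>t. t \<notin> {a..b} \<Longrightarrow> q1 t = 0"
    using q1(1) unfolding has_density_def by auto
  have P: "integrable lborel P" "\<And>t. t \<notin> {a..b} \<Longrightarrow> P t = 0" 
  proof -
    have "zero_ext a b (\<lambda>_. 1) = (indicator {a..b} :: real \<Rightarrow> real)" by (auto simp: zero_ext_def fun_eq_iff)
    then have "integrable lborel (indicator {a..b} :: real \<Rightarrow> real)"
      using zero_ext_integrable[of a b "\<lambda>_. 1"] by simp
    then show "integrable lborel P"
      unfolding P_def[abs_def] using q1L(1) by (intro integrable_mult_right Bochner_Integration.integrable_add integrable_abs)
    show "P t = 0" if "t \<notin> {a..b}" for t using that q1L(3) by (simp add: P_def)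
  qed
  have Pk: "integrable lborel (\<lambda>t. frac_kernel (1 - \<alpha>) (x - t) * P t)" if x: "x \<in> {a..b}" for x
  proof -
    have "integrable lborel (\<lambda>t. frac_kernel (1 - \<alpha>) (x - t) * zero_ext a b (\<lambda>_. 1) t)"
      by (rule conv_left_continuous(2)[OF \<alpha>' zero_ext_continuous zero_ext_simps(2) x]) (rule continuous_on_const)
    moreover have "zero_ext a b (\<lambda>_. 1) = indicator {a..b}" by (auto simp: zero_ext_def fun_eq_iff)
    moreover have "integrable lborel (\<lambda>t. \<bar>frac_kernel (1 - \<alpha>) (x - t) * q1 t\<bar>)" using q1(2)[OF x] by simp
    ultimately have "integrable lborel (\<lambda>t. K * (frac_kernel (1 - \<alpha>) (x - t) * indicator {a..b} t
        + \<bar>frac_kernel (1 - \<alpha>) (x - t) * q1 t\<bar>))"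
      by (intro integrable_mult_right Bochner_Integration.integrable_add) auto
    then show ?thesis unfolding P_def by (simp add: abs_mult algebra_simps)
  qed
  have dom1: "\<bar>p1 \<epsilon> t - p1 0 t\<bar> \<le> \<bar>\<epsilon>\<bar> * P t" for \<epsilon> t
  proof (cases "t \<in> {a..b}")
    case True
    have "\<bar>\<kappa>0 t\<bar> \<le> K * 1" using \<kappa>0(3)[of t] K0 unfolding K_def by simp
    also have "\<dots> \<le> P t" unfolding P_def using True K0(3) by (intro mult_left_mono) auto
    finally have "\<bar>\<epsilon>\<bar> * \<bar>\<kappa>0 t\<bar> \<le> \<bar>\<epsilon>\<bar> * P t" by (intro mult_left_mono) auto
    then show ?thesis unfolding p1_def by (simp add: abs_mult)
  next
    case False
    then show ?thesis using P(2)[OF False] by (auto simp: p1_def \<kappa>0_def zero_ext_def)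
  qed
  have p2eq: "p2 \<epsilon> t - p2 0 t = (slope0 (t, u \<epsilon> t) - slope0 (t, y t)) + (slope1 (t, u \<epsilon> t) - slope1 (t, y t)) * q1 t
      + slope1 (t, u \<epsilon> t) * (\<epsilon> * \<kappa>0 t)" if "t \<in> {a..b}" for \<epsilon> t
    using that unfolding p2_def curve_density_def p1_def u0 by (simp add: zero_ext_def algebra_simps)
  have p20: "p2 \<epsilon> t = 0" if "t \<notin> {a..b}" for \<epsilon> t
    unfolding p2_def curve_density_def zero_ext_simps(2)[OF that] by simp
  have dom2: "\<bar>p2 \<epsilon> t - p2 0 t\<bar> \<le> \<bar>\<epsilon>\<bar> * P t" if \<epsilon>: "\<bar>\<epsilon>\<bar> \<le> \<epsilon>0" for \<epsilon> t
  proof (cases "t \<in> {a..b}")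
    case True
    have b: "(t, u \<epsilon> t) \<in> tube (R + 1)" "(t, y t) \<in> tube (R + 1)" using ubox[OF \<epsilon> True] ubox[OF z0 True] u0 by auto
    have n: "norm ((t, u \<epsilon> t) - (t, y t)) \<le> \<bar>\<epsilon>\<bar> * (E * (1 + C3))" using ydiff[OF \<epsilon> True] by (simp add: norm_Pair)
    define N where "N = \<bar>\<epsilon>\<bar> * (S * (E * (1 + C3)))"
    have N: "S * norm ((t, u \<epsilon> t) - (t, y t)) \<le> N"
      unfolding N_def using mult_left_mono[OF n S(1)] by (simp add: mult.left_commute)
    have 1: "\<bar>slope0 (t, u \<epsilon> t) - slope0 (t, y t)\<bar> \<le> N" "\<bar>slope1 (t, u \<epsilon> t) - slope1 (t, y t)\<bar> \<le> N"
      using S(4)[OF b(2,1)] S(5)[OF b(2,1)] N by linarith+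
    have 2: "\<bar>slope1 (t, u \<epsilon> t) * (\<epsilon> * \<kappa>0 t)\<bar> \<le> S * (\<bar>\<epsilon>\<bar> * V)"
      unfolding abs_mult using S(1) S(3)[OF b(1)] \<kappa>0(3)[of t] by (intro mult_mono) auto
    have 3: "\<bar>(slope1 (t, u \<epsilon> t) - slope1 (t, y t)) * q1 t\<bar> \<le> N * \<bar>q1 t\<bar>"
      unfolding abs_mult using 1(2) by (rule mult_right_mono) simp
    have "\<bar>p2 \<epsilon> t - p2 0 t\<bar> \<le> N + N * \<bar>q1 t\<bar> + S * (\<bar>\<epsilon>\<bar> * V)"
      unfolding p2eq[OF True] using 1(1) 2 3 by linarith
    also have "\<dots> = \<bar>\<epsilon>\<bar> * ((S * (E * (1 + C3)) + S * V) * 1 + S * (E * (1 + C3)) * \<bar>q1 t\<bar>)"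
      unfolding N_def by (simp add: algebra_simps)
    also have "\<dots> \<le> \<bar>\<epsilon>\<bar> * (K * 1 + K * \<bar>q1 t\<bar>)"
    proof -
      have k: "S * (E * (1 + C3)) + S * V \<le> K" "S * (E * (1 + C3)) \<le> K" unfolding K_def using K0 V(1) by linarith+
      show ?thesis by (rule mult_left_mono[OF add_mono[OF mult_right_mono[OF k(1)] mult_right_mono[OF k(2)]]]) auto
    qed
    also have "\<dots> = \<bar>\<epsilon>\<bar> * P t" unfolding P_def using True by (simp add: algebra_simps)
    finally show ?thesis .
  next
    case False
    then show ?thesis using P(2) p20 by simp
  qed
  have lim1: "(\<lambda>n. (p1 (e n) t - p1 0 t) / e n) \<longlonglongrightarrow> q 1 t" if "\<And>n. e n \<noteq> 0" for e :: "nat \<Rightarrow> real" and t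
    using that by (simp add: p1_def q_def)
  have lim2: "(\<lambda>n. (p2 (e n) t - p2 0 t) / e n) \<longlonglongrightarrow> q 2 t"
    if e: "e \<longlonglongrightarrow> 0" "\<And>n. e n \<noteq> 0" "\<And>n. \<bar>e n\<bar> \<le> \<epsilon>0" and t: "t \<in> {a..b}" for e t
  proof -
    have l0: "(\<lambda>n. (slope0 (t, u (e n) t) - slope0 (t, y t)) / e n) \<longlonglongrightarrow> D0 t (w t)"
      by (rule directional_limit[OF D(1)[OF t] e(1,2) wlim[OF e t]])
    have l1: "(\<lambda>n. (slope1 (t, u (e n) t) - slope1 (t, y t)) / e n) \<longlonglongrightarrow> D1 t (w t)"
      by (rule directional_limit[OF D(2)[OF t] e(1,2) wlim[OF e t]])
    have "(\<lambda>n. e n * ((slope1 (t, u (e n) t) - slope1 (t, y t)) / e n) + slope1 (t, y t)) \<longlonglongrightarrow> 0 * D1 t (w t) + slope1 (t, y t)"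
      by (intro tendsto_intros e(1) l1)
    then have l2: "(\<lambda>n. slope1 (t, u (e n) t)) \<longlonglongrightarrow> slope1 (t, y t)" using e(2) by simp
    have "(\<lambda>n. (slope0 (t, u (e n) t) - slope0 (t, y t)) / e n + ((slope1 (t, u (e n) t) - slope1 (t, y t)) / e n) * q1 t
        + slope1 (t, u (e n) t) * \<kappa>0 t) \<longlonglongrightarrow> D0 t (w t) + D1 t (w t) * q1 t + slope1 (t, y t) * \<kappa>0 t"
      by (intro tendsto_intros l0 l1 l2)
    moreover have "(p2 (e n) t - p2 0 t) / e n = (slope0 (t, u (e n) t) - slope0 (t, y t)) / e n
        + ((slope1 (t, u (e n) t) - slope1 (t, y t)) / e n) * q1 t + slope1 (t, u (e n) t) * \<kappa>0 t" for n
      unfolding p2eq[OF t] using e(2)[of n] by (simp add: add_divide_distrib)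
    moreover have "q 2 t = D0 t (w t) + D1 t (w t) * q1 t + slope1 (t, y t) * \<kappa>0 t"
      using t by (simp add: q_def zero_ext_def)
    ultimately show ?thesis by simp
  qed
  have q0: "q i t = 0" if "t \<notin> {a..b}" for i t
    by (simp add: q_def \<kappa>0_def zero_ext_simps(2)[OF that])
  have start: "u \<epsilon> a $ i = u 0 a $ i" if "\<bar>\<epsilon>\<bar> \<le> \<epsilon>0" for \<epsilon> i using ends[OF that] u0 by simp
  have r2: "\<And>\<epsilon>. \<bar>\<epsilon>\<bar> \<le> \<epsilon>0 \<Longrightarrow> has_density a b (\<lambda>x. u \<epsilon> x $ 2) (p2 \<epsilon>)"
    "\<And>\<epsilon>. \<bar>\<epsilon>\<bar> \<le> \<epsilon>0 \<Longrightarrow> abs_continuous_on a b (\<lambda>x. u \<epsilon> x $ 2)"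
    "\<And>\<epsilon> x. \<bar>\<epsilon>\<bar> \<le> \<epsilon>0 \<Longrightarrow> x \<in> {a..b} \<Longrightarrow> integrable lborel (\<lambda>t. frac_kernel (1 - \<alpha>) (x - t) * p2 \<epsilon> t)"
    using reg by blast+
  define pp where "pp i = (if i = (1::2) then p1 else p2)" for i
  have pp: "\<And>\<epsilon>. \<bar>\<epsilon>\<bar> \<le> \<epsilon>0 \<Longrightarrow> has_density a b (\<lambda>x. u \<epsilon> x $ i) (pp i \<epsilon>)"
    "\<And>\<epsilon>. \<bar>\<epsilon>\<bar> \<le> \<epsilon>0 \<Longrightarrow> abs_continuous_on a b (\<lambda>x. u \<epsilon> x $ i)"
    "\<And>\<epsilon> x. \<bar>\<epsilon>\<bar> \<le> \<epsilon>0 \<Longrightarrow> x \<in> {a..b} \<Longrightarrow> integrable lborel (\<lambda>t. frac_kernel (1 - \<alpha>) (x - t) * pp i \<epsilon> t)"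
    "\<And>\<epsilon> t. \<bar>\<epsilon>\<bar> \<le> \<epsilon>0 \<Longrightarrow> \<bar>pp i \<epsilon> t - pp i 0 t\<bar> \<le> \<bar>\<epsilon>\<bar> * P t"
    "\<And>e t. e \<longlonglongrightarrow> 0 \<Longrightarrow> (\<And>n. e n \<noteq> 0) \<Longrightarrow> (\<And>n. \<bar>e n\<bar> \<le> \<epsilon>0) \<Longrightarrow> t \<in> {a..b} \<Longrightarrow>
      (\<lambda>n. (pp i (e n) t - pp i 0 t) / e n) \<longlonglongrightarrow> q i t" for i
  proof -
    consider "i = 1" | "i = 2" using exhaust_2[of i] by blast
    note i = this
    show "has_density a b (\<lambda>x. u \<epsilon> x $ i) (pp i \<epsilon>)" if "\<bar>\<epsilon>\<bar> \<le> \<epsilon>0" for \<epsilon>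
      using p1d r2(1)[OF that] by (cases rule: i) (simp_all add: pp_def)
    show "abs_continuous_on a b (\<lambda>x. u \<epsilon> x $ i)" if "\<bar>\<epsilon>\<bar> \<le> \<epsilon>0" for \<epsilon>
      using \<eta>ac[OF that] r2(2)[OF that] by (cases rule: i) (simp_all add: pp_def)
    show "integrable lborel (\<lambda>t. frac_kernel (1 - \<alpha>) (x - t) * pp i \<epsilon> t)"
      if "\<bar>\<epsilon>\<bar> \<le> \<epsilon>0" "x \<in> {a..b}" for \<epsilon> x
      using p1i[OF that(2)] r2(3)[OF that] by (cases rule: i) (simp_all add: pp_def)
    show "\<bar>pp i \<epsilon> t - pp i 0 t\<bar> \<le> \<bar>\<epsilon>\<bar> * P t" if "\<bar>\<epsilon>\<bar> \<le> \<epsilon>0" for \<epsilon> t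
      using dom1[of \<epsilon> t] dom2[OF that, of t] by (cases rule: i) (simp_all add: pp_def)
    show "(\<lambda>n. (pp i (e n) t - pp i 0 t) / e n) \<longlonglongrightarrow> q i t"
      if e: "e \<longlonglongrightarrow> 0" "\<And>n. e n \<noteq> 0" "\<And>n. \<bar>e n\<bar> \<le> \<epsilon>0" "t \<in> {a..b}" for e t
      using lim1[of e t, OF e(2)] lim2[OF e] by (cases rule: i) (simp_all add: pp_def)
  qed
  have F1: "integrable lborel (q i)" for i
    by (rule density_family_limit(1)[where f = "\<lambda>\<epsilon> x. u \<epsilon> x $ i" and p = "pp i" and P = P,
        OF \<alpha>(1,2) ab \<epsilon>0(1)]) (fact | rule pp start Pk q0; assumption)+
  have F2: "\<bar>caputo_left \<alpha> a (\<lambda>x. u \<epsilon> x $ i) x - caputo_left \<alpha> a (\<lambda>x. y x $ i) x\<bar>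
      \<le> \<bar>\<epsilon>\<bar> * (conv_left (1 - \<alpha>) P x / Gamma (1 - \<alpha>))" if "\<bar>\<epsilon>\<bar> \<le> \<epsilon>0" "x \<in> {a..b}" for \<epsilon> x i
    unfolding u0[symmetric]
    by (rule density_family_limit(2)[where f = "\<lambda>\<epsilon> x. u \<epsilon> x $ i" and p = "pp i" and P = P and q = "q i",
        OF \<alpha>(1,2) ab \<epsilon>0(1)]) (fact | rule pp start Pk q0; assumption)+
  have F3: "(\<lambda>n. (u (e n) x $ i - y x $ i) / e n) \<longlonglongrightarrow> (LINT t:{a..x}|lborel. q i t)"
    and F4: "(\<lambda>n. (caputo_left \<alpha> a (\<lambda>t. u (e n) t $ i) x - caputo_left \<alpha> a (\<lambda>t. y t $ i) x) / e n)
         \<longlonglongrightarrow> conv_left (1 - \<alpha>) (q i) x / Gamma (1 - \<alpha>)"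
    if "e \<longlonglongrightarrow> 0" "\<And>n. e n \<noteq> 0" "\<And>n. \<bar>e n\<bar> \<le> \<epsilon>0" "x \<in> {a..b}" for e x i
    unfolding u0[symmetric]
    by (rule density_family_limit(3,4)[where f = "\<lambda>\<epsilon> x. u \<epsilon> x $ i" and p = "pp i" and P = P and q = "q i",
        OF \<alpha>(1,2) ab \<epsilon>0(1)]; (fact | rule pp start Pk q0; assumption)+)+
  \<comment> \<open>\<open>P\<close> contains the merely integrable \<open>q1\<close>, so the change
    of the Caputo derivatives gets an integrable majorant rather than a bounded one; duality with
    the indicator of \<open>[a,b]\<close> gives its integrability.\<close>
  define W where "W x = indicator {a..b} x * conv_left (1 - \<alpha>) P x * (1 / Gamma (1 - \<alpha>))" for x
  have Wi: "integrable lborel W"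
    unfolding W_def[abs_def]
    by (intro integrable_mult_left conv_duality(1)[OF \<alpha>' P, where M = "indicator {a..b}" and C = 1])
      (auto simp: indicator_def)
  obtain B1 where B1: "0 \<le> B1" "\<And>t. \<bar>zero_ext a b (conv_left (1 - \<alpha>) q1) t\<bar> \<le> B1"
    by (rule zero_ext_bounded[OF q1(3)]) (rule that)
  obtain B3 where B3: "0 \<le> B3" "\<And>t. \<bar>zero_ext a b (conv_left (1 - \<alpha>) \<kappa>0) t\<bar> \<le> B3"
    by (rule zero_ext_bounded[OF \<kappa>0(4)]) (rule that)
  have cb1: "\<bar>conv_left (1 - \<alpha>) (p1 \<epsilon>) x\<bar> \<le> B1 + B3" if "\<bar>\<epsilon>\<bar> \<le> \<epsilon>0" "x \<in> {a..b}" for \<epsilon> x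
  proof -
    have "\<bar>\<epsilon> * conv_left (1 - \<alpha>) \<kappa>0 x\<bar> \<le> 1 * B3"
      unfolding abs_mult using that \<epsilon>0(2) B3(2)[of x] by (intro mult_mono) (auto simp: zero_ext_def)
    then show ?thesis unfolding p1v[OF that(2)] using B1(2)[of x] that(2) by (simp add: zero_ext_def)
  qed
  have cb2: "\<bar>conv_left (1 - \<alpha>) (p2 \<epsilon>) x\<bar> \<le> B2 + S * (B1 + B3)" if "\<bar>\<epsilon>\<bar> \<le> \<epsilon>0" "x \<in> {a..b}" for \<epsilon> x
  proof -
    have "\<bar>slope1 (x, u \<epsilon> x) * conv_left (1 - \<alpha>) (p1 \<epsilon>) x\<bar> \<le> S * (B1 + B3)"
      unfolding abs_mult using S(1) S(3)[OF ubox[OF that]] cb1[OF that] by (intro mult_mono) auto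
    moreover have "\<bar>conv_left (1 - \<alpha>) (p2 \<epsilon>) x - slope1 (x, u \<epsilon> x) * conv_left (1 - \<alpha>) (p1 \<epsilon>) x\<bar> \<le> B2"
      using reg[OF that(1)] that(2) by blast
    ultimately show ?thesis by linarith
  qed
  define Bc where "Bc = (B1 + B3 + (B2 + S * (B1 + B3))) / Gamma (1 - \<alpha>)"
  define B where "B = Bc + (R + 1) + E * (1 + C3)"
  have BB: "0 \<le> S * (B1 + B3)" "0 \<le> Bc" "0 \<le> E * (1 + C3)" "Bc \<le> B" "R + 1 \<le> B" "E * (1 + C3) \<le> B"
    unfolding B_def Bc_def using S B1 B2 B3 Gam R0 E C3 by auto
  show thesis
  proof (rule that[of \<epsilon>0 u q B W, OF \<epsilon>0(1) u0])
    fix i :: 2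
    consider "i = 1" | "i = 2" using exhaust_2[of i] by blast
    note i = this
    show "(\<lambda>x. u \<epsilon> x $ i) \<in> traj_class \<alpha> \<beta> a b" if \<epsilon>: "\<bar>\<epsilon>\<bar> \<le> \<epsilon>0" for \<epsilon>
    proof (cases rule: i)
      case 1
      then show ?thesis using traj_classI[OF \<alpha> p1d \<eta>ac[OF \<epsilon>] p1i p1c] by blast
    next
      case 2
      then show ?thesis using traj_classI[OF \<alpha> r2(1)[OF \<epsilon>] r2(2)[OF \<epsilon>] r2(3)[OF \<epsilon>]] reg[OF \<epsilon>] by blast
    qed
    show "integrable lborel (q i)"
      by (rule F1)
    show "q i t = 0" if "t \<notin> {a..b}" for t by (rule q0[OF that])
    show "\<bar>u \<epsilon> x $ i\<bar> \<le> B" if "\<bar>\<epsilon>\<bar> \<le> \<epsilon>0" "x \<in> {a..b}" for \<epsilon> x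
      using ubox[OF that] BB(5) unfolding mem_tube by (cases rule: i) simp_all
    show "\<bar>caputo_left \<alpha> a (\<lambda>t. u \<epsilon> t $ i) x\<bar> \<le> B" if \<epsilon>: "\<bar>\<epsilon>\<bar> \<le> \<epsilon>0" and x: "x \<in> {a..b}" for \<epsilon> x
    proof -
      have "\<bar>caputo_left \<alpha> a (\<lambda>t. u \<epsilon> t $ i) x\<bar> \<le> Bc"
      proof (cases rule: i)
        case 1
        show ?thesis unfolding 1 has_density_caputo(2)[OF p1d x] Bc_def abs_divide
          using cb1[OF \<epsilon> x] B2(1) BB(1) Gam by (intro frac_le) auto
      next
        case 2
        show ?thesis unfolding 2 has_density_caputo(2)[OF r2(1)[OF \<epsilon>] x] Bc_def abs_divide
          using cb2[OF \<epsilon> x] B1(1) B3(1) B2(1) BB(1) Gam by (intro frac_le) auto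
      qed
      then show ?thesis using BB(4) by linarith
    qed
    show "\<bar>u \<epsilon> x $ i - y x $ i\<bar> \<le> \<bar>\<epsilon>\<bar> * B" if "\<bar>\<epsilon>\<bar> \<le> \<epsilon>0" "x \<in> {a..b}" for \<epsilon> x
    proof -
      have "\<bar>u \<epsilon> x $ i - y x $ i\<bar> \<le> norm (u \<epsilon> x - y x)" using component_le_norm_cart[of "u \<epsilon> x - y x" i] by simp
      also have "\<dots> \<le> \<bar>\<epsilon>\<bar> * (E * (1 + C3))" by (rule ydiff[OF that])
      also have "\<dots> \<le> \<bar>\<epsilon>\<bar> * B" using BB(6) by (intro mult_left_mono) auto
      finally show ?thesis .
    qed
    show "\<bar>caputo_left \<alpha> a (\<lambda>t. u \<epsilon> t $ i) x - caputo_left \<alpha> a (\<lambda>t. y t $ i) x\<bar> \<le> \<bar>\<epsilon>\<bar> * W x"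
      if "\<bar>\<epsilon>\<bar> \<le> \<epsilon>0" "x \<in> {a..b}" for \<epsilon> x
    proof -
      have "W x = conv_left (1 - \<alpha>) P x / Gamma (1 - \<alpha>)" using that(2) by (simp add: W_def)
      then show ?thesis using F2[OF that] by simp
    qed
    show "W x = 0" if "x \<notin> {a..b}" for x using that by (simp add: W_def)
    fix e :: "nat \<Rightarrow> real" and x assume e: "e \<longlonglongrightarrow> 0" "\<And>n. e n \<noteq> 0" "\<And>n. \<bar>e n\<bar> \<le> \<epsilon>0" "x \<in> {a..b}"
    show "(\<lambda>n. (u (e n) x $ i - y x $ i) / e n) \<longlonglongrightarrow> (LINT t:{a..x}|lborel. q i t)"
      by (rule F3[OF e])
    show "(\<lambda>n. (caputo_left \<alpha> a (\<lambda>t. u (e n) t $ i) x - caputo_left \<alpha> a (\<lambda>t. y t $ i) x) / e n)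
         \<longlonglongrightarrow> conv_left (1 - \<alpha>) (q i) x / Gamma (1 - \<alpha>)"
      by (rule F4[OF e])
  next
    show "q 1 = zero_ext a b \<kappa>" by (simp add: q_def \<kappa>0_def)
    fix x assume x: "x \<in> {a..b}"
    define e where "e n = \<epsilon>0 / real (Suc n)" for n
    have e: "e \<longlonglongrightarrow> 0" "e n \<noteq> 0" "\<bar>e n\<bar> \<le> \<epsilon>0" for n
    proof -
      show "e \<longlonglongrightarrow> 0" unfolding e_def by (rule LIMSEQ_Suc[OF lim_const_over_n])
      show "e n \<noteq> 0" "\<bar>e n\<bar> \<le> \<epsilon>0" using \<epsilon>0(1) unfolding e_def by (auto simp: field_simps)
    qed
    \<comment> \<open>The same difference quotients converge to both sides: through the densities by
      \<open>F3\<close>, and through the constraint by \<open>\<zeta>lim\<close>.\<close>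
    have "(LINT t:{a..x}|lborel. q 2 t) = \<zeta> x"
      by (rule LIMSEQ_unique[OF F3[OF e x] \<zeta>lim[OF e x]])
    also have "\<zeta> x = slope1 (x, y x) * (LINT t:{a..x}|lborel. q 1 t)"
      unfolding \<zeta>_def \<eta>_def by (simp add: q_def \<kappa>0_def)
    finally show "(LINT t:{a..x}|lborel. q 2 t) = slope1 (x, y x) * (LINT t:{a..x}|lborel. q 1 t)" .
  qed (use ends uG Wi in blast)+
qed

end

section \<open>The first variation of the functional\<close>

lemma harmonic_sequence:
  assumes "0 < (c::real)"
  shows "(\<lambda>n. c / real (Suc n)) \<longlonglongrightarrow> 0" "c / real (Suc n) \<noteq> 0" "\<bar>c / real (Suc n)\<bar> \<le> c"
proof -
  show "(\<lambda>n. c / real (Suc n)) \<longlonglongrightarrow> 0" by (rule LIMSEQ_Suc[OF lim_const_over_n])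
  show "c / real (Suc n) \<noteq> 0" "\<bar>c / real (Suc n)\<bar> \<le> c" using assms by (auto simp: field_simps)
qed

text \<open>On the compact convex set that contains all curves \<open>h\<close> is Lipschitz, so a
  multiple of \<Omega> dominates the difference quotients of the integrand. The upper limit
  \<open>c\<close> is left free with bounds uniform in it: for \<open>l\<close> the integral is the
  variable \<open>z\<close>, for \<open>L\<close> it is the functional.\<close>

lemma integral_first_variation:
  fixes X :: "real \<Rightarrow> real \<Rightarrow> 'a::euclidean_space"
  assumes U: "open U" "Ck_on (Suc k) h U" and K: "compact K" "convex K" "K \<subseteq> U" and "0 < \<epsilon>0"
    and XK: "\<And>\<epsilon> x. \<bar>\<epsilon>\<bar> \<le> \<epsilon>0 \<Longrightarrow> x \<in> {a..b} \<Longrightarrow> X \<epsilon> x \<in> K"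
    and Xc: "\<And>\<epsilon>. \<bar>\<epsilon>\<bar> \<le> \<epsilon>0 \<Longrightarrow> continuous_on {a..b} (X \<epsilon>)"
    and dom: "\<And>\<epsilon> x. \<bar>\<epsilon>\<bar> \<le> \<epsilon>0 \<Longrightarrow> x \<in> {a..b} \<Longrightarrow> norm (X \<epsilon> x - X 0 x) \<le> \<bar>\<epsilon>\<bar> * \<Omega> x"
    and \<Omega>: "integrable lborel \<Omega>" "\<And>x. 0 \<le> \<Omega> x"
    and lim: "\<And>e x. e \<longlonglongrightarrow> 0 \<Longrightarrow> (\<And>n. e n \<noteq> 0) \<Longrightarrow> (\<And>n. \<bar>e n\<bar> \<le> \<epsilon>0) \<Longrightarrow> x \<in> {a..b} \<Longrightarrow>
      (\<lambda>n. (X (e n) x - X 0 x) /\<^sub>R e n) \<longlonglongrightarrow> \<delta> x"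
  defines "I \<equiv> \<lambda>\<epsilon> c. LINT t:{a..c}|lborel. zero_ext a b (\<lambda>t. h (X \<epsilon> t)) t"
  shows "\<exists>C. 0 \<le> C \<and> integrable lborel (zero_ext a b (\<lambda>x. grad h (X 0 x) (\<delta> x))) \<and>
    (\<forall>\<epsilon> c. \<bar>\<epsilon>\<bar> \<le> \<epsilon>0 \<longrightarrow> \<bar>I \<epsilon> c - I 0 c\<bar> \<le> \<bar>\<epsilon>\<bar> * C) \<and>
    (\<forall>\<epsilon> c. \<bar>\<epsilon>\<bar> \<le> \<epsilon>0 \<longrightarrow> \<bar>I \<epsilon> c\<bar> \<le> C) \<and>
    (\<forall>e c. e \<longlonglongrightarrow> 0 \<longrightarrow> (\<forall>n. e n \<noteq> 0) \<longrightarrow> (\<forall>n. \<bar>e n\<bar> \<le> \<epsilon>0) \<longrightarrow>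
      (\<lambda>n. (I (e n) c - I 0 c) / e n) \<longlonglongrightarrow> (LINT t:{a..c}|lborel. zero_ext a b (\<lambda>x. grad h (X 0 x) (\<delta> x)) t))"
proof -
  have z: "\<bar>0::real\<bar> \<le> \<epsilon>0" using \<open>0 < \<epsilon>0\<close> by simp
  obtain C1 where C1: "0 \<le> C1" "\<And>p q. p \<in> K \<Longrightarrow> q \<in> K \<Longrightarrow> \<bar>h q - h p\<bar> \<le> C1 * norm (q - p)"
    by (rule Ck_on_Lipschitz[OF U K]) (rule that)
  define H where "H \<epsilon> = zero_ext a b (\<lambda>t. h (X \<epsilon> t))" for \<epsilon>
  define q where "q = zero_ext a b (\<lambda>x. grad h (X 0 x) (\<delta> x))"
  have hc: "continuous_on {a..b} (\<lambda>t. h (X \<epsilon> t))" if "\<bar>\<epsilon>\<bar> \<le> \<epsilon>0" for \<epsilon>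
    using XK[OF that] K(3)
    by (intro continuous_on_compose2[OF Ck_on_continuous_on[OF U] Xc[OF that]]) auto
  have Hi: "integrable lborel (H \<epsilon>)" and Hm: "H \<epsilon> \<in> borel_measurable borel" if "\<bar>\<epsilon>\<bar> \<le> \<epsilon>0" for \<epsilon>
    unfolding H_def using zero_ext_integrable[OF hc[OF that]] zero_ext_measurable[OF hc[OF that]] by auto
  have Hd: "\<bar>H \<epsilon> t - H 0 t\<bar> \<le> \<bar>\<epsilon>\<bar> * (C1 * \<Omega> t)" if \<epsilon>: "\<bar>\<epsilon>\<bar> \<le> \<epsilon>0" for \<epsilon> t
  proof (cases "t \<in> {a..b}")
    case True
    have "\<bar>h (X \<epsilon> t) - h (X 0 t)\<bar> \<le> C1 * norm (X \<epsilon> t - X 0 t)" by (rule C1(2)[OF XK[OF z True] XK[OF \<epsilon> True]])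
    also have "\<dots> \<le> C1 * (\<bar>\<epsilon>\<bar> * \<Omega> t)" by (rule mult_left_mono[OF dom[OF \<epsilon> True] C1(1)])
    finally show ?thesis unfolding H_def zero_ext_simps(1)[OF True] by (simp add: mult.left_commute)
  next
    case False
    then show ?thesis unfolding H_def zero_ext_simps(2)[OF False] using C1(1) \<Omega>(2) by simp
  qed
  define D where "D \<epsilon> t = (H \<epsilon> t - H 0 t) / \<epsilon>" for \<epsilon> t
  have Dm: "D \<epsilon> \<in> borel_measurable borel" if "\<bar>\<epsilon>\<bar> \<le> \<epsilon>0" for \<epsilon>
    unfolding D_def[abs_def] using Hm[OF that] Hm[OF z] by measurable
  have Db: "\<bar>D \<epsilon> t\<bar> \<le> C1 * \<Omega> t" if "\<bar>\<epsilon>\<bar> \<le> \<epsilon>0" for \<epsilon> t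
  proof (cases "\<epsilon> = 0")
    case True
    then show ?thesis using C1(1) \<Omega>(2) by (simp add: D_def)
  next
    case False
    then show ?thesis using Hd[OF that, of t] unfolding D_def by (simp add: abs_divide field_simps)
  qed
  have Dlim: "(\<lambda>n. D (e n) t) \<longlonglongrightarrow> q t"
    if e: "e \<longlonglongrightarrow> 0" "\<And>n. e n \<noteq> 0" "\<And>n. \<bar>e n\<bar> \<le> \<epsilon>0" for e t
  proof (cases "t \<in> {a..b}")
    case True
    have "(h has_derivative grad h (X 0 t)) (at (X 0 t))"
      using XK[OF z True] K(3) by (intro Ck_on_has_derivative[OF U]) auto
    from directional_limit[OF this e(1,2) lim[OF e True]] show ?thesis
      unfolding D_def H_def q_def zero_ext_simps(1)[OF True] .
  next
    case False
    then show ?thesis unfolding D_def H_def q_def zero_ext_simps(2)[OF False] by simp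
  qed
  note e0 = harmonic_sequence[OF \<open>0 < \<epsilon>0\<close>]
  have qm: "q \<in> borel_measurable borel"
  proof (rule borel_measurable_LIMSEQ_real[where u = "\<lambda>n. D (\<epsilon>0 / real (Suc n))"])
    show "(\<lambda>n. D (\<epsilon>0 / real (Suc n)) t) \<longlonglongrightarrow> q t" for t by (rule Dlim) (rule e0)+
    show "D (\<epsilon>0 / real (Suc n)) \<in> borel_measurable borel" for n by (rule Dm[OF e0(3)])
  qed
  have qb: "\<bar>q t\<bar> \<le> C1 * \<Omega> t" for t
  proof (rule LIMSEQ_le_const2)
    show "(\<lambda>n. \<bar>D (\<epsilon>0 / real (Suc n)) t\<bar>) \<longlonglongrightarrow> \<bar>q t\<bar>" by (intro tendsto_rabs Dlim e0)
    show "\<exists>N. \<forall>n\<ge>N. \<bar>D (\<epsilon>0 / real (Suc n)) t\<bar> \<le> C1 * \<Omega> t" using Db[OF e0(3)] by blast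
  qed
  have \<Omega>i: "integrable lborel (\<lambda>t. C1 * \<Omega> t)" using \<Omega>(1) by simp
  have qi: "integrable lborel q"
    using qm qb by (intro Bochner_Integration.integrable_bound[OF \<Omega>i]) (auto intro!: AE_I2 order_trans[OF qb abs_ge_self])
  have I: "I \<epsilon> c = (LINT t|lborel. indicator {a..c} t *\<^sub>R H \<epsilon> t)" for \<epsilon> c
    unfolding I_def H_def set_lebesgue_integral_def ..
  have ii: "integrable lborel (\<lambda>t. indicator {a..c} t *\<^sub>R H \<epsilon> t)" if "\<bar>\<epsilon>\<bar> \<le> \<epsilon>0" for \<epsilon> c
    by (rule integrable_mult_indicator[OF _ Hi[OF that]]) simp
  \<comment> \<open>One constant for two claims: the first term bounds the difference quotients, the
    other two bound \<open>I 0\<close> and the change of \<open>I\<close> over the range of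
    \<epsilon>.\<close>
  define C where "C = (LINT t|lborel. C1 * \<Omega> t) + \<bar>LINT t|lborel. \<bar>H 0 t\<bar>\<bar> + \<epsilon>0 * (LINT t|lborel. C1 * \<Omega> t)"
  have nn: "0 \<le> (LINT t|lborel. C1 * \<Omega> t)" using C1(1) \<Omega>(2) by (intro integral_nonneg_AE AE_I2) auto
  have diff: "\<bar>I \<epsilon> c - I 0 c\<bar> \<le> \<bar>\<epsilon>\<bar> * (LINT t|lborel. C1 * \<Omega> t)" if \<epsilon>: "\<bar>\<epsilon>\<bar> \<le> \<epsilon>0" for \<epsilon> c
  proof -
    have "I \<epsilon> c - I 0 c = (LINT t|lborel. indicator {a..c} t *\<^sub>R H \<epsilon> t - indicator {a..c} t *\<^sub>R H 0 t)"
      unfolding I using ii[OF \<epsilon>] ii[OF z] by simp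
    then have "\<bar>I \<epsilon> c - I 0 c\<bar> \<le> (LINT t|lborel. norm (indicator {a..c} t *\<^sub>R H \<epsilon> t - indicator {a..c} t *\<^sub>R H 0 t))"
      using integral_norm_bound[of lborel "\<lambda>t. indicator {a..c} t *\<^sub>R H \<epsilon> t - indicator {a..c} t *\<^sub>R H 0 t"] by simp
    also have "\<dots> \<le> (LINT t|lborel. \<bar>\<epsilon>\<bar> * (C1 * \<Omega> t))"
    proof (rule integral_mono)
      show "integrable lborel (\<lambda>t. norm (indicator {a..c} t *\<^sub>R H \<epsilon> t - indicator {a..c} t *\<^sub>R H 0 t))"
        using ii[OF \<epsilon>] ii[OF z] by (intro integrable_norm Bochner_Integration.integrable_diff)
      show "integrable lborel (\<lambda>t. \<bar>\<epsilon>\<bar> * (C1 * \<Omega> t))" using \<Omega>i by (rule integrable_mult_right)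
      fix t
      show "norm (indicator {a..c} t *\<^sub>R H \<epsilon> t - indicator {a..c} t *\<^sub>R H 0 t) \<le> \<bar>\<epsilon>\<bar> * (C1 * \<Omega> t)"
        using Hd[OF \<epsilon>, of t] C1(1) \<Omega>(2)[of t] by (cases "t \<in> {a..c}") simp_all
    qed
    finally show ?thesis by simp
  qed
  show ?thesis
  proof (intro exI[of _ C] conjI allI impI)
    show "0 \<le> C" unfolding C_def using nn \<open>0 < \<epsilon>0\<close> by simp
    show "integrable lborel (zero_ext a b (\<lambda>x. grad h (X 0 x) (\<delta> x)))" using qi unfolding q_def .
    show "\<bar>I \<epsilon> c - I 0 c\<bar> \<le> \<bar>\<epsilon>\<bar> * C" if \<epsilon>: "\<bar>\<epsilon>\<bar> \<le> \<epsilon>0" for \<epsilon> c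
    proof -
      have "(LINT t|lborel. C1 * \<Omega> t) \<le> C" unfolding C_def using nn \<open>0 < \<epsilon>0\<close> by simp
      then have "\<bar>\<epsilon>\<bar> * (LINT t|lborel. C1 * \<Omega> t) \<le> \<bar>\<epsilon>\<bar> * C" by (rule mult_left_mono) simp
      then show ?thesis using diff[OF \<epsilon>, of c] by linarith
    qed
    show "\<bar>I \<epsilon> c\<bar> \<le> C" if \<epsilon>: "\<bar>\<epsilon>\<bar> \<le> \<epsilon>0" for \<epsilon> c
    proof -
      have "\<bar>I 0 c\<bar> \<le> (LINT t|lborel. norm (indicator {a..c} t *\<^sub>R H 0 t))"
        unfolding I using integral_norm_bound[of lborel "\<lambda>t. indicator {a..c} t *\<^sub>R H 0 t"] by simp
      also have "\<dots> \<le> (LINT t|lborel. \<bar>H 0 t\<bar>)"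
        using integrable_norm[OF ii[OF z]] integrable_abs[OF Hi[OF z]]
        by (rule integral_mono) (simp add: indicator_def)
      finally have 1: "\<bar>I 0 c\<bar> \<le> \<bar>LINT t|lborel. \<bar>H 0 t\<bar>\<bar>" by linarith
      have "\<bar>\<epsilon>\<bar> * (LINT t|lborel. C1 * \<Omega> t) \<le> \<epsilon>0 * (LINT t|lborel. C1 * \<Omega> t)"
        using \<epsilon> nn by (rule mult_right_mono)
      then show ?thesis using diff[OF \<epsilon>, of c] 1 nn unfolding C_def by linarith
    qed
    fix e :: "nat \<Rightarrow> real" and c assume e': "e \<longlonglongrightarrow> 0" "\<forall>n. e n \<noteq> 0" "\<forall>n. \<bar>e n\<bar> \<le> \<epsilon>0"
    then have e: "e \<longlonglongrightarrow> 0" "\<And>n. e n \<noteq> 0" "\<And>n. \<bar>e n\<bar> \<le> \<epsilon>0" by blast+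
    have "(I (e n) c - I 0 c) / e n = (LINT t|lborel. indicator {a..c} t *\<^sub>R D (e n) t)" for n
      unfolding I D_def using ii[OF e(3)] ii[OF z] by (simp add: right_diff_distrib diff_divide_distrib)
    moreover have "(\<lambda>n. LINT t|lborel. indicator {a..c} t *\<^sub>R D (e n) t) \<longlonglongrightarrow> (LINT t|lborel. indicator {a..c} t *\<^sub>R q t)"
    proof (rule integral_dominated_convergence[where w = "\<lambda>t. C1 * \<Omega> t"])
      show "AE t in lborel. (\<lambda>n. indicator {a..c} t *\<^sub>R D (e n) t) \<longlonglongrightarrow> indicator {a..c} t *\<^sub>R q t"
        using Dlim[OF e] by (intro AE_I2 tendsto_intros)
      show "AE t in lborel. norm (indicator {a..c} t *\<^sub>R D (e n) t) \<le> C1 * \<Omega> t" for n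
        using Db[OF e(3)] C1(1) \<Omega>(2) by (intro AE_I2) (auto simp: indicator_def)
    qed (use Dm[OF e(3)] qm \<Omega>i in auto)
    ultimately show "(\<lambda>n. (I (e n) c - I 0 c) / e n) \<longlonglongrightarrow>
        (LINT t:{a..c}|lborel. zero_ext a b (\<lambda>x. grad h (X 0 x) (\<delta> x)) t)"
      unfolding set_lebesgue_integral_def q_def by simp
  qed
qed

lemma set_integral_lebesgue_zero_ext:
  assumes "continuous_on {a..b} f" "{c..d} \<subseteq> {a..b}"
  shows "(LINT t:{c..d}|lebesgue. f t) = (LINT t:{c..d}|lborel. zero_ext a b f t)"
  using assms(2)
  by (intro integral_spike_lborel(2)[OF negligible_empty _ zero_ext_measurable[OF assms(1)]]) (auto simp: zero_ext_def)

lemma continuous_on_primitive: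
  assumes "a < b" "continuous_on {a..b} f"
  shows "continuous_on {a..b} (\<lambda>x. LINT t:{a..x}|lborel. zero_ext a b f t)"
proof -
  obtain V where V: "0 \<le> V" "\<And>t. \<bar>zero_ext a b f t\<bar> \<le> V" by (rule zero_ext_bounded[OF assms(2)]) (rule that)
  show ?thesis
    unfolding continuous_on_iff
  proof (intro ballI allI impI)
    fix x e :: real assume x: "x \<in> {a..b}" and e: "0 < e"
    let ?F = "\<lambda>x. LINT t:{a..x}|lborel. zero_ext a b f t"
    show "\<exists>d>0. \<forall>x'\<in>{a..b}. dist x' x < d \<longrightarrow> dist (?F x') (?F x) < e"
    proof (intro exI[of _ "e / (V + 1)"] conjI ballI impI)
      fix x' assume x': "x' \<in> {a..b}" "dist x' x < e / (V + 1)"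
      have "\<bar>?F x' - ?F x\<bar> \<le> V * \<bar>x' - x\<bar>" by (rule has_density_primitive(2)[OF assms V(2) x x'(1)])
      also have "\<dots> \<le> (V + 1) * \<bar>x' - x\<bar>" by (rule mult_right_mono) auto
      also have "\<dots> < e" using x'(2) V(1) by (simp add: dist_real_def pos_less_divide_eq mult.commute)
      finally show "dist (?F x') (?F x) < e" by (simp add: dist_real_def)
    qed (use e V(1) in simp)
  qed
qed

lemma partial_deriv_cong:
  assumes "\<And>s. f (p + s *\<^sub>R e) = h (p + s *\<^sub>R e)"
  shows "partial_deriv e f p = partial_deriv e h p"
  unfolding partial_deriv_def assms ..

text \<open>Valid even where \<open>f\<close> is not differentiable, since both sides select from
  the same derivative predicate.\<close>

lemma deriv_diff_const: "deriv (\<lambda>s. f s - c) x = deriv f (x::real)"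
proof -
  have "((\<lambda>s. f s - c) has_field_derivative D) (at x) \<longleftrightarrow> (f has_field_derivative D) (at x)" for D
    using DERIV_diff[of f D x UNIV "\<lambda>_. c" 0] DERIV_add[of "\<lambda>s. f s - c" D x UNIV "\<lambda>_. c" 0] by auto
  then show ?thesis unfolding deriv_def by simp
qed

lemma grad_basis: "(h has_derivative grad h p) (at p) \<Longrightarrow> grad h p e = partial_deriv e h p"
  by (rule partial_deriv_eqI[symmetric])

lemma grad_state:
  fixes h :: "state \<Rightarrow> real"
  assumes "(h has_derivative grad h p) (at p)"
  shows "grad h p (0, dy, dv, dw) = (\<Sum>i\<in>UNIV. dy $ i * partial_deriv (dir_y i) h p
    + dv $ i * partial_deriv (dir_v i) h p + dw $ i * partial_deriv (dir_w i) h p)"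
proof -
  interpret g: bounded_linear "grad h p" by (rule grad_linear)
  have "(0, dy, dv, dw) = (\<Sum>i\<in>UNIV. dy $ i *\<^sub>R dir_y i + dv $ i *\<^sub>R dir_v i + dw $ i *\<^sub>R dir_w i)"
    by (simp add: sum_2 vec_eq_iff forall_2 axis_def)
  then have "grad h p (0, dy, dv, dw) = (\<Sum>i\<in>UNIV. dy $ i * grad h p (dir_y i)
    + dv $ i * grad h p (dir_v i) + dw $ i * grad h p (dir_w i))"
    by (simp only: g.sum g.add g.scaleR real_scaleR_def)
  then show ?thesis by (simp only: grad_basis[OF assms])
qed

lemma grad_ext_state:
  fixes h :: "state \<times> real \<Rightarrow> real"
  assumes "(h has_derivative grad h p) (at p)"
  shows "grad h p ((0, dy, dv, dw), dz) = (\<Sum>i\<in>UNIV. dy $ i * partial_deriv (dir_y i, 0) h p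
    + dv $ i * partial_deriv (dir_v i, 0) h p + dw $ i * partial_deriv (dir_w i, 0) h p) + dz * partial_deriv (0, 1) h p"
proof -
  interpret g: bounded_linear "grad h p" by (rule grad_linear)
  have "((0, dy, dv, dw), dz) = (\<Sum>i\<in>UNIV. dy $ i *\<^sub>R (dir_y i, 0) + dv $ i *\<^sub>R (dir_v i, 0) + dw $ i *\<^sub>R (dir_w i, 0))
      + dz *\<^sub>R (0, 1::real)"
    by (simp add: sum_2 vec_eq_iff forall_2 axis_def)
  then have "grad h p ((0, dy, dv, dw), dz) = (\<Sum>i\<in>UNIV. dy $ i * grad h p (dir_y i, 0)
    + dv $ i * grad h p (dir_v i, 0) + dw $ i * grad h p (dir_w i, 0)) + dz * grad h p (0, 1)"
    by (simp only: g.sum g.add g.scaleR real_scaleR_def)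
  then show ?thesis by (simp only: grad_basis[OF assms])
qed

lemma conv_left_bound:
  assumes "0 < \<gamma>" "a \<le> x" and f: "f \<in> borel_measurable borel" "\<And>t. \<bar>f t\<bar> \<le> V" "\<And>t. t < a \<Longrightarrow> f t = 0"
  shows "integrable lborel (\<lambda>t. frac_kernel \<gamma> (x - t) * f t)"
    and "\<bar>conv_left \<gamma> f x\<bar> \<le> V * ((x - a) powr \<gamma> / \<gamma>)"
proof -
  note f(1)[measurable]
  have V: "0 \<le> V" using f(2)[of 0] by linarith
  let ?g = "\<lambda>t. V * (indicator {a..} t * frac_kernel \<gamma> (x - t))"
  have g: "integrable lborel ?g" "(LINT t|lborel. ?g t) = V * ((x - a) powr \<gamma> / \<gamma>)"
    using frac_kernel_integral_left[OF assms(1,2)] by auto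
  have b: "norm (frac_kernel \<gamma> (x - t) * f t) \<le> ?g t" for t
    using f(3)[of t] mult_right_mono[OF f(2)[of t] frac_kernel_nonneg[of \<gamma> "x - t"]]
    by (cases "t < a") (auto simp: abs_mult mult.commute)
  show i: "integrable lborel (\<lambda>t. frac_kernel \<gamma> (x - t) * f t)"
  proof (rule Bochner_Integration.integrable_bound[OF g(1)])
    have "norm (frac_kernel \<gamma> (x - t) * f t) \<le> norm (?g t)" for t
      unfolding real_norm_def[of "?g t"] by (rule order_trans[OF b abs_ge_self])
    then show "AE t in lborel. norm (frac_kernel \<gamma> (x - t) * f t) \<le> norm (?g t)" by (rule AE_I2)
  qed measurable
  have "\<bar>conv_left \<gamma> f x\<bar> \<le> (LINT t|lborel. norm (frac_kernel \<gamma> (x - t) * f t))"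
    using integral_norm_bound[of lborel "\<lambda>t. frac_kernel \<gamma> (x - t) * f t"] unfolding conv_left_def by simp
  also have "\<dots> \<le> (LINT t|lborel. ?g t)" by (rule integral_mono[OF integrable_norm[OF i] g(1) b])
  finally show "\<bar>conv_left \<gamma> f x\<bar> \<le> V * ((x - a) powr \<gamma> / \<gamma>)" unfolding g(2) .
qed

text \<open>The operator is linear with a nonnegative integrable kernel: uniform bounds pass through
  it with the total mass of the kernel as factor, and limits of difference quotients by dominated
  convergence.\<close>

lemma rl_int_family_limit:
  fixes f :: "real \<Rightarrow> real \<Rightarrow> real"
  assumes "0 < \<beta>" "a < b" "0 < \<epsilon>0"
    and fc: "\<And>\<epsilon>. \<bar>\<epsilon>\<bar> \<le> \<epsilon>0 \<Longrightarrow> continuous_on {a..b} (f \<epsilon>)"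
    and bnd: "\<And>\<epsilon> x. \<bar>\<epsilon>\<bar> \<le> \<epsilon>0 \<Longrightarrow> x \<in> {a..b} \<Longrightarrow> \<bar>f \<epsilon> x\<bar> \<le> B"
    and dom: "\<And>\<epsilon> x. \<bar>\<epsilon>\<bar> \<le> \<epsilon>0 \<Longrightarrow> x \<in> {a..b} \<Longrightarrow> \<bar>f \<epsilon> x - f 0 x\<bar> \<le> \<bar>\<epsilon>\<bar> * B"
    and lim: "\<And>e x. e \<longlonglongrightarrow> 0 \<Longrightarrow> (\<And>n. e n \<noteq> 0) \<Longrightarrow> (\<And>n. \<bar>e n\<bar> \<le> \<epsilon>0) \<Longrightarrow> x \<in> {a..b} \<Longrightarrow>
      (\<lambda>n. (f (e n) x - f 0 x) / e n) \<longlonglongrightarrow> d x"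
    and dc: "continuous_on {a..b} d"
  defines "C \<equiv> B * ((b - a) powr \<beta> / \<beta>) / Gamma \<beta>"
  shows "\<And>\<epsilon> x. \<bar>\<epsilon>\<bar> \<le> \<epsilon>0 \<Longrightarrow> x \<in> {a..b} \<Longrightarrow> \<bar>rl_int_left \<beta> a (f \<epsilon>) x\<bar> \<le> C"
    and "\<And>\<epsilon> x. \<bar>\<epsilon>\<bar> \<le> \<epsilon>0 \<Longrightarrow> x \<in> {a..b} \<Longrightarrow> \<bar>rl_int_left \<beta> a (f \<epsilon>) x - rl_int_left \<beta> a (f 0) x\<bar> \<le> \<bar>\<epsilon>\<bar> * C"
    and "\<And>e x. e \<longlonglongrightarrow> 0 \<Longrightarrow> (\<And>n. e n \<noteq> 0) \<Longrightarrow> (\<And>n. \<bar>e n\<bar> \<le> \<epsilon>0) \<Longrightarrow> x \<in> {a..b} \<Longrightarrow>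
      (\<lambda>n. (rl_int_left \<beta> a (f (e n)) x - rl_int_left \<beta> a (f 0) x) / e n)
        \<longlonglongrightarrow> conv_left \<beta> (zero_ext a b d) x / Gamma \<beta>"
proof -
  have G: "0 < Gamma \<beta>" using \<open>0 < \<beta>\<close> by (rule Gamma_real_pos)
  have z: "\<bar>0::real\<bar> \<le> \<epsilon>0" using \<open>0 < \<epsilon>0\<close> by simp
  have B0: "0 \<le> B" using bnd[OF z, of a] \<open>a < b\<close> by (auto intro: order_trans[OF abs_ge_zero])
  define F where "F \<epsilon> = zero_ext a b (f \<epsilon>)" for \<epsilon>
  have Fm: "F \<epsilon> \<in> borel_measurable borel" if "\<bar>\<epsilon>\<bar> \<le> \<epsilon>0" for \<epsilon>
    unfolding F_def by (rule zero_ext_measurable[OF fc[OF that]])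
  have Fb: "\<bar>F \<epsilon> t\<bar> \<le> B" if "\<bar>\<epsilon>\<bar> \<le> \<epsilon>0" for \<epsilon> t
    using bnd[OF that, of t] B0 by (auto simp: F_def zero_ext_def)
  have F0: "F \<epsilon> t = 0" if "t < a" for \<epsilon> t using that by (simp add: F_def zero_ext_def)
  have Fd: "\<bar>F \<epsilon> t - F 0 t\<bar> \<le> \<bar>\<epsilon>\<bar> * B" if "\<bar>\<epsilon>\<bar> \<le> \<epsilon>0" for \<epsilon> t
    using dom[OF that, of t] B0 by (auto simp: F_def zero_ext_def)
  have rl: "rl_int_left \<beta> a (f \<epsilon>) x = conv_left \<beta> (F \<epsilon>) x / Gamma \<beta>" if "\<bar>\<epsilon>\<bar> \<le> \<epsilon>0" "x \<in> {a..b}" for \<epsilon> x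
    unfolding F_def by (rule rl_int_left_continuous(2)[OF \<open>0 < \<beta>\<close> fc[OF that(1)] that(2)])
  have mono: "V * ((x - a) powr \<beta> / \<beta>) / Gamma \<beta> \<le> V * ((b - a) powr \<beta> / \<beta>) / Gamma \<beta>"
    if "0 \<le> V" "x \<in> {a..b}" for V x
    using that G \<open>0 < \<beta>\<close> by (intro divide_right_mono mult_left_mono powr_mono2) auto
  show "\<bar>rl_int_left \<beta> a (f \<epsilon>) x\<bar> \<le> C" if \<epsilon>: "\<bar>\<epsilon>\<bar> \<le> \<epsilon>0" and x: "x \<in> {a..b}" for \<epsilon> x
  proof -
    have "\<bar>conv_left \<beta> (F \<epsilon>) x\<bar> / Gamma \<beta> \<le> B * ((x - a) powr \<beta> / \<beta>) / Gamma \<beta>"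
      using G x by (intro divide_right_mono conv_left_bound(2)[OF \<open>0 < \<beta>\<close> _ Fm[OF \<epsilon>] Fb[OF \<epsilon>] F0]) auto
    then show ?thesis unfolding rl[OF \<epsilon> x] C_def using G mono[OF B0 x] by (simp add: abs_divide)
  qed
  have cd: "conv_left \<beta> (F \<epsilon>) x - conv_left \<beta> (F 0) x = conv_left \<beta> (\<lambda>t. F \<epsilon> t - F 0 t) x"
    if \<epsilon>: "\<bar>\<epsilon>\<bar> \<le> \<epsilon>0" and x: "x \<in> {a..b}" for \<epsilon> x
    unfolding conv_left_def right_diff_distrib
    using x conv_left_bound(1)[OF \<open>0 < \<beta>\<close> _ Fm[OF \<epsilon>] Fb[OF \<epsilon>] F0] conv_left_bound(1)[OF \<open>0 < \<beta>\<close> _ Fm[OF z] Fb[OF z] F0]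
    by (intro Bochner_Integration.integral_diff[symmetric]) auto
  show "\<bar>rl_int_left \<beta> a (f \<epsilon>) x - rl_int_left \<beta> a (f 0) x\<bar> \<le> \<bar>\<epsilon>\<bar> * C"
    if \<epsilon>: "\<bar>\<epsilon>\<bar> \<le> \<epsilon>0" and x: "x \<in> {a..b}" for \<epsilon> x
  proof -
    have "\<bar>conv_left \<beta> (\<lambda>t. F \<epsilon> t - F 0 t) x\<bar> \<le> (\<bar>\<epsilon>\<bar> * B) * ((x - a) powr \<beta> / \<beta>)"
      using x Fm[OF \<epsilon>] Fm[OF z] Fd[OF \<epsilon>] F0
      by (intro conv_left_bound(2)[OF \<open>0 < \<beta>\<close>]) auto
    then have "\<bar>conv_left \<beta> (\<lambda>t. F \<epsilon> t - F 0 t) x\<bar> / Gamma \<beta> \<le> (\<bar>\<epsilon>\<bar> * B) * ((x - a) powr \<beta> / \<beta>) / Gamma \<beta>"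
      using G by (intro divide_right_mono) auto
    also have "\<dots> \<le> (\<bar>\<epsilon>\<bar> * B) * ((b - a) powr \<beta> / \<beta>) / Gamma \<beta>" using B0 by (intro mono x) auto
    finally show ?thesis unfolding rl[OF \<epsilon> x] rl[OF z x] C_def diff_divide_distrib[symmetric] cd[OF \<epsilon> x]
      using G by (simp add: abs_divide mult.assoc)
  qed
  fix e :: "nat \<Rightarrow> real" and x assume e: "e \<longlonglongrightarrow> 0" "\<And>n. e n \<noteq> 0" "\<And>n. \<bar>e n\<bar> \<le> \<epsilon>0" and x: "x \<in> {a..b}"
  define D where "D n t = (F (e n) t - F 0 t) / e n" for n t
  have Dm[measurable]: "D n \<in> borel_measurable borel" for n
    unfolding D_def[abs_def] using Fm[OF e(3)] Fm[OF z] by measurable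
  have Db: "\<bar>D n t\<bar> \<le> B" for n t
    using Fd[OF e(3), of n t] e(2)[of n] unfolding D_def by (simp add: abs_divide field_simps)
  have Dl: "(\<lambda>n. D n t) \<longlonglongrightarrow> zero_ext a b d t" for t
  proof (cases "t \<in> {a..b}")
    case True
    then show ?thesis using lim[OF e True] unfolding D_def F_def by (simp add: zero_ext_simps)
  next
    case False
    then show ?thesis unfolding D_def F_def zero_ext_simps(2)[OF False] by simp
  qed
  have "(\<lambda>n. conv_left \<beta> (D n) x) \<longlonglongrightarrow> conv_left \<beta> (zero_ext a b d) x"
    unfolding conv_left_def
  proof (rule integral_dominated_convergence[where w = "\<lambda>t. B * (indicator {a..} t * frac_kernel \<beta> (x - t))"])
    show "(\<lambda>t. frac_kernel \<beta> (x - t) * zero_ext a b d t) \<in> borel_measurable lborel"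
      using zero_ext_measurable[OF dc] by measurable
    show "integrable lborel (\<lambda>t. B * (indicator {a..} t * frac_kernel \<beta> (x - t)))"
      using frac_kernel_integral_left(1)[OF \<open>0 < \<beta>\<close>, of a x] x by auto
    show "AE t in lborel. (\<lambda>n. frac_kernel \<beta> (x - t) * D n t) \<longlonglongrightarrow> frac_kernel \<beta> (x - t) * zero_ext a b d t"
      by (intro AE_I2 tendsto_intros Dl)
    show "AE t in lborel. norm (frac_kernel \<beta> (x - t) * D n t) \<le> B * (indicator {a..} t * frac_kernel \<beta> (x - t))" for n
    proof (rule AE_I2)
      fix t
      have "t < a \<Longrightarrow> D n t = 0" by (simp add: D_def F0)
      then show "norm (frac_kernel \<beta> (x - t) * D n t) \<le> B * (indicator {a..} t * frac_kernel \<beta> (x - t))"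
        using mult_right_mono[OF Db[of n t] frac_kernel_nonneg[of \<beta> "x - t"]]
        by (cases "t < a") (auto simp: abs_mult mult.commute)
    qed
  qed measurable
  moreover have "(rl_int_left \<beta> a (f (e n)) x - rl_int_left \<beta> a (f 0) x) / e n = conv_left \<beta> (D n) x / Gamma \<beta>" for n
  proof -
    have "conv_left \<beta> (D n) x = conv_left \<beta> (\<lambda>t. F (e n) t - F 0 t) x / e n"
      unfolding conv_left_def D_def by simp
    then show ?thesis unfolding rl[OF e(3) x] rl[OF z x] diff_divide_distrib[symmetric] cd[OF e(3) x] by simp
  qed
  ultimately show "(\<lambda>n. (rl_int_left \<beta> a (f (e n)) x - rl_int_left \<beta> a (f 0) x) / e n)
        \<longlonglongrightarrow> conv_left \<beta> (zero_ext a b d) x / Gamma \<beta>"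
    using G by (simp add: tendsto_divide)
qed

lemma norm_triple_le:
  "norm ((dy, dv, dw) :: (real^2) \<times> (real^2) \<times> (real^2)) \<le> (\<Sum>i\<in>UNIV. \<bar>dy $ i\<bar> + \<bar>dv $ i\<bar> + \<bar>dw $ i\<bar>)"
proof -
  have "norm (dy, dv, dw) \<le> norm dy + (norm dv + norm dw)"
    by (intro order_trans[OF norm_Pair_le] add_left_mono norm_Pair_le)
  then show ?thesis
    using norm_le_l1_cart[of dy] norm_le_l1_cart[of dv] norm_le_l1_cart[of dw] by (simp add: sum.distrib)
qed

text \<open>\<open>hL\<close> and \<open>hl\<close> are smooth extensions that agree with
  \<open>L\<close> and \<open>l\<close> over the strip. Minimality is expressed with
  \<open>G\<close> and with the boundary values of \<open>y\<close> itself.\<close>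

locale fractional_problem = constraint +
  fixes \<alpha> \<beta> :: real and L hL :: "state \<times> real \<Rightarrow> real" and l hl :: "state \<Rightarrow> real"
    and UL Ul and y :: "real \<Rightarrow> real^2"
  assumes \<alpha>: "0 < \<alpha>" "\<alpha> < 1" and \<beta>: "0 < \<beta>"
    and UL: "open UL" "({a..b} \<times> UNIV) \<times> UNIV \<subseteq> UL" "\<And>k. Ck_on k hL UL"
      "\<And>p. p \<in> ({a..b} \<times> UNIV) \<times> UNIV \<Longrightarrow> hL p = L p"
    and Ul: "open Ul" "{a..b} \<times> UNIV \<subseteq> Ul" "\<And>k. Ck_on k hl Ul" "\<And>p. p \<in> {a..b} \<times> UNIV \<Longrightarrow> hl p = l p"
    and y_traj: "\<And>i. (\<lambda>x. y x $ i) \<in> traj_class \<alpha> \<beta> a b"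
    and y_G: "\<And>x. x \<in> {a..b} \<Longrightarrow> G (x, y x) = 0"
    and minimal: "\<And>u. (\<And>i. (\<lambda>x. u x $ i) \<in> traj_class \<alpha> \<beta> a b) \<Longrightarrow> u a = y a \<Longrightarrow> u b = y b \<Longrightarrow>
      (\<And>x. x \<in> {a..b} \<Longrightarrow> G (x, u x) = 0) \<Longrightarrow> functional \<alpha> \<beta> a b L l y \<le> functional \<alpha> \<beta> a b L l u"
begin

lemma traj_continuous:
  assumes "\<And>i. (\<lambda>x. u x $ i) \<in> traj_class \<alpha> \<beta> a b"
  shows "continuous_on {a..b} u"
proof -
  have "continuous_on {a..b} (\<lambda>x. \<chi> i. u x $ i)"
    using assms abs_continuous_on_imp_continuous unfolding traj_class_def
    by (intro continuous_on_vec_lambda) blast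
  then show ?thesis by simp
qed

lemma jet_continuous:
  assumes u: "\<And>i. (\<lambda>x. u x $ i) \<in> traj_class \<alpha> \<beta> a b"
  shows "continuous_on {a..b} (jet \<alpha> \<beta> a u)"
  unfolding jet_def[abs_def]
  using u traj_continuous[OF u] unfolding traj_class_def
  by (intro continuous_on_Pair continuous_on_id continuous_on_vec_lambda) auto

lemma l_jet_continuous:
  assumes u: "\<And>i. (\<lambda>x. u x $ i) \<in> traj_class \<alpha> \<beta> a b"
  shows "continuous_on {a..b} (\<lambda>t. hl (jet \<alpha> \<beta> a u t))"
  using Ul(2) by (intro continuous_on_compose2[OF Ck_on_continuous_on[OF Ul(1) Ul(3)[of 0]] jet_continuous[OF u]])
    (auto simp: jet_def)

lemma ext_jet_eq:
  assumes u: "\<And>i. (\<lambda>x. u x $ i) \<in> traj_class \<alpha> \<beta> a b" and x: "x \<in> {a..b}"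
  shows "ext_jet \<alpha> \<beta> a l u x = (jet \<alpha> \<beta> a u x, LINT t:{a..x}|lborel. zero_ext a b (\<lambda>t. hl (jet \<alpha> \<beta> a u t)) t)"
proof -
  have "(LINT t:{a..x}|lebesgue. l (jet \<alpha> \<beta> a u t)) = (LINT t:{a..x}|lebesgue. hl (jet \<alpha> \<beta> a u t))"
    unfolding set_lebesgue_integral_def
  proof (rule Bochner_Integration.integral_cong[OF refl])
    fix t
    have "t \<in> {a..x} \<Longrightarrow> hl (jet \<alpha> \<beta> a u t) = l (jet \<alpha> \<beta> a u t)"
      using x by (intro Ul(4)) (auto simp: jet_def)
    then show "indicator {a..x} t *\<^sub>R l (jet \<alpha> \<beta> a u t) = indicator {a..x} t *\<^sub>R hl (jet \<alpha> \<beta> a u t)"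
      by (auto simp: indicator_def)
  qed
  also have "\<dots> = (LINT t:{a..x}|lborel. zero_ext a b (\<lambda>t. hl (jet \<alpha> \<beta> a u t)) t)"
    using x by (intro set_integral_lebesgue_zero_ext l_jet_continuous[OF u]) auto
  finally show ?thesis unfolding ext_jet_def by simp
qed

lemma ext_jet_continuous:
  assumes u: "\<And>i. (\<lambda>x. u x $ i) \<in> traj_class \<alpha> \<beta> a b"
  shows "continuous_on {a..b} (ext_jet \<alpha> \<beta> a l u)"
proof -
  have "continuous_on {a..b} (\<lambda>x. (jet \<alpha> \<beta> a u x, LINT t:{a..x}|lborel. zero_ext a b (\<lambda>t. hl (jet \<alpha> \<beta> a u t)) t))"
    by (intro continuous_on_Pair jet_continuous[OF u] continuous_on_primitive[OF ab l_jet_continuous[OF u]])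
  then show ?thesis by (rule continuous_on_eq) (simp add: ext_jet_eq[OF u])
qed

lemma ext_jet_mem: "x \<in> {a..b} \<Longrightarrow> ext_jet \<alpha> \<beta> a l u x \<in> ({a..b} \<times> UNIV) \<times> UNIV"
  by (simp add: ext_jet_def jet_def)

lemma functional_eq:
  assumes u: "\<And>i. (\<lambda>x. u x $ i) \<in> traj_class \<alpha> \<beta> a b"
  shows "functional \<alpha> \<beta> a b L l u = (LINT t:{a..b}|lborel. zero_ext a b (\<lambda>t. hL (ext_jet \<alpha> \<beta> a l u t)) t)"
proof -
  have "functional \<alpha> \<beta> a b L l u = (LINT t:{a..b}|lebesgue. hL (ext_jet \<alpha> \<beta> a l u t))"
    unfolding functional_def set_lebesgue_integral_def
  proof (rule Bochner_Integration.integral_cong[OF refl])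
    fix t show "indicator {a..b} t *\<^sub>R L (ext_jet \<alpha> \<beta> a l u t) = indicator {a..b} t *\<^sub>R hL (ext_jet \<alpha> \<beta> a l u t)"
      using UL(4)[OF ext_jet_mem[of t u]] by (auto simp: indicator_def)
  qed
  also have "\<dots> = (LINT t:{a..b}|lborel. zero_ext a b (\<lambda>t. hL (ext_jet \<alpha> \<beta> a l u t)) t)"
  proof (rule set_integral_lebesgue_zero_ext)
    show "continuous_on {a..b} (\<lambda>t. hL (ext_jet \<alpha> \<beta> a l u t))"
      using UL(2) ext_jet_mem
      by (intro continuous_on_compose2[OF Ck_on_continuous_on[OF UL(1) UL(3)[of 0]] ext_jet_continuous[OF u]]) blast
  qed simp
  finally show ?thesis .
qed

text \<open>The \<epsilon>-derivative at 0 of the jet along a variation with densities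
  \<open>q i\<close>; the leading 0 reflects that \<open>x\<close> is not varied.\<close>

definition direction :: "(2 \<Rightarrow> real \<Rightarrow> real) \<Rightarrow> real \<Rightarrow> state" where
  "direction q x = (0, \<chi> i. (LINT t:{a..x}|lborel. q i t), \<chi> i. conv_left (1 - \<alpha>) (q i) x / Gamma (1 - \<alpha>),
     \<chi> i. conv_left \<beta> (zero_ext a b (\<lambda>x. LINT t:{a..x}|lborel. q i t)) x / Gamma \<beta>)"

definition direction_l :: "(2 \<Rightarrow> real \<Rightarrow> real) \<Rightarrow> real \<Rightarrow> real" where
  "direction_l q = zero_ext a b (\<lambda>t. grad hl (jet \<alpha> \<beta> a y t) (direction q t))"

text \<open>The last slot of the direction is the variation of \<open>z\<close>, the primitive of
  the variation of its integrand.\<close>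

definition direction_L :: "(2 \<Rightarrow> real \<Rightarrow> real) \<Rightarrow> real \<Rightarrow> real" where
  "direction_L q = zero_ext a b (\<lambda>x. grad hL (ext_jet \<alpha> \<beta> a l y x) (direction q x, LINT t:{a..x}|lborel. direction_l q t))"

text \<open>\<open>integral_first_variation\<close> acts twice: for \<open>hl\<close> along the
  jets, which supplies the variation of \<open>z\<close> and a bound for \<open>z\<close>, and then
  for \<open>hL\<close> along the jets extended by \<open>z\<close>.\<close>

lemma first_variation:
  assumes \<kappa>: "continuous_on {a..b} \<kappa>" and mean: "(LINT t:{a..b}|lborel. zero_ext a b \<kappa> t) = 0"
  obtains q where
    "\<And>i. integrable lborel (q i)" "\<And>i t. t \<notin> {a..b} \<Longrightarrow> q i t = 0" "q 1 = zero_ext a b \<kappa>"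
    "\<And>x. x \<in> {a..b} \<Longrightarrow> (LINT t:{a..x}|lborel. q 2 t) = slope1 (x, y x) * (LINT t:{a..x}|lborel. q 1 t)"
    "integrable lborel (direction_l q)" "integrable lborel (direction_L q)"
    "(LINT x:{a..b}|lborel. direction_L q x) = 0"
proof -
  obtain \<epsilon>0 B :: real and u :: "real \<Rightarrow> real \<Rightarrow> real^2" and q :: "2 \<Rightarrow> real \<Rightarrow> real" and W :: "real \<Rightarrow> real"
  where v: "0 < \<epsilon>0" "u 0 = y"
    "\<And>\<epsilon> i. \<bar>\<epsilon>\<bar> \<le> \<epsilon>0 \<Longrightarrow> (\<lambda>x. u \<epsilon> x $ i) \<in> traj_class \<alpha> \<beta> a b"
    "\<And>\<epsilon>. \<bar>\<epsilon>\<bar> \<le> \<epsilon>0 \<Longrightarrow> u \<epsilon> a = y a \<and> u \<epsilon> b = y b"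
    "\<And>\<epsilon> x. \<bar>\<epsilon>\<bar> \<le> \<epsilon>0 \<Longrightarrow> x \<in> {a..b} \<Longrightarrow> G (x, u \<epsilon> x) = 0"
    "\<And>i. integrable lborel (q i)" "\<And>i t. t \<notin> {a..b} \<Longrightarrow> q i t = 0" "q 1 = zero_ext a b \<kappa>"
    "\<And>x. x \<in> {a..b} \<Longrightarrow> (LINT t:{a..x}|lborel. q 2 t) = slope1 (x, y x) * (LINT t:{a..x}|lborel. q 1 t)"
    "\<And>\<epsilon> x i. \<bar>\<epsilon>\<bar> \<le> \<epsilon>0 \<Longrightarrow> x \<in> {a..b} \<Longrightarrow> \<bar>u \<epsilon> x $ i\<bar> \<le> B"
    "\<And>\<epsilon> x i. \<bar>\<epsilon>\<bar> \<le> \<epsilon>0 \<Longrightarrow> x \<in> {a..b} \<Longrightarrow> \<bar>caputo_left \<alpha> a (\<lambda>t. u \<epsilon> t $ i) x\<bar> \<le> B"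
    "\<And>\<epsilon> x i. \<bar>\<epsilon>\<bar> \<le> \<epsilon>0 \<Longrightarrow> x \<in> {a..b} \<Longrightarrow> \<bar>u \<epsilon> x $ i - y x $ i\<bar> \<le> \<bar>\<epsilon>\<bar> * B"
    "\<And>\<epsilon> x i. \<bar>\<epsilon>\<bar> \<le> \<epsilon>0 \<Longrightarrow> x \<in> {a..b} \<Longrightarrow>
       \<bar>caputo_left \<alpha> a (\<lambda>t. u \<epsilon> t $ i) x - caputo_left \<alpha> a (\<lambda>t. y t $ i) x\<bar> \<le> \<bar>\<epsilon>\<bar> * W x"
    "integrable lborel W" "\<And>x. x \<notin> {a..b} \<Longrightarrow> W x = 0"
    "\<And>e x i. e \<longlonglongrightarrow> 0 \<Longrightarrow> (\<And>n. e n \<noteq> 0) \<Longrightarrow> (\<And>n. \<bar>e n\<bar> \<le> \<epsilon>0) \<Longrightarrow> x \<in> {a..b} \<Longrightarrow>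
       (\<lambda>n. (u (e n) x $ i - y x $ i) / e n) \<longlonglongrightarrow> (LINT t:{a..x}|lborel. q i t)"
    "\<And>e x i. e \<longlonglongrightarrow> 0 \<Longrightarrow> (\<And>n. e n \<noteq> 0) \<Longrightarrow> (\<And>n. \<bar>e n\<bar> \<le> \<epsilon>0) \<Longrightarrow> x \<in> {a..b} \<Longrightarrow>
       (\<lambda>n. (caputo_left \<alpha> a (\<lambda>t. u (e n) t $ i) x - caputo_left \<alpha> a (\<lambda>t. y t $ i) x) / e n)
         \<longlonglongrightarrow> conv_left (1 - \<alpha>) (q i) x / Gamma (1 - \<alpha>)"
  proof (rule constrained_variation[OF \<alpha> \<beta> y_traj y_G \<kappa> mean], goal_cases)
    case (1 x)
    then show ?case by simp
  next
    case (2 \<epsilon>0 B u q W)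
    show ?case by (rule that[of \<epsilon>0 u q B W]; fact)
  qed
  have z: "\<bar>0::real\<bar> \<le> \<epsilon>0" using v(1) by simp
  have B0: "0 \<le> B" using v(10)[OF z, of a 1] ab by (auto intro: order_trans[OF abs_ge_zero])
  define dY where "dY i x = (LINT t:{a..x}|lborel. q i t)" for i x
  have dYc: "continuous_on {a..b} (dY i)" for i
  proof -
    have 1: "continuous_on {a..b} (dY 1)"
      unfolding dY_def v(8) by (rule continuous_on_primitive[OF ab \<kappa>])
    have "continuous_on {a..b} (\<lambda>x. slope1 (x, y x) * dY 1 x)"
      by (intro continuous_on_mult curve_slope_continuous traj_continuous[OF y_traj] 1)
    then have "continuous_on {a..b} (dY 2)" by (rule continuous_on_eq) (simp add: dY_def v(9))
    then show ?thesis using 1 exhaust_2[of i] by auto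
  qed
  define C where "C = B * ((b - a) powr \<beta> / \<beta>) / Gamma \<beta>"
  have C0: "0 \<le> C" unfolding C_def using B0 \<beta> Gamma_real_pos[OF \<beta>] by simp
  have uc: "continuous_on {a..b} (\<lambda>x. u \<epsilon> x $ i)" if "\<bar>\<epsilon>\<bar> \<le> \<epsilon>0" for \<epsilon> i
    using v(3)[OF that] abs_continuous_on_imp_continuous unfolding traj_class_def by blast
  have D0: "\<bar>u \<epsilon> x $ i - u 0 x $ i\<bar> \<le> \<bar>\<epsilon>\<bar> * B" if "\<bar>\<epsilon>\<bar> \<le> \<epsilon>0" "x \<in> {a..b}" for \<epsilon> x i
    unfolding v(2) by (rule v(12)[OF that])
  have L0: "(\<lambda>n. (u (e n) x $ i - u 0 x $ i) / e n) \<longlonglongrightarrow> dY i x"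
    if "e \<longlonglongrightarrow> 0" "\<And>n. e n \<noteq> 0" "\<And>n. \<bar>e n\<bar> \<le> \<epsilon>0" "x \<in> {a..b}" for e x i
    unfolding v(2) dY_def by (rule v(16)[OF that])
  have R1: "\<bar>rl_int_left \<beta> a (\<lambda>t. u \<epsilon> t $ i) x\<bar> \<le> C" if "\<bar>\<epsilon>\<bar> \<le> \<epsilon>0" "x \<in> {a..b}" for \<epsilon> x i
    unfolding C_def
    by (rule rl_int_family_limit(1)[where f = "\<lambda>\<epsilon> t. u \<epsilon> t $ i" and d = "dY i",
        OF \<beta> ab v(1)]) (fact | rule uc v(10) D0 L0 dYc; assumption)+
  have R2: "\<bar>rl_int_left \<beta> a (\<lambda>t. u \<epsilon> t $ i) x - rl_int_left \<beta> a (\<lambda>t. y t $ i) x\<bar> \<le> \<bar>\<epsilon>\<bar> * C"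
    if "\<bar>\<epsilon>\<bar> \<le> \<epsilon>0" "x \<in> {a..b}" for \<epsilon> x i
    unfolding C_def v(2)[symmetric]
    by (rule rl_int_family_limit(2)[where f = "\<lambda>\<epsilon> t. u \<epsilon> t $ i" and d = "dY i",
        OF \<beta> ab v(1)]) (fact | rule uc v(10) D0 L0 dYc; assumption)+
  have R3: "(\<lambda>n. (rl_int_left \<beta> a (\<lambda>t. u (e n) t $ i) x - rl_int_left \<beta> a (\<lambda>t. y t $ i) x) / e n)
        \<longlonglongrightarrow> conv_left \<beta> (zero_ext a b (dY i)) x / Gamma \<beta>"
    if "e \<longlonglongrightarrow> 0" "\<And>n. e n \<noteq> 0" "\<And>n. \<bar>e n\<bar> \<le> \<epsilon>0" "x \<in> {a..b}" for e x i
    unfolding v(2)[symmetric]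
    by (rule rl_int_family_limit(3)[where f = "\<lambda>\<epsilon> t. u \<epsilon> t $ i" and d = "dY i" and B = B,
        OF \<beta> ab v(1)]) (fact | rule uc v(10) D0 L0 dYc; assumption)+
  define X where "X \<epsilon> = jet \<alpha> \<beta> a (u \<epsilon>)" for \<epsilon>
  \<comment> \<open>Twice \<open>B + B + C\<close>: two components, each with its value, Caputo
    derivative and fractional integral.\<close>
  define M where "M = 4 * B + 2 * C"
  define K where "K = {a..b} \<times> (cball 0 M :: ((real^2) \<times> (real^2) \<times> (real^2)) set)"
  have K: "compact K" "convex K" "K \<subseteq> Ul"
    using Ul(2) unfolding K_def by (auto intro!: compact_Times convex_Times)
  have XK: "X \<epsilon> x \<in> K" if "\<bar>\<epsilon>\<bar> \<le> \<epsilon>0" "x \<in> {a..b}" for \<epsilon> x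
  proof -
    let ?n = "(u \<epsilon> x, (\<chi> i. caputo_left \<alpha> a (\<lambda>t. u \<epsilon> t $ i) x), (\<chi> i. rl_int_left \<beta> a (\<lambda>t. u \<epsilon> t $ i) x)) :: (real^2) \<times> (real^2) \<times> (real^2)"
    have "norm ?n \<le> (\<Sum>i\<in>UNIV. \<bar>u \<epsilon> x $ i\<bar> + \<bar>caputo_left \<alpha> a (\<lambda>t. u \<epsilon> t $ i) x\<bar> + \<bar>rl_int_left \<beta> a (\<lambda>t. u \<epsilon> t $ i) x\<bar>)"
      using norm_triple_le[of "u \<epsilon> x" "\<chi> i. caputo_left \<alpha> a (\<lambda>t. u \<epsilon> t $ i) x" "\<chi> i. rl_int_left \<beta> a (\<lambda>t. u \<epsilon> t $ i) x"] by simp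
    also have "\<dots> \<le> (\<Sum>i\<in>(UNIV::2 set). B + B + C)"
      using v(10)[OF that] v(11)[OF that] R1[OF that] by (intro sum_mono add_mono)
    also have "\<dots> = M" unfolding M_def by (simp add: sum_2)
    finally show ?thesis using that(2) unfolding X_def jet_def K_def by simp
  qed
  have Xc: "continuous_on {a..b} (X \<epsilon>)" if "\<bar>\<epsilon>\<bar> \<le> \<epsilon>0" for \<epsilon>
    unfolding X_def by (rule jet_continuous[OF v(3)[OF that]])
  define \<Omega> where "\<Omega> x = zero_ext a b (\<lambda>_. 2 * B + 2 * C) x + 2 * \<bar>W x\<bar>" for x
  have \<Omega>: "integrable lborel \<Omega>" "0 \<le> \<Omega> x" for x
  proof -
    show "integrable lborel \<Omega>" unfolding \<Omega>_def[abs_def]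
      by (intro Bochner_Integration.integrable_add zero_ext_integrable integrable_mult_right integrable_abs v(14) continuous_on_const)
    show "0 \<le> \<Omega> x" using B0 C0 by (simp add: \<Omega>_def zero_ext_def)
  qed
  have dom: "norm (X \<epsilon> x - X 0 x) \<le> \<bar>\<epsilon>\<bar> * \<Omega> x" if "\<bar>\<epsilon>\<bar> \<le> \<epsilon>0" "x \<in> {a..b}" for \<epsilon> x
  proof -
    let ?c = "\<lambda>i. caputo_left \<alpha> a (\<lambda>t. u \<epsilon> t $ i) x - caputo_left \<alpha> a (\<lambda>t. y t $ i) x"
    let ?r = "\<lambda>i. rl_int_left \<beta> a (\<lambda>t. u \<epsilon> t $ i) x - rl_int_left \<beta> a (\<lambda>t. y t $ i) x"
    have "X \<epsilon> x - X 0 x = (0, u \<epsilon> x - y x, \<chi> i. ?c i, \<chi> i. ?r i)"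
      unfolding X_def jet_def v(2) by (simp add: vec_eq_iff)
    then have "norm (X \<epsilon> x - X 0 x) = norm (u \<epsilon> x - y x, \<chi> i. ?c i, \<chi> i. ?r i)" by (simp add: norm_Pair)
    also have "\<dots> \<le> (\<Sum>i\<in>UNIV. \<bar>u \<epsilon> x $ i - y x $ i\<bar> + \<bar>?c i\<bar> + \<bar>?r i\<bar>)"
      using norm_triple_le[of "u \<epsilon> x - y x" "\<chi> i. ?c i" "\<chi> i. ?r i"] by simp
    also have "\<dots> \<le> (\<Sum>i\<in>(UNIV::2 set). \<bar>\<epsilon>\<bar> * B + \<bar>\<epsilon>\<bar> * \<bar>W x\<bar> + \<bar>\<epsilon>\<bar> * C)"
      using v(12)[OF that] order_trans[OF v(13)[OF that] mult_left_mono[OF abs_ge_self abs_ge_zero]] R2[OF that]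
      by (intro sum_mono add_mono) 
    also have "\<dots> = \<bar>\<epsilon>\<bar> * \<Omega> x" using that(2) by (simp add: sum_2 \<Omega>_def zero_ext_def algebra_simps)
    finally show ?thesis .
  qed
  have lim: "(\<lambda>n. (X (e n) x - X 0 x) /\<^sub>R e n) \<longlonglongrightarrow> direction q x"
    if e: "e \<longlonglongrightarrow> 0" "\<And>n. e n \<noteq> 0" "\<And>n. \<bar>e n\<bar> \<le> \<epsilon>0" "x \<in> {a..b}" for e x
  proof -
    have "(X (e n) x - X 0 x) /\<^sub>R e n = (0, \<chi> i. (u (e n) x $ i - y x $ i) / e n,
        \<chi> i. (caputo_left \<alpha> a (\<lambda>t. u (e n) t $ i) x - caputo_left \<alpha> a (\<lambda>t. y t $ i) x) / e n,
        \<chi> i. (rl_int_left \<beta> a (\<lambda>t. u (e n) t $ i) x - rl_int_left \<beta> a (\<lambda>t. y t $ i) x) / e n)" for n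
      unfolding X_def jet_def v(2) by (simp add: vec_eq_iff divide_inverse mult.commute)
    moreover have "(\<lambda>n. (0, \<chi> i. (u (e n) x $ i - y x $ i) / e n,
        \<chi> i. (caputo_left \<alpha> a (\<lambda>t. u (e n) t $ i) x - caputo_left \<alpha> a (\<lambda>t. y t $ i) x) / e n,
        \<chi> i. (rl_int_left \<beta> a (\<lambda>t. u (e n) t $ i) x - rl_int_left \<beta> a (\<lambda>t. y t $ i) x) / e n)) \<longlonglongrightarrow> direction q x"
      unfolding direction_def dY_def[abs_def, symmetric]
      by (intro tendsto_Pair tendsto_const vec_tendstoI; simp add: dY_def v(16)[OF e] v(17)[OF e] R3[OF e, unfolded dY_def])
    ultimately show ?thesis by simp
  qed
  define I where "I \<epsilon> c = (LINT t:{a..c}|lborel. zero_ext a b (\<lambda>t. hl (X \<epsilon> t)) t)" for \<epsilon> c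
  have zX: "zero_ext a b (\<lambda>t. grad hl (X 0 t) (direction q t)) = direction_l q"
    unfolding X_def v(2) direction_l_def ..
  have "\<exists>Cz. 0 \<le> Cz \<and> integrable lborel (direction_l q) \<and>
    (\<forall>\<epsilon> c. \<bar>\<epsilon>\<bar> \<le> \<epsilon>0 \<longrightarrow> \<bar>I \<epsilon> c - I 0 c\<bar> \<le> \<bar>\<epsilon>\<bar> * Cz) \<and> (\<forall>\<epsilon> c. \<bar>\<epsilon>\<bar> \<le> \<epsilon>0 \<longrightarrow> \<bar>I \<epsilon> c\<bar> \<le> Cz) \<and>
    (\<forall>e c. e \<longlonglongrightarrow> 0 \<longrightarrow> (\<forall>n. e n \<noteq> 0) \<longrightarrow> (\<forall>n. \<bar>e n\<bar> \<le> \<epsilon>0) \<longrightarrow>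
      (\<lambda>n. (I (e n) c - I 0 c) / e n) \<longlonglongrightarrow> (LINT t:{a..c}|lborel. direction_l q t))"
    unfolding I_def zX[symmetric]
    by (rule integral_first_variation[OF Ul(1) Ul(3)[of "Suc 0"] K v(1)])
      (fact \<Omega> | rule XK Xc dom lim; assumption)+
  then obtain Cz where Cz: "0 \<le> Cz" "integrable lborel (direction_l q)"
    "\<And>\<epsilon> c. \<bar>\<epsilon>\<bar> \<le> \<epsilon>0 \<Longrightarrow> \<bar>I \<epsilon> c - I 0 c\<bar> \<le> \<bar>\<epsilon>\<bar> * Cz"
    "\<And>\<epsilon> c. \<bar>\<epsilon>\<bar> \<le> \<epsilon>0 \<Longrightarrow> \<bar>I \<epsilon> c\<bar> \<le> Cz"
    "\<And>e c. e \<longlonglongrightarrow> 0 \<Longrightarrow> (\<And>n. e n \<noteq> 0) \<Longrightarrow> (\<And>n. \<bar>e n\<bar> \<le> \<epsilon>0) \<Longrightarrow>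
      (\<lambda>n. (I (e n) c - I 0 c) / e n) \<longlonglongrightarrow> (LINT t:{a..c}|lborel. direction_l q t)"
    by blast
  define Y where "Y \<epsilon> x = (X \<epsilon> x, I \<epsilon> x)" for \<epsilon> x
  have Yeq: "ext_jet \<alpha> \<beta> a l (u \<epsilon>) x = Y \<epsilon> x" if "\<bar>\<epsilon>\<bar> \<le> \<epsilon>0" "x \<in> {a..b}" for \<epsilon> x
    unfolding Y_def I_def X_def by (rule ext_jet_eq[OF v(3)[OF that(1)] that(2)])
  have Yc: "continuous_on {a..b} (Y \<epsilon>)" if "\<bar>\<epsilon>\<bar> \<le> \<epsilon>0" for \<epsilon>
    by (rule continuous_on_eq[OF ext_jet_continuous[OF v(3)[OF that]]]) (rule Yeq[OF that])
  \<comment> \<open>The uniform bound \<open>Cz\<close> confines the variable \<open>z\<close>, so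
    the extended curves again stay in a compact convex set.\<close>
  define K2 where "K2 = K \<times> cball (0::real) Cz"
  have K2: "compact K2" "convex K2" "K2 \<subseteq> UL"
    using UL(2) K(1,2) unfolding K2_def K_def by (auto intro!: compact_Times convex_Times)
  have YK: "Y \<epsilon> x \<in> K2" if "\<bar>\<epsilon>\<bar> \<le> \<epsilon>0" "x \<in> {a..b}" for \<epsilon> x
    using XK[OF that] Cz(4)[OF that(1), of x] unfolding Y_def K2_def by simp
  define \<Omega>2 where "\<Omega>2 x = \<Omega> x + zero_ext a b (\<lambda>_. Cz) x" for x
  have \<Omega>2: "integrable lborel \<Omega>2" "0 \<le> \<Omega>2 x" for x
  proof -
    show "integrable lborel \<Omega>2" unfolding \<Omega>2_def[abs_def]
      by (intro Bochner_Integration.integrable_add zero_ext_integrable \<Omega>(1) continuous_on_const)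
    show "0 \<le> \<Omega>2 x" using \<Omega>(2)[of x] Cz(1) by (simp add: \<Omega>2_def zero_ext_def)
  qed
  have dom2: "norm (Y \<epsilon> x - Y 0 x) \<le> \<bar>\<epsilon>\<bar> * \<Omega>2 x" if "\<bar>\<epsilon>\<bar> \<le> \<epsilon>0" "x \<in> {a..b}" for \<epsilon> x
  proof -
    have "norm (Y \<epsilon> x - Y 0 x) \<le> norm (X \<epsilon> x - X 0 x) + norm (I \<epsilon> x - I 0 x)"
      unfolding Y_def using norm_Pair_le[of "X \<epsilon> x - X 0 x" "I \<epsilon> x - I 0 x"] by simp
    also have "\<dots> \<le> \<bar>\<epsilon>\<bar> * \<Omega> x + \<bar>\<epsilon>\<bar> * Cz" using dom[OF that] Cz(3)[OF that(1), of x] by simp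
    also have "\<dots> = \<bar>\<epsilon>\<bar> * \<Omega>2 x" using that(2) by (simp add: \<Omega>2_def zero_ext_def algebra_simps)
    finally show ?thesis .
  qed
  define \<delta>2 where "\<delta>2 x = (direction q x, LINT t:{a..x}|lborel. direction_l q t)" for x
  have lim2: "(\<lambda>n. (Y (e n) x - Y 0 x) /\<^sub>R e n) \<longlonglongrightarrow> \<delta>2 x"
    if e: "e \<longlonglongrightarrow> 0" "\<And>n. e n \<noteq> 0" "\<And>n. \<bar>e n\<bar> \<le> \<epsilon>0" "x \<in> {a..b}" for e x
  proof -
    have "(\<lambda>n. ((X (e n) x - X 0 x) /\<^sub>R e n, (I (e n) x - I 0 x) / e n)) \<longlonglongrightarrow> \<delta>2 x"
      unfolding \<delta>2_def by (intro tendsto_Pair lim[OF e] Cz(5)[OF e(1,2,3)])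
    then show ?thesis unfolding Y_def by (simp add: divide_inverse mult.commute)
  qed
  define J where "J \<epsilon> c = (LINT t:{a..c}|lborel. zero_ext a b (\<lambda>t. hL (Y \<epsilon> t)) t)" for \<epsilon> c
  have zY: "zero_ext a b (\<lambda>x. grad hL (Y 0 x) (\<delta>2 x)) = direction_L q"
    using Yeq[OF z] unfolding direction_L_def \<delta>2_def v(2) by (auto simp: zero_ext_def fun_eq_iff)
  have "\<exists>C. 0 \<le> C \<and> integrable lborel (direction_L q) \<and>
    (\<forall>\<epsilon> c. \<bar>\<epsilon>\<bar> \<le> \<epsilon>0 \<longrightarrow> \<bar>J \<epsilon> c - J 0 c\<bar> \<le> \<bar>\<epsilon>\<bar> * C) \<and> (\<forall>\<epsilon> c. \<bar>\<epsilon>\<bar> \<le> \<epsilon>0 \<longrightarrow> \<bar>J \<epsilon> c\<bar> \<le> C) \<and>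
    (\<forall>e c. e \<longlonglongrightarrow> 0 \<longrightarrow> (\<forall>n. e n \<noteq> 0) \<longrightarrow> (\<forall>n. \<bar>e n\<bar> \<le> \<epsilon>0) \<longrightarrow>
      (\<lambda>n. (J (e n) c - J 0 c) / e n) \<longlonglongrightarrow> (LINT t:{a..c}|lborel. direction_L q t))"
    unfolding J_def zY[symmetric]
    by (rule integral_first_variation[OF UL(1) UL(3)[of "Suc 0"] K2 v(1)])
      (fact \<Omega>2 | rule YK Yc dom2 lim2; assumption)+
  then have Cy: "integrable lborel (direction_L q)"
    "\<And>e c. e \<longlonglongrightarrow> 0 \<Longrightarrow> (\<And>n. e n \<noteq> 0) \<Longrightarrow> (\<And>n. \<bar>e n\<bar> \<le> \<epsilon>0) \<Longrightarrow>
      (\<lambda>n. (J (e n) c - J 0 c) / e n) \<longlonglongrightarrow> (LINT t:{a..c}|lborel. direction_L q t)"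
    by blast+
  have Jeq: "functional \<alpha> \<beta> a b L l (u \<epsilon>) = J \<epsilon> b" if "\<bar>\<epsilon>\<bar> \<le> \<epsilon>0" for \<epsilon>
  proof -
    have "zero_ext a b (\<lambda>t. hL (ext_jet \<alpha> \<beta> a l (u \<epsilon>) t)) = zero_ext a b (\<lambda>t. hL (Y \<epsilon> t))"
      using Yeq[OF that] by (auto simp: zero_ext_def fun_eq_iff)
    then show ?thesis unfolding J_def functional_eq[OF v(3)[OF that]] by simp
  qed
  have Jmin: "J 0 b \<le> J \<epsilon> b" if "\<bar>\<epsilon>\<bar> \<le> \<epsilon>0" for \<epsilon>
    using minimal[of "u \<epsilon>", OF v(3)[OF that] _ _ v(5)[OF that]] v(4)[OF that] Jeq[OF that] Jeq[OF z] v(2) by simp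
  note e0 = harmonic_sequence[OF v(1)]
  have "(LINT t:{a..b}|lborel. direction_L q t) = 0"
  \<comment> \<open>At a minimum the difference quotients are nonnegative for positive \<epsilon>
    and nonpositive for negative \<epsilon>, and both sequences have this limit.\<close>
  proof (rule antisym)
    have "(\<lambda>n. (J (\<epsilon>0 / real (Suc n)) b - J 0 b) / (\<epsilon>0 / real (Suc n))) \<longlonglongrightarrow> (LINT t:{a..b}|lborel. direction_L q t)"
      by (rule Cy(2)) (rule e0)+
    moreover have "0 \<le> (J (\<epsilon>0 / real (Suc n)) b - J 0 b) / (\<epsilon>0 / real (Suc n))" for n
      using Jmin[OF e0(3)] v(1) by (intro divide_nonneg_pos) auto
    ultimately show "0 \<le> (LINT t:{a..b}|lborel. direction_L q t)"
      by (intro LIMSEQ_le_const) auto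
    have e1: "(\<lambda>n. - (\<epsilon>0 / real (Suc n))) \<longlonglongrightarrow> 0" "- (\<epsilon>0 / real (Suc n)) \<noteq> 0" "\<bar>- (\<epsilon>0 / real (Suc n))\<bar> \<le> \<epsilon>0" for n
      using tendsto_minus[OF e0(1)] e0(2,3)[of n] by auto
    have "(\<lambda>n. (J (- (\<epsilon>0 / real (Suc n))) b - J 0 b) / (- (\<epsilon>0 / real (Suc n)))) \<longlonglongrightarrow> (LINT t:{a..b}|lborel. direction_L q t)"
      by (rule Cy(2)) (rule e1)+
    moreover have "(J (- (\<epsilon>0 / real (Suc n))) b - J 0 b) / (- (\<epsilon>0 / real (Suc n))) \<le> 0" for n
      using Jmin[OF e1(3)] v(1) by (intro divide_nonneg_neg) auto
    ultimately show "(LINT t:{a..b}|lborel. direction_L q t) \<le> 0"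
      by (intro LIMSEQ_le_const2) auto
  qed
  then show thesis using that[of q, OF v(6,7,8,9) Cz(2) Cy(1)] by blast
qed

end

section \<open>The Euler--Lagrange equations\<close>

lemma zero_ext_add: "zero_ext a b (\<lambda>x. f x + g x) = (\<lambda>x. zero_ext a b f x + zero_ext a b g x)"
  by (auto simp: zero_ext_def fun_eq_iff)

lemma conv_right_integrable:
  assumes "0 < \<gamma>" "continuous_on {a..b} f" "x \<in> {a..b}"
  shows "integrable lborel (\<lambda>t. frac_kernel \<gamma> (t - x) * zero_ext a b f t)"
proof -
  have "continuous_on {-b..-a} (\<lambda>y. zero_ext a b f (- y))"
    by (intro continuous_on_compose2[OF zero_ext_continuous[OF assms(2)]]) (auto intro!: continuous_intros)
  then have i: "integrable lborel (\<lambda>y. frac_kernel \<gamma> (- x - y) * zero_ext a b f (- y))"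
    using assms(3) by (intro conv_left_continuous(2)[OF assms(1)]) (auto simp: zero_ext_def)
  have eq: "(\<lambda>y. frac_kernel \<gamma> (- x - y) * zero_ext a b f (- y)) =
      (\<lambda>y. frac_kernel \<gamma> (0 + - 1 * y - x) * zero_ext a b f (0 + - 1 * y))"
  proof
    fix y
    have "0 + - 1 * y - x = - x - y" "0 + - 1 * y = - y" by simp_all
    then show "frac_kernel \<gamma> (- x - y) * zero_ext a b f (- y) =
        frac_kernel \<gamma> (0 + - 1 * y - x) * zero_ext a b f (0 + - 1 * y)" by (simp only:)
  qed
  note i[unfolded eq]
  then show ?thesis
    using lborel_integrable_real_affine_iff[of "- 1" "\<lambda>t. frac_kernel \<gamma> (t - x) * zero_ext a b f t" 0] by simp
qed

lemma conv_right_add: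
  assumes "0 < \<gamma>" "continuous_on {a..b} f" "continuous_on {a..b} g" "x \<in> {a..b}"
  shows "conv_right \<gamma> (zero_ext a b (\<lambda>x. f x + g x)) x = conv_right \<gamma> (zero_ext a b f) x + conv_right \<gamma> (zero_ext a b g) x"
  unfolding conv_right_def zero_ext_add
  using conv_right_integrable[OF assms(1,2,4)] conv_right_integrable[OF assms(1,3,4)] by (simp add: distrib_left)

lemma conv_left_one:
  assumes f: "f \<in> borel_measurable borel" "\<And>t. t < a \<Longrightarrow> f t = 0"
  shows "conv_left 1 f x = (LINT t:{a..x}|lborel. f t)"
  unfolding conv_left_def set_lebesgue_integral_def
proof (rule integral_cong_AE)
  note f(1)[measurable]
  show "(\<lambda>t. frac_kernel 1 (x - t) * f t) \<in> borel_measurable lborel" by measurable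
  show "(\<lambda>t. indicator {a..x} t *\<^sub>R f t) \<in> borel_measurable lborel" by measurable
  show "AE t in lborel. frac_kernel 1 (x - t) * f t = indicator {a..x} t *\<^sub>R f t"
    using AE_lborel_singleton[of x]
  proof eventually_elim
    case (elim t)
    then show ?case using f(2)[of t] by (cases "t < a") (auto simp: frac_kernel_def indicator_def)
  qed
qed

lemma conv_right_one:
  assumes f: "continuous_on {a..b} f" and x: "x \<in> {a..b}"
  shows "conv_right 1 (zero_ext a b f) x = integral {x..b} f"
    and "conv_right 1 (zero_ext a b f) x = (LINT t:{x..b}|lebesgue. f t)"
proof -
  have "rl_int_right 1 b f x = conv_right 1 (zero_ext a b f) x / Gamma 1" by (rule rl_int_right_conv[OF f x])
  then have "(LINT t:{x..b}|lebesgue. (t - x) powr 0 * f t) = conv_right 1 (zero_ext a b f) x"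
    unfolding rl_int_right_def by simp
  moreover have "(LINT t:{x..b}|lebesgue. (t - x) powr 0 * f t) = (LINT t:{x..b}|lborel. zero_ext a b f t)"
    using x by (intro integral_spike_lborel(2)[OF negligible_sing[of x] _ zero_ext_measurable[OF f]]) (auto simp: zero_ext_def)
  moreover have "(LINT t:{x..b}|lebesgue. f t) = (LINT t:{x..b}|lborel. zero_ext a b f t)"
    using x by (intro set_integral_lebesgue_zero_ext f) auto
  ultimately show 1: "conv_right 1 (zero_ext a b f) x = (LINT t:{x..b}|lebesgue. f t)" by simp
  have "f absolutely_integrable_on {x..b}"
    using continuous_on_subset[OF f, of "{x..b}"] x by (intro absolutely_integrable_continuous_real) auto
  then show "conv_right 1 (zero_ext a b f) x = integral {x..b} f"
    unfolding 1 by (rule set_lebesgue_integral_eq_integral(2))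
qed

lemma conv_right_one_derivative:
  assumes f: "continuous_on {a..b} f" and x: "x \<in> {a..b}"
  shows "(conv_right 1 (zero_ext a b f) has_real_derivative - f x) (at x within {a..b})"
proof -
  have i: "f integrable_on {a..b}" using f by (rule integrable_continuous_real)
  have "((\<lambda>u. integral {a..b} f - integral {a..u} f) has_real_derivative 0 - f x) (at x within {a..b})"
    by (intro DERIV_diff DERIV_const integral_has_real_derivative[OF f x])
  then have "((\<lambda>u. integral {a..b} f - integral {a..u} f) has_real_derivative - f x) (at x within {a..b})" by simp
  then show ?thesis
  proof (rule has_field_derivative_transform_within[OF _ zero_less_one x])
    fix u assume u: "u \<in> {a..b}"
    have "integral {a..u} f + integral {u..b} f = integral {a..b} f"
      using u i by (intro Henstock_Kurzweil_Integration.integral_combine) auto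
    then show "integral {a..b} f - integral {a..u} f = conv_right 1 (zero_ext a b f) u"
      using conv_right_one(1)[OF f u] by simp
  qed
qed

text \<open>\<open>rl_deriv_right\<close> is minus a \<open>vector_derivative\<close>, which is a
  genuine derivative thanks to the assumed differentiability; the integral in it is the right
  convolution of order \<open>1 - \<alpha>\<close>.\<close>

lemma rl_deriv_right_derivative:
  assumes "\<alpha> < 1" and f: "continuous_on {a..b} f" and ex: "rl_deriv_right_exists \<alpha> a b f" and x: "x \<in> {a..b}"
  shows "((\<lambda>u. conv_right (1 - \<alpha>) (zero_ext a b f) u / Gamma (1 - \<alpha>)) has_real_derivative - rl_deriv_right \<alpha> a b f x)
     (at x within {a..b})"
proof -
  let ?g = "\<lambda>u. LINT t:{u..b}|lebesgue. (t - u) powr (- \<alpha>) * f t"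
  have "?g differentiable (at x within {a..b})" using ex x unfolding rl_deriv_right_exists_def by blast
  then have "(?g has_real_derivative vector_derivative ?g (at x within {a..b})) (at x within {a..b})"
    unfolding has_real_derivative_iff_has_vector_derivative by (simp add: vector_derivative_works)
  then have "((\<lambda>u. ?g u / Gamma (1 - \<alpha>)) has_real_derivative vector_derivative ?g (at x within {a..b}) / Gamma (1 - \<alpha>)) (at x within {a..b})"
    by (rule DERIV_cdivide)
  moreover have "vector_derivative ?g (at x within {a..b}) / Gamma (1 - \<alpha>) = - rl_deriv_right \<alpha> a b f x"
    unfolding rl_deriv_right_def by simp
  ultimately have "((\<lambda>u. ?g u / Gamma (1 - \<alpha>)) has_real_derivative - rl_deriv_right \<alpha> a b f x) (at x within {a..b})" by simp
  then show ?thesis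
  proof (rule has_field_derivative_transform_within[OF _ zero_less_one x])
    fix u assume u: "u \<in> {a..b}"
    have e: "1 - \<alpha> - 1 = - \<alpha>" by simp
    have "?g u = conv_right (1 - \<alpha>) (zero_ext a b f) u"
      using frac_integral_right_eq(2)[OF zero_ext_simps(1)[symmetric] zero_ext_measurable[OF f] zero_ext_simps(2) u, of "1 - \<alpha>", unfolded e] by simp
    then show "?g u / Gamma (1 - \<alpha>) = conv_right (1 - \<alpha>) (zero_ext a b f) u / Gamma (1 - \<alpha>)" by simp
  qed
qed

lemma zero_ext_duality:
  assumes "0 < \<gamma>" and f: "continuous_on {a..b} f" and q: "integrable lborel q" "\<And>t. t \<notin> {a..b} \<Longrightarrow> q t = 0"
  shows "integrable lborel (\<lambda>x. zero_ext a b f x * conv_left \<gamma> q x)"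
    and "integrable lborel (\<lambda>t. q t * conv_right \<gamma> (zero_ext a b f) t)"
    and "(LINT x|lborel. zero_ext a b f x * conv_left \<gamma> q x) = (LINT t|lborel. q t * conv_right \<gamma> (zero_ext a b f) t)"
proof -
  obtain V where V: "\<And>t. \<bar>zero_ext a b f t\<bar> \<le> V" by (rule zero_ext_bounded[OF f]) (rule that)
  note d = conv_duality[OF assms(1) q zero_ext_measurable[OF f] zero_ext_simps(2) V]
  show "integrable lborel (\<lambda>x. zero_ext a b f x * conv_left \<gamma> q x)"
    "integrable lborel (\<lambda>t. q t * conv_right \<gamma> (zero_ext a b f) t)"
    "(LINT x|lborel. zero_ext a b f x * conv_left \<gamma> q x) = (LINT t|lborel. q t * conv_right \<gamma> (zero_ext a b f) t)"
    using d by blast+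
qed

context fractional_problem
begin

text \<open>Derivatives of \<open>L\<close> rather than of the augmented function: the multiplier is
  still to be found, and it enters only the \<open>y\<close>-derivatives.\<close>

definition "LY i x = partial_deriv (dir_y i, 0) L (ext_jet \<alpha> \<beta> a l y x)"
definition "LV i x = partial_deriv (dir_v i, 0) L (ext_jet \<alpha> \<beta> a l y x)"
definition "LW i x = partial_deriv (dir_w i, 0) L (ext_jet \<alpha> \<beta> a l y x)"
definition "LZ x = partial_deriv (0, 1) L (ext_jet \<alpha> \<beta> a l y x)"
definition "lY i x = partial_deriv (dir_y i) l (jet \<alpha> \<beta> a y x)"
definition "lV i x = partial_deriv (dir_v i) l (jet \<alpha> \<beta> a y x)"
definition "lW i x = partial_deriv (dir_w i) l (jet \<alpha> \<beta> a y x)"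
definition "Z x = (LINT t:{x..b}|lebesgue. LZ t)"

text \<open>A direction without \<open>x\<close>-component never leaves the strip, and there
  \<open>L\<close> coincides with its smooth extension.\<close>

lemma partial_L:
  assumes "fst (fst e) = 0"
  shows "x \<in> {a..b} \<Longrightarrow> partial_deriv e L (ext_jet \<alpha> \<beta> a l y x) = partial_deriv e hL (ext_jet \<alpha> \<beta> a l y x)"
    and "continuous_on {a..b} (\<lambda>x. partial_deriv e L (ext_jet \<alpha> \<beta> a l y x))"
proof -
  show 1: "partial_deriv e L (ext_jet \<alpha> \<beta> a l y x) = partial_deriv e hL (ext_jet \<alpha> \<beta> a l y x)"
    if x: "x \<in> {a..b}" for x
  proof (rule partial_deriv_cong)
    fix s
    have "ext_jet \<alpha> \<beta> a l y x + s *\<^sub>R e \<in> ({a..b} \<times> UNIV) \<times> UNIV"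
      using x assms by (cases e; cases "fst e") (simp add: ext_jet_def jet_def)
    then show "L (ext_jet \<alpha> \<beta> a l y x + s *\<^sub>R e) = hL (ext_jet \<alpha> \<beta> a l y x + s *\<^sub>R e)" by (rule UL(4)[symmetric])
  qed
  have sub: "ext_jet \<alpha> \<beta> a l y ` {a..b} \<subseteq> UL" using ext_jet_mem UL(2) by blast
  have "continuous_on {a..b} (\<lambda>x. grad hL (ext_jet \<alpha> \<beta> a l y x) e)"
    by (rule continuous_on_grad[OF UL(1) UL(3)[of "Suc 0"] ext_jet_continuous[OF y_traj] sub continuous_on_const])
  then show "continuous_on {a..b} (\<lambda>x. partial_deriv e L (ext_jet \<alpha> \<beta> a l y x))"
  proof (rule continuous_on_eq)
    fix x assume x: "x \<in> {a..b}"
    then have "ext_jet \<alpha> \<beta> a l y x \<in> UL" using sub by blast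
    then show "grad hL (ext_jet \<alpha> \<beta> a l y x) e = partial_deriv e L (ext_jet \<alpha> \<beta> a l y x)"
      unfolding 1[OF x] by (intro grad_basis Ck_on_has_derivative[OF UL(1) UL(3)[of "Suc 0"]])
  qed
qed

lemma partial_l:
  assumes "fst e = 0"
  shows "x \<in> {a..b} \<Longrightarrow> partial_deriv e l (jet \<alpha> \<beta> a y x) = partial_deriv e hl (jet \<alpha> \<beta> a y x)"
    and "continuous_on {a..b} (\<lambda>x. partial_deriv e l (jet \<alpha> \<beta> a y x))"
proof -
  show 1: "partial_deriv e l (jet \<alpha> \<beta> a y x) = partial_deriv e hl (jet \<alpha> \<beta> a y x)" if x: "x \<in> {a..b}" for x
  proof (rule partial_deriv_cong)
    fix s
    have "jet \<alpha> \<beta> a y x + s *\<^sub>R e \<in> {a..b} \<times> UNIV"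
      using x assms by (cases e) (simp add: jet_def)
    then show "l (jet \<alpha> \<beta> a y x + s *\<^sub>R e) = hl (jet \<alpha> \<beta> a y x + s *\<^sub>R e)" by (rule Ul(4)[symmetric])
  qed
  have sub: "jet \<alpha> \<beta> a y ` {a..b} \<subseteq> Ul" using Ul(2) by (auto simp: jet_def)
  have "continuous_on {a..b} (\<lambda>x. grad hl (jet \<alpha> \<beta> a y x) e)"
    by (rule continuous_on_grad[OF Ul(1) Ul(3)[of "Suc 0"] jet_continuous[OF y_traj] sub continuous_on_const])
  then show "continuous_on {a..b} (\<lambda>x. partial_deriv e l (jet \<alpha> \<beta> a y x))"
  proof (rule continuous_on_eq)
    fix x assume x: "x \<in> {a..b}"
    then have "jet \<alpha> \<beta> a y x \<in> Ul" using sub by blast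
    then show "grad hl (jet \<alpha> \<beta> a y x) e = partial_deriv e l (jet \<alpha> \<beta> a y x)"
      unfolding 1[OF x] by (intro grad_basis Ck_on_has_derivative[OF Ul(1) Ul(3)[of "Suc 0"]])
  qed
qed

lemma partials_along_continuous:
  "continuous_on {a..b} (LY i)" "continuous_on {a..b} (LV i)" "continuous_on {a..b} (LW i)" "continuous_on {a..b} LZ"
  "continuous_on {a..b} (lY i)" "continuous_on {a..b} (lV i)" "continuous_on {a..b} (lW i)" "continuous_on {a..b} Z"
proof -
  show "continuous_on {a..b} (LY i)" "continuous_on {a..b} (LV i)" "continuous_on {a..b} (LW i)"
    unfolding LY_def[abs_def] LV_def[abs_def] LW_def[abs_def] by (rule partial_L(2), simp)+
  show LZ: "continuous_on {a..b} LZ" unfolding LZ_def[abs_def] by (rule partial_L(2)) simp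
  show "continuous_on {a..b} (lY i)" "continuous_on {a..b} (lV i)" "continuous_on {a..b} (lW i)"
    unfolding lY_def[abs_def] lV_def[abs_def] lW_def[abs_def] by (rule partial_l(2), simp)+
  have "continuous_on {a..b} (conv_right 1 (zero_ext a b LZ))"
    by (rule conv_right_continuous[OF zero_less_one zero_ext_continuous[OF LZ] zero_ext_simps(2)])
  then show "continuous_on {a..b} Z" by (rule continuous_on_eq) (simp add: Z_def conv_right_one(2)[OF LZ])
qed

text \<open>\<open>MY\<close>, \<open>MV\<close> and \<open>MW\<close> are the coefficients of the
  variations of \<open>y\<close>, \<open>v\<close> and \<open>w\<close> once the variation of
  \<open>z\<close> has been eliminated by duality, which turns its factor \<open>LZ\<close> into the
  tail integral \<open>Z\<close>.\<close>

definition "MY i x = LY i x + Z x * lY i x"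
definition "MV i x = LV i x + Z x * lV i x"
definition "MW i x = LW i x + Z x * lW i x"

lemma M_continuous: "continuous_on {a..b} (MY i)" "continuous_on {a..b} (MV i)" "continuous_on {a..b} (MW i)"
  unfolding MY_def[abs_def] MV_def[abs_def] MW_def[abs_def]
  by (intro continuous_intros partials_along_continuous)+

definition "A i x = MY i x + conv_right \<beta> (zero_ext a b (MW i)) x / Gamma \<beta>"
definition "P i x = conv_right (1 - \<alpha>) (zero_ext a b (MV i)) x / Gamma (1 - \<alpha>)"

lemma A_continuous: "continuous_on {a..b} (A i)" and P_continuous: "continuous_on {a..b} (P i)"
proof -
  have G: "Gamma \<beta> \<noteq> 0" "Gamma (1 - \<alpha>) \<noteq> 0"
    using less_imp_neq[OF Gamma_real_pos[OF \<beta>]] less_imp_neq[OF Gamma_real_pos[of "1 - \<alpha>"]] \<alpha> by simp_all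
  have c: "continuous_on {a..b} (conv_right \<gamma> (zero_ext a b f))" if "continuous_on {a..b} f" "0 < \<gamma>" for f \<gamma>
    by (rule conv_right_continuous[OF that(2) zero_ext_continuous[OF that(1)] zero_ext_simps(2)])
  show "continuous_on {a..b} (A i)" unfolding A_def[abs_def] using G \<beta>
    by (intro continuous_intros M_continuous c) auto
  show "continuous_on {a..b} (P i)" unfolding P_def[abs_def] using G \<alpha>
    by (intro continuous_intros M_continuous c) auto
qed

text \<open>Every part of the variation is a left convolution of the densities: order 1 for
  \<open>y\<close>, order \<open>1 - \<alpha>\<close> for the Caputo derivative, order 1 followed by
  order \<beta> for the fractional integral. Duality moves each convolution onto its coefficient and
  leaves \<open>q i\<close> as the only factor.\<close>

lemma weak_equation:
  assumes q: "\<And>i. integrable lborel (q i)" "\<And>i t. t \<notin> {a..b} \<Longrightarrow> q i t = 0"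
    and dl: "integrable lborel (direction_l q)" and dL: "integrable lborel (direction_L q)"
    and z: "(LINT x:{a..b}|lborel. direction_L q x) = 0"
  shows "integrable lborel (\<lambda>t. q i t * (conv_right 1 (zero_ext a b (A i)) t + P i t))"
    and "(\<Sum>i\<in>UNIV. LINT t|lborel. q i t * (conv_right 1 (zero_ext a b (A i)) t + P i t)) = 0"
proof -
  have \<alpha>': "0 < 1 - \<alpha>" using \<alpha> by simp
  have qm: "q i \<in> borel_measurable borel" for i using q(1)[of i] by auto
  have qa: "q i t = 0" if "t < a" for i t using q(2)[of t] that by simp
  define dY where "dY i x = conv_left 1 (q i) x" for i x
  have dYe: "(LINT t:{a..x}|lborel. q i t) = dY i x" for i x
    unfolding dY_def by (rule conv_left_one[OF qm qa, symmetric])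
  define dV where "dV i x = conv_left (1 - \<alpha>) (q i) x / Gamma (1 - \<alpha>)" for i x
  define dW where "dW i x = conv_left \<beta> (zero_ext a b (dY i)) x / Gamma \<beta>" for i x
  have dir: "direction q x = (0, \<chi> i. dY i x, \<chi> i. dV i x, \<chi> i. dW i x)" for x
    unfolding direction_def dV_def dW_def dYe ..
  have dlz: "direction_l q t = 0" if "t \<notin> {a..b}" for t
    unfolding direction_l_def by (rule zero_ext_simps(2)[OF that])
  have dlm: "direction_l q \<in> borel_measurable borel" using dl by auto
  define dZ where "dZ x = conv_left 1 (direction_l q) x" for x
  have dZe: "(LINT t:{a..x}|lborel. direction_l q t) = dZ x" for x
    unfolding dZ_def using dlz by (intro conv_left_one[OF dlm, symmetric]) auto
  have el: "direction_l q x = (\<Sum>i\<in>UNIV. dY i x * lY i x + dV i x * lV i x + dW i x * lW i x)" if x: "x \<in> {a..b}" for x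
  proof -
    have "(hl has_derivative grad hl (jet \<alpha> \<beta> a y x)) (at (jet \<alpha> \<beta> a y x))"
      using x Ul(2) by (intro Ck_on_has_derivative[OF Ul(1) Ul(3)[of "Suc 0"]]) (auto simp: jet_def)
    from grad_state[OF this] show ?thesis
      unfolding direction_l_def zero_ext_simps(1)[OF x] dir lY_def lV_def lW_def
      using partial_l(1)[OF _ x] by simp
  qed
  have eL: "direction_L q x = (\<Sum>i\<in>UNIV. dY i x * LY i x + dV i x * LV i x + dW i x * LW i x) + dZ x * LZ x"
    if x: "x \<in> {a..b}" for x
  proof -
    have "(hL has_derivative grad hL (ext_jet \<alpha> \<beta> a l y x)) (at (ext_jet \<alpha> \<beta> a l y x))"
      by (intro Ck_on_has_derivative[OF UL(1) UL(3)[of "Suc 0"]] subsetD[OF UL(2)] ext_jet_mem x)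
    from grad_ext_state[OF this] show ?thesis
      unfolding direction_L_def zero_ext_simps(1)[OF x] dir dZe LY_def LV_def LW_def LZ_def
      using partial_L(1)[OF _ x] by simp
  qed
  let ?z = "zero_ext a b"
  note dual_Z = zero_ext_duality[OF zero_less_one partials_along_continuous(4) dl dlz, folded dZ_def]
  have ZZ: "direction_l q t * conv_right 1 (?z LZ) t = direction_l q t * Z t" for t
    using dlz[of t] conv_right_one(2)[OF partials_along_continuous(4), of t] unfolding Z_def by (cases "t \<in> {a..b}") auto
  define S where "S i x = ?z (MY i) x * dY i x + ?z (MV i) x * dV i x + ?z (MW i) x * dW i x" for i x
  have tot: "direction_L q x - ?z LZ x * dZ x + direction_l q x * Z x = (\<Sum>i\<in>UNIV. S i x)" for x
  proof (cases "x \<in> {a..b}")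
    case True
    then show ?thesis unfolding eL[OF True] el[OF True] S_def zero_ext_simps(1)[OF True] MY_def MV_def MW_def
      by (simp add: sum_2 algebra_simps)
  next
    case False
    then show ?thesis unfolding S_def zero_ext_simps(2)[OF False] dlz[OF False] direction_L_def by simp
  qed
  have "0 = (LINT x|lborel. direction_L q x)"
  proof -
    have "(LINT x:{a..b}|lborel. direction_L q x) = (LINT x|lborel. direction_L q x)"
      unfolding set_lebesgue_integral_def
      by (intro Bochner_Integration.integral_cong) (auto simp: direction_L_def zero_ext_def indicator_def)
    then show ?thesis using z by simp
  qed
  also have "\<dots> = (LINT x|lborel. direction_L q x) - (LINT x|lborel. ?z LZ x * dZ x) + (LINT x|lborel. direction_l q x * Z x)"
    using dual_Z(3) unfolding ZZ by simp
  also have "\<dots> = (LINT x|lborel. direction_L q x - ?z LZ x * dZ x + direction_l q x * Z x)"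
    using dL dual_Z(1) dual_Z(2)[unfolded ZZ] by simp
  also have "\<dots> = (LINT x|lborel. (\<Sum>i\<in>UNIV. S i x))" unfolding tot ..
  finally have S0: "(LINT x|lborel. (\<Sum>i\<in>UNIV. S i x)) = 0" by simp
  have summand: "integrable lborel (S i) \<and> integrable lborel (\<lambda>t. q i t * (conv_right 1 (?z (A i)) t + P i t)) \<and>
      (LINT x|lborel. S i x) = (LINT t|lborel. q i t * (conv_right 1 (?z (A i)) t + P i t))" for i
  proof -
    let ?R = "conv_right \<beta> (?z (MW i))"
    have Rc: "continuous_on {a..b} ?R"
      by (rule conv_right_continuous[OF \<beta> zero_ext_continuous[OF M_continuous(3)] zero_ext_simps(2)])
    note y1 = zero_ext_duality[OF zero_less_one M_continuous(1)[of i] q(1)[of i] q(2), folded dY_def]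
    note v1 = zero_ext_duality[OF \<alpha>' M_continuous(2)[of i] q(1)[of i] q(2)]
    have dYi: "integrable lborel (?z (dY i))"
    proof -
      have "integrable lborel (\<lambda>x. ?z (\<lambda>_. 1) x * dY i x)"
        unfolding dY_def by (rule zero_ext_duality(1)[OF zero_less_one continuous_on_const q])
      also have "(\<lambda>x. ?z (\<lambda>_. 1) x * dY i x) = ?z (dY i)" by (auto simp: zero_ext_def fun_eq_iff)
      finally show ?thesis .
    qed
    note w1 = zero_ext_duality[OF \<beta> M_continuous(3)[of i] dYi zero_ext_simps(2)]
    note w2 = zero_ext_duality[OF zero_less_one Rc q(1)[of i] q(2), folded dY_def]
    \<comment> \<open>The convolution of order \<beta> is moved first; its result \<open>?R\<close>
      is then the coefficient for the convolution of order 1.\<close>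
    have sw: "?z (dY i) t * ?R t = ?z ?R t * dY i t" for t by (simp add: zero_ext_def)
    have Se: "S i x = ?z (MY i) x * dY i x + (?z (MV i) x * conv_left (1 - \<alpha>) (q i) x) / Gamma (1 - \<alpha>)
        + (?z (MW i) x * conv_left \<beta> (?z (dY i)) x) / Gamma \<beta>" for x
      unfolding S_def dV_def dW_def by simp
    have c1: "conv_right 1 (?z (A i)) t = conv_right 1 (?z (MY i)) t + conv_right 1 (?z ?R) t / Gamma \<beta>" if t: "t \<in> {a..b}" for t
    proof -
      have "conv_right 1 (?z (A i)) t = conv_right 1 (?z (MY i)) t + conv_right 1 (?z (\<lambda>x. ?R x / Gamma \<beta>)) t"
        unfolding A_def[abs_def] using Gamma_real_pos[OF \<beta>]
        by (intro conv_right_add t M_continuous continuous_intros Rc) auto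
      also have "conv_right 1 (?z (\<lambda>x. ?R x / Gamma \<beta>)) t = conv_right 1 (?z ?R) t / Gamma \<beta>"
      proof -
        have "?z (\<lambda>x. ?R x / Gamma \<beta>) = (\<lambda>x. ?z ?R x / Gamma \<beta>)" by (auto simp: zero_ext_def fun_eq_iff)
        then show ?thesis unfolding conv_right_def by simp
      qed
      finally show ?thesis .
    qed
    have Te: "q i t * (conv_right 1 (?z (A i)) t + P i t) = q i t * conv_right 1 (?z (MY i)) t
        + (q i t * conv_right (1 - \<alpha>) (?z (MV i)) t) / Gamma (1 - \<alpha>) + (q i t * conv_right 1 (?z ?R) t) / Gamma \<beta>" for t
      using q(2)[of t i] c1[of t] unfolding P_def by (cases "t \<in> {a..b}") (simp_all add: distrib_left)
    show ?thesis
      unfolding Se[abs_def] Te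
      using y1 v1 w1 w2 unfolding sw by simp
  qed
  show "integrable lborel (\<lambda>t. q i t * (conv_right 1 (?z (A i)) t + P i t))" using summand by blast
  have "(\<Sum>i\<in>UNIV. LINT t|lborel. q i t * (conv_right 1 (?z (A i)) t + P i t)) = (\<Sum>i\<in>UNIV. LINT x|lborel. S i x)"
    using summand by simp
  also have "\<dots> = (LINT x|lborel. (\<Sum>i\<in>UNIV. S i x))"
    using summand by (intro Bochner_Integration.integral_sum[symmetric]) auto
  finally show "(\<Sum>i\<in>UNIV. LINT t|lborel. q i t * (conv_right 1 (?z (A i)) t + P i t)) = 0" using S0 by simp
qed

text \<open>Kept as two applications of the operator, as in the equations; existence is assumed for
  each of them, while \<open>P i\<close> is formed from the sum of their arguments.\<close>

definition "D i x = rl_deriv_right \<alpha> a b (LV i) x + rl_deriv_right \<alpha> a b (\<lambda>s. Z s * lV i s) x"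

lemma P_derivative:
  assumes "rl_deriv_right_exists \<alpha> a b (LV i)" "rl_deriv_right_exists \<alpha> a b (\<lambda>s. Z s * lV i s)" and x: "x \<in> {a..b}"
  shows "(P i has_real_derivative - D i x) (at x within {a..b})"
proof -
  have c: "continuous_on {a..b} (\<lambda>s. Z s * lV i s)" by (intro continuous_intros partials_along_continuous)
  have "((\<lambda>u. conv_right (1 - \<alpha>) (zero_ext a b (LV i)) u / Gamma (1 - \<alpha>)
      + conv_right (1 - \<alpha>) (zero_ext a b (\<lambda>s. Z s * lV i s)) u / Gamma (1 - \<alpha>)) has_real_derivative
      - rl_deriv_right \<alpha> a b (LV i) x + - rl_deriv_right \<alpha> a b (\<lambda>s. Z s * lV i s) x) (at x within {a..b})"
    by (intro DERIV_add rl_deriv_right_derivative[OF \<alpha>(2)] assms partials_along_continuous c)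
  then have "((\<lambda>u. conv_right (1 - \<alpha>) (zero_ext a b (LV i)) u / Gamma (1 - \<alpha>)
      + conv_right (1 - \<alpha>) (zero_ext a b (\<lambda>s. Z s * lV i s)) u / Gamma (1 - \<alpha>)) has_real_derivative - D i x) (at x within {a..b})"
    unfolding D_def by simp
  then show ?thesis
  proof (rule has_field_derivative_transform_within[OF _ zero_less_one x])
    fix u assume u: "u \<in> {a..b}"
    have "0 < 1 - \<alpha>" using \<alpha> by simp
    from conv_right_add[OF this partials_along_continuous(2) c u]
    show "conv_right (1 - \<alpha>) (zero_ext a b (LV i)) u / Gamma (1 - \<alpha>)
      + conv_right (1 - \<alpha>) (zero_ext a b (\<lambda>s. Z s * lV i s)) u / Gamma (1 - \<alpha>) = P i u"
      unfolding P_def MV_def[abs_def] by (simp add: add_divide_distrib)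
  qed
qed

text \<open>The du Bois-Reymond argument: the admissible variation is driven by the deviation of the function
  \<open>F\<close> from its mean.\<close>

lemma Euler_Lagrange:
  assumes ex: "\<And>i. rl_deriv_right_exists \<alpha> a b (LV i)" "\<And>i. rl_deriv_right_exists \<alpha> a b (\<lambda>s. Z s * lV i s)"
    and D2: "continuous_on {a..b} (D 2)" and x: "x \<in> {a..b}"
  shows "A 1 x + D 1 x + slope1 (x, y x) * (A 2 x + D 2 x) = 0"
proof -
  let ?z = "zero_ext a b"
  let ?c = "conv_right 1"
  define E where "E x = A 2 x + D 2 x" for x
  define Q where "Q x = slope1 (x, y x) * E x" for x
  have Ec: "continuous_on {a..b} E" unfolding E_def[abs_def] by (intro continuous_intros A_continuous D2)
  have Qc: "continuous_on {a..b} Q" unfolding Q_def[abs_def]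
    by (intro continuous_on_mult curve_slope_continuous traj_continuous[OF y_traj] Ec)
  have cr: "continuous_on {a..b} (?c (?z f))" if "continuous_on {a..b} f" for f
    by (rule conv_right_continuous[OF zero_less_one zero_ext_continuous[OF that] zero_ext_simps(2)])
  define F where "F x = ?c (?z (A 1)) x + P 1 x + ?c (?z Q) x" for x
  have Fc: "continuous_on {a..b} F"
    unfolding F_def[abs_def] by (intro continuous_intros cr A_continuous P_continuous Qc)
  \<comment> \<open>\<open>P 2\<close> and the integral of \<open>D 2\<close> over
    \<open>[t,b]\<close> have the same derivative. Continuity of \<open>D 2\<close> makes that
    integral differentiable at every point.\<close>
  obtain c2 where c2: "\<And>t. t \<in> {a..b} \<Longrightarrow> P 2 t - ?c (?z (D 2)) t = c2"
  proof -
    have "((\<lambda>t. P 2 t - ?c (?z (D 2)) t) has_real_derivative - D 2 t - - D 2 t) (at t within {a..b})" if "t \<in> {a..b}" for t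
      by (intro DERIV_diff P_derivative[OF ex that] conv_right_one_derivative[OF D2 that])
    then have "\<exists>c. \<forall>t\<in>{a..b}. P 2 t - ?c (?z (D 2)) t = c"
      by (intro has_field_derivative_zero_constant) auto
    then show thesis using that by blast
  qed
  define m where "m = (LINT t|lborel. ?z F t) / (b - a)"
  define \<kappa> where "\<kappa> t = F t - m" for t
  have \<kappa>c: "continuous_on {a..b} \<kappa>" unfolding \<kappa>_def[abs_def] by (intro continuous_intros Fc)
  have one: "(LINT t|lborel. ?z (\<lambda>_. 1) t) = b - a"
  proof -
    have "?z (\<lambda>_. 1) = (indicator {a..b} :: real \<Rightarrow> real)" by (auto simp: zero_ext_def fun_eq_iff)
    then show ?thesis using ab by simp
  qed
  have set_z: "(LINT t:{a..b}|lborel. ?z f t) = (LINT t|lborel. ?z f t)" for f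
    unfolding set_lebesgue_integral_def by (intro Bochner_Integration.integral_cong) (auto simp: zero_ext_def indicator_def)
  have mean: "(LINT t|lborel. ?z \<kappa> t) = 0"
  proof -
    have "?z \<kappa> t = ?z F t - m * ?z (\<lambda>_. 1) t" for t by (simp add: zero_ext_def \<kappa>_def)
    then have "(LINT t|lborel. ?z \<kappa> t) = (LINT t|lborel. ?z F t) - m * (LINT t|lborel. ?z (\<lambda>_. 1) t)"
      using zero_ext_integrable[OF Fc] zero_ext_integrable[of a b "\<lambda>_. 1"] by simp
    then show ?thesis unfolding one m_def using ab by simp
  qed
  obtain q where q: "\<And>i. integrable lborel (q i)" "\<And>i t. t \<notin> {a..b} \<Longrightarrow> q i t = 0" "q 1 = ?z \<kappa>"
    "\<And>x. x \<in> {a..b} \<Longrightarrow> (LINT t:{a..x}|lborel. q 2 t) = slope1 (x, y x) * (LINT t:{a..x}|lborel. q 1 t)"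
    "integrable lborel (direction_l q)" "integrable lborel (direction_L q)"
    "(LINT x:{a..b}|lborel. direction_L q x) = 0"
    by (rule first_variation[OF \<kappa>c]) (simp add: set_z mean, rule that)
  have qm: "q i \<in> borel_measurable borel" for i using q(1)[of i] by auto
  have qa: "q i t = 0" if "t < a" for i t using q(2)[of t i] that by simp
  have dY: "conv_left 1 (q i) x = (LINT t:{a..x}|lborel. q i t)" for i x
    by (rule conv_left_one[OF qm qa])
  note we = weak_equation[OF q(1,2,5,6,7)]
  \<comment> \<open>At \<open>b\<close> the variation of the first component is 0, and the slope
    relation carries this over to the second; the unknown constant \<open>c2\<close> then drops
    out.\<close>
  have int2: "(LINT t|lborel. q 2 t) = 0"
  proof -
    have "(LINT t|lborel. q 2 t) = (LINT t:{a..b}|lborel. q 2 t)"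
      unfolding set_lebesgue_integral_def by (intro Bochner_Integration.integral_cong) (use q(2)[of _ 2] in \<open>auto simp: indicator_def simp del: atLeastAtMost_iff\<close>)
    also have "\<dots> = 0" using q(4)[of b] ab set_z[of \<kappa>] mean unfolding q(3) by simp
    finally show ?thesis .
  qed
  \<comment> \<open>The passage from \<open>q 2\<close> to \<open>q 1\<close>: duality returns to
    the primitives of the densities, which are proportional with factor \<open>slope1\<close> at
    each point, and a second duality leads back to a density.\<close>
  have "(LINT t|lborel. q 2 t * (?c (?z (A 2)) t + P 2 t)) = (LINT t|lborel. c2 * q 2 t + q 2 t * ?c (?z E) t)"
  proof (rule Bochner_Integration.integral_cong[OF refl])
    fix t
    show "q 2 t * (?c (?z (A 2)) t + P 2 t) = c2 * q 2 t + q 2 t * ?c (?z E) t"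
    proof (cases "t \<in> {a..b}")
      case True
      have "?c (?z E) t = ?c (?z (A 2)) t + ?c (?z (D 2)) t"
        unfolding E_def[abs_def] by (rule conv_right_add[OF zero_less_one A_continuous D2 True])
      then show ?thesis using c2[OF True] by (simp add: algebra_simps)
    qed (simp add: q(2))
  qed
  also have "\<dots> = c2 * (LINT t|lborel. q 2 t) + (LINT t|lborel. q 2 t * ?c (?z E) t)"
    using q(1)[of 2] zero_ext_duality(2)[OF zero_less_one Ec q(1,2)] by simp
  also have "\<dots> = (LINT x|lborel. ?z E x * conv_left 1 (q 2) x)"
    using zero_ext_duality(3)[OF zero_less_one Ec q(1)[of 2] q(2)] int2 by simp
  also have "\<dots> = (LINT x|lborel. ?z Q x * conv_left 1 (q 1) x)"
  proof (rule Bochner_Integration.integral_cong[OF refl])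
    fix x
    show "?z E x * conv_left 1 (q 2) x = ?z Q x * conv_left 1 (q 1) x"
      unfolding dY using q(4)[of x] by (cases "x \<in> {a..b}") (simp_all add: zero_ext_simps Q_def del: atLeastAtMost_iff)
  qed
  also have "\<dots> = (LINT t|lborel. q 1 t * ?c (?z Q) t)" by (rule zero_ext_duality(3)[OF zero_less_one Qc q(1)]) (rule q(2))
  finally have e2: "(LINT t|lborel. q 2 t * (?c (?z (A 2)) t + P 2 t)) = (LINT t|lborel. q 1 t * ?c (?z Q) t)" .
  have "0 = (LINT t|lborel. q 1 t * (?c (?z (A 1)) t + P 1 t)) + (LINT t|lborel. q 1 t * ?c (?z Q) t)"
    using we(2) e2 by (simp add: sum_2)
  also have "\<dots> = (LINT t|lborel. q 1 t * F t)"
    using we(1)[of 1] zero_ext_duality(2)[OF zero_less_one Qc q(1,2)] unfolding F_def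
    by (simp add: distrib_left)
  \<comment> \<open>Since \<open>F = \<kappa> + m\<close> and \<kappa> has mean 0, testing
    \<open>F\<close> with \<kappa> leaves the integral of the square of \<kappa>.\<close>
  also have "\<dots> = (LINT t|lborel. ?z (\<lambda>t. \<kappa> t * \<kappa> t) t + m * ?z \<kappa> t)"
    unfolding q(3) by (intro Bochner_Integration.integral_cong refl) (simp add: zero_ext_def \<kappa>_def algebra_simps)
  also have "\<dots> = (LINT t|lborel. ?z (\<lambda>t. \<kappa> t * \<kappa> t) t)"
    using zero_ext_integrable[OF continuous_on_mult[OF \<kappa>c \<kappa>c]] zero_ext_integrable[OF \<kappa>c] mean by simp
  also have "\<dots> = integral {a..b} (\<lambda>t. \<kappa> t * \<kappa> t)"
  proof -
    have c: "continuous_on {a..b} (\<lambda>t. \<kappa> t * \<kappa> t)" by (rule continuous_on_mult[OF \<kappa>c \<kappa>c])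
    have "(LINT t:{a..b}|lebesgue. \<kappa> t * \<kappa> t) = (LINT t|lborel. ?z (\<lambda>t. \<kappa> t * \<kappa> t) t)"
      unfolding set_integral_lebesgue_zero_ext[OF c order_refl] by (rule set_z)
    moreover have "(LINT t:{a..b}|lebesgue. \<kappa> t * \<kappa> t) = integral {a..b} (\<lambda>t. \<kappa> t * \<kappa> t)"
      by (rule set_lebesgue_integral_eq_integral(2)[OF absolutely_integrable_continuous_real[OF c]])
    ultimately show ?thesis by simp
  qed
  finally have i0: "integral {a..b} (\<lambda>t. \<kappa> t * \<kappa> t) = 0" by simp
  have \<kappa>0: "\<kappa> t = 0" if "t \<in> {a..b}" for t
  proof -
    have c: "continuous_on {a..b} (\<lambda>t. \<kappa> t * \<kappa> t)" by (rule continuous_on_mult[OF \<kappa>c \<kappa>c])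
    have "((\<lambda>t. \<kappa> t * \<kappa> t) has_integral 0) {a..b}"
      using integrable_integral[OF integrable_continuous_real[OF c]] i0 by simp
    then have "\<kappa> t * \<kappa> t = 0"
      using has_integral_0_cbox_imp_0[of a b "\<lambda>t. \<kappa> t * \<kappa> t" t] c that ab by simp
    then show ?thesis by simp
  qed
  \<comment> \<open>Only here is \<open>P 1\<close> differentiated. Derivatives within
    \<open>[a,b]\<close> are unique at the endpoints as well, so the equation holds on the closed
    interval.\<close>
  have "((\<lambda>t. ?c (?z (A 1)) t + P 1 t + ?c (?z Q) t) has_real_derivative - A 1 x + - D 1 x + - Q x) (at x within {a..b})"
    by (intro DERIV_add P_derivative[OF ex x] conv_right_one_derivative x A_continuous Qc)
  then have 1: "(F has_vector_derivative - A 1 x + - D 1 x + - Q x) (at x within {a..b})"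
    unfolding F_def[abs_def] has_real_derivative_iff_has_vector_derivative .
  have "((\<lambda>_. m) has_real_derivative 0) (at x within {a..b})" by (rule DERIV_const)
  then have "(F has_real_derivative 0) (at x within {a..b})"
    by (rule has_field_derivative_transform_within[OF _ zero_less_one x]) (use \<kappa>0 in \<open>simp add: \<kappa>_def\<close>)
  then have 2: "(F has_vector_derivative 0) (at x within {a..b})"
    unfolding has_real_derivative_iff_has_vector_derivative .
  have "- A 1 x + - D 1 x + - Q x = 0"
    by (rule vector_derivative_unique_within_closed_interval[of a b x F]) (use 1 2 ab x in simp_all)
  then show ?thesis unfolding Q_def E_def by linarith
qed

end

lemma (in fractional_problem) rl_int_right_MW:
  assumes x: "x \<in> {a..b}"
  shows "rl_int_right \<beta> b (LW i) x + rl_int_right \<beta> b (\<lambda>s. Z s * lW i s) x = conv_right \<beta> (zero_ext a b (MW i)) x / Gamma \<beta>"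
proof -
  have c: "continuous_on {a..b} (\<lambda>s. Z s * lW i s)" by (intro continuous_intros partials_along_continuous)
  show ?thesis
    unfolding MW_def[abs_def] conv_right_add[OF \<beta> partials_along_continuous(3) c x]
      rl_int_right_conv[OF partials_along_continuous(3) x] rl_int_right_conv[OF c x]
    by (simp add: add_divide_distrib)
qed

lemma (in fractional_problem) Euler_Lagrange_multiplier:
  assumes ex: "\<And>i. rl_deriv_right_exists \<alpha> a b (LV i)" "\<And>i. rl_deriv_right_exists \<alpha> a b (\<lambda>s. Z s * lV i s)"
    and D2: "continuous_on {a..b} (D 2)"
  obtains lam where "continuous_on {a..b} lam"
    "\<And>x i. x \<in> {a..b} \<Longrightarrow> A i x + D i x = lam x * partial_deriv (0, axis i 1) G (x, y x)"
proof (rule that)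
  let ?lam = "\<lambda>x. (A 2 x + D 2 x) / dG2 (x, y x)"
  have sub: "(x, y x) \<in> U" if "x \<in> {a..b}" for x using strip_subset that by blast
  have nz: "dG2 (x, y x) \<noteq> 0" if "x \<in> {a..b}" for x unfolding dG2_def by (rule nondegenerate[OF that])
  have "continuous_on {a..b} (\<lambda>x. (x, y x))"
    by (intro continuous_intros traj_continuous[OF y_traj])
  then have "continuous_on {a..b} (\<lambda>x. dG2 (x, y x))"
    by (rule continuous_on_compose2[OF partials_continuous(3)]) (use sub in blast)
  then show "continuous_on {a..b} ?lam"
    by (intro continuous_intros A_continuous D2) (use nz in blast)+
  fix x i assume x: "x \<in> {a..b}"
  have "A 2 x + D 2 x = ?lam x * dG2 (x, y x)" using nz[OF x] by simp
  moreover have "A 1 x + D 1 x = ?lam x * dG1 (x, y x)"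
    using Euler_Lagrange[OF ex D2 x] nz[OF x] unfolding slope1_def by (simp add: field_simps)
  ultimately show "A i x + D i x = ?lam x * partial_deriv (0, axis i 1) G (x, y x)"
    unfolding dG1_def dG2_def using exhaust_2[of i] by auto
qed

text \<open>The direction changes neither \<open>x\<close> nor \<open>y\<close>, so the constraint
  term is constant along the line.\<close>

lemma partial_deriv_augmented:
  assumes "fst (fst e) = 0" "fst (snd (fst e)) = 0"
  shows "partial_deriv e (augmented L lam g) p = partial_deriv e L p"
proof -
  obtain x Y v w z where p: "p = ((x, Y, v, w), z)" by (cases p) auto
  obtain dv dw dz where e: "e = ((0, 0, dv, dw), dz)" using assms by (cases e) auto
  have "augmented L lam g (p + s *\<^sub>R e) = L (p + s *\<^sub>R e) - lam x * g (x, Y)" for s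
    unfolding augmented_def p e by simp
  then show ?thesis unfolding partial_deriv_def by (simp add: deriv_diff_const)
qed

lemma partial_deriv_augmented_y:
  assumes "((\<lambda>s. L (((x, Y, v, w), z) + s *\<^sub>R (dir_y i, 0))) has_real_derivative DL) (at 0)"
    and "((\<lambda>s. g ((x, Y) + s *\<^sub>R (0, axis i 1))) has_real_derivative Dg) (at 0)"
  shows "partial_deriv (dir_y i, 0) (augmented L lam g) ((x, Y, v, w), z) = DL - lam x * Dg"
proof -
  have "augmented L lam g (((x, Y, v, w), z) + s *\<^sub>R (dir_y i, 0)) =
      L (((x, Y, v, w), z) + s *\<^sub>R (dir_y i, 0)) - lam x * g ((x, Y) + s *\<^sub>R (0, axis i 1))" for s
    unfolding augmented_def by simp
  then show ?thesis
    unfolding partial_deriv_def using DERIV_diff[OF assms(1) DERIV_cmult[OF assms(2)]]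
    by (simp add: DERIV_imp_deriv)
qed

text \<open>Along \<open>dir_y i\<close> the factor \<open>lam x\<close> is a fixed number, so no
  derivative of \<open>lam\<close> occurs. The line stays over \<open>x\<close>, where
  \<open>L\<close> and \<open>g\<close> agree with their extensions, and these supply the
  derivatives.\<close>

lemma (in fractional_problem) partial_y_augmented:
  assumes x: "x \<in> {a..b}" and g: "\<And>p. p \<in> {a..b} \<times> UNIV \<Longrightarrow> G p = g p"
  shows "partial_deriv (dir_y i, 0) (augmented L lam g) (ext_jet \<alpha> \<beta> a l y x) =
    LY i x - lam x * partial_deriv (0, axis i 1) G (x, y x)"
proof -
  let ?p = "ext_jet \<alpha> \<beta> a l y x"
  obtain v w z where p: "?p = ((x, y x, v, w), z)" unfolding ext_jet_def jet_def by blast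
  have hL: "(hL has_derivative grad hL ?p) (at ?p)"
    by (intro Ck_on_has_derivative[OF UL(1) UL(3)[of "Suc 0"]] subsetD[OF UL(2)] ext_jet_mem x)
  from has_real_derivative_line[OF hL, of "(dir_y i, 0)"]
  have "((\<lambda>s. hL (?p + s *\<^sub>R (dir_y i, 0))) has_real_derivative LY i x) (at 0)"
    unfolding LY_def grad_basis[OF hL] using partial_L(1)[OF _ x] by simp
  moreover have "hL (?p + s *\<^sub>R (dir_y i, 0)) = L (?p + s *\<^sub>R (dir_y i, 0))" for s
    by (rule UL(4)) (use x in \<open>simp add: p\<close>)
  ultimately have 1: "((\<lambda>s. L (((x, y x, v, w), z) + s *\<^sub>R (dir_y i, 0))) has_real_derivative LY i x) (at 0)"
    unfolding p by simp
  have dG: "(G has_derivative grad G (x, y x)) (at (x, y x))"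
    by (rule G_derivative) (use x strip_subset in auto)
  from has_real_derivative_line[OF dG, of "(0, axis i 1)"]
  have 2: "((\<lambda>s. G ((x, y x) + s *\<^sub>R (0, axis i 1))) has_real_derivative partial_deriv (0, axis i 1) G (x, y x)) (at 0)"
    unfolding grad_basis[OF dG] .
  have "G ((x, y x) + s *\<^sub>R (0, axis i 1)) = g ((x, y x) + s *\<^sub>R (0, axis i 1))" for s
    by (rule g) (use x in simp)
  with 2 have 2: "((\<lambda>s. g ((x, y x) + s *\<^sub>R (0, axis i 1))) has_real_derivative partial_deriv (0, axis i 1) G (x, y x)) (at 0)"
    by simp
  show ?thesis unfolding p by (rule partial_deriv_augmented_y[where L = L and g = g, OF 1 2])
qed

theorem theorem18:
  fixes a b \<alpha> \<beta> :: real
    and ya yb :: "real^2"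
    and L :: "state \<times> real \<Rightarrow> real"
    and l :: "state \<Rightarrow> real"
    and g :: "real \<times> (real^2) \<Rightarrow> real"
    and y :: "real \<Rightarrow> real^2"
  assumes "a < b" and "0 < \<alpha>" and "\<alpha> < 1" and "0 < \<beta>"
    and smooth_L: "smooth_on (({a..b} \<times> UNIV) \<times> UNIV) L"
    and smooth_l: "smooth_on ({a..b} \<times> UNIV) l"
    and smooth_g: "smooth_on ({a..b} \<times> UNIV) g"
    and minimizer: "y \<in> admissible \<alpha> \<beta> a b ya yb g"
      "\<And>u. u \<in> admissible \<alpha> \<beta> a b ya yb g \<Longrightarrow>
         functional \<alpha> \<beta> a b L l y \<le> functional \<alpha> \<beta> a b L l u"
    and nondegenerate: "\<And>x Y. x \<in> {a..b} \<Longrightarrow> partial_deriv (0, axis 2 1) g (x, Y) \<noteq> 0"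
    \<comment> \<open>the right fractional derivatives written in the conclusion exist, and those of the
        second equation (which determines \<open>lam\<close>) add up to a continuous function; both are
        necessary for the conclusion and do not follow from the other hypotheses\<close>
    and deriv_exists:
      "\<And>i. rl_deriv_right_exists \<alpha> a b
         (\<lambda>x. partial_deriv (dir_v i, 0) L (ext_jet \<alpha> \<beta> a l y x))"
      "\<And>i. rl_deriv_right_exists \<alpha> a b
         (\<lambda>x. (LINT t:{x..b}|lebesgue. partial_deriv (0, 1) L (ext_jet \<alpha> \<beta> a l y t)) *
              partial_deriv (dir_v i) l (jet \<alpha> \<beta> a y x))"
    and deriv_continuous:
      "continuous_on {a..b} (\<lambda>s.
         rl_deriv_right \<alpha> a b
           (\<lambda>x. partial_deriv (dir_v 2, 0) L (ext_jet \<alpha> \<beta> a l y x)) s +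
         rl_deriv_right \<alpha> a b
           (\<lambda>x. (LINT t:{x..b}|lebesgue. partial_deriv (0, 1) L (ext_jet \<alpha> \<beta> a l y t)) *
                partial_deriv (dir_v 2) l (jet \<alpha> \<beta> a y x)) s)"
  shows "\<exists>lam. continuous_on {a..b} lam \<and>
    (let F = augmented L lam g;
         Z = (\<lambda>x. LINT t:{x..b}|lebesgue. partial_deriv (0, 1) F (ext_jet \<alpha> \<beta> a l y t))
     in \<forall>x\<in>{a..b}. \<forall>i::2.
          partial_deriv (dir_y i, 0) F (ext_jet \<alpha> \<beta> a l y x)
        + rl_deriv_right \<alpha> a b (\<lambda>s. partial_deriv (dir_v i, 0) F (ext_jet \<alpha> \<beta> a l y s)) x
        + rl_int_right \<beta> b (\<lambda>s. partial_deriv (dir_w i, 0) F (ext_jet \<alpha> \<beta> a l y s)) x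
        + Z x * partial_deriv (dir_y i) l (jet \<alpha> \<beta> a y x)
        + rl_deriv_right \<alpha> a b (\<lambda>s. Z s * partial_deriv (dir_v i) l (jet \<alpha> \<beta> a y s)) x
        + rl_int_right \<beta> b (\<lambda>s. Z s * partial_deriv (dir_w i) l (jet \<alpha> \<beta> a y s)) x
        = 0)"
proof -
  obtain UL hL where UL: "open UL" "({a..b} \<times> UNIV) \<times> UNIV \<subseteq> UL" "\<And>k. Ck_on k hL UL"
    "\<And>p. p \<in> ({a..b} \<times> UNIV) \<times> UNIV \<Longrightarrow> hL p = L p"
    using smooth_L unfolding smooth_on_def by metis
  obtain Ul hl where Ul: "open Ul" "{a..b} \<times> UNIV \<subseteq> Ul" "\<And>k. Ck_on k hl Ul"
    "\<And>p. p \<in> {a..b} \<times> UNIV \<Longrightarrow> hl p = l p"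
    using smooth_l unfolding smooth_on_def by metis
  obtain U G where U: "open U" "{a..b} \<times> UNIV \<subseteq> U" "\<And>k. Ck_on k G U"
    "\<And>p. p \<in> {a..b} \<times> UNIV \<Longrightarrow> G p = g p"
    using smooth_g unfolding smooth_on_def by metis
  \<comment> \<open>A \<open>y\<close>-direction stays in the strip, so the nondegeneracy passes
    from \<open>g\<close> to its extension \<open>G\<close>.\<close>
  have Gg: "partial_deriv (0, axis i 1) G (x, Y) = partial_deriv (0, axis i 1) g (x, Y)" if "x \<in> {a..b}" for i x Y
    by (rule partial_deriv_cong, rule U(4)) (use that in simp)
  interpret fractional_problem a b G U \<alpha> \<beta> L hL l hl UL Ul y
  proof
    show "partial_deriv (0, axis 2 1) G (x, Y) \<noteq> 0" if "x \<in> {a..b}" for x Y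
      unfolding Gg[OF that] by (rule nondegenerate[OF that])
    show "(\<lambda>x. y x $ i) \<in> traj_class \<alpha> \<beta> a b" for i using minimizer(1) unfolding admissible_def by blast
    show "G (x, y x) = 0" if "x \<in> {a..b}" for x
      using minimizer(1) that U(4)[of "(x, y x)"] unfolding admissible_def by auto
    show "functional \<alpha> \<beta> a b L l y \<le> functional \<alpha> \<beta> a b L l u"
      if u: "\<And>i. (\<lambda>x. u x $ i) \<in> traj_class \<alpha> \<beta> a b" "u a = y a" "u b = y b" "\<And>x. x \<in> {a..b} \<Longrightarrow> G (x, u x) = 0" for u
    proof (rule minimizer(2))
      have "g (x, u x) = 0" if "x \<in> {a..b}" for x using u(4)[OF that] U(4)[of "(x, u x)"] that by simp
      then show "u \<in> admissible \<alpha> \<beta> a b ya yb g"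
        using minimizer(1) u(1-3) unfolding admissible_def by simp
    qed
  qed (rule assms UL Ul U; assumption)+
  have ex: "\<And>i. rl_deriv_right_exists \<alpha> a b (LV i)" "\<And>i. rl_deriv_right_exists \<alpha> a b (\<lambda>s. Z s * lV i s)"
    unfolding LV_def[abs_def] Z_def lV_def LZ_def by (rule deriv_exists)+
  have D2: "continuous_on {a..b} (D 2)"
    unfolding D_def[abs_def] LV_def[abs_def] Z_def lV_def LZ_def by (rule deriv_continuous)
  obtain lam where lam: "continuous_on {a..b} lam"
    "\<And>x i. x \<in> {a..b} \<Longrightarrow> A i x + D i x = lam x * partial_deriv (0, axis i 1) G (x, y x)"
    by (rule Euler_Lagrange_multiplier[OF ex D2]) (rule that)
  let ?F = "augmented L lam g"
  have FV: "(\<lambda>s. partial_deriv (dir_v i, 0) ?F (ext_jet \<alpha> \<beta> a l y s)) = LV i" for i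
    unfolding LV_def[abs_def] by (simp add: partial_deriv_augmented)
  have FW: "(\<lambda>s. partial_deriv (dir_w i, 0) ?F (ext_jet \<alpha> \<beta> a l y s)) = LW i" for i
    unfolding LW_def[abs_def] by (simp add: partial_deriv_augmented)
  have FZ: "(LINT t:{s..b}|lebesgue. partial_deriv (0, 1) ?F (ext_jet \<alpha> \<beta> a l y t)) = Z s" for s
    unfolding Z_def LZ_def by (simp add: partial_deriv_augmented)
  have lY: "partial_deriv (dir_y i) l (jet \<alpha> \<beta> a y s) = lY i s"
    and lV: "partial_deriv (dir_v i) l (jet \<alpha> \<beta> a y s) = lV i s"
    and lW: "partial_deriv (dir_w i) l (jet \<alpha> \<beta> a y s) = lW i s" for i s
    unfolding lY_def lV_def lW_def by (rule refl)+
  show ?thesis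
    unfolding Let_def
  proof (intro exI[of _ lam] conjI ballI allI lam(1))
    fix x i assume x: "x \<in> {a..b}"
    have py: "partial_deriv (dir_y i, 0) ?F (ext_jet \<alpha> \<beta> a l y x) = LY i x - lam x * partial_deriv (0, axis i 1) G (x, y x)"
      by (rule partial_y_augmented[OF x]) (rule U(4))
    show "partial_deriv (dir_y i, 0) ?F (ext_jet \<alpha> \<beta> a l y x)
        + rl_deriv_right \<alpha> a b (\<lambda>s. partial_deriv (dir_v i, 0) ?F (ext_jet \<alpha> \<beta> a l y s)) x
        + rl_int_right \<beta> b (\<lambda>s. partial_deriv (dir_w i, 0) ?F (ext_jet \<alpha> \<beta> a l y s)) x
        + (LINT t:{x..b}|lebesgue. partial_deriv (0, 1) ?F (ext_jet \<alpha> \<beta> a l y t)) * partial_deriv (dir_y i) l (jet \<alpha> \<beta> a y x)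
        + rl_deriv_right \<alpha> a b (\<lambda>s. (LINT t:{s..b}|lebesgue. partial_deriv (0, 1) ?F (ext_jet \<alpha> \<beta> a l y t)) * partial_deriv (dir_v i) l (jet \<alpha> \<beta> a y s)) x
        + rl_int_right \<beta> b (\<lambda>s. (LINT t:{s..b}|lebesgue. partial_deriv (0, 1) ?F (ext_jet \<alpha> \<beta> a l y t)) * partial_deriv (dir_w i) l (jet \<alpha> \<beta> a y s)) x = 0"
      \<comment> \<open>The six terms add up to \<open>A i x + D i x\<close> minus the multiplier
        term that \<open>py\<close> contributes.\<close>
      unfolding FV FW FZ lY lV lW py
      using lam(2)[OF x, of i] rl_int_right_MW[OF x, of i] unfolding A_def D_def MY_def by simp
  qed
qed

end
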